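(* Let $p\ge5$ and let $\chi:\mathcal{O}_D^\times\to\mathbb{F}^\times$ be a smooth character with $\chi\ne\chi^\sigma$ and $\chi\neq\chi^\sigma\alpha^p$. Then there does not exist any smooth $\mathbb{F}$-representation $\pi$ of $D^\times/Z_D^1$ such that there is an isomorphism of graded $\mathrm{gr}(\Lambda)$-modules with compatible $H$-action $$\mathrm{gr}_{\mathfrak{m}_D}(\pi^\vee)\cong\big(\chi^\vee\otimes\mathbb{F}[y]/(y^{p+2})\big)\oplus\big((\chi^\sigma)^\vee\otimes\mathbb{F}[z]/(z^{p+2})\big).$$
   Context: $\mathbb{F}$ finite field of characteristic $p$ with a fixed embedding $\mathbb{F}_{q}\hookrightarrow\mathbb{F}$, $q=p^2$. $D$ non-split quaternion algebra over $\mathbb{Q}_p$, $\mathcal{O}_D$ its maximal order, $\varpi_D$ a uniformizer with $\varpi_D^2=p$ and $\varpi_D^{-1}a\varpi_D=\sigma(a)$ for $a\in\mathbb{Q}_{p^2}\subset D$; $U_D^n=1+\varpi_D^n\mathcal{O}_D$; $Z_D^1=U_D^1\cap Z(D^\times)$; $H\subset\mathcal{O}_D^\times$ is the image of $\mathbb{F}_q^\times$ under the Teichmüller lift $[\cdot]$. $\alpha:\mathcal{O}_D^\times\to\mathbb{F}^\times$, $\alpha(x)=\overline{x}^{p-1}$ ($\overline x$ the reduction in $\mathbb{F}_q\subset\mathbb{F}$). For a character $\chi$, $\chi^\sigma(x)=\chi(\varpi_D^{-1}x\varpi_D)$, and $\chi^\vee=\chi^{-1}$. $\Lambda=\mathbb{F}[[U_D^1/Z_D^1]]$,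 $\mathfrak{m}_D$ its maximal ideal, $\mathrm{gr}(\Lambda)=\bigoplus\mathfrak{m}_D^n/\mathfrak{m}_D^{n+1}$; $y,z$ are the images in $\mathfrak{m}_D/\mathfrak{m}_D^2$ of $Y=\sum_{\lambda\in\mathbb{F}_q^\times}\lambda^{-1}(1+\varpi_D[\lambda])$ and $Z=\sum_{\lambda\in\mathbb{F}_q^\times}\lambda^{-p}(1+\varpi_D[\lambda])$. $\mathrm{gr}(\Lambda)$ is the universal enveloping algebra of the Lie algebra $\mathbb{F}y\oplus\mathbb{F}z\oplus\mathbb{F}h$ with $[y,z]=h$ central, $\deg y=\deg z=1$; $H$ acts on it by $gy=\alpha(g)y$, $gz=\alpha^{-1}(g)z$, $gh=h$. $\pi^\vee$ is the Pontryagin dual with its $\mathfrak{m}_D$-adic filtration; its graded module carries a compatible $H$-action. $\mathbb{F}[y]/(y^{p+2})$ is the graded $\mathrm{gr}(\Lambda)$-module $\mathrm{gr}(\Lambda)/(z,y^{p+2})$ (similarly for $z$), and $\chi^\vee\otimes(-)$ means the same module with $H$-action twisted by $\chi^\vee$. *)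

theory Defs
  imports
    Complex_Main
    "HOL-Computational_Algebra.Computational_Algebra"
    "HOL-Algebra.Ideal_Product"
    "HOL-Algebra.QuotRing"
    "HOL-Algebra.Generated_Groups"
    "HOL-Algebra.Module"
begin

section \<open>The quaternion algebra\<close>

text \<open>
  The fixed data. The type \<open>'k\<close> is the field of \<open>p\<close>-adic numbers, with absolute value
  \<open>qp_abs\<close>; \<open>'d\<close> is the quaternion algebra \<open>D\<close>, a \<open>'k\<close>-algebra via \<open>qp_emb\<close>; \<open>'f\<close> is the
  finite coefficient field. Further, \<open>max_ord\<close> is the maximal order, \<open>unram\<close> the copy inside
  \<open>D\<close> of the unramified quadratic extension of the \<open>p\<close>-adic numbers, \<open>frob\<close> its automorphism
  \<open>\<sigma>\<close>, and \<open>unif\<close> the uniformizer of \<open>D\<close>. The map \<open>red\<close> is the reduction of the maximal order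
  modulo the uniformizer followed by the fixed embedding into \<open>'f\<close> of the field with
  \<open>p ^ 2\<close> elements; only its values on \<open>max_ord\<close> matter.
\<close>

record ('k, 'd, 'f) quat_datum =
  qp_abs :: "'k \<Rightarrow> real"
  qp_emb :: "'k \<Rightarrow> 'd"
  max_ord :: "'d set"
  unram :: "'d set"
  frob :: "'d \<Rightarrow> 'd"
  unif :: "'d"
  red :: "'d \<Rightarrow> 'f"

text \<open>
  The \<open>p\<close>-adic numbers are the completion of the rationals for the \<open>p\<close>-adic absolute value:
  a complete valued field containing the rationals densely.
\<close>

definition is_padic_field :: "nat \<Rightarrow> ('k::field_char_0 \<Rightarrow> real) \<Rightarrow> bool" where
  "is_padic_field p nrm \<longleftrightarrow>
     (\<forall>x. 0 \<le> nrm x) \<and>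
     (\<forall>x. nrm x = 0 \<longleftrightarrow> x = 0) \<and>
     (\<forall>x y. nrm (x * y) = nrm x * nrm y) \<and>
     (\<forall>x y. nrm (x + y) \<le> max (nrm x) (nrm y)) \<and>
     (\<forall>m::int. m \<noteq> 0 \<longrightarrow> nrm (of_int m) = 1 / real p ^ multiplicity (int p) m) \<and>
     (\<forall>x. \<forall>e>0. \<exists>r::rat. nrm (x - of_rat r) < e) \<and>
     (\<forall>s::nat \<Rightarrow> 'k. (\<forall>e>0. \<exists>N. \<forall>m\<ge>N. \<forall>n\<ge>N. nrm (s m - s n) < e) \<longrightarrow>
        (\<exists>x. (\<lambda>n. nrm (s n - x)) \<longlonglongrightarrow> 0))"

definition qp_scale :: "('k::field_char_0, 'd::division_ring, 'f) quat_datum \<Rightarrow> 'k \<Rightarrow> 'd \<Rightarrow> 'd"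
  where "qp_scale D c x = qp_emb D c * x"

definition centre :: "'d::division_ring set" where
  "centre = {z. \<forall>x. z * x = x * z}"

text \<open>
  Central of dimension 4, and non-split because \<open>'d\<close> is a division ring.
\<close>

definition is_nonsplit_quaternion_algebra ::
    "('k::field_char_0, 'd::division_ring, 'f) quat_datum \<Rightarrow> bool" where
  "is_nonsplit_quaternion_algebra D \<longleftrightarrow>
     qp_emb D 1 = 1 \<and>
     (\<forall>a b. qp_emb D (a + b) = qp_emb D a + qp_emb D b) \<and>
     (\<forall>a b. qp_emb D (a * b) = qp_emb D a * qp_emb D b) \<and>
     range (qp_emb D) = centre \<and>
     vector_space.dim (qp_scale D) UNIV = 4"

text \<open>
  An order is a subring which is also a finitely generated module over the \<open>p\<close>-adic integers
  (the elements of absolute value at most 1) and spans \<open>D\<close>.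
\<close>

definition is_order :: "('k::field_char_0, 'd::division_ring, 'f) quat_datum \<Rightarrow> 'd set \<Rightarrow> bool"
  where
  "is_order D S \<longleftrightarrow>
     1 \<in> S \<and> (\<forall>x\<in>S. \<forall>y\<in>S. x - y \<in> S \<and> x * y \<in> S) \<and>
     (\<exists>B. finite B \<and>
        S = {(\<Sum>b\<in>B. qp_scale D (c b) b) | c. \<forall>b\<in>B. qp_abs D (c b) \<le> 1} \<and>
        module.span (qp_scale D) B = UNIV)"

definition is_maximal_order ::
    "('k::field_char_0, 'd::division_ring, 'f) quat_datum \<Rightarrow> 'd set \<Rightarrow> bool" where
  "is_maximal_order D S \<longleftrightarrow> is_order D S \<and> (\<forall>T. is_order D T \<and> S \<subseteq> T \<longrightarrow> T = S)"

text \<open>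
  The unramified quadratic extension is the quadratic extension containing a primitive root of
  unity of order \<open>p ^ 2 - 1\<close>.
\<close>

definition is_unramified_quadratic ::
    "nat \<Rightarrow> ('k::field_char_0, 'd::division_ring, 'f) quat_datum \<Rightarrow> 'd set \<Rightarrow> bool" where
  "is_unramified_quadratic p D L \<longleftrightarrow>
     range (qp_emb D) \<subseteq> L \<and>
     (\<forall>x\<in>L. \<forall>y\<in>L. x - y \<in> L \<and> x * y \<in> L \<and> x * y = y * x) \<and>
     (\<forall>x\<in>L. inverse x \<in> L) \<and>
     vector_space.dim (qp_scale D) L = 2 \<and>
     (\<exists>\<zeta>\<in>L. \<zeta> ^ (p\<^sup>2 - 1) = 1 \<and> (\<forall>k. 0 < k \<and> k < p\<^sup>2 - 1 \<longrightarrow> \<zeta> ^ k \<noteq> 1))"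

definition is_nontrivial_automorphism ::
    "('k::field_char_0, 'd::division_ring, 'f) quat_datum \<Rightarrow> 'd set \<Rightarrow> ('d \<Rightarrow> 'd) \<Rightarrow> bool" where
  "is_nontrivial_automorphism D L s \<longleftrightarrow>
     bij_betw s L L \<and>
     (\<forall>x\<in>L. \<forall>y\<in>L. s (x + y) = s x + s y \<and> s (x * y) = s x * s y) \<and>
     (\<forall>c. s (qp_emb D c) = qp_emb D c) \<and>
     (\<exists>x\<in>L. s x \<noteq> x)"

definition quat_setting ::
    "nat \<Rightarrow> ('k::field_char_0, 'd::division_ring, 'f::{finite,field}) quat_datum \<Rightarrow> bool" where
  "quat_setting p D \<longleftrightarrow>
     is_padic_field p (qp_abs D) \<and>
     is_nonsplit_quaternion_algebra D \<and>
     is_maximal_order D (max_ord D) \<and>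
     is_unramified_quadratic p D (unram D) \<and>
     is_nontrivial_automorphism D (unram D) (frob D) \<and>
     unif D \<in> max_ord D \<and> unif D ^ 2 = of_nat p \<and>
     (\<forall>a\<in>unram D. inverse (unif D) * a * unif D = frob D a) \<and>
     red D 1 = 1 \<and>
     (\<forall>x\<in>max_ord D. \<forall>y\<in>max_ord D.
        red D (x + y) = red D x + red D y \<and> red D (x * y) = red D x * red D y) \<and>
     {x \<in> max_ord D. red D x = 0} = {unif D * x | x. x \<in> max_ord D}"

definition ord_units :: "('k, 'd::division_ring, 'f) quat_datum \<Rightarrow> 'd set" where
  "ord_units D = {x \<in> max_ord D. x \<noteq> 0 \<and> inverse x \<in> max_ord D}"

definition UD :: "('k, 'd::division_ring, 'f) quat_datum \<Rightarrow> nat \<Rightarrow> 'd set" where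
  "UD D n = {1 + unif D ^ n * x | x. x \<in> max_ord D}"

definition ZD1 :: "('k, 'd::division_ring, 'f) quat_datum \<Rightarrow> 'd set" where
  "ZD1 D = UD D 1 \<inter> centre"

text \<open>The nonzero elements of the residue field of \<open>D\<close>, viewed inside \<open>'f\<close>.\<close>

definition residue_units :: "('k, 'd, 'f::zero) quat_datum \<Rightarrow> 'f set" where
  "residue_units D = red D ` max_ord D - {0}"

definition teich :: "nat \<Rightarrow> ('k, 'd::division_ring, 'f) quat_datum \<Rightarrow> 'f \<Rightarrow> 'd" where
  "teich p D l = (THE x. x \<in> unram D \<inter> max_ord D \<and> x ^ (p\<^sup>2) = x \<and> red D x = l)"

definition Hgrp :: "nat \<Rightarrow> ('k, 'd::division_ring, 'f::zero) quat_datum \<Rightarrow> 'd set" where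
  "Hgrp p D = teich p D ` residue_units D"

definition alpha :: "nat \<Rightarrow> ('k, 'd, 'f::field) quat_datum \<Rightarrow> 'd \<Rightarrow> 'f" where
  "alpha p D x = red D x ^ (p - 1)"

definition sigma_conj ::
    "('k, 'd::division_ring, 'f) quat_datum \<Rightarrow> ('d \<Rightarrow> 'f) \<Rightarrow> 'd \<Rightarrow> 'f" where
  "sigma_conj D \<chi> x = \<chi> (inverse (unif D) * x * unif D)"

definition dual_char :: "('d \<Rightarrow> 'f::field) \<Rightarrow> 'd \<Rightarrow> 'f" where
  "dual_char \<chi> x = inverse (\<chi> x)"

definition smooth_character ::
    "('k, 'd::division_ring, 'f::field) quat_datum \<Rightarrow> ('d \<Rightarrow> 'f) \<Rightarrow> bool" where
  "smooth_character D \<chi> \<longleftrightarrow>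
     (\<forall>x\<in>ord_units D. \<chi> x \<noteq> 0) \<and>
     (\<forall>x\<in>ord_units D. \<forall>y\<in>ord_units D. \<chi> (x * y) = \<chi> x * \<chi> y) \<and>
     (\<exists>n\<ge>1. \<forall>u\<in>UD D n. \<chi> u = 1)"

definition smooth_rep ::
    "('k, 'd::division_ring, 'f::field) quat_datum \<Rightarrow>
     ('f \<Rightarrow> 'v::ab_group_add \<Rightarrow> 'v) \<Rightarrow> ('d \<Rightarrow> 'v \<Rightarrow> 'v) \<Rightarrow> bool" where
  "smooth_rep D sc act \<longleftrightarrow>
     vector_space sc \<and>
     (\<forall>g. g \<noteq> 0 \<longrightarrow> Vector_Spaces.linear sc sc (act g)) \<and>
     (\<forall>v. act 1 v = v) \<and>
     (\<forall>g h v. g \<noteq> 0 \<longrightarrow> h \<noteq> 0 \<longrightarrow> act (g * h) v = act g (act h v)) \<and>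
     (\<forall>z\<in>ZD1 D. \<forall>v. act z v = v) \<and>
     (\<forall>v. \<exists>n\<ge>1. \<forall>u\<in>UD D n. act u v = v)"


section \<open>The Iwasawa algebra\<close>

definition rep :: "'a set \<Rightarrow> 'a" where
  "rep C = (SOME x. x \<in> C)"

text \<open>The group algebra of a finite group; elements are functions vanishing off the carrier.\<close>

definition group_algebra :: "('a, 'b) monoid_scheme \<Rightarrow> ('a \<Rightarrow> 'f::field) ring" where
  "group_algebra G =
     \<lparr>carrier = {f. \<forall>x. x \<notin> carrier G \<longrightarrow> f x = 0},
      monoid.mult = (\<lambda>f g x. if x \<in> carrier G
                then \<Sum>a\<in>carrier G. f a * g (inv\<^bsub>G\<^esub> a \<otimes>\<^bsub>G\<^esub> x) else 0),
      one = (\<lambda>x. if x = \<one>\<^bsub>G\<^esub> then 1 else 0),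
      zero = (\<lambda>x. 0),
      add = (\<lambda>f g x. f x + g x)\<rparr>"

text \<open>
  For a decreasing sequence \<open>N\<close> of normal subgroups of finite index, the inverse limit of the
  group algebras of \<open>G Mod N n\<close>: the transition map from level \<open>Suc n\<close> to level \<open>n\<close> sums the
  coefficients over the cosets of \<open>N (Suc n)\<close> contained in a given coset of \<open>N n\<close>.
\<close>

definition completed_group_algebra ::
    "('a, 'b) monoid_scheme \<Rightarrow> (nat \<Rightarrow> 'a set) \<Rightarrow> (nat \<Rightarrow> 'a set \<Rightarrow> 'f::field) ring" where
  "completed_group_algebra G N =
     \<lparr>carrier = {\<mu>. (\<forall>n. \<mu> n \<in> carrier (group_algebra (G Mod N n))) \<and>
                   (\<forall>n. \<forall>C\<in>carrier (G Mod N n).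
                      \<mu> n C = (\<Sum>C' | C' \<in> carrier (G Mod N (Suc n)) \<and> C' \<subseteq> C. \<mu> (Suc n) C'))},
      monoid.mult = (\<lambda>\<mu> \<nu> n. \<mu> n \<otimes>\<^bsub>group_algebra (G Mod N n)\<^esub> \<nu> n),
      one = (\<lambda>n. \<one>\<^bsub>group_algebra (G Mod N n)\<^esub>),
      zero = (\<lambda>n. \<zero>\<^bsub>group_algebra (G Mod N n)\<^esub>),
      add = (\<lambda>\<mu> \<nu> n. \<mu> n \<oplus>\<^bsub>group_algebra (G Mod N n)\<^esub> \<nu> n)\<rparr>"

definition U1grp :: "('k, 'd::division_ring, 'f) quat_datum \<Rightarrow> 'd monoid" where
  "U1grp D = \<lparr>carrier = UD D 1, monoid.mult = (*), one = 1\<rparr>"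

text \<open>
  The preimages in \<open>UD D 1\<close> of a fundamental system of open normal subgroups of the quotient of
  \<open>UD D 1\<close> by \<open>ZD1 D\<close>. Level \<open>n\<close> corresponds to \<open>UD D (Suc n)\<close>.
\<close>

definition Nlev :: "('k, 'd::division_ring, 'f) quat_datum \<Rightarrow> nat \<Rightarrow> 'd set" where
  "Nlev D n = UD D (Suc n) <#>\<^bsub>U1grp D\<^esub> ZD1 D"

abbreviation levgrp :: "('k, 'd::division_ring, 'f) quat_datum \<Rightarrow> nat \<Rightarrow> 'd set monoid" where
  "levgrp D n \<equiv> U1grp D Mod Nlev D n"

definition Lam ::
    "('k, 'd::division_ring, 'f::field) quat_datum \<Rightarrow> (nat \<Rightarrow> 'd set \<Rightarrow> 'f) ring" where
  "Lam D = completed_group_algebra (U1grp D) (Nlev D)"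

definition delta ::
    "('k, 'd::division_ring, 'f::field) quat_datum \<Rightarrow> 'd \<Rightarrow> nat \<Rightarrow> 'd set \<Rightarrow> 'f" where
  "delta D g n C = (if C \<in> carrier (levgrp D n) \<and> g \<in> C then 1 else 0)"

definition lam_scale :: "'f::field \<Rightarrow> (nat \<Rightarrow> 'd set \<Rightarrow> 'f) \<Rightarrow> nat \<Rightarrow> 'd set \<Rightarrow> 'f" where
  "lam_scale c \<mu> n C = c * \<mu> n C"

text \<open>The automorphism of the Iwasawa algebra sending the group element \<open>u\<close> to \<open>g u g\<inverse>\<close>.\<close>

definition lam_conj ::
    "'d::division_ring \<Rightarrow> (nat \<Rightarrow> 'd set \<Rightarrow> 'f) \<Rightarrow> nat \<Rightarrow> 'd set \<Rightarrow> 'f" where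
  "lam_conj g \<mu> n C = \<mu> n ((\<lambda>x. inverse g * x * g) ` C)"

definition mD ::
    "('k, 'd::division_ring, 'f::field) quat_datum \<Rightarrow> (nat \<Rightarrow> 'd set \<Rightarrow> 'f) set" where
  "mD D = (THE I. maximalideal I (Lam D))"

fun mD_pow ::
    "('k, 'd::division_ring, 'f::field) quat_datum \<Rightarrow> nat \<Rightarrow> (nat \<Rightarrow> 'd set \<Rightarrow> 'f) set" where
  "mD_pow D 0 = carrier (Lam D)" |
  "mD_pow D (Suc n) = mD D \<cdot>\<^bsub>Lam D\<^esub> mD_pow D n"

definition Yelt ::
    "nat \<Rightarrow> ('k, 'd::division_ring, 'f::field) quat_datum \<Rightarrow> nat \<Rightarrow> 'd set \<Rightarrow> 'f" where
  "Yelt p D n C =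
     (\<Sum>l\<in>residue_units D. inverse l * delta D (1 + unif D * teich p D l) n C)"

definition Zelt ::
    "nat \<Rightarrow> ('k, 'd::division_ring, 'f::field) quat_datum \<Rightarrow> nat \<Rightarrow> 'd set \<Rightarrow> 'f" where
  "Zelt p D n C =
     (\<Sum>l\<in>residue_units D. inverse (l ^ p) * delta D (1 + unif D * teich p D l) n C)"


section \<open>Associated graded objects\<close>

text \<open>
  For a decreasing filtration \<open>Fil\<close> of an additive group \<open>A\<close>, the direct sum over \<open>n\<close> of the
  quotients \<open>Fil n / Fil (Suc n)\<close>: finitely supported families of cosets.
\<close>

definition gr_carrier :: "('a, 'b) ring_scheme \<Rightarrow> (nat \<Rightarrow> 'a set) \<Rightarrow> (nat \<Rightarrow> 'a set) set" where
  "gr_carrier A Fil =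
     {a. (\<forall>n. \<exists>x\<in>Fil n. a n = Fil (Suc n) +>\<^bsub>A\<^esub> x) \<and> finite {n. a n \<noteq> Fil (Suc n)}}"

definition gr_zero :: "(nat \<Rightarrow> 'a set) \<Rightarrow> nat \<Rightarrow> 'a set" where
  "gr_zero Fil n = Fil (Suc n)"

definition gr_add ::
    "('a, 'b) ring_scheme \<Rightarrow> (nat \<Rightarrow> 'a set) \<Rightarrow> (nat \<Rightarrow> 'a set) \<Rightarrow> nat \<Rightarrow> 'a set" where
  "gr_add A a b n = a n <+>\<^bsub>A\<^esub> b n"

definition gr_component ::
    "('a, 'b) ring_scheme \<Rightarrow> (nat \<Rightarrow> 'a set) \<Rightarrow> nat \<Rightarrow> (nat \<Rightarrow> 'a set) set" where
  "gr_component A Fil n = {a \<in> gr_carrier A Fil. \<forall>k. k \<noteq> n \<longrightarrow> a k = gr_zero Fil k}"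

definition gr_class ::
    "('a, 'b) ring_scheme \<Rightarrow> (nat \<Rightarrow> 'a set) \<Rightarrow> nat \<Rightarrow> 'a \<Rightarrow> nat \<Rightarrow> 'a set" where
  "gr_class A Fil n x k = (if k = n then Fil (Suc n) +>\<^bsub>A\<^esub> x else gr_zero Fil k)"

text \<open>
  The product of \<open>a\<close> and \<open>b\<close> induced by a biadditive map \<open>m\<close> compatible with the filtrations,
  computed on representatives of the cosets.
\<close>

definition gr_prod ::
    "('a, 'b) ring_scheme \<Rightarrow> (nat \<Rightarrow> 'a set) \<Rightarrow> ('r \<Rightarrow> 'a \<Rightarrow> 'a) \<Rightarrow>
     (nat \<Rightarrow> 'r set) \<Rightarrow> (nat \<Rightarrow> 'a set) \<Rightarrow> nat \<Rightarrow> 'a set" where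
  "gr_prod A Fil m a b n =
     Fil (Suc n) +>\<^bsub>A\<^esub> (\<Oplus>\<^bsub>A\<^esub>i\<in>{..n}. m (rep (a i)) (rep (b (n - i))))"

definition gr_ring :: "('a, 'b) ring_scheme \<Rightarrow> (nat \<Rightarrow> 'a set) \<Rightarrow> (nat \<Rightarrow> 'a set) ring" where
  "gr_ring R Fil =
     \<lparr>carrier = gr_carrier R Fil,
      monoid.mult = gr_prod R Fil (\<lambda>x y. x \<otimes>\<^bsub>R\<^esub> y),
      one = gr_class R Fil 0 \<one>\<^bsub>R\<^esub>,
      zero = gr_zero Fil,
      add = gr_add R\<rparr>"

type_synonym ('d, 'f) lam = "nat \<Rightarrow> 'd set \<Rightarrow> 'f"
type_synonym ('d, 'f) grlam = "nat \<Rightarrow> ('d, 'f) lam set"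

definition grLam ::
    "('k, 'd::division_ring, 'f::field) quat_datum \<Rightarrow> ('d, 'f) grlam ring" where
  "grLam D = gr_ring (Lam D) (mD_pow D)"

definition y_elt :: "nat \<Rightarrow> ('k, 'd::division_ring, 'f::field) quat_datum \<Rightarrow> ('d, 'f) grlam" where
  "y_elt p D = gr_class (Lam D) (mD_pow D) 1 (Yelt p D)"

definition z_elt :: "nat \<Rightarrow> ('k, 'd::division_ring, 'f::field) quat_datum \<Rightarrow> ('d, 'f) grlam" where
  "z_elt p D = gr_class (Lam D) (mD_pow D) 1 (Zelt p D)"

definition gr_scalar ::
    "('k, 'd::division_ring, 'f::field) quat_datum \<Rightarrow> 'f \<Rightarrow> ('d, 'f) grlam" where
  "gr_scalar D c = gr_class (Lam D) (mD_pow D) 0 (lam_scale c \<one>\<^bsub>Lam D\<^esub>)"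

definition gr_conj :: "'d::division_ring \<Rightarrow> ('d, 'f) grlam \<Rightarrow> ('d, 'f) grlam" where
  "gr_conj g a n = lam_conj g ` a n"


section \<open>Graded modules with an action of \<open>H\<close>\<close>

text \<open>
  As for every module record of \<open>HOL-Algebra\<close>, the fields \<open>mult\<close> and \<open>one\<close> have no meaning.
\<close>

record ('r, 'm, 'd) graded_module = "('r, 'm) module" +
  hact :: "'d \<Rightarrow> 'm \<Rightarrow> 'm"
  component :: "nat \<Rightarrow> 'm set"

text \<open>
  The quotient of the graded ring by the two-sided ideal generated by \<open>S\<close>, as a left module.
  The left ideal generated by \<open>z\<close> and \<open>y ^ (p + 2)\<close> would be too small: the quotient is a
  truncated polynomial ring in \<open>y\<close> only because the central element \<open>h = y z - z y\<close> is
  killed. If \<open>S\<close> consists of eigenvectors of \<open>H\<close>, the ideal is \<open>H\<close>-stable, and the image of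
  a coset under \<open>H\<close> is again a coset.
\<close>

definition grLam_quot ::
    "('k, 'd::division_ring, 'f::field) quat_datum \<Rightarrow> ('d, 'f) grlam set \<Rightarrow>
     (('d, 'f) grlam, ('d, 'f) grlam set, 'd) graded_module" where
  "grLam_quot D S = (let R = grLam D; I = Idl\<^bsub>R\<^esub> S in
     \<lparr>carrier = a_rcosets\<^bsub>R\<^esub> I,
      monoid.mult = undefined,
      one = undefined,
      zero = I,
      add = set_add R,
      smult = (\<lambda>r C. I +>\<^bsub>R\<^esub> (r \<otimes>\<^bsub>R\<^esub> rep C)),
      hact = (\<lambda>g C. gr_conj g ` C),
      component = (\<lambda>n. {I +>\<^bsub>R\<^esub> a | a. a \<in> gr_component (Lam D) (mD_pow D) n})\<rparr>)"

definition twist ::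
    "('k, 'd::division_ring, 'f::field) quat_datum \<Rightarrow> ('d \<Rightarrow> 'f) \<Rightarrow>
     (('d, 'f) grlam, 'm, 'd) graded_module \<Rightarrow> (('d, 'f) grlam, 'm, 'd) graded_module" where
  "twist D \<psi> M = M\<lparr>hact := (\<lambda>g m. gr_scalar D (\<psi> g) \<odot>\<^bsub>M\<^esub> hact M g m)\<rparr>"

definition direct_sum ::
    "('r, 'm, 'd) graded_module \<Rightarrow> ('r, 'n, 'd) graded_module \<Rightarrow>
     ('r, 'm \<times> 'n, 'd) graded_module" where
  "direct_sum M N =
     \<lparr>carrier = carrier M \<times> carrier N,
      monoid.mult = undefined,
      one = undefined,
      zero = (\<zero>\<^bsub>M\<^esub>, \<zero>\<^bsub>N\<^esub>),
      add = (\<lambda>(a, b) (c, d). (a \<oplus>\<^bsub>M\<^esub> c, b \<oplus>\<^bsub>N\<^esub> d)),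
      smult = (\<lambda>r (a, b). (r \<odot>\<^bsub>M\<^esub> a, r \<odot>\<^bsub>N\<^esub> b)),
      hact = (\<lambda>g (a, b). (hact M g a, hact N g b)),
      component = (\<lambda>n. component M n \<times> component N n)\<rparr>"

definition graded_iso ::
    "('r, 'c) ring_scheme \<Rightarrow> 'd set \<Rightarrow> ('r, 'm, 'd) graded_module \<Rightarrow> ('r, 'n, 'd) graded_module \<Rightarrow>
     ('m \<Rightarrow> 'n) \<Rightarrow> bool" where
  "graded_iso R H M N \<phi> \<longleftrightarrow>
     bij_betw \<phi> (carrier M) (carrier N) \<and>
     (\<forall>a\<in>carrier M. \<forall>b\<in>carrier M. \<phi> (a \<oplus>\<^bsub>M\<^esub> b) = \<phi> a \<oplus>\<^bsub>N\<^esub> \<phi> b) \<and>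
     (\<forall>r\<in>carrier R. \<forall>a\<in>carrier M. \<phi> (r \<odot>\<^bsub>M\<^esub> a) = r \<odot>\<^bsub>N\<^esub> \<phi> a) \<and>
     (\<forall>n. \<phi> ` component M n = component N n) \<and>
     (\<forall>g\<in>H. \<forall>a\<in>carrier M. \<phi> (hact M g a) = hact N g (\<phi> a))"


section \<open>The Pontryagin dual of a smooth representation\<close>

definition dual_act ::
    "('d::division_ring \<Rightarrow> 'v \<Rightarrow> 'v) \<Rightarrow> 'd \<Rightarrow> ('v \<Rightarrow> 'f) \<Rightarrow> 'v \<Rightarrow> 'f" where
  "dual_act act g f v = f (act (inverse g) v)"

text \<open>
  The action of the Iwasawa algebra extending \<open>dual_act\<close>: to evaluate on \<open>v\<close>, take a level
  \<open>n\<close> whose subgroup fixes \<open>v\<close>; the contragredient action on \<open>f\<close>, evaluated at \<open>v\<close>, then only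
  depends on the class of the group element at that level.
\<close>

definition lam_dual_act ::
    "('k, 'd::division_ring, 'f::field) quat_datum \<Rightarrow> ('d \<Rightarrow> 'v \<Rightarrow> 'v) \<Rightarrow>
     ('d, 'f) lam \<Rightarrow> ('v \<Rightarrow> 'f) \<Rightarrow> 'v \<Rightarrow> 'f" where
  "lam_dual_act D act \<mu> f v = (let n = (LEAST n. \<forall>u\<in>UD D (Suc n). act u v = v) in
     \<Sum>C\<in>carrier (levgrp D n). \<mu> n C * dual_act act (rep C) f v)"

text \<open>
  A smooth representation is discrete, so its Pontryagin dual is the full linear dual.
\<close>

definition dual_module ::
    "('k, 'd::division_ring, 'f::field) quat_datum \<Rightarrow> ('f \<Rightarrow> 'v::ab_group_add \<Rightarrow> 'v) \<Rightarrow>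
     ('d \<Rightarrow> 'v \<Rightarrow> 'v) \<Rightarrow> (('d, 'f) lam, 'v \<Rightarrow> 'f) module" where
  "dual_module D sc act =
     \<lparr>carrier = {f. Vector_Spaces.linear sc (*) f},
      monoid.mult = undefined,
      one = undefined,
      zero = (\<lambda>v. 0),
      add = (\<lambda>f g v. f v + g v),
      smult = lam_dual_act D act\<rparr>"

definition dual_filtration ::
    "('k, 'd::division_ring, 'f::field) quat_datum \<Rightarrow> ('f \<Rightarrow> 'v::ab_group_add \<Rightarrow> 'v) \<Rightarrow>
     ('d \<Rightarrow> 'v \<Rightarrow> 'v) \<Rightarrow> nat \<Rightarrow> ('v \<Rightarrow> 'f) set" where
  "dual_filtration D sc act n = (let M = dual_module D sc act in
     generate (add_monoid M) {\<mu> \<odot>\<^bsub>M\<^esub> f | \<mu> f. \<mu> \<in> mD_pow D n \<and> f \<in> carrier M})"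

definition gr_dual ::
    "('k, 'd::division_ring, 'f::field) quat_datum \<Rightarrow> ('f \<Rightarrow> 'v::ab_group_add \<Rightarrow> 'v) \<Rightarrow>
     ('d \<Rightarrow> 'v \<Rightarrow> 'v) \<Rightarrow> (('d, 'f) grlam, nat \<Rightarrow> ('v \<Rightarrow> 'f) set, 'd) graded_module" where
  "gr_dual D sc act = (let M = dual_module D sc act; Fil = dual_filtration D sc act in
     \<lparr>carrier = gr_carrier M Fil,
      monoid.mult = undefined,
      one = undefined,
      zero = gr_zero Fil,
      add = gr_add M,
      smult = gr_prod M Fil (\<lambda>\<mu> f. \<mu> \<odot>\<^bsub>M\<^esub> f),
      hact = (\<lambda>g a n. dual_act act g ` a n),
      component = gr_component M Fil\<rparr>)"

end

(*
  An isomorphism as in the theorem lifts to H-eigenvectors e1, e2 of the dual, generating it modulo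
  m_D, with Y^k e1 and Z^k e2 spanning the k-th graded piece, nonzero in degree p, and zero beyond
  degree p + 1. For every n, modulo the functionals vanishing on the vectors fixed by U^(n+1), the
  operator u - 1 raises the filtration by 1, 2, p, 2 p for u in U^1, U^2, U^3, U^4; letting n grow,
  the dual turns out to be finite, so that such estimates hold on the dual itself.

  Let X = u - 1 with u = 1 + p [zeta], where zeta generates H; it is H-invariant. In the group,
  u (1 + varpi t) = u' (1 + varpi rho t)^p (1 + varpi t) u with u' in U^4 and rho a unit. Hence
  [X, Z] e1 is a nonzero multiple of Y^p e1 up to terms of degree p + 1. On the other hand the
  H-eigenvalues determine Z e1, X e1 and X e2 up to high degree and force [X, Z] e1 to be a multiple
  of Z^(b+1) e2 up to degree p + 1, where 1 <= b <= p - 1 by the two conditions on the character.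
  This contradicts the independence of Y^p e1 and Z^p e2 in degree p.
*)

theory Submission
  imports Defs "HOL-Algebra.UnivPoly" "HOL-Algebra.Subrings" "HOL-Library.Function_Algebras"
begin

text \<open>The power Y^p comes from the group: in characteristic p one has g^p - 1 = (g - 1)^p, and
  p-th powers of U^1 lie in U^3, as do commutators of U^2 with U^1. The same identity applied to U^2
  makes U^4 raise degrees by 2 p, so the error u' is negligible. Approximations by p-th powers only
  converge, hence the finite levels: there U^(n+1) acts trivially and a descending induction can
  start. Relative to e1, the operators Y, Z, X have H-weights 1, p, 0 modulo p + 1, the order of the
  character alpha. So among p + 1 consecutive degrees a weight occurs for at most one power of Y on
  e1 and one power of Z on e2. Here b is the weight of e2; the conditions on the character exclude b
  = 0 and b = p. That Y^p survives in the quotient is tested by a function on the group rather than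
  read off a basis of the enveloping algebra. Powers of the leading coordinate reach only degree p -
  1, since its p-th power is additive. Degree p is reached by delta(t) = (sigma(t) - t^p) / p at the
  ratio t = d / c of the coordinates of g = c + varpi d.\<close>

lemma (in vector_space) independent_spans_of_card_eq_dim:
  assumes "independent S" "S \<subseteq> V" "card S = dim V" "dim V > 0"
  shows "V \<subseteq> span S"
proof
  fix x assume x: "x \<in> V"
  obtain B where B: "B \<subseteq> V" "independent B" "V \<subseteq> span B" "card B = dim V"
    using basis_exists by blast
  \<comment> \<open>The cardinality of an infinite basis is 0, so a positive dimension supplies the
    finiteness.\<close>
  have fB: "finite B" using B(4) assms(4) card_ge_0_finite[of B] by simp
  have fS: "finite S" using assms(3,4) card_ge_0_finite[of S] by simp
  show "x \<in> span S"
  proof (rule ccontr)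
    assume nx: "x \<notin> span S"
    have "independent (insert x S)" using nx assms(1) by (rule independent_insertI)
    moreover have "insert x S \<subseteq> span B" using x assms(2) B(3) by blast
    ultimately have "card (insert x S) \<le> card B" using independent_span_bound[OF fB] by blast
    moreover have "x \<notin> S" using nx span_superset by blast
    ultimately show False using fS B(4) assms(3) by simp
  qed
qed

locale quat =
  fixes p :: nat
    and D :: "('k::field_char_0, 'd::division_ring, 'f::{finite,field}) quat_datum"
  assumes prime_p: "prime p" and p_ge_5: "p \<ge> 5" and char_f: "CHAR('f) = p"
    and setting: "quat_setting p D"
begin

abbreviation "q \<equiv> p\<^sup>2"
abbreviation "emb \<equiv> qp_emb D"
abbreviation "nrm \<equiv> qp_abs D"
abbreviation "Od \<equiv> max_ord D"
abbreviation "Ld \<equiv> unram D"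
abbreviation "\<pi> \<equiv> unif D"
abbreviation "rd \<equiv> red D"

section \<open>The p-adic absolute value and the p-adic integers\<close>

lemma p_pos [simp]: "0 < p" using p_ge_5 by simp

lemma padic: "is_padic_field p nrm" using setting by (simp add: quat_setting_def)

lemma nrm_ge_0 [simp]: "0 \<le> nrm x" using padic by (simp add: is_padic_field_def)
lemma nrm_eq_0 [simp]: "nrm x = 0 \<longleftrightarrow> x = 0" using padic by (simp add: is_padic_field_def)
lemma nrm_mult: "nrm (x * y) = nrm x * nrm y" using padic by (simp add: is_padic_field_def)
lemma nrm_add: "nrm (x + y) \<le> max (nrm x) (nrm y)" using padic by (simp add: is_padic_field_def)
lemma nrm_int: "m \<noteq> 0 \<Longrightarrow> nrm (of_int m) = 1 / real p ^ multiplicity (int p) m"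
  using padic by (simp add: is_padic_field_def)
lemma nrm_dense: "e > 0 \<Longrightarrow> \<exists>r::rat. nrm (x - of_rat r) < e"
  using padic by (simp add: is_padic_field_def)

lemma nrm_1 [simp]: "nrm 1 = 1" using nrm_int[of 1] by simp
lemma nrm_p: "nrm (of_nat p) = 1 / real p"
  using nrm_int[of "int p"] prime_p by (simp add: multiplicity_self)
lemma nrm_uminus [simp]: "nrm (- x) = nrm x"
proof -
  have "nrm (-1) ^ 2 = 1" using nrm_mult[of "-1" "-1"] by (simp add: power2_eq_square)
  hence "nrm (-1) = 1" using nrm_ge_0[of "-1"] by (simp add: power2_eq_1_iff)
  thus ?thesis using nrm_mult[of "-1" x] by simp
qed
lemma nrm_diff: "nrm (x - y) \<le> max (nrm x) (nrm y)" using nrm_add[of x "- y"] by simp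
lemma nrm_inverse: "nrm (inverse x) = inverse (nrm x)"
proof (cases "x = 0")
  case False
  hence "nrm x * nrm (inverse x) = 1" using nrm_mult[of x "inverse x"] by simp
  thus ?thesis by (simp add: inverse_unique)
qed (simp add: nrm_eq_0[THEN iffD2])
lemma nrm_divide: "nrm (x / y) = nrm x / nrm y"
  by (simp add: divide_inverse nrm_mult nrm_inverse)
lemma nrm_power: "nrm (x ^ n) = nrm x ^ n" by (induction n) (simp_all add: nrm_mult)
lemma nrm_int_le: "nrm (of_int m) \<le> 1"
  using p_ge_5 by (cases "m = 0") (simp_all add: nrm_int nrm_eq_0[THEN iffD2])

lemma nrm_less_imp_eq: "nrm (x - y) < nrm x \<Longrightarrow> nrm y = nrm x"
  using nrm_add[of "x - y" y] nrm_diff[of x "x - y"] by (auto simp: max_def split: if_splits)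

text \<open>A rational number closer to \<open>c\<close> than \<open>nrm c\<close> has the same
  absolute value, and on rationals the value is read off numerator and denominator. Two powers
  instead of one quotient avoid negative exponents.\<close>

lemma nrm_value:
  assumes "c \<noteq> 0"
  shows "\<exists>m n. nrm c * real p ^ m = real p ^ n"
proof -
  obtain r where r: "nrm (c - of_rat r) < nrm c" using nrm_dense[of "nrm c" c] assms
    by (metis less_eq_real_def nrm_eq_0 nrm_ge_0)
  have eq: "nrm (of_rat r) = nrm c" using nrm_less_imp_eq[OF r] .
  obtain a b where ab: "quotient_of r = (a, b)" by fastforce
  have b: "b > 0" using quotient_of_denom_pos[OF ab] .
  have rr: "r = of_int a / of_int b" using quotient_of_div[OF ab] .
  have "nrm (of_rat r) \<noteq> 0" using eq assms by simp
  hence "(of_rat r :: 'k) \<noteq> 0" by simp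
  hence a: "a \<noteq> 0" using rr by auto
  have "nrm (of_rat r) = nrm (of_int a) / nrm (of_int b)"
    by (simp add: rr of_rat_divide nrm_divide)
  also have "\<dots> = real p ^ multiplicity (int p) b / real p ^ multiplicity (int p) a"
    using a b by (simp add: nrm_int)
  finally have "nrm c * real p ^ multiplicity (int p) a = real p ^ multiplicity (int p) b"
    using eq by simp
  thus ?thesis by blast
qed

lemma nrm_value_unit:
  assumes "c \<noteq> 0"
  shows "\<exists>m n c'. nrm c' = 1 \<and> of_nat p ^ m * c = of_nat p ^ n * c'"
proof -
  obtain m n where mn: "nrm c * real p ^ m = real p ^ n" using nrm_value[OF assms] by blast
  have nz: "(of_nat p :: 'k) \<noteq> 0" by simp
  define c' where "c' = of_nat p ^ n * c / of_nat p ^ m"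
  have "nrm c' = 1" using mn by (simp add: c'_def nrm_divide nrm_mult nrm_power nrm_p field_simps)
  moreover have "of_nat p ^ n * c = of_nat p ^ m * c'" using nz by (simp add: c'_def)
  ultimately show ?thesis by blast
qed

text \<open>The value group consists of the powers of \<open>p\<close>, so an absolute value below 1
  is at most \<open>1 / p\<close>, and division by \<open>p\<close> stays integral.\<close>

lemma nrm_less_1:
  assumes "nrm c < 1"
  shows "\<exists>e. nrm e \<le> 1 \<and> c = of_nat p * e"
proof (cases "c = 0")
  case True thus ?thesis by (intro exI[of _ 0]) (simp add: nrm_eq_0[THEN iffD2])
next
  case False
  obtain m n where mn: "nrm c * real p ^ m = real p ^ n" using nrm_value[OF False] by blast
  have "real p ^ n < real p ^ m"
    using mn assms p_ge_5 mult_strict_right_mono[of "nrm c" 1 "real p ^ m"] by simp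
  hence "n < m" using p_ge_5 by (simp add: power_strict_increasing_iff)
  then obtain k where k: "m = Suc n + k" by (metis Suc_leI le_Suc_ex)
  have "nrm c * real p * real p ^ k = 1"
    using mn p_ge_5 by (simp add: k power_add field_simps)
  moreover have "real p ^ k \<ge> 1" using p_ge_5 by simp
  moreover have "nrm c * real p * 1 \<le> nrm c * real p * real p ^ k"
    using calculation(2) by (intro mult_left_mono) auto
  ultimately have "nrm c * real p \<le> 1" by linarith
  hence "nrm (c / of_nat p) \<le> 1" by (simp add: nrm_divide nrm_p)
  thus ?thesis by (intro exI[of _ "c / of_nat p"]) simp
qed

text \<open>The residue field of the \<open>p\<close>-adic integers is the prime field: a rational
  approximation of \<open>c\<close> has denominator prime to \<open>p\<close>, and modulo
  \<open>p\<close> division by it becomes multiplication by an integer.\<close>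

lemma zp_approx:
  assumes "nrm c \<le> 1"
  shows "\<exists>m::int. nrm (c - of_int m) < 1"
proof -
  obtain r where r: "nrm (c - of_rat r) < 1" using nrm_dense[of 1 c] by auto
  have r1: "nrm (of_rat r) \<le> 1" using nrm_diff[of c "c - of_rat r"] r assms by (auto simp: max_def split: if_splits)
  obtain a b where ab: "quotient_of r = (a, b)" by fastforce
  have b: "b > 0" using quotient_of_denom_pos[OF ab] .
  have rr: "r = of_int a / of_int b" using quotient_of_div[OF ab] .
  have cop: "coprime a b" using quotient_of_coprime[OF ab] .
  have nb: "\<not> int p dvd b"
  proof
    assume d: "int p dvd b"
    hence na: "\<not> int p dvd a" using cop prime_p coprime_common_divisor[of a b "int p"]
      by (auto simp: prime_nat_iff)
    hence a0: "a \<noteq> 0" by auto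
    have m0: "multiplicity (int p) a = 0" using na by (simp add: not_dvd_imp_multiplicity_0)
    have "multiplicity (int p) b \<ge> 1"
      using d b prime_p by (intro multiplicity_geI) auto
    hence "real p ^ multiplicity (int p) b > 1" using p_ge_5 by (simp add: one_less_power)
    moreover have "nrm (of_rat r) = real p ^ multiplicity (int p) b"
      using a0 b m0 by (simp add: rr of_rat_divide nrm_divide nrm_int)
    ultimately show False using r1 by simp
  qed
  hence "coprime (int p) b" using prime_p by (simp add: prime_imp_coprime)
  then obtain t e where "t * int p + e * b = 1" using bezout_int[of "int p" b] by auto
  hence t: "1 - b * e = int p * t" by (simp add: algebra_simps)
  have "(of_rat r - of_int (a * e) :: 'k) = of_int a / of_int b * of_int (1 - b * e)"
    using b by (simp add: rr of_rat_divide field_simps)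
  also have "\<dots> = of_rat r * of_nat p * of_int t" by (simp add: t rr of_rat_divide)
  finally have "nrm (of_rat r - of_int (a * e)) = nrm (of_rat r) * (1 / real p) * nrm (of_int t)"
    by (simp only: nrm_mult nrm_p)
  also have "\<dots> \<le> 1 * (1 / real p) * 1"
    using r1 nrm_int_le[of t] by (intro mult_mono) auto
  also have "\<dots> < 1" using p_ge_5 by simp
  finally have "nrm (of_rat r - of_int (a * e)) < 1" .
  hence "nrm ((c - of_rat r) + (of_rat r - of_int (a * e))) < 1"
    using r nrm_add[of "c - of_rat r" "of_rat r - of_int (a * e)"] by linarith
  thus ?thesis by (intro exI[of _ "a * e"]) simp
qed

subsection \<open>The valuation ring\<close>

lemma quat_alg: "is_nonsplit_quaternion_algebra D" using setting by (simp add: quat_setting_def)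
lemma emb_1 [simp]: "emb 1 = 1" using quat_alg by (simp add: is_nonsplit_quaternion_algebra_def)
lemma emb_add: "emb (a + b) = emb a + emb b" using quat_alg by (simp add: is_nonsplit_quaternion_algebra_def)
lemma emb_mult: "emb (a * b) = emb a * emb b" using quat_alg by (simp add: is_nonsplit_quaternion_algebra_def)
lemma emb_range: "range emb = centre" using quat_alg by (simp add: is_nonsplit_quaternion_algebra_def)
lemma emb_comm: "emb c * x = x * emb c"
  using emb_range by (auto simp: centre_def)
lemma emb_0 [simp]: "emb 0 = 0" using emb_add[of 0 0] by simp
lemma emb_uminus: "emb (- c) = - emb c" using emb_add[of c "- c"] by (simp add: eq_neg_iff_add_eq_0 add.commute)
lemma emb_of_nat [simp]: "emb (of_nat n) = of_nat n" by (induction n) (simp_all add: emb_add)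
lemma emb_of_int [simp]: "emb (of_int n) = of_int n"
  by (cases n rule: int_cases2) (simp_all add: emb_uminus)
lemma emb_eq_0 [simp]: "emb c = 0 \<longleftrightarrow> c = 0"
proof
  assume "emb c = 0"
  hence "emb (c * inverse c) = 0" by (simp add: emb_mult)
  thus "c = 0" by (cases "c = 0") simp_all
qed simp

lemma of_nat_p_comm: "of_nat n * (x::'d) = x * of_nat n" using emb_comm[of "of_nat n" x] by simp
lemma of_nat_p_pow_comm: "of_nat p ^ n * (x::'d) = x * of_nat p ^ n"
  using of_nat_p_comm[of "p ^ n" x] by simp
lemma of_nat_d_eq_0 [simp]: "(of_nat n :: 'd) = 0 \<longleftrightarrow> n = 0"
  using emb_eq_0[of "of_nat n"] by simp

lemma qp_vs: "vector_space (qp_scale D)"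
  by unfold_locales (simp_all add: qp_scale_def emb_add emb_mult algebra_simps)

lemma pi_sq: "\<pi> * \<pi> = of_nat p" using setting by (simp add: quat_setting_def power2_eq_square)
lemma pi_nz [simp]: "\<pi> \<noteq> 0" proof
  assume "\<pi> = 0"
  hence "(of_nat p :: 'd) = 0" using pi_sq by simp
  thus False using p_pos by (simp only: of_nat_d_eq_0)
qed
lemma pi_pow2: "\<pi> ^ (2 * n) = of_nat p ^ n" by (simp add: power_mult power2_eq_square pi_sq)

lemma ord: "is_order D Od" using setting by (simp add: quat_setting_def is_maximal_order_def)
lemma O_1 [simp]: "1 \<in> Od" using ord by (simp add: is_order_def)
lemma O_diff: "x \<in> Od \<Longrightarrow> y \<in> Od \<Longrightarrow> x - y \<in> Od" using ord by (simp add: is_order_def)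
lemma O_mult: "x \<in> Od \<Longrightarrow> y \<in> Od \<Longrightarrow> x * y \<in> Od" using ord by (simp add: is_order_def)
lemma O_0 [simp]: "0 \<in> Od" using O_diff[of 1 1] by simp
lemma O_uminus: "x \<in> Od \<Longrightarrow> - x \<in> Od" using O_diff[of 0 x] by simp
lemma O_add: "x \<in> Od \<Longrightarrow> y \<in> Od \<Longrightarrow> x + y \<in> Od" using O_diff[of x "- y"] O_uminus[of y] by simp
lemma O_power: "x \<in> Od \<Longrightarrow> x ^ n \<in> Od" by (induction n) (simp_all add: O_mult)
lemma O_of_nat [simp]: "of_nat n \<in> Od" by (induction n) (simp_all add: O_add)
lemma O_of_int [simp]: "of_int n \<in> Od" by (cases n rule: int_cases2) (simp_all add: O_uminus)
lemma O_pi [simp]: "\<pi> \<in> Od" using setting by (simp add: quat_setting_def)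
lemma O_pi_pow [simp]: "\<pi> ^ n \<in> Od" by (simp add: O_power)
lemma O_sum: "(\<And>i. i \<in> A \<Longrightarrow> g i \<in> Od) \<Longrightarrow> sum g A \<in> Od"
  by (induction A rule: infinite_finite_induct) (simp_all add: O_add)

lemma O_gen: "\<exists>B. finite B \<and>
        Od = {(\<Sum>b\<in>B. qp_scale D (c b) b) | c. \<forall>b\<in>B. nrm (c b) \<le> 1} \<and>
        module.span (qp_scale D) B = UNIV"
  using ord by (simp add: is_order_def)

text \<open>The order is given by generators over the \<open>p\<close>-adic integers, so 1 is an
  integral combination of them; multiplying its coefficients by \<open>c\<close> keeps them
  integral.\<close>

lemma O_zp:
  assumes "nrm c \<le> 1"
  shows "emb c \<in> Od"
proof -
  obtain B where B: "finite B" "Od = {(\<Sum>b\<in>B. qp_scale D (c b) b) | c. \<forall>b\<in>B. nrm (c b) \<le> 1}"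
    using O_gen by blast
  have "1 \<in> Od" by simp
  then obtain d where d: "1 = (\<Sum>b\<in>B. qp_scale D (d b) b)" "\<forall>b\<in>B. nrm (d b) \<le> 1" using B(2) by auto
  have "emb c = emb c * (\<Sum>b\<in>B. qp_scale D (d b) b)" by (simp flip: d(1))
  also have "\<dots> = (\<Sum>b\<in>B. qp_scale D (c * d b) b)"
    by (simp add: sum_distrib_left qp_scale_def emb_mult mult.assoc)
  finally have "emb c = (\<Sum>b\<in>B. qp_scale D (c * d b) b)" .
  moreover have "\<forall>b\<in>B. nrm (c * d b) \<le> 1"
    using d(2) assms by (simp add: nrm_mult mult_le_one)
  ultimately have "\<exists>c'. emb c = (\<Sum>b\<in>B. qp_scale D (c' b) b) \<and> (\<forall>b\<in>B. nrm (c' b) \<le> 1)"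
    by (intro exI[of _ "\<lambda>b. c * d b"]) simp
  thus ?thesis by (subst B(2)) (rule CollectI)
qed

text \<open>The generators of the order span \<open>D\<close>, and a power of \<open>p\<close>
  clears the finitely many denominators. Together with \<open>O_factor\<close> this substitutes for
  a valuation on \<open>D\<close>, which is not part of the setting.\<close>

lemma O_absorb: "\<exists>N. of_nat p ^ N * x \<in> Od"
proof -
  obtain B where B: "finite B" "Od = {(\<Sum>b\<in>B. qp_scale D (c b) b) | c. \<forall>b\<in>B. nrm (c b) \<le> 1}"
    "module.span (qp_scale D) B = UNIV" using O_gen by blast
  interpret vs: vector_space "qp_scale D" by (rule qp_vs)
  obtain c where c: "x = (\<Sum>b\<in>B. qp_scale D (c b) b)"
    using B(3) vs.span_finite[OF B(1)] by auto
  have "\<exists>N. \<forall>b\<in>B'. nrm (of_nat p ^ N * c b) \<le> 1" if "finite B'" for B'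
    using that
  proof (induction B')
    case (insert b B')
    then obtain N where N: "\<forall>b\<in>B'. nrm (of_nat p ^ N * c b) \<le> 1" by blast
    obtain M where M: "nrm (c b) < real p ^ M"
      using real_arch_pow[of "real p" "nrm (c b)"] p_ge_5 by auto
    have small: "nrm (of_nat p ^ k) \<le> 1" for k using p_ge_5 by (simp add: nrm_power nrm_p power_le_one)
    have "nrm (of_nat p ^ (N + M) * c b') \<le> 1" if "b' \<in> insert b B'" for b'
    proof (cases "b' = b")
      case True
      have "nrm (of_nat p ^ M * c b) \<le> 1"
        using M p_ge_5 by (simp add: nrm_mult nrm_power nrm_p field_simps)
      thus ?thesis using small[of N] True by (simp add: power_add nrm_mult mult_le_one mult.assoc)
    next
      case False
      hence "nrm (of_nat p ^ N * c b') \<le> 1" using N that by simp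
      thus ?thesis using small[of M]
        using mult_le_one[of "nrm (of_nat p ^ M)" "nrm (of_nat p ^ N * c b')"]
        by (simp add: nrm_mult power_add mult_ac)
    qed
    thus ?case by blast
  qed (rule exI[of _ 0], simp)
  then obtain N where N: "\<forall>b\<in>B. nrm (of_nat p ^ N * c b) \<le> 1" using B(1) by blast
  have "of_nat p ^ N * x = (\<Sum>b\<in>B. qp_scale D (of_nat p ^ N * c b) b)"
    using emb_of_nat[of "p ^ N"]
    by (simp add: c sum_distrib_left qp_scale_def emb_mult mult.assoc)
  hence "\<exists>c'. of_nat p ^ N * x = (\<Sum>b\<in>B. qp_scale D (c' b) b) \<and> (\<forall>b\<in>B. nrm (c' b) \<le> 1)"
    using N by (intro exI[of _ "\<lambda>b. of_nat p ^ N * c b"]) simp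
  hence "of_nat p ^ N * x \<in> Od" by (subst B(2)) (rule CollectI)
  thus ?thesis ..
qed

lemma rd_1 [simp]: "rd 1 = 1" using setting by (simp add: quat_setting_def)
lemma rd_add: "x \<in> Od \<Longrightarrow> y \<in> Od \<Longrightarrow> rd (x + y) = rd x + rd y"
  using setting by (simp add: quat_setting_def)
lemma rd_mult: "x \<in> Od \<Longrightarrow> y \<in> Od \<Longrightarrow> rd (x * y) = rd x * rd y"
  using setting by (simp add: quat_setting_def)
lemma rd_ker: "{x \<in> Od. rd x = 0} = {\<pi> * x | x. x \<in> Od}"
  using setting unfolding quat_setting_def by blast
lemma rd_eq_0D: "x \<in> Od \<Longrightarrow> rd x = 0 \<Longrightarrow> \<exists>y\<in>Od. x = \<pi> * y" using rd_ker by blast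
lemma rd_pi_mult [simp]: "x \<in> Od \<Longrightarrow> rd (\<pi> * x) = 0" using rd_ker by blast
lemma rd_0 [simp]: "rd 0 = 0" using rd_add[of 0 0] O_0 by (metis add_cancel_right_right add_0)
lemma rd_uminus: "x \<in> Od \<Longrightarrow> rd (- x) = - rd x"
  using rd_add[of x "- x"] O_uminus[of x] by (simp add: eq_neg_iff_add_eq_0 add.commute)
lemma rd_diff: "x \<in> Od \<Longrightarrow> y \<in> Od \<Longrightarrow> rd (x - y) = rd x - rd y"
  using rd_add[of x "- y"] O_uminus[of y] rd_uminus[of y] by simp
lemma rd_pi [simp]: "rd \<pi> = 0" using rd_pi_mult[of 1] by simp
lemma rd_power: "x \<in> Od \<Longrightarrow> rd (x ^ n) = rd x ^ n"
  by (induction n) (simp_all add: rd_mult O_power)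
lemma rd_of_nat [simp]: "rd (of_nat n) = of_nat n" by (induction n) (simp_all add: rd_add)
lemma rd_of_int [simp]: "rd (of_int n) = of_int n"
  by (cases n rule: int_cases2) (simp_all add: rd_uminus)
lemma rd_sum: "(\<And>i. i \<in> A \<Longrightarrow> g i \<in> Od) \<Longrightarrow> rd (sum g A) = (\<Sum>i\<in>A. rd (g i))"
  by (induction A rule: infinite_finite_induct) (simp_all add: rd_add O_sum)
lemma of_nat_f_eq_0: "(of_nat n :: 'f) = 0 \<longleftrightarrow> p dvd n"
  using of_nat_eq_0_iff_char_dvd[where 'a = 'f] char_f by simp
lemma of_nat_p_f [simp]: "(of_nat p :: 'f) = 0" by (simp add: of_nat_f_eq_0)

text \<open>Conjugation by the uniformizer on all of \<open>D\<close>; on the unramified subfield it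
  is the automorphism \<sigma>. It is the rule for moving \<pi> to the left of a product.\<close>

definition cj :: "'d \<Rightarrow> 'd" where "cj x = inverse \<pi> * x * \<pi>"

lemma mult_pi: "x * \<pi> = \<pi> * cj x" by (simp add: cj_def mult.assoc[symmetric])
lemma cj_mult: "cj (x * y) = cj x * cj y" by (simp add: cj_def mult.assoc[symmetric]) (simp add: mult.assoc)
lemma cj_add: "cj (x + y) = cj x + cj y" by (simp add: cj_def algebra_simps)
lemma cj_diff: "cj (x - y) = cj x - cj y" by (simp add: cj_def algebra_simps)
lemma cj_1 [simp]: "cj 1 = 1" by (simp add: cj_def)
lemma cj_0 [simp]: "cj 0 = 0" by (simp add: cj_def)
lemma cj_pi [simp]: "cj \<pi> = \<pi>" by (simp add: cj_def)
lemma cj_power: "cj (x ^ n) = cj x ^ n" by (induction n) (simp_all add: cj_mult)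
lemma cj_of_nat [simp]: "cj (of_nat n) = of_nat n" by (induction n) (simp_all add: cj_add)
lemma cj_emb [simp]: "cj (emb c) = emb c"
  by (simp add: cj_def mult.assoc emb_comm) (simp add: mult.assoc[symmetric])
text \<open>The square of the uniformizer is \<open>p\<close>, which is central.\<close>

lemma cj_cj [simp]: "cj (cj x) = x"
proof -
  have "\<pi> * \<pi> * cj (cj x) = x * (\<pi> * \<pi>)"
    using mult_pi[of x] mult_pi[of "cj x"] by (metis mult.assoc)
  hence "of_nat p * cj (cj x) = of_nat p * x" using of_nat_p_comm[of p x] by (simp add: pi_sq)
  thus ?thesis using of_nat_d_eq_0[of p] p_pos by (metis mult_left_cancel less_irrefl)
qed
lemma cj_inverse: "cj (inverse x) = inverse (cj x)"
proof (cases "x = 0")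
  case False
  hence "cj x * cj (inverse x) = 1" by (simp flip: cj_mult)
  thus ?thesis using inverse_unique by metis
qed simp
lemma cj_eq_0 [simp]: "cj x = 0 \<longleftrightarrow> x = 0" by (simp add: cj_def)

text \<open>The right ideal generated by the uniformizer is the kernel of \<open>rd\<close>, hence
  two-sided.\<close>

lemma cj_O [simp]: "x \<in> Od \<Longrightarrow> cj x \<in> Od"
proof -
  assume x: "x \<in> Od"
  have "rd (x * \<pi>) = 0" using x by (simp add: rd_mult)
  then obtain y where y: "y \<in> Od" "x * \<pi> = \<pi> * y" using rd_eq_0D x O_mult O_pi by blast
  thus ?thesis using mult_pi[of x] by simp
qed
lemma rd_cj_eq_0: "x \<in> Od \<Longrightarrow> rd (cj x) = 0 \<longleftrightarrow> rd x = 0"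
proof -
  have a: "rd (cj x) = 0" if x: "x \<in> Od" "rd x = 0" for x
  proof -
    obtain y where "y \<in> Od" "x = \<pi> * y" using rd_eq_0D x by blast
    thus ?thesis by (simp add: cj_mult)
  qed
  assume x: "x \<in> Od"
  show ?thesis using a[OF x] a[of "cj x"] x by auto
qed

lemma mult_pi_pow: "x * \<pi> ^ n = \<pi> ^ n * (cj ^^ n) x"
proof (induction n arbitrary: x)
  case (Suc n)
  have "x * \<pi> ^ Suc n = (x * \<pi>) * \<pi> ^ n" by (simp add: mult.assoc)
  also have "\<dots> = \<pi> * (cj x * \<pi> ^ n)" by (simp only: mult_pi mult.assoc)
  also have "\<dots> = \<pi> ^ Suc n * (cj ^^ n) (cj x)" by (simp only: Suc[of "cj x"] power_Suc mult.assoc)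
  finally show ?case by (simp only: funpow.simps comp_apply funpow_swap1)
qed simp
lemma cjn_O: "x \<in> Od \<Longrightarrow> (cj ^^ n) x \<in> Od" by (induction n) simp_all
lemma rd_cjn_eq_0: "x \<in> Od \<Longrightarrow> rd ((cj ^^ n) x) = 0 \<longleftrightarrow> rd x = 0"
  by (induction n) (simp_all add: rd_cj_eq_0 cjn_O)

text \<open>The exponent in a factorization \<open>\<pi> ^ m * u\<close> is a well-defined
  valuation. Units appear here as elements of nonzero reduction, since their inverses are shown to
  be integral only in \<open>unit_inv\<close>.\<close>

lemma pi_pow_inject:
  assumes "\<pi> ^ m * u = \<pi> ^ n * v" "u \<in> Od" "v \<in> Od" "rd u \<noteq> 0" "rd v \<noteq> 0"
  shows "m = n"
proof -
  have *: False if H: "\<pi> ^ m * u = \<pi> ^ n * v" "u \<in> Od" "v \<in> Od" "rd u \<noteq> 0" "m < n" for m n u v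
  proof -
    obtain k where k: "n = m + Suc k" using H(5) less_iff_Suc_add by auto
    have "\<pi> ^ m * u = \<pi> ^ m * (\<pi> * (\<pi> ^ k * v))" using H(1) by (simp only: k power_add power_Suc mult.assoc)
    hence "u = \<pi> * (\<pi> ^ k * v)" by simp
    thus False using H(3,4) by (simp add: O_mult)
  qed
  show ?thesis using *[of m u n v] *[of n v m u] assms by (metis linorder_neqE_nat)
qed

text \<open>If \<open>x\<close> were nonzero, some \<open>of_nat p ^ N * inverse x\<close> would be
  integral; divisibility of \<open>x\<close> by \<open>\<pi> ^ Suc (2 * N)\<close> would then make 1
  reduce to 0.\<close>

lemma O_inter:
  assumes "\<And>k. \<exists>y\<in>Od. x = \<pi> ^ k * y"
  shows "x = 0"
proof (rule ccontr)
  assume nz: "x \<noteq> 0"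
  obtain N where N: "of_nat p ^ N * inverse x \<in> Od" using O_absorb by blast
  obtain y where y: "y \<in> Od" "x = \<pi> ^ Suc (2 * N) * y" using assms by blast
  have "x = of_nat p ^ N * \<pi> * y" using y(2) by (simp only: power_Suc2 pi_pow2)
  hence "1 = inverse x * (of_nat p ^ N * \<pi> * y)" using nz by simp
  also have "\<dots> = (of_nat p ^ N * inverse x) * (\<pi> * y)"
    by (simp only: mult.assoc[symmetric] of_nat_p_pow_comm[of N "inverse x"])
  finally have "rd 1 = rd ((of_nat p ^ N * inverse x) * (\<pi> * y))" by simp
  thus False using N y(1) by (simp add: rd_mult O_mult)
qed

text \<open>Dividing out the uniformizer repeatedly must stop, by \<open>O_inter\<close>.\<close>

lemma O_factor:
  assumes "x \<in> Od" "x \<noteq> 0"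
  shows "\<exists>k. \<exists>u\<in>Od. rd u \<noteq> 0 \<and> x = \<pi> ^ k * u"
proof (rule ccontr)
  assume neg: "\<not> ?thesis"
  have "\<exists>y\<in>Od. x = \<pi> ^ k * y" for k
  proof (induction k)
    case 0 thus ?case using assms by simp
  next
    case (Suc k)
    then obtain y where y: "y \<in> Od" "x = \<pi> ^ k * y" by blast
    hence "rd y = 0" using neg by blast
    then obtain z where "z \<in> Od" "y = \<pi> * z" using rd_eq_0D y by blast
    thus ?case using y by (intro bexI[of _ z]) (simp_all add: mult.assoc[symmetric] power_commutes)
  qed
  thus False using O_inter assms(2) by blast
qed

lemma D_factor:
  assumes "x \<noteq> 0"
  shows "\<exists>N k. \<exists>u\<in>Od. rd u \<noteq> 0 \<and> of_nat p ^ N * x = \<pi> ^ k * u"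
proof -
  obtain N where "of_nat p ^ N * x \<in> Od" using O_absorb by blast
  moreover have "of_nat p ^ N * x \<noteq> 0" using assms by simp
  ultimately show ?thesis using O_factor by blast
qed

text \<open>Up to a power of \<open>p\<close>, the inverse is a power of the uniformizer times an
  element of nonzero reduction; multiplying by \<open>u\<close> and comparing exponents shows that
  the two powers cancel.\<close>

lemma unit_inv:
  assumes "u \<in> Od" "rd u \<noteq> 0"
  shows "inverse u \<in> Od"
proof -
  have nz: "u \<noteq> 0" using assms by auto
  obtain N k w where w: "w \<in> Od" "rd w \<noteq> 0" "of_nat p ^ N * inverse u = \<pi> ^ k * w"
    using D_factor[of "inverse u"] nz by auto
  have "\<pi> ^ (2 * N) * 1 = u * (of_nat p ^ N * inverse u)"
    using nz by (simp add: pi_pow2 mult.assoc[symmetric] of_nat_p_pow_comm[symmetric])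
      (simp add: mult.assoc)
  also have "\<dots> = \<pi> ^ k * ((cj ^^ k) u * w)" by (simp add: w(3) mult_pi_pow mult.assoc[symmetric])
  finally have eq: "\<pi> ^ (2 * N) * 1 = \<pi> ^ k * ((cj ^^ k) u * w)" .
  have "2 * N = k" using pi_pow_inject[OF eq] assms w
    by (simp add: O_mult rd_mult cjn_O rd_cjn_eq_0)
  hence "of_nat p ^ N * inverse u = of_nat p ^ N * w" using w(3) by (simp only: pi_pow2[symmetric])
  hence "inverse u = w" using p_pos by simp
  thus ?thesis using w by simp
qed

text \<open>The order behaves like a valuation ring: a non-integral element has negative valuation,
  so its inverse lies in the maximal ideal. This forces all roots of unity into the order.\<close>

lemma not_O_inverse:
  assumes "x \<notin> Od"
  shows "inverse x \<in> Od \<and> rd (inverse x) = 0"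
proof -
  have nz: "x \<noteq> 0" using assms by auto
  obtain N k u where u: "u \<in> Od" "rd u \<noteq> 0" "of_nat p ^ N * x = \<pi> ^ k * u"
    using D_factor[OF nz] by auto
  have eq: "\<pi> ^ (2 * N) * x = \<pi> ^ k * u" using u(3) by (simp add: pi_pow2)
  have "\<not> 2 * N \<le> k"
  proof
    assume "2 * N \<le> k"
    then obtain j where "k = 2 * N + j" using le_Suc_ex by blast
    hence "x = \<pi> ^ j * u" using eq by (simp add: power_add mult.assoc)
    thus False using assms u(1) by (simp add: O_mult)
  qed
  then obtain j where j: "2 * N = k + Suc j" using less_imp_Suc_add[of k "2 * N"] by (auto simp: not_le)
  have "\<pi> ^ k * (\<pi> ^ Suc j * x) = \<pi> ^ k * u" using eq by (simp only: j power_add mult.assoc)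
  hence "\<pi> ^ Suc j * x = u" by (simp del: power_Suc)
  moreover have "u \<noteq> 0" using u(2) by auto
  ultimately have "(inverse u * \<pi> ^ Suc j) * x = 1" by (simp only: mult.assoc) (rule left_inverse)
  hence x: "inverse (inverse u * \<pi> ^ Suc j) = x" by (rule inverse_unique)
  have "inverse x = inverse u * \<pi> ^ Suc j" unfolding x[symmetric] by (rule inverse_inverse_eq)
  moreover have "inverse u * \<pi> ^ Suc j \<in> Od" using unit_inv[OF u(1,2)] O_mult O_pi_pow by blast
  moreover have "rd (inverse u * \<pi> ^ Suc j) = 0"
    using unit_inv[OF u(1,2)] rd_mult[of "inverse u" "\<pi> * \<pi> ^ j"] by (simp add: O_mult)
  ultimately show ?thesis by simp
qed

lemma root_O:
  assumes "x ^ m = 1" "m > 0"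
  shows "x \<in> Od"
proof (rule ccontr)
  assume "x \<notin> Od"
  hence *: "inverse x \<in> Od" "rd (inverse x) = 0" using not_O_inverse by auto
  have "inverse x ^ m = 1" using assms by (simp add: power_inverse)
  thus False using rd_power[OF *(1), of m] *(2) assms(2) by (simp add: power_0_left)
qed

lemma geom_sum: "(x - 1) * (\<Sum>i<m. x ^ i) = x ^ m - (1::'d)"
  by (induction m) (simp_all add: algebra_simps)

text \<open>In \<open>w ^ m - 1 = (w - 1) * (1 + ... + w ^ (m - 1))\<close> the second factor
  reduces to \<open>m\<close>, which is nonzero in characteristic \<open>p\<close>.\<close>

lemma root_eq_1:
  assumes "w \<in> Od" "w ^ m = 1" "rd w = 1" "\<not> p dvd m"
  shows "w = 1"
proof -
  have "rd (\<Sum>i<m. w ^ i) = of_nat m" using assms by (simp add: rd_sum O_power rd_power)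
  hence "(\<Sum>i<m. w ^ i) \<noteq> 0" using assms(4) of_nat_f_eq_0[of m] by auto
  thus ?thesis using geom_sum[of w m] assms(2) by auto
qed

end

lemma card_power_roots_le:
  assumes "n > 0"
  shows "card {x::'a::{field,finite}. x ^ n = c} \<le> n"
proof -
  define P :: "'a poly" where "P = Polynomial.monom 1 n - [:c:]"
  have d: "degree P = n" unfolding P_def
    using assms by (subst diff_conv_add_uminus, subst degree_add_eq_left) (simp_all add: Polynomial.degree_monom_eq)
  hence "P \<noteq> 0" using assms by auto
  hence "card {x. poly P x = 0} \<le> n" using card_poly_roots_bound[of P] d by simp
  moreover have "{x. poly P x = 0} = {x. x ^ n = c}"
    by (auto simp: P_def poly_monom)
  ultimately show ?thesis by simp
qed

lemma power_mult_distrib_commuting: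
  fixes x y :: "'a::monoid_mult"
  assumes "x * y = y * x"
  shows "(x * y) ^ n = x ^ n * y ^ n"
proof (induction n)
  case (Suc n)
  have "(x * y) ^ Suc n = x * (y * x ^ n) * y ^ n" by (simp add: Suc mult.assoc)
  also have "y * x ^ n = x ^ n * y" using assms by (simp add: power_commuting_commutes)
  finally show ?case by (simp add: mult.assoc)
qed simp

context quat
begin

subsection \<open>The unramified subfield\<close>

lemma unram_quad: "is_unramified_quadratic p D Ld" using setting by (simp add: quat_setting_def)
lemma L_emb [simp]: "emb c \<in> Ld" using unram_quad by (auto simp: is_unramified_quadratic_def)
lemma L_diff: "x \<in> Ld \<Longrightarrow> y \<in> Ld \<Longrightarrow> x - y \<in> Ld" using unram_quad by (simp add: is_unramified_quadratic_def)
lemma L_mult: "x \<in> Ld \<Longrightarrow> y \<in> Ld \<Longrightarrow> x * y \<in> Ld" using unram_quad by (simp add: is_unramified_quadratic_def)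
lemma L_comm: "x \<in> Ld \<Longrightarrow> y \<in> Ld \<Longrightarrow> x * y = y * x" using unram_quad by (simp add: is_unramified_quadratic_def)
lemma L_inverse: "x \<in> Ld \<Longrightarrow> inverse x \<in> Ld" using unram_quad by (simp add: is_unramified_quadratic_def)
lemma L_of_nat [simp]: "of_nat n \<in> Ld" using L_emb[of "of_nat n"] by simp
lemma L_0 [simp]: "0 \<in> Ld" using L_of_nat[of 0] by simp
lemma L_1 [simp]: "1 \<in> Ld" using L_of_nat[of 1] by simp
lemma L_add: "x \<in> Ld \<Longrightarrow> y \<in> Ld \<Longrightarrow> x + y \<in> Ld" using L_diff[of x "0 - y"] L_diff[of 0 y] by simp
lemma L_uminus: "x \<in> Ld \<Longrightarrow> - x \<in> Ld" using L_diff[of 0 x] by simp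
lemma L_power: "x \<in> Ld \<Longrightarrow> x ^ n \<in> Ld" by (induction n) (simp_all add: L_mult)

lemma cj_frob: "x \<in> Ld \<Longrightarrow> cj x = frob D x" using setting by (simp add: quat_setting_def cj_def)
lemma frob_aut: "is_nontrivial_automorphism D Ld (frob D)" using setting by (simp add: quat_setting_def)
lemma cj_L [simp]: "x \<in> Ld \<Longrightarrow> cj x \<in> Ld"
  using frob_aut by (auto simp: is_nontrivial_automorphism_def cj_frob bij_betw_def)

lemma q_gt: "q > 2" "q - 1 > 0" "\<not> p dvd (q - 1)" "Suc (q - 1) = q"
proof -
  have "p * p \<ge> 5 * 5" using p_ge_5 by (intro mult_le_mono)
  thus "q > 2" "q - 1 > 0" "Suc (q - 1) = q" by (simp_all add: power2_eq_square)
  show "\<not> p dvd (q - 1)"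
  proof
    assume "p dvd q - 1"
    moreover have "p dvd q" by (simp add: power2_eq_square)
    ultimately have "p dvd q - (q - 1)" by (rule dvd_diff_nat[rotated])
    moreover have "q - (q - 1) = 1" using \<open>q > 2\<close> by simp
    ultimately show False using p_ge_5 by simp
  qed
qed

text \<open>A generator of the group \<open>H\<close> of Teichmueller units; its reduction
  \<open>tau\<close> generates the multiplicative group of the residue field. Sums over residue
  classes are later written as sums over exponents below \<open>q - 1\<close>.\<close>

definition zeta :: 'd where
  "zeta = (SOME z. z \<in> Ld \<and> z ^ (q - 1) = 1 \<and> (\<forall>k. 0 < k \<and> k < q - 1 \<longrightarrow> z ^ k \<noteq> 1))"

lemma zeta: "zeta \<in> Ld" "zeta ^ (q - 1) = 1" "0 < k \<Longrightarrow> k < q - 1 \<Longrightarrow> zeta ^ k \<noteq> 1"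
proof -
  have "\<exists>z. z \<in> Ld \<and> z ^ (q - 1) = 1 \<and> (\<forall>k. 0 < k \<and> k < q - 1 \<longrightarrow> z ^ k \<noteq> 1)"
    using unram_quad by (auto simp: is_unramified_quadratic_def)
  from someI_ex[OF this]
  show "zeta \<in> Ld" "zeta ^ (q - 1) = 1" "0 < k \<Longrightarrow> k < q - 1 \<Longrightarrow> zeta ^ k \<noteq> 1"
    unfolding zeta_def by blast+
qed
lemma zeta_O [simp]: "zeta \<in> Od" using root_O[OF zeta(2)] q_gt by simp
lemma zeta_pow_O [simp]: "zeta ^ k \<in> Od" by (simp add: O_power)
lemma zeta_L [simp]: "zeta ^ k \<in> Ld" "zeta \<in> Ld" using zeta(1) L_power by blast+

definition tau :: 'f where "tau = rd zeta"

lemma rd_zeta_pow: "rd (zeta ^ k) = tau ^ k" by (simp add: rd_power tau_def)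
lemma tau_pow: "tau ^ (q - 1) = 1" using rd_zeta_pow[of "q - 1"] zeta(2) by simp
lemma tau_nz [simp]: "tau \<noteq> 0"
proof
  assume "tau = 0"
  thus False using tau_pow q_gt(2) by (simp add: power_0_left)
qed
lemma zeta_pow_q: "(zeta ^ k) ^ (q - 1) = 1"
proof -
  have "(zeta ^ k) ^ (q - 1) = (zeta ^ (q - 1)) ^ k" by (simp only: power_mult[symmetric] mult.commute)
  thus ?thesis by (simp only: zeta(2) power_one)
qed
lemma tau_pow_q: "(tau ^ k) ^ (q - 1) = 1"
proof -
  have "(tau ^ k) ^ (q - 1) = (tau ^ (q - 1)) ^ k" by (simp only: power_mult[symmetric] mult.commute)
  thus ?thesis by (simp only: tau_pow power_one)
qed
text \<open>Reduction is injective on roots of unity of order prime to \<open>p\<close>, by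
  \<open>root_eq_1\<close>.\<close>

lemma tau_order: "0 < k \<Longrightarrow> k < q - 1 \<Longrightarrow> tau ^ k \<noteq> 1"
proof
  assume k: "0 < k" "k < q - 1" and t: "tau ^ k = 1"
  have "zeta ^ k = 1"
    by (rule root_eq_1[of _ "q - 1"]) (simp_all only: zeta_pow_q t q_gt rd_zeta_pow zeta_pow_O not_False_eq_True)
  thus False using zeta(3) k by blast
qed

lemma tau_inj: "inj_on (\<lambda>i. tau ^ i) {..<q - 1}"
proof (rule linorder_inj_onI')
  fix i j assume ij: "i \<in> {..<q - 1}" "j \<in> {..<q - 1}" "i < j"
  have "tau ^ j = tau ^ i * tau ^ (j - i)" using ij(3) by (simp flip: power_add)
  thus "tau ^ i \<noteq> tau ^ j" using tau_order[of "j - i"] ij by auto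
qed

text \<open>The coefficient field may be larger than the field with \<open>q\<close> elements;
  counting roots shows that the powers of \<open>tau\<close> exhaust the nonzero elements of that
  subfield.\<close>

lemma mu_eq: "{x::'f. x ^ (q - 1) = 1} = (\<lambda>i. tau ^ i) ` {..<q - 1}"
proof (rule sym, rule card_seteq)
  show "(\<lambda>i. tau ^ i) ` {..<q - 1} \<subseteq> {x::'f. x ^ (q - 1) = 1}"
    using tau_pow_q by blast
  show "card {x::'f. x ^ (q - 1) = 1} \<le> card ((\<lambda>i. tau ^ i) ` {..<q - 1})"
    unfolding card_image[OF tau_inj] card_lessThan by (rule card_power_roots_le) (rule q_gt(2))
qed simp

section \<open>Frobenius and the prime field\<close>

lemma frobenius_add: "((x::'f) + y) ^ p = x ^ p + y ^ p"
proof -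
  have "(x + y) ^ p = (\<Sum>k\<le>p. of_nat (p choose k) * x ^ k * y ^ (p - k))" by (rule binomial_ring)
  also have "\<dots> = (\<Sum>k\<in>{0, p}. of_nat (p choose k) * x ^ k * y ^ (p - k))"
  proof (rule sum.mono_neutral_right)
    show "\<forall>i\<in>{..p} - {0, p}. of_nat (p choose i) * x ^ i * y ^ (p - i) = 0"
      using prime_p by (auto simp: of_nat_f_eq_0 intro!: dvd_choose_prime)
  qed auto
  finally show ?thesis using p_pos by (simp add: add.commute)
qed
lemma frobenius_uminus: "(- x :: 'f) ^ p = - (x ^ p)"
  using frobenius_add[of x "- x"] p_pos by (simp add: power_0_left eq_neg_iff_add_eq_0 add.commute)
lemma frobenius_diff: "((x::'f) - y) ^ p = x ^ p - y ^ p"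
  using frobenius_add[of x "- y"] by (simp add: frobenius_uminus)
lemma frobenius_of_nat [simp]: "(of_nat n :: 'f) ^ p = of_nat n"
  using p_pos by (induction n) (simp_all add: frobenius_add power_0_left)
lemma frobenius_sum: "(sum g A :: 'f) ^ p = (\<Sum>i\<in>A. g i ^ p)"
  using p_pos by (induction A rule: infinite_finite_induct) (simp_all add: frobenius_add power_0_left)

text \<open>The integers from 1 to \<open>p - 1\<close> already provide \<open>p - 1\<close> roots
  of \<open>x ^ (p - 1) = 1\<close>, so there are no others. Traces and norms from the field with
  \<open>q\<close> elements are turned into integers in this way.\<close>

lemma prime_subfield: "(x::'f) ^ p = x \<Longrightarrow> \<exists>m::nat. x = of_nat m"
proof -
  assume x: "x ^ p = x"
  have *: "x ^ p = x \<longleftrightarrow> x = 0 \<or> x ^ (p - 1) = 1" for x :: 'f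
    using power_eq_if[of x p] p_pos by auto
  have "inj_on (of_nat :: nat \<Rightarrow> 'f) {1..<p}"
  proof (rule linorder_inj_onI')
    fix i j assume ij: "i \<in> {1..<p}" "j \<in> {1..<p}" "i < j"
    have "(of_nat j :: 'f) = of_nat i + of_nat (j - i)" using ij(3) by (simp flip: of_nat_add)
    moreover have "\<not> p dvd (j - i)" using ij by (auto dest: dvd_imp_le)
    ultimately show "(of_nat i :: 'f) \<noteq> of_nat j" by (simp add: of_nat_f_eq_0)
  qed
  hence c: "card (of_nat ` {1..<p} :: 'f set) = p - 1" by (simp add: card_image)
  have "(of_nat ` {1..<p} :: 'f set) = {x. x ^ (p - 1) = 1}"
  proof (rule card_seteq)
    show "(of_nat ` {1..<p} :: 'f set) \<subseteq> {x. x ^ (p - 1) = 1}"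
    proof clarify
      fix i assume "i \<in> {1..<p}"
      hence "(of_nat i :: 'f) \<noteq> 0" by (auto simp: of_nat_f_eq_0 dest: dvd_imp_le)
      thus "(of_nat i :: 'f) ^ (p - 1) = 1" using *[of "of_nat i"] by simp
    qed
    show "card {x::'f. x ^ (p - 1) = 1} \<le> card (of_nat ` {1..<p} :: 'f set)"
      using card_power_roots_le[of "p - 1" "1::'f"] p_ge_5 c by simp
  qed simp
  thus ?thesis using x * by (metis (mono_tags, lifting) imageE mem_Collect_eq of_nat_0)
qed

lemma tau_p_neq: "tau ^ p \<noteq> tau"
proof
  assume "tau ^ p = tau"
  hence "tau ^ (p - 1) = 1" using power_eq_if[of tau p] p_pos by simp
  moreover have "1 * p < p * p" using p_ge_5 by (intro mult_strict_right_mono) auto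
  hence "p - 1 < q - 1" "0 < p - 1" using p_ge_5 by (simp_all add: power2_eq_square diff_less_mono)
  ultimately show False using tau_order by blast
qed
lemma tau_q [simp]: "tau ^ q = tau" using tau_pow q_gt(4) power_Suc[of tau "q - 1"] by simp
lemma tau_pp [simp]: "(tau ^ p) ^ p = tau" using tau_q by (simp add: power_mult[symmetric] power2_eq_square)

lemma rd_emb: "nrm c \<le> 1 \<Longrightarrow> \<exists>m::nat. rd (emb c) = of_nat m"
proof -
  assume c: "nrm c \<le> 1"
  obtain m :: int where m: "nrm (c - of_int m) < 1" using zp_approx c by blast
  obtain e where e: "nrm e \<le> 1" "c - of_int m = of_nat p * e" using nrm_less_1[OF m] by blast
  have "emb c = of_int m + of_nat p * emb e"
    using e(2) by (metis add_diff_cancel_left' diff_add_cancel emb_add emb_mult emb_of_int emb_of_nat add.commute)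
  hence "rd (emb c) = of_int m" using O_zp[OF e(1)] by (simp add: rd_add rd_mult O_mult)
  moreover have "(of_int m :: 'f) = of_int (m mod int p)"
  proof -
    have "(of_int m :: 'f) = of_int (int p * (m div int p) + m mod int p)" by simp
    also have "\<dots> = of_int (m mod int p)" by (simp only: of_int_add of_int_mult) simp
    finally show ?thesis .
  qed
  moreover have "(of_int (m mod int p) :: 'f) = of_nat (nat (m mod int p))" by simp
  ultimately show ?thesis by metis
qed

lemma rd_emb_unit: "nrm c = 1 \<Longrightarrow> rd (emb c) \<noteq> 0"
proof
  assume c: "nrm c = 1" and z: "rd (emb c) = 0"
  have c0: "c \<noteq> 0" using c by (metis nrm_eq_0 zero_neq_one)
  have "emb c * emb (inverse c) = 1" using c0 by (simp flip: emb_mult)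
  moreover have "emb c \<in> Od" "emb (inverse c) \<in> Od" using c by (simp_all add: O_zp nrm_inverse)
  ultimately have "rd (emb c) * rd (emb (inverse c)) = 1" using rd_mult by fastforce
  thus False using z by simp
qed

lemma rd_emb_small: "nrm c < 1 \<Longrightarrow> rd (emb c) = 0"
proof -
  assume "nrm c < 1"
  then obtain e where e: "nrm e \<le> 1" "c = of_nat p * e" using nrm_less_1 by blast
  thus ?thesis using O_zp[OF e(1)] by (simp add: emb_mult rd_mult)
qed

text \<open>\<open>tau\<close> does not lie in the prime field, its Frobenius conjugate being
  different. This is what makes 1 and \<open>zeta\<close> independent modulo
  \<open>p\<close>.\<close>

lemma tau_comb_nz: "of_nat i + tau \<noteq> 0"
proof
  assume "of_nat i + tau = 0"
  hence "tau = - of_nat i" by (simp add: eq_neg_iff_add_eq_0 add.commute)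
  thus False using tau_p_neq by (simp add: frobenius_uminus)
qed

text \<open>Dividing by the coefficient of larger absolute value leaves an element reducing to
  \<open>i + tau\<close>, with \<open>i\<close> in the prime field, or to 1. A further power of
  \<open>p\<close> then reduces the scalar to a unit, so no ramification occurs in the span of 1 and
  \<open>zeta\<close>. The clause on \<open>rd u ^ q\<close> serves to identify the residue field of
  \<open>D\<close>.\<close>

lemma comb_factor:
  assumes "c \<noteq> 0 \<or> d \<noteq> 0"
  shows "\<exists>m n u i j. u = emb i + emb j * zeta \<and> u \<in> Od \<and> rd u \<noteq> 0 \<and> rd u ^ q = rd u
            \<and> of_nat p ^ m * (emb c + emb d * zeta) = of_nat p ^ n * u"
proof -
  have main: "\<exists>m n u i j. u = emb i + emb j * zeta \<and> u \<in> Od \<and> rd u \<noteq> 0 \<and> rd u ^ q = rd u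
            \<and> of_nat p ^ m * (emb c + emb d * zeta) = of_nat p ^ n * u"
    if e: "e \<noteq> 0" and x: "emb c + emb d * zeta = emb e * x" "x = emb i + emb j * zeta" "x \<in> Od"
       "rd x \<noteq> 0" "rd x ^ q = rd x" for e x i j
  proof -
    obtain m n e' where e': "nrm e' = 1" "of_nat p ^ m * e = of_nat p ^ n * e'"
      using nrm_value_unit[OF e] by blast
    have O: "emb e' \<in> Od" using e'(1) by (simp add: O_zp)
    obtain k where k: "rd (emb e') = of_nat k" using rd_emb[of e'] e'(1) by auto
    have kq: "(of_nat k :: 'f) ^ q = of_nat k" by (simp add: power2_eq_square power_mult)
    have "emb e' * x = emb (e' * i) + emb (e' * j) * zeta"
      by (simp add: x(2) emb_mult algebra_simps)
    moreover have "emb e' * x \<in> Od" using O x(3) by (rule O_mult)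
    moreover have "rd (emb e' * x) \<noteq> 0" using rd_emb_unit[OF e'(1)] O x(3,4) by (simp add: rd_mult)
    moreover have "rd (emb e' * x) ^ q = rd (emb e' * x)"
      using O x(3,5) k kq by (simp add: rd_mult power_mult_distrib)
    moreover have "of_nat p ^ m * (emb c + emb d * zeta) = of_nat p ^ n * (emb e' * x)"
      using arg_cong[OF e'(2), of emb] emb_of_nat[of "p ^ m"] emb_of_nat[of "p ^ n"]
      by (simp add: x(1) emb_mult mult.assoc[symmetric])
    ultimately show ?thesis by blast
  qed
  show ?thesis
  proof (cases "nrm c \<le> nrm d")
    case True
    have d: "d \<noteq> 0" using True assms nrm_ge_0[of c] by (metis nrm_eq_0 order_antisym)
    have "nrm d > 0" using d nrm_ge_0[of d] nrm_eq_0[of d] by (simp add: less_le)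
    hence n: "nrm (c / d) \<le> 1" using True d by (simp add: nrm_divide divide_le_eq_1)
    obtain i where i: "rd (emb (c / d)) = of_nat i" using rd_emb[OF n] by blast
    define x where "x = emb (c / d) + emb 1 * zeta"
    have r: "rd x = of_nat i + tau" using O_zp[OF n] i by (simp add: x_def rd_add tau_def)
    show ?thesis
    proof (rule main[OF d _ x_def])
      show "emb c + emb d * zeta = emb d * x"
        using d by (simp add: x_def distrib_left mult.assoc[symmetric] flip: emb_mult)
      show "x \<in> Od" using O_zp[OF n] by (simp add: x_def O_add)
      show "rd x \<noteq> 0" using tau_comb_nz r by simp
      show "rd x ^ q = rd x" unfolding r
        by (simp add: power2_eq_square power_mult frobenius_add)
    qed
  next
    case False
    have c: "c \<noteq> 0" using False nrm_ge_0[of d] by (metis nrm_eq_0)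
    have "nrm c > 0" using c nrm_ge_0[of c] nrm_eq_0[of c] by (simp add: less_le)
    hence n: "nrm (d / c) < 1" using False c by (simp add: nrm_divide divide_less_eq_1)
    hence n': "nrm (d / c) \<le> 1" by simp
    define x where "x = emb 1 + emb (d / c) * zeta"
    have r: "rd x = 1" using O_zp[OF n'] rd_emb_small[OF n] by (simp add: x_def rd_add rd_mult O_mult)
    show ?thesis
    proof (rule main[OF c _ x_def])
      show "emb c + emb d * zeta = emb c * x"
        using c by (simp add: x_def distrib_left mult.assoc[symmetric] flip: emb_mult)
      show "x \<in> Od" using O_zp[OF n'] by (simp add: x_def O_add O_mult)
    qed (simp_all add: r)
  qed
qed

lemma comb_eq_0: "emb c + emb d * zeta = 0 \<Longrightarrow> c = 0 \<and> d = 0"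
proof (rule ccontr)
  assume z: "emb c + emb d * zeta = 0" and "\<not> (c = 0 \<and> d = 0)"
  then obtain m n u i j where u: "u \<in> Od" "rd u \<noteq> 0"
      "of_nat p ^ m * (emb c + emb d * zeta) = of_nat p ^ n * u"
    using comb_factor[of c d] by blast
  have "u = 0" using u(3) z p_pos by simp
  thus False using u(2) by simp
qed

lemma L_comb: "x \<in> Ld \<Longrightarrow> \<exists>c d. x = emb c + emb d * zeta"
proof -
  assume x: "x \<in> Ld"
  interpret vs: vector_space "qp_scale D" by (rule qp_vs)
  have "1 \<notin> vs.span {}" by simp
  hence i1: "vs.independent {1}" using vs.independent_insertI[of 1 "{}"] by simp
  have "zeta \<notin> vs.span {1}"
  proof
    assume "zeta \<in> vs.span {1}"
    then obtain c where "zeta = emb c" by (auto simp: vs.span_singleton qp_scale_def)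
    hence "emb (- c) + emb 1 * zeta = 0" by (simp add: emb_uminus)
    thus False using comb_eq_0 by (metis zero_neq_one)
  qed
  hence i2: "vs.independent {zeta, 1}" using vs.independent_insertI i1 by blast
  have n: "zeta \<noteq> 1" using \<open>zeta \<notin> vs.span {1}\<close> vs.span_base by blast
  have dim: "vs.dim Ld = 2" using unram_quad by (simp add: is_unramified_quadratic_def)
  have "Ld \<subseteq> vs.span {zeta, 1}"
    by (rule vs.independent_spans_of_card_eq_dim[OF i2]) (use n dim in auto)
  hence "x \<in> vs.span {zeta, 1}" using x by blast
  then obtain k k' where "x - qp_scale D k zeta - qp_scale D k' 1 = 0"
    by (auto simp: vs.span_insert vs.span_singleton qp_scale_def diff_eq_eq)
  hence "x = emb k' + emb k * zeta" by (simp add: qp_scale_def algebra_simps)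
  thus ?thesis by blast
qed

lemma L_factor:
  assumes "x \<in> Ld" "x \<noteq> 0"
  shows "\<exists>m n. \<exists>u\<in>Ld \<inter> Od. rd u \<noteq> 0 \<and> rd u ^ q = rd u \<and> of_nat p ^ m * x = of_nat p ^ n * u"
proof -
  obtain c d where cd: "x = emb c + emb d * zeta" using L_comb assms(1) by blast
  hence "c \<noteq> 0 \<or> d \<noteq> 0" using assms(2) by auto
  from comb_factor[OF this] obtain m n u i j where
    "u = emb i + emb j * zeta" "u \<in> Od" "rd u \<noteq> 0" "rd u ^ q = rd u"
    "of_nat p ^ m * (emb c + emb d * zeta) = of_nat p ^ n * u" by blast
  moreover have "u \<in> Ld" using calculation(1) by (simp add: L_add L_mult)
  ultimately show ?thesis using cd by blast
qed

lemma p_pow_left: "of_nat p ^ n * (x * y) = (x::'d) * (of_nat p ^ n * y)"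
  by (simp only: mult.assoc[symmetric] of_nat_p_pow_comm[of n x])

lemma p_pow_LO [simp]: "of_nat p ^ n \<in> Od" "of_nat p ^ n \<in> Ld" by (simp_all add: O_power L_power)

text \<open>Valuations normalized by the uniformizer are even on the unramified subfield, while
  multiplication by \<pi> makes them odd.\<close>

lemma L_pi_L:
  assumes "a \<in> Ld" "b \<in> Ld" "a = \<pi> * b"
  shows "b = 0"
proof (rule ccontr)
  assume b: "b \<noteq> 0"
  hence a: "a \<noteq> 0" using assms(3) by simp
  obtain m n u where u: "u \<in> Od" "rd u \<noteq> 0" "of_nat p ^ m * a = of_nat p ^ n * u"
    using L_factor[OF assms(1) a] by auto
  obtain m' n' u' where u': "u' \<in> Od" "rd u' \<noteq> 0" "of_nat p ^ m' * b = of_nat p ^ n' * u'"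
    using L_factor[OF assms(2) b] by auto
  have "\<pi> ^ (2 * (m' + n)) * u = of_nat p ^ m' * (of_nat p ^ m * a)"
    by (simp only: u(3) pi_pow2 power_add mult.assoc)
  also have "\<dots> = \<pi> * (of_nat p ^ m * (of_nat p ^ m' * b))"
    by (simp only: assms(3) p_pow_left[of m \<pi>] p_pow_left[of m' \<pi>] p_pow_left[of m' "of_nat p ^ m"])
  also have "\<dots> = \<pi> ^ Suc (2 * (m + n')) * u'"
    by (simp only: u'(3) power_Suc pi_pow2 power_add mult.assoc)
  finally have "2 * (m' + n) = Suc (2 * (m + n'))" using pi_pow_inject u u' by blast
  thus False by presburger
qed

text \<open>By parity of valuations 1, \<open>zeta\<close>, \<pi> and \<open>\<pi> * zeta\<close>
  are independent over the centre, and the dimension is 4.\<close>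

lemma D_decomp: "\<exists>a\<in>Ld. \<exists>b\<in>Ld. x = a + \<pi> * b"
proof -
  interpret vs: vector_space "qp_scale D" by (rule qp_vs)
  have lin: "c0 = 0 \<and> c1 = 0 \<and> c2 = 0 \<and> c3 = 0"
    if "(emb c0 + emb c1 * zeta) + \<pi> * (emb c2 + emb c3 * zeta) = 0" for c0 c1 c2 c3
  proof -
    define a b where "a = emb c0 + emb c1 * zeta" and "b = - (emb c2 + emb c3 * zeta)"
    have "a \<in> Ld" "b \<in> Ld" by (simp_all add: a_def b_def L_add L_mult L_diff L_uminus)
    moreover have "a = \<pi> * b" using that by (simp add: a_def b_def algebra_simps eq_neg_iff_add_eq_0)
    ultimately have "b = 0" using L_pi_L by blast
    hence "a = 0" using \<open>a = \<pi> * b\<close> by simp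
    have "emb c2 + emb c3 * zeta = 0" using \<open>b = 0\<close> unfolding b_def by (metis neg_equal_0_iff_equal)
    thus ?thesis using comb_eq_0 \<open>a = 0\<close> unfolding a_def by blast
  qed
  have sc: "qp_scale D c (\<pi> * x) = \<pi> * (emb c * x)" for c x
    unfolding qp_scale_def by (metis emb_comm mult.assoc)
  have "1 \<notin> vs.span {}" by simp
  hence i1: "vs.independent {1}" using vs.independent_insertI[of 1 "{}"] by simp
  have n2: "zeta \<notin> vs.span {1}"
  proof
    assume "zeta \<in> vs.span {1}"
    then obtain c where "zeta = emb c" by (auto simp: vs.span_singleton qp_scale_def)
    hence "(emb (- c) + emb 1 * zeta) + \<pi> * (emb 0 + emb 0 * zeta) = 0" by (simp add: emb_uminus)
    thus False using lin by (metis zero_neq_one)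
  qed
  have i2: "vs.independent {zeta, 1}" using vs.independent_insertI n2 i1 by blast
  have n3: "\<pi> * 1 \<notin> vs.span {zeta, 1}"
  proof
    assume "\<pi> * 1 \<in> vs.span {zeta, 1}"
    then obtain k k' where "\<pi> * 1 - qp_scale D k zeta - qp_scale D k' 1 = 0"
      by (auto simp: vs.span_insert vs.span_singleton qp_scale_def diff_eq_eq)
    hence "(emb (- k') + emb (- k) * zeta) + \<pi> * (emb 1 + emb 0 * zeta) = 0"
      by (simp add: qp_scale_def emb_uminus algebra_simps)
    thus False using lin by (metis zero_neq_one)
  qed
  have i3: "vs.independent {\<pi> * 1, zeta, 1}" using vs.independent_insertI n3 i2 by blast
  have n4: "\<pi> * zeta \<notin> vs.span {\<pi> * 1, zeta, 1}"
  proof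
    assume "\<pi> * zeta \<in> vs.span {\<pi> * 1, zeta, 1}"
    then obtain k'' k k' where "\<pi> * zeta - qp_scale D k'' (\<pi> * 1) - qp_scale D k zeta - qp_scale D k' 1 = 0"
      by (auto simp: vs.span_insert vs.span_singleton qp_scale_def diff_eq_eq)
    hence "(emb (- k') + emb (- k) * zeta) + \<pi> * (emb (- k'') + emb 1 * zeta) = 0"
      by (simp only: sc) (simp add: qp_scale_def emb_uminus algebra_simps)
    thus False using lin by (metis zero_neq_one)
  qed
  have i4: "vs.independent {\<pi> * zeta, \<pi> * 1, zeta, 1}" using vs.independent_insertI n4 i3 by blast
  have "card {\<pi> * zeta, \<pi> * 1, zeta, 1} = 4"
    using n2 n3 n4 vs.span_base by (auto simp: card_insert_if) 
  moreover have dim: "vs.dim (UNIV :: 'd set) = 4"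
    using quat_alg by (simp add: is_nonsplit_quaternion_algebra_def)
  ultimately have "UNIV \<subseteq> vs.span {\<pi> * zeta, \<pi> * 1, zeta, 1}"
    by (intro vs.independent_spans_of_card_eq_dim[OF i4]) auto
  hence "x \<in> vs.span {\<pi> * zeta, \<pi> * 1, zeta, 1}" by blast
  then obtain k3 k2 k1 k0 where
    "x - qp_scale D k3 (\<pi> * zeta) - qp_scale D k2 (\<pi> * 1) - qp_scale D k1 zeta - qp_scale D k0 1 = 0"
    by (auto simp: vs.span_insert vs.span_singleton qp_scale_def diff_eq_eq)
  hence "x = (emb k0 + emb k1 * zeta) + \<pi> * (emb k2 + emb k3 * zeta)"
    by (simp only: sc) (simp add: qp_scale_def algebra_simps)
  moreover have "emb k0 + emb k1 * zeta \<in> Ld" "emb k2 + emb k3 * zeta \<in> Ld"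
    by (simp_all add: L_add L_mult)
  ultimately show ?thesis by blast
qed

text \<open>In the unramified subfield \<open>p\<close> is a uniformizer, so reduction 0 means
  divisibility by \<open>p\<close> and not only by \<pi>.\<close>

lemma L_div_p:
  assumes "a \<in> Ld" "a \<in> Od" "rd a = 0"
  shows "\<exists>b\<in>Ld \<inter> Od. a = of_nat p * b"
proof (cases "a = 0")
  case True thus ?thesis by (intro bexI[of _ 0]) auto
next
  case False
  obtain m n u where u: "u \<in> Ld" "u \<in> Od" "rd u \<noteq> 0" "of_nat p ^ m * a = of_nat p ^ n * u"
    using L_factor[OF assms(1) False] by auto
  have "m < n"
  proof (rule ccontr)
    assume "\<not> m < n"
    then obtain k where k: "m = n + k" using le_Suc_ex not_less by blast
    have "of_nat p ^ n * (of_nat p ^ k * a) = of_nat p ^ n * u"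
      using u(4) by (simp add: k power_add mult.assoc)
    hence "of_nat p ^ k * a = u" using p_pos by simp
    hence "rd u = of_nat (p ^ k) * rd a" using assms(2) rd_mult[OF O_of_nat[of "p ^ k"], of a] rd_of_nat[of "p ^ k"] by simp
    thus False using u(3) assms(3) by simp
  qed
  then obtain k where k: "n = Suc (m + k)" using less_iff_Suc_add by auto
  have "of_nat p ^ m * a = of_nat p ^ m * (of_nat p * (of_nat p ^ k * u))"
    unfolding u(4) k by (simp only: power_Suc power_add mult.assoc p_pow_left[of m "of_nat p"])
  hence "a = of_nat p * (of_nat p ^ k * u)" using p_pos by simp
  moreover have "of_nat p ^ k * u \<in> Ld \<inter> Od"
    using u(1,2) by (simp add: L_mult O_mult)
  ultimately show ?thesis by blast
qed

text \<open>The coordinates could a priori have denominators. If the least exponent clearing them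
  were positive, the cleared \<open>a'\<close> would reduce to 0 and be divisible by
  \<open>p\<close>, after which the same follows for \<open>b'\<close>, contradicting
  minimality.\<close>

lemma O_decomp:
  assumes "x \<in> Od"
  shows "\<exists>a\<in>Ld \<inter> Od. \<exists>b\<in>Ld \<inter> Od. x = a + \<pi> * b"
proof -
  obtain a b where ab: "a \<in> Ld" "b \<in> Ld" "x = a + \<pi> * b" using D_decomp by blast
  define P where "P N \<longleftrightarrow> of_nat p ^ N * a \<in> Od \<and> of_nat p ^ N * b \<in> Od" for N
  obtain N1 where N1: "of_nat p ^ N1 * a \<in> Od" using O_absorb by blast
  obtain N2 where N2: "of_nat p ^ N2 * b \<in> Od" using O_absorb by blast
  have "P (N1 + N2)" unfolding P_def
    using O_mult[OF O_of_nat N1, of "p ^ N2"] O_mult[OF O_of_nat N2, of "p ^ N1"]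
    by (simp add: power_add mult.assoc p_pow_left[of N2 "of_nat p ^ N1"])
  hence L: "P (LEAST N. P N)" by (rule LeastI)
  have "(LEAST N. P N) = 0"
  proof (rule ccontr)
    assume "(LEAST N. P N) \<noteq> 0"
    then obtain N where N: "(LEAST N. P N) = Suc N" using not0_implies_Suc by blast
    define a' b' where "a' = of_nat p ^ Suc N * a" and "b' = of_nat p ^ Suc N * b"
    have a': "a' \<in> Ld" "a' \<in> Od" and b': "b' \<in> Ld" "b' \<in> Od"
      using L N ab L_mult[OF L_of_nat[of "p ^ Suc N"]] by (simp_all add: P_def a'_def b'_def)
    have "of_nat p ^ Suc N * x = a' + \<pi> * b'"
      by (simp only: a'_def b'_def ab(3) distrib_left mult.assoc[symmetric] of_nat_p_pow_comm[of "Suc N" \<pi>])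
    hence eq: "\<pi> * (\<pi> * (of_nat p ^ N * x)) = a' + \<pi> * b'"
      by (simp add: mult.assoc[symmetric] pi_sq)
    have px: "of_nat p ^ N * x \<in> Od" using O_mult[OF O_of_nat[of "p ^ N"] assms] by simp
    have "rd (a' + \<pi> * b') = 0" unfolding eq[symmetric] using px by (simp add: O_mult)
    hence "rd a' = 0" using a' b' by (simp add: rd_add O_mult)
    then obtain a'' where a'': "a'' \<in> Od" "a' = of_nat p * a''" using L_div_p a' by auto
    have "\<pi> * (\<pi> * (of_nat p ^ N * x) - \<pi> * a'') = \<pi> * b'"
      using eq a''(2) by (simp add: right_diff_distrib mult.assoc[symmetric] pi_sq)
    hence "\<pi> * (of_nat p ^ N * x) - \<pi> * a'' = b'" by (simp only: mult_left_cancel[OF pi_nz] right_diff_distrib[symmetric])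
    hence "b' = \<pi> * (of_nat p ^ N * x - a'')" by (simp only: right_diff_distrib)
    hence "rd b' = 0" using px a'' by (simp add: O_diff)
    then obtain b'' where b'': "b'' \<in> Od" "b' = of_nat p * b''" using L_div_p b' by auto
    have "of_nat p ^ N * a = a''" "of_nat p ^ N * b = b''"
      using a''(2) b''(2) p_pos by (simp_all add: a'_def b'_def mult.assoc)
    hence "P N" unfolding P_def using a'' b'' by simp
    thus False using N Least_le[of P N] by simp
  qed
  hence "a \<in> Od" "b \<in> Od" using L by (simp_all add: P_def)
  thus ?thesis using ab by blast
qed

text \<open>The second summand of the decomposition reduces to 0, so the residue field of
  \<open>D\<close> is that of the unramified subfield.\<close>

lemma rd_q: "x \<in> Od \<Longrightarrow> rd x ^ q = rd x"
proof -
  assume "x \<in> Od"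
  then obtain a b where ab: "a \<in> Ld" "a \<in> Od" "b \<in> Od" "x = a + \<pi> * b" using O_decomp by blast
  have r: "rd x = rd a" using ab by (simp add: rd_add O_mult)
  show ?thesis
  proof (cases "rd a = 0")
    case True thus ?thesis using r q_gt by (simp add: power_0_left)
  next
    case False
    hence "a \<noteq> 0" by auto
    then obtain m n u where u: "u \<in> Od" "rd u \<noteq> 0" "rd u ^ q = rd u" "of_nat p ^ m * a = of_nat p ^ n * u"
      using L_factor[OF ab(1) \<open>a \<noteq> 0\<close>] by auto
    have "\<pi> ^ (2 * m) * a = \<pi> ^ (2 * n) * u" using u(4) by (simp only: pi_pow2)
    hence "2 * m = 2 * n" using pi_pow_inject False ab(2) u by blast
    hence "a = u" using u(4) p_pos by simp
    thus ?thesis using r u(3) by simp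
  qed
qed

lemma residue_units_eq: "residue_units D = {x. x ^ (q - 1) = 1}"
proof (intro equalityI subsetI)
  fix l assume "l \<in> residue_units D"
  then obtain x where "x \<in> Od" "l = rd x" "l \<noteq> 0" by (auto simp: residue_units_def)
  hence "l * l ^ (q - 1) = l * 1" using rd_q[of x] q_gt(4) power_Suc[of l "q - 1"] by simp
  thus "l \<in> {x. x ^ (q - 1) = 1}" using \<open>l \<noteq> 0\<close> mult_left_cancel[of l] by blast
next
  fix l :: 'f assume "l \<in> {x. x ^ (q - 1) = 1}"
  then obtain i where "l = tau ^ i" using mu_eq by auto
  thus "l \<in> residue_units D" by (simp add: residue_units_def flip: rd_zeta_pow) (simp add: rd_zeta_pow)
qed

lemma res_power: "l \<in> residue_units D \<longleftrightarrow> (\<exists>i. l = tau ^ i)"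
proof
  assume "l \<in> residue_units D" thus "\<exists>i. l = tau ^ i" unfolding residue_units_eq mu_eq by auto
next
  assume "\<exists>i. l = tau ^ i"
  thus "l \<in> residue_units D" unfolding residue_units_eq using tau_pow_q by blast
qed

lemma rd_cases: "x \<in> Od \<Longrightarrow> rd x = 0 \<or> (\<exists>i. rd x = tau ^ i)"
  using res_power[of "rd x"] by (auto simp: residue_units_def)

text \<open>Both roots lie in a commutative field, so their quotient is again a root of unity, and
  \<open>root_eq_1\<close> applies to it.\<close>

lemma root_L_eq:
  assumes "x \<in> Ld" "y \<in> Ld" "x ^ (q - 1) = 1" "y ^ (q - 1) = 1" "rd x = rd y"
  shows "x = y"
proof -
  have O: "x \<in> Od" "y \<in> Od" using root_O assms q_gt(2) by blast+
  have "y \<noteq> 0" using assms(4) q_gt(2) by (metis power_0_left neq0_conv zero_neq_one)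
  have ry: "rd y \<noteq> 0" using rd_power[OF O(2), of "q - 1"] assms(4) q_gt(2) by (auto simp: power_0_left)
  have iy: "inverse y \<in> Od" using unit_inv O ry by blast
  have "(x * inverse y) ^ (q - 1) = x ^ (q - 1) * inverse y ^ (q - 1)"
    using L_comm[OF assms(1) L_inverse[OF assms(2)]] by (rule power_mult_distrib_commuting)
  also have "\<dots> = 1" using assms by (simp add: power_inverse)
  finally have 1: "(x * inverse y) ^ (q - 1) = 1" .
  have "rd (x * inverse y) = rd (y * inverse y)" using O iy assms(5) by (simp add: rd_mult)
  also have "\<dots> = 1" using \<open>y \<noteq> 0\<close> by simp
  finally have "x * inverse y = 1" using root_eq_1 1 q_gt(3) O iy O_mult by blast
  thus ?thesis using \<open>y \<noteq> 0\<close> by (metis mult.assoc left_inverse mult.right_neutral mult.left_neutral)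
qed

text \<open>Conjugation fixes integers, so the reduction of \<open>cj zeta\<close> is again a root
  of the minimal polynomial of \<open>tau\<close> over the prime field, whose roots are
  \<open>tau\<close> and \<open>tau ^ p\<close>. The first is impossible because \<sigma> would be
  trivial.\<close>

lemma rd_cj_zeta: "rd (cj zeta) = tau ^ p"
proof -
  define s where "s = rd (cj zeta)"
  have "(tau + tau ^ p) ^ p = tau ^ p + tau" by (subst frobenius_add) (subst tau_pp, rule refl)
  hence 1: "(tau + tau ^ p) ^ p = tau + tau ^ p" by (subst (2) add.commute)
  then obtain m where m: "tau + tau ^ p = of_nat m" using prime_subfield[OF 1] by (elim exE)
  have "(tau * tau ^ p) ^ p = tau ^ p * tau" by (subst power_mult_distrib) (subst tau_pp, rule refl)
  hence 2: "(tau * tau ^ p) ^ p = tau * tau ^ p" by (subst (2) mult.commute)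
  then obtain n where n: "tau * tau ^ p = of_nat n" using prime_subfield[OF 2] by (elim exE)
  \<comment> \<open>The minimal polynomial of \<open>tau\<close>, with its trace \<open>m\<close>
    and norm \<open>n\<close> lifted to integers, evaluated at \<open>zeta\<close>.\<close>
  define w where "w = zeta * zeta - of_nat m * zeta + of_nat n"
  have O: "w \<in> Od" by (simp add: w_def O_add O_diff O_mult)
  have "rd w = tau * tau - of_nat m * tau + of_nat n"
    by (simp add: w_def rd_add rd_diff rd_mult O_mult O_diff flip: tau_def)
  also have "\<dots> = 0" unfolding m[symmetric] n[symmetric] by (simp only: ring_distribs) simp
  finally have "rd (cj w) = 0" using O rd_cj_eq_0 by blast
  moreover have "cj w = cj zeta * cj zeta - of_nat m * cj zeta + of_nat n"
    by (simp add: w_def cj_add cj_diff cj_mult)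
  ultimately have "s * s - of_nat m * s + of_nat n = 0"
    by (simp add: rd_add rd_diff rd_mult O_mult O_diff s_def)
  hence "s * s - (tau + tau ^ p) * s + tau * tau ^ p = 0" by (simp only: m n)
  moreover have "(s - tau) * (s - tau ^ p) = s * s - (tau + tau ^ p) * s + tau * tau ^ p"
    by (simp add: ring_distribs mult.commute)
  ultimately have "(s - tau) * (s - tau ^ p) = 0" by metis
  hence "s = tau \<or> s = tau ^ p" by (simp only: mult_eq_0_iff right_minus_eq)
  moreover have "s \<noteq> tau"
  proof
    assume "s = tau"
    hence "rd (cj zeta) = rd zeta" by (simp only: s_def tau_def)
    hence "cj zeta = zeta"
      by - (rule root_L_eq, simp_all only: zeta_L cj_L cj_power[symmetric] zeta(2) cj_1)
    have "frob D x = x" if x: "x \<in> Ld" for x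
    proof -
      obtain c d where cd: "x = emb c + emb d * zeta" using L_comb[OF x] by blast
      have "cj x = x" unfolding cd by (simp only: cj_add cj_mult cj_emb \<open>cj zeta = zeta\<close>)
      thus ?thesis using cj_frob[OF x] by simp
    qed
    thus False using frob_aut by (auto simp: is_nontrivial_automorphism_def)
  qed
  ultimately show ?thesis unfolding s_def by blast
qed

lemma cj_zeta: "cj zeta = zeta ^ p"
  by (rule root_L_eq) (simp_all only: zeta_L cj_L rd_cj_zeta rd_zeta_pow cj_power[symmetric] zeta_pow_q
      zeta(2) cj_1)

text \<open>Modulo the uniformizer every integral element is 0 or a power of \<open>zeta\<close>, so
  the case of \<open>zeta\<close> decides.\<close>

lemma rd_cj: "x \<in> Od \<Longrightarrow> rd (cj x) = rd x ^ p"
proof -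
  assume x: "x \<in> Od"
  from rd_cases[OF x] show ?thesis
  proof
    assume "rd x = 0" thus ?thesis using rd_cj_eq_0[OF x] p_pos by (simp add: power_0_left)
  next
    assume "\<exists>i. rd x = tau ^ i"
    then obtain i where i: "rd x = tau ^ i" by blast
    have "rd (x - zeta ^ i) = 0" using x i by (simp add: rd_diff rd_zeta_pow)
    hence "rd (cj (x - zeta ^ i)) = 0" using x rd_cj_eq_0[of "x - zeta ^ i"] by (simp add: O_diff)
    hence "rd (cj x) = rd (cj zeta ^ i)" using x by (simp add: cj_diff cj_power rd_diff O_power)
    thus ?thesis by (simp add: i rd_power rd_cj_zeta power_mult[symmetric] mult.commute)
  qed
qed

lemma teich_tau: "teich p D (tau ^ i) = zeta ^ i"
  unfolding teich_def
proof (rule the_equality)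
  have "(zeta ^ i) ^ q = zeta ^ i"
    using zeta_pow_q[of i] power_Suc[of "zeta ^ i" "q - 1"] by (simp only: q_gt(4) mult_1_right)
  thus "zeta ^ i \<in> Ld \<inter> Od \<and> (zeta ^ i) ^ q = zeta ^ i \<and> rd (zeta ^ i) = tau ^ i"
    by (simp add: rd_zeta_pow)
  fix x assume x: "x \<in> Ld \<inter> Od \<and> x ^ q = x \<and> rd x = tau ^ i"
  have "x \<noteq> 0" using x by auto
  moreover have "x * x ^ (q - 1) = x * 1" using x q_gt(4) power_Suc[of x "q - 1"] by simp
  ultimately have "x ^ (q - 1) = 1" by simp
  thus "x = zeta ^ i" using x
    by - (rule root_L_eq, simp_all only: rd_zeta_pow zeta_pow_q zeta_L Int_iff)
qed

lemma Hgrp_zeta: "zeta \<in> Hgrp p D"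
proof -
  have "tau \<in> residue_units D" using res_power[of tau] power_one_right by metis
  thus ?thesis using teich_tau[of 1] by (auto simp: Hgrp_def intro!: image_eqI[of _ _ tau])
qed

end

text \<open>Meant for the noncommutative ring \<open>D\<close>, where only the two arguments commute
  with each other.\<close>

lemma binomial_commuting:
  fixes x y :: "'a::ring_1"
  assumes "x * y = y * x"
  shows "(x + y) ^ n = (\<Sum>k\<le>n. of_nat (n choose k) * (x ^ k * y ^ (n - k)))"
proof (induction n)
  case (Suc n)
  have c: "y * x ^ k = x ^ k * y" for k using assms by (simp add: power_commuting_commutes)
  let ?f = "\<lambda>k. of_nat (n choose k) * (x ^ Suc k * y ^ (n - k))"
  let ?g = "\<lambda>k. of_nat (n choose k) * (x ^ k * y ^ (Suc n - k))"
  have sw: "z * (of_nat m * w) = of_nat m * (z * w)" for z w :: 'a and m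
    by (metis mult.assoc mult_of_nat_commute)
  have "(x + y) ^ Suc n = x * (\<Sum>k\<le>n. of_nat (n choose k) * (x ^ k * y ^ (n - k)))
      + y * (\<Sum>k\<le>n. of_nat (n choose k) * (x ^ k * y ^ (n - k)))"
    by (simp only: power_Suc Suc distrib_right)
  also have "x * (\<Sum>k\<le>n. of_nat (n choose k) * (x ^ k * y ^ (n - k))) = (\<Sum>k\<le>n. ?f k)"
    by (simp add: sum_distrib_left sw mult.assoc)
  also have "y * (\<Sum>k\<le>n. of_nat (n choose k) * (x ^ k * y ^ (n - k))) = (\<Sum>k\<le>n. ?g k)"
  proof -
    have "y * (of_nat (n choose k) * (x ^ k * y ^ (n - k))) = ?g k" if "k \<le> n" for k
    proof -
      have "y * (x ^ k * y ^ (n - k)) = x ^ k * (y * y ^ (n - k))"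
        by (simp only: mult.assoc[symmetric] c)
      thus ?thesis using that by (simp add: sw Suc_diff_le)
    qed
    thus ?thesis by (simp add: sum_distrib_left)
  qed
  also have "(\<Sum>k\<le>n. ?f k) + (\<Sum>k\<le>n. ?g k) =
      (\<Sum>k\<le>Suc n. of_nat (Suc n choose k) * (x ^ k * y ^ (Suc n - k)))"
  proof -
    have "(\<Sum>k\<le>n. ?g k) = (\<Sum>k\<le>Suc n. ?g k)" by (simp add: binomial_eq_0)
    also have "\<dots> = ?g 0 + (\<Sum>k\<le>n. ?g (Suc k))" by (rule sum.atMost_Suc_shift)
    finally have g: "(\<Sum>k\<le>n. ?g k) = ?g 0 + (\<Sum>k\<le>n. ?g (Suc k))" .
    have "(\<Sum>k\<le>Suc n. of_nat (Suc n choose k) * (x ^ k * y ^ (Suc n - k))) =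
        ?g 0 + (\<Sum>k\<le>n. of_nat (Suc n choose Suc k) * (x ^ Suc k * y ^ (n - k)))"
      by (subst sum.atMost_Suc_shift) simp
    also have "(\<Sum>k\<le>n. of_nat (Suc n choose Suc k) * (x ^ Suc k * y ^ (n - k))) =
       (\<Sum>k\<le>n. ?f k) + (\<Sum>k\<le>n. ?g (Suc k))"
      by (simp only: binomial_Suc_Suc of_nat_add distrib_right sum.distrib diff_Suc_Suc)
    finally show ?thesis unfolding g by (simp add: algebra_simps)
  qed
  finally show ?case .
qed simp

context quat
begin

subsection \<open>The unit filtration\<close>

definition PP :: "nat \<Rightarrow> 'd set" where "PP n = {\<pi> ^ n * x | x. x \<in> Od}"

lemma PP_O: "x \<in> PP n \<Longrightarrow> x \<in> Od" by (auto simp: PP_def O_mult)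
lemma PP_0 [simp]: "0 \<in> PP n" by (auto simp: PP_def intro!: exI[of _ 0])
lemma PP_add: "x \<in> PP n \<Longrightarrow> y \<in> PP n \<Longrightarrow> x + y \<in> PP n"
  by (auto simp: PP_def distrib_left[symmetric] intro: O_add)
lemma PP_diff: "x \<in> PP n \<Longrightarrow> y \<in> PP n \<Longrightarrow> x - y \<in> PP n"
  by (auto simp: PP_def right_diff_distrib[symmetric] intro: O_diff)
lemma PP_uminus: "x \<in> PP n \<Longrightarrow> - x \<in> PP n" using PP_diff[OF PP_0] by fastforce
lemma PP_mult_r: "x \<in> PP n \<Longrightarrow> y \<in> Od \<Longrightarrow> x * y \<in> PP n"
  by (auto simp: PP_def mult.assoc intro: O_mult)
lemma PP_mult: "x \<in> PP m \<Longrightarrow> y \<in> PP n \<Longrightarrow> x * y \<in> PP (m + n)"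
proof -
  assume "x \<in> PP m" "y \<in> PP n"
  then obtain a b where ab: "x = \<pi> ^ m * a" "y = \<pi> ^ n * b" "a \<in> Od" "b \<in> Od" by (auto simp: PP_def)
  have "x * y = \<pi> ^ m * (a * \<pi> ^ n) * b" by (simp add: ab mult.assoc)
  also have "\<dots> = \<pi> ^ (m + n) * ((cj ^^ n) a * b)" by (simp only: mult_pi_pow[of a n] power_add mult.assoc)
  finally have "x * y = \<pi> ^ (m + n) * ((cj ^^ n) a * b)" .
  moreover have "(cj ^^ n) a * b \<in> Od" using ab by (simp add: O_mult cjn_O)
  ultimately show ?thesis by (auto simp: PP_def)
qed
lemma PP_zero: "PP 0 = Od" by (auto simp: PP_def)
lemma PP_mult_l: "x \<in> Od \<Longrightarrow> y \<in> PP n \<Longrightarrow> x * y \<in> PP n" using PP_mult[of x 0 y n] PP_zero by simp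
lemma PP_mono: "x \<in> PP n \<Longrightarrow> m \<le> n \<Longrightarrow> x \<in> PP m"
proof -
  assume "x \<in> PP n" "m \<le> n"
  then obtain a k where "x = \<pi> ^ n * a" "a \<in> Od" "n = m + k" by (auto simp: PP_def le_iff_add)
  hence "x = \<pi> ^ m * (\<pi> ^ k * a)" "\<pi> ^ k * a \<in> Od" by (simp_all add: power_add mult.assoc O_mult)
  thus ?thesis by (auto simp: PP_def)
qed
lemma PP_pi: "x \<in> PP n \<Longrightarrow> \<pi> * x \<in> PP (Suc n)"
  by (auto simp: PP_def mult.assoc[symmetric])
lemma PP_p: "x \<in> PP n \<Longrightarrow> of_nat p * x \<in> PP (Suc (Suc n))"
  using PP_pi[OF PP_pi, of x n] by (simp add: pi_sq mult.assoc[symmetric])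
lemma PP_1: "x \<in> Od \<Longrightarrow> rd x = 0 \<longleftrightarrow> x \<in> PP 1"
  using rd_eq_0D by (auto simp: PP_def)
lemma PP_Suc: "PP (Suc n) = (\<lambda>x. \<pi> * x) ` PP n"
  by (auto simp: PP_def mult.assoc)
lemma PP_sum: "(\<And>i. i \<in> A \<Longrightarrow> g i \<in> PP n) \<Longrightarrow> sum g A \<in> PP n"
  by (induction A rule: infinite_finite_induct) (simp_all add: PP_add)
lemma PP_power: "x \<in> PP n \<Longrightarrow> x ^ k \<in> PP (k * n)"
  by (induction k) (auto simp: PP_zero intro: PP_mult)

abbreviation "U \<equiv> UD D"

lemma U_iff: "g \<in> U n \<longleftrightarrow> g - 1 \<in> PP n"
proof
  assume "g - 1 \<in> PP n"
  then obtain x where "g - 1 = \<pi> ^ n * x" "x \<in> Od" by (auto simp: PP_def)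
  hence "g = 1 + \<pi> ^ n * x" by (simp add: algebra_simps)
  thus "g \<in> U n" using \<open>x \<in> Od\<close> by (auto simp: UD_def)
qed (auto simp: UD_def PP_def)

lemma U_O: "g \<in> U n \<Longrightarrow> g \<in> Od" using O_add[of "g - 1" 1] PP_O by (simp add: U_iff)
lemma U_1 [simp]: "1 \<in> U n" by (simp add: U_iff)
lemma U_mono: "g \<in> U n \<Longrightarrow> m \<le> n \<Longrightarrow> g \<in> U m" using PP_mono by (simp add: U_iff)
lemma U_mult: "g \<in> U n \<Longrightarrow> h \<in> U n \<Longrightarrow> g * h \<in> U n"
proof -
  assume g: "g \<in> U n" and h: "h \<in> U n"
  have "g * h - 1 = g * (h - 1) + (g - 1)" by (simp add: algebra_simps)
  moreover have "g * (h - 1) + (g - 1) \<in> PP n"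
    using g h PP_mult_l[OF U_O[OF g], of "h - 1" n] by (intro PP_add) (simp_all add: U_iff)
  ultimately show ?thesis by (simp only: U_iff)
qed
lemma U_rd: "g \<in> U n \<Longrightarrow> n \<ge> 1 \<Longrightarrow> rd g = 1"
proof -
  assume g: "g \<in> U n" "n \<ge> 1"
  hence "g - 1 \<in> PP 1" using PP_mono by (simp add: U_iff)
  hence "rd (g - 1) = 0" using PP_1 PP_O by blast
  thus ?thesis using rd_diff[OF U_O[OF g(1)] O_1] by simp
qed
lemma U_nz: "g \<in> U n \<Longrightarrow> n \<ge> 1 \<Longrightarrow> g \<noteq> 0" using U_rd by force
lemma U_inv_O: "g \<in> U n \<Longrightarrow> n \<ge> 1 \<Longrightarrow> inverse g \<in> Od" using U_rd U_O unit_inv by fastforce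
lemma U_inv: "g \<in> U n \<Longrightarrow> n \<ge> 1 \<Longrightarrow> inverse g \<in> U n"
proof -
  assume g: "g \<in> U n" "n \<ge> 1"
  have "inverse g - 1 = - (inverse g * (g - 1))" using U_nz[OF g] by (simp add: algebra_simps)
  thus ?thesis using g PP_mult_l[OF U_inv_O[OF g], of "g - 1" n] by (simp add: U_iff PP_uminus)
qed
lemma U_power: "g \<in> U n \<Longrightarrow> g ^ k \<in> U n" by (induction k) (simp_all add: U_mult)

lemma U_conj:
  assumes "u \<in> U n" "g \<in> Od" "rd g \<noteq> 0"
  shows "g * u * inverse g \<in> U n"
proof -
  have "g \<noteq> 0" using assms(3) by auto
  hence "g * u * inverse g - 1 = g * (u - 1) * inverse g" by (simp add: algebra_simps)
  moreover have "g * (u - 1) * inverse g \<in> PP n"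
    using assms unit_inv by (intro PP_mult_r PP_mult_l) (auto simp: U_iff)
  ultimately show ?thesis by (simp add: U_iff)
qed
lemma U_conj': "u \<in> U n \<Longrightarrow> g \<in> U 1 \<Longrightarrow> g * u * inverse g \<in> U n"
  using U_conj[of u n g] U_O U_rd by fastforce

lemma U_cong:
  assumes "a \<in> U 1" "b \<in> U 1" "a - b \<in> PP n"
  shows "\<exists>u\<in>U n. a = b * u" "\<exists>u\<in>U n. a = u * b"
proof -
  have nz: "b \<noteq> 0" using U_nz assms(2) by blast
  have i: "inverse b \<in> Od" using U_inv_O assms(2) by blast
  have "inverse b * a - 1 = inverse b * (a - b)" "a * inverse b - 1 = (a - b) * inverse b"
    using nz by (simp_all add: algebra_simps)
  hence "inverse b * a \<in> U n" "a * inverse b \<in> U n"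
    using assms(3) i by (simp_all add: U_iff PP_mult_l PP_mult_r)
  moreover have "a = b * (inverse b * a)" "a = (a * inverse b) * b"
    using nz by (simp_all add: mult.assoc[symmetric]) (simp add: mult.assoc)
  ultimately show "\<exists>u\<in>U n. a = b * u" "\<exists>u\<in>U n. a = u * b" by blast+
qed

text \<open>Terms with \<open>1 < i < p\<close> gain valuation 2 from the binomial coefficient and
  at least \<open>2 * k\<close> from \<open>y ^ i\<close>; the term \<open>i = p\<close> has
  valuation at least \<open>5 * k\<close>. Both reach \<open>k + 3\<close>, the latter because
  \<open>p \<ge> 5\<close>.\<close>

lemma power_p_approx:
  assumes y: "y \<in> PP k" and k: "k \<ge> 1"
  shows "(1 + y) ^ p - (1 + of_nat p * y) \<in> PP (k + 3)"
proof -
  have "(y + 1) ^ p = (\<Sum>i\<le>p. of_nat (p choose i) * (y ^ i * 1 ^ (p - i)))"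
    by (rule binomial_commuting) simp
  also have "\<dots> = (\<Sum>i\<in>{0,1} \<union> {2..p}. of_nat (p choose i) * y ^ i)"
    using p_ge_5 by (intro sum.cong) auto
  also have "\<dots> = 1 + of_nat p * y + (\<Sum>i\<in>{2..p}. of_nat (p choose i) * y ^ i)"
    by (subst sum.union_disjoint) simp_all
  finally have eq: "(1 + y) ^ p - (1 + of_nat p * y) = (\<Sum>i\<in>{2..p}. of_nat (p choose i) * y ^ i)"
    by (simp add: add.commute)
  have "of_nat (p choose i) * y ^ i \<in> PP (k + 3)" if i: "i \<in> {2..p}" for i
  proof (cases "i = p")
    case True
    have "5 * k \<le> p * k" using p_ge_5 by simp
    hence "k + 3 \<le> p * k" using k by linarith
    thus ?thesis using True PP_mono[OF PP_power[OF y, of p], of "k + 3"] by simp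
  next
    case False
    hence "p dvd (p choose i)" using i prime_p by (intro dvd_choose_prime) auto
    then obtain m where m: "p choose i = p * m" by (auto simp: dvd_def)
    have "2 * k \<le> i * k" using i by simp
    hence "k + 3 \<le> Suc (Suc (i * k))" using k by linarith
    moreover have "of_nat p * (of_nat m * y ^ i) \<in> PP (Suc (Suc (i * k)))"
      using PP_power[OF y, of i] by (intro PP_p PP_mult_l) auto
    ultimately show ?thesis using PP_mono by (simp add: m mult.assoc)
  qed
  thus ?thesis unfolding eq by (intro PP_sum)
qed

lemma U_power_p: "g \<in> U k \<Longrightarrow> k \<ge> 1 \<Longrightarrow> g ^ p \<in> U (k + 2)"
proof -
  assume g: "g \<in> U k" "k \<ge> 1"
  have "g ^ p - (1 + of_nat p * (g - 1)) \<in> PP (k + 3)"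
    using power_p_approx[of "g - 1" k] g by (simp add: U_iff)
  hence 1: "g ^ p - (1 + of_nat p * (g - 1)) \<in> PP (k + 2)" by (rule PP_mono) simp
  have "of_nat p * (g - 1) \<in> PP (k + 2)" using PP_p g by (simp add: U_iff)
  from PP_add[OF 1 this] show ?thesis by (simp add: U_iff)
qed

text \<open>Since \<open>p\<close> has valuation 2, raising to the \<open>p\<close>-th power maps
  \<open>U (k - 2)\<close> onto \<open>U k\<close> modulo \<open>U (Suc k)\<close>: the root is
  \<open>1 + y\<close> with \<open>of_nat p * y = u - 1\<close>. For \<open>k = 2\<close> the root
  would leave \<open>U 1\<close>, so level 2 is treated separately in
  \<open>U2_decomp\<close>.\<close>

lemma U_root_approx:
  assumes "u \<in> U k" "k \<ge> 3"
  shows "\<exists>g\<in>U (k - 2). \<exists>u'\<in>U (Suc k). u = g ^ p * u'"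
proof -
  obtain x where x: "x \<in> Od" "u - 1 = \<pi> ^ k * x" using assms by (auto simp: U_iff PP_def)
  define y where "y = \<pi> ^ (k - 2) * x"
  have k: "k = Suc (Suc (k - 2))" using assms(2) by simp
  have y: "y \<in> PP (k - 2)" using x by (auto simp: y_def PP_def)
  have py: "of_nat p * y = u - 1"
    unfolding x(2) y_def by (subst (2) k) (simp add: pi_sq[symmetric] mult.assoc)
  have "(1 + y) ^ p - (1 + of_nat p * y) \<in> PP (k - 2 + 3)" using y assms(2) by (intro power_p_approx) auto
  moreover have "k - 2 + 3 = Suc k" using assms(2) by simp
  ultimately have "(1 + y) ^ p - u \<in> PP (Suc k)" by (simp add: py)
  hence d: "u - (1 + y) ^ p \<in> PP (Suc k)" using PP_uminus by fastforce
  have g: "1 + y \<in> U (k - 2)" using y by (simp add: U_iff)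
  have "u \<in> U 1" "(1 + y) ^ p \<in> U 1"
    using U_mono[OF assms(1), of 1] U_mono[OF U_power[OF g], of 1] assms(2) by auto
  from U_cong(1)[OF this d] show ?thesis using g by blast
qed

lemma ZD1_nat: "1 + of_nat p * of_nat m \<in> ZD1 D"
proof -
  have "of_nat p * of_nat m \<in> PP 1" using PP_mono[OF PP_p[of "of_nat m" 0], of 1] PP_zero by simp
  moreover have "(of_nat (1 + p * m) :: 'd) \<in> centre" unfolding centre_def by (rule CollectI, rule allI, rule of_nat_p_comm)
  hence "1 + of_nat p * of_nat m \<in> (centre :: 'd set)" by simp
  ultimately show ?thesis by (simp add: ZD1_def U_iff)
qed

text \<open>Modulo \<open>U 3\<close>, commutators of \<open>1 + \<pi>\<close> and
  \<open>1 + \<pi> * b\<close> give the elements \<open>1 + p * (b - cj b)\<close>, whose coordinate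
  has trace zero in the residue field; the centre contributes the prime field. Half of
  \<open>x\<close> serves as \<open>b\<close> and half of its trace as the central part, as
  \<open>x = (x - x ^ p) / 2 + (x + x ^ p) / 2\<close> after reduction.\<close>

lemma U2_decomp:
  assumes "u \<in> U 2"
  shows "\<exists>g1\<in>U 1. \<exists>g2\<in>U 1. \<exists>z\<in>ZD1 D. \<exists>u'\<in>U 3. u * (g2 * g1) = (g1 * g2) * z * u'"
proof -
  obtain x where x: "x \<in> Od" "u - 1 = \<pi> ^ 2 * x" using assms by (auto simp: U_iff PP_def)
  have ux: "u = 1 + of_nat p * x" using x(2) by (simp add: power2_eq_square pi_sq algebra_simps)
  define i where "i = (p + 1) div 2"
  have "odd p" using prime_p p_ge_5 by (intro prime_odd_nat) auto
  hence "2 * i = p + 1" by (simp add: i_def)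
  hence i: "(2::'f) * of_nat i = 1" by (metis of_nat_mult of_nat_add of_nat_numeral of_nat_p_f of_nat_1 add_0)
  define b where "b = of_nat i * x"
  have bO: "b \<in> Od" using x(1) by (simp add: b_def O_mult)
  define c where "c = of_nat i * (rd x + rd x ^ p)"
  have "c ^ p = c" using rd_q[OF x(1)]
    by (simp add: c_def power_mult_distrib frobenius_add power_mult[symmetric] power2_eq_square add.commute)
  then obtain m where m: "c = of_nat m" using prime_subfield[of c] by blast
  have rb: "rd b = of_nat i * rd x" using x(1) by (simp add: b_def rd_mult)
  have "rd (x - (b - cj b) - of_nat m) = rd x - (of_nat i * rd x - of_nat i * rd x ^ p) - c"
    using x(1) bO by (simp add: rd_diff O_diff rd_cj rb m power_mult_distrib)
  also have "\<dots> = rd x - 2 * of_nat i * rd x" by (simp add: c_def algebra_simps)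
  also have "\<dots> = 0" by (simp add: i)
  finally have w: "x - (b - cj b) - of_nat m \<in> PP 1" using x(1) bO PP_1 by (simp add: O_diff)
  define g1 g2 z where "g1 = 1 + \<pi>" and "g2 = 1 + \<pi> * b" and "z = (1::'d) + of_nat p * of_nat m"
  have g1: "g1 \<in> U 1" and g2: "g2 \<in> U 1" using bO by (auto simp: U_iff g1_def g2_def PP_def intro: O_1 exI[of _ 1])
  have z: "z \<in> ZD1 D" using ZD1_nat by (simp add: z_def)
  have zU: "z \<in> U 1" using z by (simp add: ZD1_def)
  have com: "g1 * g2 - g2 * g1 = of_nat p * (b - cj b)"
  proof -
    have "g1 * g2 - g2 * g1 = \<pi> * (\<pi> * b) - \<pi> * (b * \<pi>)" by (simp add: g1_def g2_def algebra_simps)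
    also have "\<dots> = \<pi> * \<pi> * b - \<pi> * \<pi> * cj b" by (simp only: mult_pi[of b] mult.assoc)
    finally show ?thesis by (simp only: pi_sq right_diff_distrib)
  qed
  have g21: "g2 * g1 - 1 \<in> PP 1" "g1 * g2 - 1 \<in> PP 1" using U_mult g1 g2 U_iff by blast+
  have p2: "of_nat p * x \<in> PP 2" if "x \<in> Od" for x using PP_p[of x 0] that PP_zero by (simp add: numeral_2_eq_2)
  have "u * (g2 * g1) - (g1 * g2) * z = of_nat p * x * (g2 * g1 - 1) - (g1 * g2 - 1) * (of_nat p * of_nat m)
        + of_nat p * (x - (b - cj b) - of_nat m)"
    using com by (simp add: ux z_def algebra_simps)
  moreover have "of_nat p * x * (g2 * g1 - 1) \<in> PP 3"
    using PP_mult[OF p2[OF x(1)] g21(1)] by simp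
  moreover have "(g1 * g2 - 1) * (of_nat p * of_nat m) \<in> PP 3"
    using PP_mult[OF g21(2) p2[OF O_of_nat[of m]]] by (simp add: numeral_3_eq_3 numeral_2_eq_2)
  moreover have "of_nat p * (x - (b - cj b) - of_nat m) \<in> PP 3" using PP_p[OF w] by (simp add: numeral_3_eq_3)
  ultimately have "u * (g2 * g1) - (g1 * g2) * z \<in> PP 3" by (simp add: PP_add PP_diff)
  moreover have "u * (g2 * g1) \<in> U 1" "(g1 * g2) * z \<in> U 1"
    using U_mono[OF assms, of 1] g1 g2 zU by (simp_all add: U_mult)
  ultimately obtain u' where "u' \<in> U 3" "u * (g2 * g1) = (g1 * g2) * z * u'" using U_cong(1) by blast
  thus ?thesis using g1 g2 z by blast
qed

section \<open>The units 1 + varpi t and 1 + p zeta\<close>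

definition gg :: "'d \<Rightarrow> 'd" where "gg t = 1 + \<pi> * t"

lemma gg_U: "t \<in> Od \<Longrightarrow> gg t \<in> U 1" by (auto simp: gg_def U_iff PP_def)

lemma gg_add:
  assumes "s \<in> Od" "t \<in> Od" "r \<in> Od" "rd r = rd s + rd t"
  shows "\<exists>u\<in>U 2. gg s * gg t = gg r * u"
proof -
  have "s + t - r \<in> PP 1" using assms PP_1[of "s + t - r"] by (simp add: rd_diff rd_add O_diff O_add)
  hence "\<pi> * (s + t - r) \<in> PP 2" using PP_pi by (simp add: numeral_2_eq_2)
  moreover have "\<pi> * s * (\<pi> * t) \<in> PP 2"
    using PP_mult[of "\<pi> * s" 1 "\<pi> * t" 1] PP_pi[of s 0] PP_pi[of t 0] assms PP_zero by (simp add: numeral_2_eq_2)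
  ultimately have "\<pi> * (s + t - r) + \<pi> * s * (\<pi> * t) \<in> PP 2" by (rule PP_add)
  moreover have "gg s * gg t - gg r = \<pi> * (s + t - r) + \<pi> * s * (\<pi> * t)"
    by (simp add: gg_def algebra_simps)
  ultimately have "gg s * gg t - gg r \<in> PP 2" by simp
  thus ?thesis using U_cong(1)[of "gg s * gg t" "gg r" 2] assms gg_U U_mult by blast
qed

definition hh :: 'd where "hh = 1 + of_nat p * zeta"
text \<open>Measures the failure of \<open>zeta\<close> to commute with the uniformizer; it is a
  unit because \<open>tau\<close> is not fixed by Frobenius.\<close>

definition rho :: 'd where "rho = cj zeta - zeta"

lemma rho_O [simp]: "rho \<in> Od" by (simp add: rho_def O_diff)
lemma rd_rho: "rd rho = tau ^ p - tau" by (simp add: rho_def rd_diff rd_cj_zeta tau_def)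
lemma rd_rho_nz: "rd rho \<noteq> 0" using tau_p_neq by (simp add: rd_rho)
lemma hh_U: "hh \<in> U 2" using PP_p[of zeta 0] by (simp add: hh_def U_iff PP_zero numeral_2_eq_2)

text \<open>As \<open>t\<close> commutes with \<open>zeta\<close>, the commutator of
  \<open>hh\<close> and \<open>gg t\<close> has leading term \<open>p * \<pi> * rho * t\<close>,
  which is also the leading term of \<open>gg (rho * t) ^ p\<close>. The two sides agree modulo
  \<open>PP 4\<close>, and the unit \<open>u\<close> absorbs the difference.\<close>

lemma hh_gg:
  assumes t: "t \<in> Ld" "t \<in> Od"
  shows "\<exists>u\<in>U 4. hh * gg t = u * (gg (rho * t) ^ p * gg t * hh)"
proof -
  define y where "y = \<pi> * (rho * t)"
  have yP: "y \<in> PP 1" using t PP_pi[of "rho * t" 0] by (simp add: y_def PP_zero O_mult)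
  define e where "e = gg (rho * t) ^ p - (1 + of_nat p * y)"
  have e: "e \<in> PP 4" using power_p_approx[OF yP] by (simp add: e_def y_def gg_def)
  have a: "hh * gg t - gg t * hh = of_nat p * y"
  proof -
    have "hh * gg t - gg t * hh = of_nat p * (zeta * \<pi> * t - \<pi> * t * zeta)"
      by (simp add: hh_def gg_def algebra_simps) (metis mult.assoc of_nat_p_comm)
    also have "zeta * \<pi> * t = \<pi> * (cj zeta * t)" by (simp add: mult_pi mult.assoc)
    also have "\<pi> * t * zeta = \<pi> * (zeta * t)" using L_comm[OF t(1), of zeta] by (simp add: mult.assoc)
    finally show ?thesis by (simp add: y_def rho_def algebra_simps)
  qed
  have gh: "gg t * hh \<in> U 1" by (intro U_mult gg_U t(2) U_mono[OF hh_U]) simp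
  have py: "of_nat p * y \<in> PP 3" using PP_p[OF yP] by (simp add: numeral_3_eq_3)
  have "hh * gg t - gg (rho * t) ^ p * (gg t * hh) = - (of_nat p * y * (gg t * hh - 1)) - e * (gg t * hh)"
    using a by (simp add: e_def algebra_simps)
  moreover have "of_nat p * y * (gg t * hh - 1) \<in> PP 4"
    using PP_mult[OF py, of "gg t * hh - 1" 1] gh by (simp add: U_iff)
  moreover have "e * (gg t * hh) \<in> PP 4" using e U_O[OF gh] by (rule PP_mult_r)
  ultimately have "hh * gg t - gg (rho * t) ^ p * (gg t * hh) \<in> PP 4" by (simp add: PP_diff PP_uminus)
  moreover have "hh * gg t \<in> U 1" by (intro U_mult gg_U t(2) U_mono[OF hh_U]) simp
  moreover have "gg (rho * t) ^ p * (gg t * hh) \<in> U 1"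
  proof (rule U_mult[OF _ gh], rule U_power, rule gg_U)
    show "rho * t \<in> Od" using t by (simp add: O_mult)
  qed
  ultimately obtain u where "u \<in> U 4" "hh * gg t = u * (gg (rho * t) ^ p * (gg t * hh))"
    using U_cong(2) by blast
  thus ?thesis by (intro bexI[of _ u]) (simp_all only: mult.assoc)
qed

lemma zeta_nz [simp]: "zeta \<noteq> 0" using tau_nz rd_0 unfolding tau_def by metis

text \<open>Moving \<open>zeta\<close> past \<pi> turns it into \<open>zeta ^ p\<close>, so
  conjugation multiplies the coordinate by \<open>zeta ^ (p - 1)\<close>; this is the origin of the
  character \<alpha>.\<close>

lemma zeta_gg: "zeta * gg (zeta ^ i) * inverse zeta = gg (zeta ^ (p - 1 + i))"
proof -
  have "zeta * (\<pi> * zeta ^ i) = \<pi> * (zeta ^ p * zeta ^ i)"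
    by (simp add: mult_pi cj_zeta mult.assoc[symmetric])
  also have "zeta ^ p * zeta ^ i = zeta ^ (p - 1 + i) * zeta"
  proof -
    have "p + i = (p - 1 + i) + 1" using p_pos by simp
    thus ?thesis by (metis power_add power_one_right)
  qed
  finally have "zeta * (\<pi> * zeta ^ i) = \<pi> * zeta ^ (p - 1 + i) * zeta" by (simp add: mult.assoc)
  hence "zeta * (\<pi> * zeta ^ i) * inverse zeta = \<pi> * zeta ^ (p - 1 + i)" by (simp add: mult.assoc)
  thus ?thesis by (simp add: gg_def algebra_simps)
qed

lemma hh_zeta: "zeta * hh * inverse zeta = hh"
proof -
  have "zeta * hh = hh * zeta" using of_nat_p_comm[of p zeta] by (simp add: hh_def algebra_simps)
  thus ?thesis by (simp add: mult.assoc)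
qed

end

subsection \<open>Associated graded objects of filtrations\<close>

lemma rep_in: "x \<in> C \<Longrightarrow> rep C \<in> C"
  unfolding rep_def by (rule someI)

context abelian_group
begin

lemma a_minus_zero: "\<ominus> \<zero> = \<zero>" "x \<in> carrier G \<Longrightarrow> x \<ominus> \<zero> = x"
proof -
  show z: "\<ominus> \<zero> = \<zero>" using r_neg[of \<zero>] by simp
  show "x \<in> carrier G \<Longrightarrow> x \<ominus> \<zero> = x" by (simp add: minus_eq z)
qed

lemma a_minus_trans:
  assumes "a \<in> carrier G" "b \<in> carrier G" "c \<in> carrier G"
  shows "(a \<ominus> b) \<oplus> (b \<ominus> c) = a \<ominus> c"
proof -
  have "(a \<ominus> b) \<oplus> (b \<ominus> c) = a \<oplus> ((\<ominus> b \<oplus> b) \<oplus> \<ominus> c)" using assms by (simp add: minus_eq a_assoc)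
  thus ?thesis using assms by (simp add: l_neg minus_eq)
qed

lemma a_minus_mem:
  assumes "additive_subgroup H G" "x \<in> H" "y \<in> H"
  shows "x \<ominus> y \<in> H"
  using assms additive_subgroup.a_closed additive_subgroup.a_inv_closed abelian_group_axioms
  unfolding minus_eq by metis

lemma a_mem_coset_iff:
  assumes "additive_subgroup H G" "x \<in> carrier G" "y \<in> carrier G"
  shows "x \<in> H +> y \<longleftrightarrow> x \<ominus> y \<in> H"
proof -
  interpret H: abelian_subgroup H G
    using assms(1) abelian_group_axioms by (rule abelian_subgroupI3)
  show ?thesis using H.a_rcos_module[OF assms(3,2)] by (simp add: minus_eq)
qed

lemma a_coset_eq_iff:
  assumes "additive_subgroup H G" "x \<in> carrier G" "y \<in> carrier G"
  shows "H +> x = H +> y \<longleftrightarrow> x \<ominus> y \<in> H"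
proof -
  interpret H: abelian_subgroup H G
    using assms(1) abelian_group_axioms by (rule abelian_subgroupI3)
  show ?thesis
    using a_mem_coset_iff[OF assms] H.a_repr_independence'[of x y] H.a_rcos_self[of x] assms by auto
qed

lemma a_coset_zero:
  assumes "additive_subgroup H G"
  shows "H +> \<zero> = H"
  using assms additive_subgroup.a_subset by fastforce

lemma a_coset_add:
  assumes "additive_subgroup H G" "x \<in> carrier G" "y \<in> carrier G"
  shows "(H +> x) <+> (H +> y) = H +> (x \<oplus> y)"
proof -
  interpret H: abelian_subgroup H G
    using assms(1) abelian_group_axioms by (rule abelian_subgroupI3)
  show ?thesis using H.a_rcos_sum assms by simp
qed

lemma a_coset_rep:
  assumes "additive_subgroup H G" "x \<in> carrier G"
  shows "rep (H +> x) \<in> carrier G" "rep (H +> x) \<ominus> x \<in> H" "H +> rep (H +> x) = H +> x"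
proof -
  interpret H: abelian_subgroup H G
    using assms(1) abelian_group_axioms by (rule abelian_subgroupI3)
  have r: "rep (H +> x) \<in> H +> x" using H.a_rcos_self[OF assms(2)] by (rule rep_in)
  show c: "rep (H +> x) \<in> carrier G"
    using r a_r_coset_subset_G[of H x] H.a_subset assms(2) by blast
  show "rep (H +> x) \<ominus> x \<in> H" using r a_mem_coset_iff[OF assms(1) c assms(2)] by blast
  show "H +> rep (H +> x) = H +> x" using H.a_repr_independence'[OF r assms(2)] by simp
qed

lemma finsum_mem:
  assumes "additive_subgroup H G" "finite A" "\<And>i. i \<in> A \<Longrightarrow> f i \<in> H"
  shows "finsum G f A \<in> H"
  using assms(2,3)
proof (induction A)
  case empty thus ?case using additive_subgroup.zero_closed[OF assms(1)] by simp
next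
  case (insert a A)
  have "f \<in> insert a A \<rightarrow> carrier G" using insert(4) additive_subgroup.a_subset[OF assms(1)] by blast
  thus ?case using insert additive_subgroup.a_closed[OF assms(1)] by (simp add: Pi_def)
qed

lemma finsum_diff_mem:
  assumes H: "additive_subgroup H G" and "finite A"
    and "\<And>i. i \<in> A \<Longrightarrow> f i \<in> carrier G" "\<And>i. i \<in> A \<Longrightarrow> g i \<in> carrier G" "\<And>i. i \<in> A \<Longrightarrow> f i \<ominus> g i \<in> H"
  shows "finsum G f A \<ominus> finsum G g A \<in> H"
  using assms(2-5)
proof (induction A)
  case empty thus ?case using additive_subgroup.zero_closed[OF H] by (simp add: a_minus_zero)
next
  case (insert a A)
  have c: "f \<in> A \<rightarrow> carrier G" "g \<in> A \<rightarrow> carrier G" "f a \<in> carrier G" "g a \<in> carrier G"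
    using insert by auto
  have "finsum G f (insert a A) \<ominus> finsum G g (insert a A)
      = (f a \<ominus> g a) \<oplus> (finsum G f A \<ominus> finsum G g A)"
    using insert(1,2) c by (simp add: minus_eq minus_add a_ac)
  thus ?case using insert additive_subgroup.a_closed[OF H] by simp
qed

end

locale filtered_ring = R?: ring R for R (structure) +
  fixes Fil :: "nat \<Rightarrow> 'a set"
  assumes Fil_0: "Fil 0 = carrier R"
    and Fil_sub: "additive_subgroup (Fil n) R"
    and Fil_Suc: "Fil (Suc n) \<subseteq> Fil n"
    and Fil_mult: "x \<in> Fil i \<Longrightarrow> y \<in> Fil j \<Longrightarrow> x \<otimes> y \<in> Fil (i + j)"

text \<open>Serves both the multiplication of the graded ring and its action on the graded dual.
  Biadditivity and compatibility with the filtrations are all that computations with classes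
  use.\<close>

locale filtered_action = filtered_ring R Fil + A?: abelian_group A
  for R (structure) and Fil :: "nat \<Rightarrow> 'a set" and A :: "('b, 'm) ring_scheme" +
  fixes FA :: "nat \<Rightarrow> 'b set" and act :: "'a \<Rightarrow> 'b \<Rightarrow> 'b"
  assumes FA_sub: "additive_subgroup (FA n) A"
    and FA_Suc: "FA (Suc n) \<subseteq> FA n"
    and act_mem: "x \<in> Fil i \<Longrightarrow> y \<in> FA j \<Longrightarrow> act x y \<in> FA (i + j)"
    and act_closed: "x \<in> carrier R \<Longrightarrow> y \<in> carrier A \<Longrightarrow> act x y \<in> carrier A"
    and act_add_l: "x \<in> carrier R \<Longrightarrow> x' \<in> carrier R \<Longrightarrow> y \<in> carrier A \<Longrightarrow> act (x \<oplus> x') y = act x y \<oplus>\<^bsub>A\<^esub> act x' y"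
    and act_add_r: "x \<in> carrier R \<Longrightarrow> y \<in> carrier A \<Longrightarrow> y' \<in> carrier A \<Longrightarrow> act x (y \<oplus>\<^bsub>A\<^esub> y') = act x y \<oplus>\<^bsub>A\<^esub> act x y'"

context filtered_ring
begin

lemma Fil_carrier: "x \<in> Fil n \<Longrightarrow> x \<in> carrier R"
  using additive_subgroup.a_subset[OF Fil_sub] by blast

lemma Fil_mono: "m \<le> n \<Longrightarrow> Fil n \<subseteq> Fil m"
  using Fil_Suc by (rule lift_Suc_antimono_le)

end

context filtered_action
begin

lemma FA_carrier: "x \<in> FA n \<Longrightarrow> x \<in> carrier A"
  using additive_subgroup.a_subset[OF FA_sub] by blast

lemma FA_mono: "m \<le> n \<Longrightarrow> FA n \<subseteq> FA m"
  using FA_Suc by (rule lift_Suc_antimono_le)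

lemma act_minus_l:
  assumes "x \<in> carrier R" "x' \<in> carrier R" "y \<in> carrier A"
  shows "act (x \<ominus> x') y = act x y \<ominus>\<^bsub>A\<^esub> act x' y"
proof -
  have "act x y = act ((x \<ominus> x') \<oplus> x') y" using assms by (simp add: R.minus_eq R.a_assoc R.l_neg)
  also have "\<dots> = act (x \<ominus> x') y \<oplus>\<^bsub>A\<^esub> act x' y" using assms by (simp add: act_add_l)
  finally show ?thesis using assms act_closed by (simp add: A.minus_eq A.a_assoc A.r_neg)
qed

lemma act_minus_r:
  assumes "x \<in> carrier R" "y \<in> carrier A" "y' \<in> carrier A"
  shows "act x (y \<ominus>\<^bsub>A\<^esub> y') = act x y \<ominus>\<^bsub>A\<^esub> act x y'"
proof -
  have "act x y = act x ((y \<ominus>\<^bsub>A\<^esub> y') \<oplus>\<^bsub>A\<^esub> y')" using assms by (simp add: A.minus_eq A.a_assoc A.l_neg)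
  also have "\<dots> = act x (y \<ominus>\<^bsub>A\<^esub> y') \<oplus>\<^bsub>A\<^esub> act x y'" using assms by (simp add: act_add_r)
  finally show ?thesis using assms act_closed by (simp add: A.minus_eq A.a_assoc A.r_neg)
qed

lemma act_cong:
  assumes "x \<in> Fil i" "x' \<in> Fil i" "x \<ominus> x' \<in> Fil (Suc i)" "y \<in> FA j" "y' \<in> FA j" "y \<ominus>\<^bsub>A\<^esub> y' \<in> FA (Suc j)"
  shows "act x y \<ominus>\<^bsub>A\<^esub> act x' y' \<in> FA (Suc (i + j))"
proof -
  have c: "x \<in> carrier R" "x' \<in> carrier R" "y \<in> carrier A" "y' \<in> carrier A"
    using assms Fil_carrier FA_carrier by blast+
  have "act (x \<ominus> x') y \<in> FA (Suc (i + j))" using act_mem[OF assms(3,4)] by simp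
  moreover have "act x' (y \<ominus>\<^bsub>A\<^esub> y') \<in> FA (Suc (i + j))" using act_mem[OF assms(2,6)] by simp
  ultimately have "act (x \<ominus> x') y \<oplus>\<^bsub>A\<^esub> act x' (y \<ominus>\<^bsub>A\<^esub> y') \<in> FA (Suc (i + j))"
    using additive_subgroup.a_closed[OF FA_sub] by blast
  moreover have "act (x \<ominus> x') y \<oplus>\<^bsub>A\<^esub> act x' (y \<ominus>\<^bsub>A\<^esub> y') = act x y \<ominus>\<^bsub>A\<^esub> act x' y'"
    unfolding act_minus_l[OF c(1-3)] act_minus_r[OF c(2-4)]
    using c act_closed by (intro A.a_minus_trans) auto
  ultimately show ?thesis by simp
qed

text \<open>\<open>gr_prod\<close> is defined on the representatives chosen by \<open>rep\<close>;
  another choice changes each summand by an element of the next filtration step.\<close>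

lemma gr_prod_eq:
  assumes "\<And>i. i \<le> n \<Longrightarrow> x i \<in> Fil i \<and> a i = Fil (Suc i) +>\<^bsub>R\<^esub> x i"
    and "\<And>i. i \<le> n \<Longrightarrow> y i \<in> FA i \<and> b i = FA (Suc i) +>\<^bsub>A\<^esub> y i"
  shows "gr_prod A FA act a b n = FA (Suc n) +>\<^bsub>A\<^esub> (\<Oplus>\<^bsub>A\<^esub>i\<in>{..n}. act (x i) (y (n - i)))"
proof -
  have ra: "rep (a i) \<in> Fil i \<and> rep (a i) \<ominus> x i \<in> Fil (Suc i)" if "i \<le> n" for i
  proof -
    have x: "x i \<in> Fil i" "a i = Fil (Suc i) +> x i" using assms(1) that by auto
    have r: "rep (a i) \<in> carrier R" "rep (a i) \<ominus> x i \<in> Fil (Suc i)"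
      using R.a_coset_rep[OF Fil_sub Fil_carrier[OF x(1)]] x(2) by auto
    have "(rep (a i) \<ominus> x i) \<oplus> x i \<in> Fil i"
      using r x Fil_Suc additive_subgroup.a_closed[OF Fil_sub] by blast
    thus ?thesis using r Fil_carrier[OF x(1)] by (simp add: R.minus_eq R.a_assoc R.l_neg)
  qed
  have rb: "rep (b i) \<in> FA i \<and> rep (b i) \<ominus>\<^bsub>A\<^esub> y i \<in> FA (Suc i)" if "i \<le> n" for i
  proof -
    have x: "y i \<in> FA i" "b i = FA (Suc i) +>\<^bsub>A\<^esub> y i" using assms(2) that by auto
    have r: "rep (b i) \<in> carrier A" "rep (b i) \<ominus>\<^bsub>A\<^esub> y i \<in> FA (Suc i)"
      using A.a_coset_rep[OF FA_sub FA_carrier[OF x(1)]] x(2) by auto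
    have "(rep (b i) \<ominus>\<^bsub>A\<^esub> y i) \<oplus>\<^bsub>A\<^esub> y i \<in> FA i"
      using r x FA_Suc additive_subgroup.a_closed[OF FA_sub] by blast
    thus ?thesis using r FA_carrier[OF x(1)] by (simp add: A.minus_eq A.a_assoc A.l_neg)
  qed
  have d: "act (rep (a i)) (rep (b (n - i))) \<ominus>\<^bsub>A\<^esub> act (x i) (y (n - i)) \<in> FA (Suc n)" if "i \<in> {..n}" for i
    using act_cong[of "rep (a i)" i "x i" "rep (b (n - i))" "n - i" "y (n - i)"]
      ra[of i] rb[of "n - i"] assms(1)[of i] assms(2)[of "n - i"] that by simp
  have c1: "act (rep (a i)) (rep (b (n - i))) \<in> carrier A" if "i \<in> {..n}" for i
    using ra[of i] rb[of "n - i"] that by (intro act_closed) (auto intro: Fil_carrier FA_carrier)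
  have c2: "act (x i) (y (n - i)) \<in> carrier A" if "i \<in> {..n}" for i
    using assms(1)[of i] assms(2)[of "n - i"] that by (intro act_closed) (auto intro: Fil_carrier FA_carrier)
  have "(\<Oplus>\<^bsub>A\<^esub>i\<in>{..n}. act (rep (a i)) (rep (b (n - i)))) \<ominus>\<^bsub>A\<^esub> (\<Oplus>\<^bsub>A\<^esub>i\<in>{..n}. act (x i) (y (n - i))) \<in> FA (Suc n)"
    by (rule A.finsum_diff_mem[OF FA_sub _ c1 c2 d]) auto
  thus ?thesis unfolding gr_prod_def
    by (subst A.a_coset_eq_iff[OF FA_sub]) (use c1 c2 in \<open>auto intro!: A.finsum_closed\<close>)
qed

lemma gr_class_mem:
  assumes "x \<in> FA k"
  shows "gr_class A FA k x \<in> gr_component A FA k"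
proof -
  have "\<exists>z\<in>FA n. gr_class A FA k x n = FA (Suc n) +>\<^bsub>A\<^esub> z" for n
  proof (cases "n = k")
    case True thus ?thesis using assms by (auto simp: gr_class_def)
  next
    case False thus ?thesis
      using A.a_coset_zero[OF FA_sub] additive_subgroup.zero_closed[OF FA_sub]
      by (intro bexI[of _ "\<zero>\<^bsub>A\<^esub>"]) (simp_all add: gr_class_def gr_zero_def)
  qed
  moreover have "finite {n. gr_class A FA k x n \<noteq> FA (Suc n)}"
    by (rule finite_subset[of _ "{k}"]) (auto simp: gr_class_def gr_zero_def)
  ultimately show ?thesis by (auto simp: gr_component_def gr_carrier_def gr_class_def)
qed

lemma gr_componentD:
  assumes "a \<in> gr_component A FA k"
  shows "\<exists>x\<in>FA k. a = gr_class A FA k x"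
proof -
  obtain x where x: "x \<in> FA k" "a k = FA (Suc k) +>\<^bsub>A\<^esub> x"
    using assms unfolding gr_component_def gr_carrier_def by blast
  have "a = gr_class A FA k x"
    using assms x by (auto simp: fun_eq_iff gr_component_def gr_class_def)
  thus ?thesis using x by blast
qed

lemma gr_class_eq_iff:
  assumes "x \<in> FA k" "x' \<in> FA k"
  shows "gr_class A FA k x = gr_class A FA k x' \<longleftrightarrow> x \<ominus>\<^bsub>A\<^esub> x' \<in> FA (Suc k)"
proof -
  have "gr_class A FA k x = gr_class A FA k x' \<longleftrightarrow> FA (Suc k) +>\<^bsub>A\<^esub> x = FA (Suc k) +>\<^bsub>A\<^esub> x'"
    by (auto simp: gr_class_def fun_eq_iff)
  thus ?thesis using A.a_coset_eq_iff[OF FA_sub] assms FA_carrier by blast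
qed

lemma gr_class_zero:
  assumes "x \<in> FA (Suc k)"
  shows "gr_class A FA k x = gr_zero FA"
proof -
  have "FA (Suc k) +>\<^bsub>A\<^esub> x = FA (Suc k)"
    using A.a_coset_eq_iff[OF FA_sub, of x "\<zero>\<^bsub>A\<^esub>" "Suc k"] A.a_coset_zero[OF FA_sub] assms FA_carrier[OF assms]
    by (simp add: A.a_minus_zero)
  thus ?thesis by (auto simp: gr_class_def gr_zero_def fun_eq_iff)
qed

lemma gr_add_class:
  assumes "x \<in> FA k" "x' \<in> FA k"
  shows "gr_add A (gr_class A FA k x) (gr_class A FA k x') = gr_class A FA k (x \<oplus>\<^bsub>A\<^esub> x')"
proof
  fix n
  have "FA (Suc n) <+>\<^bsub>A\<^esub> FA (Suc n) = FA (Suc n)"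
    using A.a_coset_add[OF FA_sub, of "\<zero>\<^bsub>A\<^esub>" "\<zero>\<^bsub>A\<^esub>" "Suc n"] A.a_coset_zero[OF FA_sub] by simp
  thus "gr_add A (gr_class A FA k x) (gr_class A FA k x') n = gr_class A FA k (x \<oplus>\<^bsub>A\<^esub> x') n"
    using A.a_coset_add[OF FA_sub] assms FA_carrier by (simp add: gr_add_def gr_class_def gr_zero_def)
qed

lemma act_zero_l: "y \<in> carrier A \<Longrightarrow> act \<zero> y = \<zero>\<^bsub>A\<^esub>"
proof -
  assume y: "y \<in> carrier A"
  have "act \<zero> y = act (\<zero> \<ominus> \<zero>) y" by (simp only: R.a_minus_zero(2)[OF R.zero_closed])
  also have "\<dots> = act \<zero> y \<ominus>\<^bsub>A\<^esub> act \<zero> y" using y by (intro act_minus_l) auto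
  also have "\<dots> = \<zero>\<^bsub>A\<^esub>" unfolding A.minus_eq by (rule A.r_neg) (rule act_closed[OF R.zero_closed y])
  finally show ?thesis .
qed

lemma act_zero_r: "x \<in> carrier R \<Longrightarrow> act x \<zero>\<^bsub>A\<^esub> = \<zero>\<^bsub>A\<^esub>"
proof -
  assume x: "x \<in> carrier R"
  have "act x \<zero>\<^bsub>A\<^esub> = act x (\<zero>\<^bsub>A\<^esub> \<ominus>\<^bsub>A\<^esub> \<zero>\<^bsub>A\<^esub>)" by (simp only: A.a_minus_zero(2)[OF A.zero_closed])
  also have "\<dots> = act x \<zero>\<^bsub>A\<^esub> \<ominus>\<^bsub>A\<^esub> act x \<zero>\<^bsub>A\<^esub>" using x by (intro act_minus_r) auto
  also have "\<dots> = \<zero>\<^bsub>A\<^esub>" unfolding A.minus_eq by (rule A.r_neg) (rule act_closed[OF x A.zero_closed])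
  finally show ?thesis .
qed

lemma gr_prod_class:
  assumes x: "x \<in> Fil i" and y: "y \<in> FA j"
  shows "gr_prod A FA act (gr_class R Fil i x) (gr_class A FA j y) = gr_class A FA (i + j) (act x y)"
proof
  fix n
  let ?x = "\<lambda>k. if k = i then x else \<zero>" and ?y = "\<lambda>k. if k = j then y else \<zero>\<^bsub>A\<^esub>"
  have c: "x \<in> carrier R" "y \<in> carrier A" using x y Fil_carrier FA_carrier by blast+
  have X: "?x k \<in> Fil k \<and> gr_class R Fil i x k = Fil (Suc k) +> ?x k" for k
    using x R.a_coset_zero[OF Fil_sub] additive_subgroup.zero_closed[OF Fil_sub]
    by (auto simp: gr_class_def gr_zero_def)
  have Y: "?y k \<in> FA k \<and> gr_class A FA j y k = FA (Suc k) +>\<^bsub>A\<^esub> ?y k" for k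
    using y A.a_coset_zero[OF FA_sub] additive_subgroup.zero_closed[OF FA_sub]
    by (auto simp: gr_class_def gr_zero_def)
  have "gr_prod A FA act (gr_class R Fil i x) (gr_class A FA j y) n
      = FA (Suc n) +>\<^bsub>A\<^esub> (\<Oplus>\<^bsub>A\<^esub>k\<in>{..n}. act (?x k) (?y (n - k)))"
    by (rule gr_prod_eq) (rule X, rule Y)
  also have "(\<Oplus>\<^bsub>A\<^esub>k\<in>{..n}. act (?x k) (?y (n - k))) = (\<Oplus>\<^bsub>A\<^esub>k\<in>{..n}. if k = i \<and> n = i + j then act x y else \<zero>\<^bsub>A\<^esub>)"
    by (rule A.finsum_cong') (auto simp: c act_zero_l act_zero_r act_closed)
  also have "\<dots> = (if n = i + j then act x y else \<zero>\<^bsub>A\<^esub>)"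
  proof (cases "n = i + j")
    case True
    have "(\<Oplus>\<^bsub>A\<^esub>k\<in>{..n}. if k = i \<and> n = i + j then act x y else \<zero>\<^bsub>A\<^esub>) = (\<Oplus>\<^bsub>A\<^esub>k\<in>{..n}. if i = k then act x y else \<zero>\<^bsub>A\<^esub>)"
      using True c by (intro A.finsum_cong') (auto simp: act_closed)
    also have "\<dots> = act x y" using True c by (intro A.finsum_singleton) (auto simp: act_closed)
    finally show ?thesis using True by simp
  qed (simp add: A.finsum_zero)
  also have "FA (Suc n) +>\<^bsub>A\<^esub> (if n = i + j then act x y else \<zero>\<^bsub>A\<^esub>) = gr_class A FA (i + j) (act x y) n"
    using A.a_coset_zero[OF FA_sub] by (simp add: gr_class_def gr_zero_def)
  finally show "gr_prod A FA act (gr_class R Fil i x) (gr_class A FA j y) n = gr_class A FA (i + j) (act x y) n" .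
qed

end

context filtered_ring
begin

lemma regular_action: "filtered_action R Fil R Fil (\<lambda>x y. x \<otimes> y)"
  by (intro filtered_action.intro filtered_action_axioms.intro filtered_ring_axioms R.abelian_group_axioms)
    (simp_all add: Fil_sub Fil_Suc Fil_mult R.l_distr R.r_distr)

text \<open>Polynomials whose coefficient in degree \<open>n\<close> lies in \<open>Fil n\<close>.
  The graded ring is the image of this subring of \<open>UP R\<close>, so that its ring axioms,
  associativity in particular, are inherited.\<close>

definition lifts :: "(nat \<Rightarrow> 'a) set" where
  "lifts = {x \<in> up R. \<forall>n. x n \<in> Fil n}"

definition cls :: "(nat \<Rightarrow> 'a) \<Rightarrow> nat \<Rightarrow> 'a set" where
  "cls x n = Fil (Suc n) +> x n"

lemma cls_lifts: "cls ` lifts = gr_carrier R Fil"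
proof (intro equalityI subsetI)
  fix a assume "a \<in> cls ` lifts"
  then obtain x where x: "x \<in> up R" "\<And>n. x n \<in> Fil n" "a = cls x" unfolding lifts_def by blast
  then obtain N where N: "bound \<zero> N x" unfolding up_def by blast
  have "{n. a n \<noteq> Fil (Suc n)} \<subseteq> {..N}"
  proof (rule subsetI, rule ccontr)
    fix n assume n: "n \<in> {n. a n \<noteq> Fil (Suc n)}" "n \<notin> {..N}"
    hence "x n = \<zero>" using bound.bound[OF N, of n] by simp
    hence "a n = Fil (Suc n)" using R.a_coset_zero[OF Fil_sub, of "Suc n"] by (simp only: x(3) cls_def)
    thus False using n(1) by simp
  qed
  hence "finite {n. a n \<noteq> Fil (Suc n)}" by (rule finite_subset) simp
  moreover have "\<exists>y\<in>Fil n. a n = Fil (Suc n) +> y" for n using x(2)[of n] unfolding x(3) cls_def by blast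
  ultimately show "a \<in> gr_carrier R Fil" by (simp add: gr_carrier_def)
next
  fix a assume a: "a \<in> gr_carrier R Fil"
  \<comment> \<open>A trivial coset is represented by zero, so that finite support of the cosets
    becomes finite support of the coefficients.\<close>
  have ex: "\<forall>n. \<exists>x. x \<in> Fil n \<and> a n = Fil (Suc n) +> x \<and> (a n = Fil (Suc n) \<longrightarrow> x = \<zero>)"
  proof
    fix n
    show "\<exists>x. x \<in> Fil n \<and> a n = Fil (Suc n) +> x \<and> (a n = Fil (Suc n) \<longrightarrow> x = \<zero>)"
    proof (cases "a n = Fil (Suc n)")
      case True thus ?thesis
        using R.a_coset_zero[OF Fil_sub, of "Suc n"] additive_subgroup.zero_closed[OF Fil_sub, of n]
        by (intro exI[of _ \<zero>]) simp
    next
      case False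
      moreover obtain x where "x \<in> Fil n" "a n = Fil (Suc n) +> x"
        using a unfolding gr_carrier_def by blast
      ultimately show ?thesis by blast
    qed
  qed
  then obtain x where "\<forall>n. x n \<in> Fil n \<and> a n = Fil (Suc n) +> x n \<and> (a n = Fil (Suc n) \<longrightarrow> x n = \<zero>)"
    by (rule choice[THEN exE])
  hence x: "\<And>n. x n \<in> Fil n" "\<And>n. a n = Fil (Suc n) +> x n"
      "\<And>n. a n = Fil (Suc n) \<Longrightarrow> x n = \<zero>" by blast+
  have fin: "finite {n. a n \<noteq> Fil (Suc n)}" using a by (simp add: gr_carrier_def)
  obtain N where N: "\<And>n. a n \<noteq> Fil (Suc n) \<Longrightarrow> n < N"
    using finite_nat_set_iff_bounded[THEN iffD1, OF fin] by blast
  have "bound \<zero> N x"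
  proof (rule bound.intro)
    fix m assume "N < m"
    hence "a m = Fil (Suc m)" using N[of m] by linarith
    thus "x m = \<zero>" by (rule x(3))
  qed
  hence "x \<in> up R" using x(1) Fil_carrier by (intro mem_upI) blast+
  hence "x \<in> lifts" using x(1) by (simp add: lifts_def)
  moreover have "a = cls x" by (rule ext) (simp only: x(2) cls_def)
  ultimately show "a \<in> cls ` lifts" by blast
qed

theorem gr_ring_is_ring: "ring (gr_ring R Fil)"
proof -
  have "UP_ring R" by (intro UP_ring.intro R.ring_axioms)
  then interpret P: ring "UP R" by (rule UP_ring.UP_ring)
  interpret reg: filtered_action R Fil R Fil "\<lambda>x y. x \<otimes> y" by (rule regular_action)
  have cP: "carrier (UP R) = up R" by (simp add: UP_def)
  have zn: "\<zero> \<in> Fil n" for n using additive_subgroup.zero_closed[OF Fil_sub] .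
  have mult_eq: "(x \<otimes>\<^bsub>UP R\<^esub> y) n = (\<Oplus>i\<in>{..n}. x i \<otimes> y (n - i))" if "x \<in> up R" "y \<in> up R" for x y n
    using that by (simp add: UP_def)
  have add_eq: "(x \<oplus>\<^bsub>UP R\<^esub> y) n = x n \<oplus> y n" if "x \<in> up R" "y \<in> up R" for x y n
    using that by (simp add: UP_def)
  have "subring lifts (UP R)"
  proof (rule P.subringI)
    show "lifts \<subseteq> carrier (UP R)" by (auto simp: lifts_def cP)
    have "(if i = 0 then \<one> else \<zero>) \<in> Fil i" for i using zn Fil_0 by simp
    thus "\<one>\<^bsub>UP R\<^esub> \<in> lifts" using P.one_closed by (simp add: lifts_def cP) (simp add: UP_def)
  next
    fix x assume x: "x \<in> lifts"
    hence xu: "x \<in> carrier (UP R)" by (simp add: lifts_def cP)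
    have c: "\<ominus>\<^bsub>UP R\<^esub> x \<in> up R" using P.a_inv_closed[OF xu] by (simp add: cP)
    have "(\<ominus>\<^bsub>UP R\<^esub> x) n \<in> Fil n" for n
    proof -
      have "x n \<oplus> (\<ominus>\<^bsub>UP R\<^esub> x) n = \<zero>"
      proof -
        have "x n \<oplus> (\<ominus>\<^bsub>UP R\<^esub> x) n = (x \<oplus>\<^bsub>UP R\<^esub> \<ominus>\<^bsub>UP R\<^esub> x) n" using c x by (intro add_eq[symmetric]) (simp_all add: lifts_def)
        also have "\<dots> = \<zero>\<^bsub>UP R\<^esub> n" by (simp only: P.r_neg[OF xu])
        finally show ?thesis by (simp add: UP_def)
      qed
      moreover have xn: "x n \<in> carrier R" using x Fil_carrier[of "x n" n] by (simp add: lifts_def)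
      moreover have yn: "(\<ominus>\<^bsub>UP R\<^esub> x) n \<in> carrier R" by (rule mem_upD[OF c])
      ultimately have "(\<ominus>\<^bsub>UP R\<^esub> x) n \<oplus> x n = \<zero>" using R.a_comm[OF xn yn] by simp
      hence "\<ominus> (x n) = (\<ominus>\<^bsub>UP R\<^esub> x) n" by (rule R.minus_equality[OF _ xn yn])
      hence "(\<ominus>\<^bsub>UP R\<^esub> x) n = \<ominus> (x n)" by (rule sym)
      thus ?thesis using additive_subgroup.a_inv_closed[OF Fil_sub] x by (simp add: lifts_def)
    qed
    thus "\<ominus>\<^bsub>UP R\<^esub> x \<in> lifts" using c by (simp add: lifts_def)
  next
    fix x y assume xy: "x \<in> lifts" "y \<in> lifts"
    hence u: "x \<in> up R" "y \<in> up R" "\<And>n. x n \<in> Fil n" "\<And>n. y n \<in> Fil n" by (auto simp: lifts_def)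
    have "(x \<otimes>\<^bsub>UP R\<^esub> y) n \<in> Fil n" for n
      unfolding mult_eq[OF u(1,2)]
      using Fil_mult[OF u(3) u(4)] by (intro R.finsum_mem[OF Fil_sub]) (simp_all, metis le_add_diff_inverse)
    thus "x \<otimes>\<^bsub>UP R\<^esub> y \<in> lifts" using P.m_closed u(1,2) by (simp add: lifts_def cP)
    have "(x \<oplus>\<^bsub>UP R\<^esub> y) n \<in> Fil n" for n
      unfolding add_eq[OF u(1,2)] using u additive_subgroup.a_closed[OF Fil_sub] by blast
    thus "x \<oplus>\<^bsub>UP R\<^esub> y \<in> lifts" using P.a_closed u(1,2) by (simp add: lifts_def cP)
  qed
  hence S: "ring ((UP R)\<lparr>carrier := lifts\<rparr>)" by (rule P.subring_is_ring)
  have "cls \<in> ring_hom ((UP R)\<lparr>carrier := lifts\<rparr>) (gr_ring R Fil)"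
  proof (rule ring_hom_memI)
    fix x assume "x \<in> carrier ((UP R)\<lparr>carrier := lifts\<rparr>)"
    thus "cls x \<in> carrier (gr_ring R Fil)" using cls_lifts by (auto simp: gr_ring_def)
  next
    fix x y assume "x \<in> carrier ((UP R)\<lparr>carrier := lifts\<rparr>)" "y \<in> carrier ((UP R)\<lparr>carrier := lifts\<rparr>)"
    hence u: "x \<in> up R" "y \<in> up R" "\<And>n. x n \<in> Fil n" "\<And>n. y n \<in> Fil n" by (auto simp: lifts_def)
    have "gr_prod R Fil (\<lambda>x y. x \<otimes> y) (cls x) (cls y) n = cls (x \<otimes>\<^bsub>UP R\<^esub> y) n" for n
      using reg.gr_prod_eq[of n x "cls x" y "cls y"] u mult_eq[OF u(1,2), of n] by (simp add: cls_def)
    thus "cls (x \<otimes>\<^bsub>(UP R)\<lparr>carrier := lifts\<rparr>\<^esub> y) = cls x \<otimes>\<^bsub>gr_ring R Fil\<^esub> cls y"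
      by (auto simp: gr_ring_def)
    have "gr_add R (cls x) (cls y) n = cls (x \<oplus>\<^bsub>UP R\<^esub> y) n" for n
      unfolding gr_add_def cls_def add_eq[OF u(1,2)]
      by (rule R.a_coset_add[OF Fil_sub Fil_carrier[OF u(3)] Fil_carrier[OF u(4)]])
    thus "cls (x \<oplus>\<^bsub>(UP R)\<lparr>carrier := lifts\<rparr>\<^esub> y) = cls x \<oplus>\<^bsub>gr_ring R Fil\<^esub> cls y"
      by (auto simp: gr_ring_def)
  next
    show "cls \<one>\<^bsub>(UP R)\<lparr>carrier := lifts\<rparr>\<^esub> = \<one>\<^bsub>gr_ring R Fil\<^esub>"
      using R.a_coset_zero[OF Fil_sub]
      by (auto simp: gr_ring_def UP_def cls_def gr_class_def gr_zero_def fun_eq_iff)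
  qed
  from ring.ring_hom_imp_img_ring[OF S this]
  have "ring ((gr_ring R Fil)\<lparr>carrier := cls ` lifts, zero := cls (\<zero>\<^bsub>UP R\<^esub>)\<rparr>)" by simp
  moreover have "cls (\<zero>\<^bsub>UP R\<^esub>) = gr_zero Fil"
    using R.a_coset_zero[OF Fil_sub] by (auto simp: UP_def cls_def gr_zero_def fun_eq_iff)
  ultimately show ?thesis by (simp add: cls_lifts gr_ring_def)
qed

end

subsection \<open>Group algebras\<close>

declare One_nat_def [simp del]

lemma group_algebra_ring:
  fixes G :: "('a, 'b) monoid_scheme"
  assumes "group G" and fin: "finite (carrier G)"
  shows "ring (group_algebra G :: ('a \<Rightarrow> 'f::field) ring)"
proof -
  interpret G: group G by fact
  let ?R = "group_algebra G :: ('a \<Rightarrow> 'f) ring"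
  let ?m = "\<lambda>(f :: 'a \<Rightarrow> 'f) g x. if x \<in> carrier G then \<Sum>a\<in>carrier G. f a * g (inv\<^bsub>G\<^esub> a \<otimes>\<^bsub>G\<^esub> x) else 0"
  have car: "carrier ?R = {f. \<forall>x. x \<notin> carrier G \<longrightarrow> f x = 0}" by (simp add: group_algebra_def)
  have mul: "f \<otimes>\<^bsub>?R\<^esub> g = ?m f g" for f g by (simp add: group_algebra_def)
  have add: "f \<oplus>\<^bsub>?R\<^esub> g = (\<lambda>x. f x + g x)" for f g by (simp add: group_algebra_def)
  have zer: "\<zero>\<^bsub>?R\<^esub> = (\<lambda>x. 0)" by (simp add: group_algebra_def)
  have one: "\<one>\<^bsub>?R\<^esub> = (\<lambda>x. if x = \<one>\<^bsub>G\<^esub> then 1 else 0)" by (simp add: group_algebra_def)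
  have shift: "(\<Sum>b\<in>carrier G. F b) = (\<Sum>c\<in>carrier G. F (a \<otimes>\<^bsub>G\<^esub> c))" if a: "a \<in> carrier G" for a and F :: "'a \<Rightarrow> 'f"
    by (rule sum.reindex_bij_witness[of _ "\<lambda>c. a \<otimes>\<^bsub>G\<^esub> c" "\<lambda>b. inv\<^bsub>G\<^esub> a \<otimes>\<^bsub>G\<^esub> b"])
      (use a in \<open>auto simp: G.m_assoc[symmetric]\<close>)
  show ?thesis
  proof (rule ringI)
    show "abelian_group ?R"
    proof (rule abelian_groupI)
      fix f assume f: "f \<in> carrier ?R"
      show "\<exists>g\<in>carrier ?R. g \<oplus>\<^bsub>?R\<^esub> f = \<zero>\<^bsub>?R\<^esub>"
        using f by (intro bexI[of _ "\<lambda>x. - f x"]) (auto simp: car add zer)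
    qed (auto simp: car add zer algebra_simps)
    show "monoid ?R"
    proof (rule monoidI)
      fix f g h assume "f \<in> carrier ?R" "g \<in> carrier ?R" "h \<in> carrier ?R"
      show "(f \<otimes>\<^bsub>?R\<^esub> g) \<otimes>\<^bsub>?R\<^esub> h = f \<otimes>\<^bsub>?R\<^esub> (g \<otimes>\<^bsub>?R\<^esub> h)"
      proof
        fix x
        show "((f \<otimes>\<^bsub>?R\<^esub> g) \<otimes>\<^bsub>?R\<^esub> h) x = (f \<otimes>\<^bsub>?R\<^esub> (g \<otimes>\<^bsub>?R\<^esub> h)) x"
        proof (cases "x \<in> carrier G")
          case x: True
          have "((f \<otimes>\<^bsub>?R\<^esub> g) \<otimes>\<^bsub>?R\<^esub> h) x
              = (\<Sum>b\<in>carrier G. \<Sum>a\<in>carrier G. f a * g (inv\<^bsub>G\<^esub> a \<otimes>\<^bsub>G\<^esub> b) * h (inv\<^bsub>G\<^esub> b \<otimes>\<^bsub>G\<^esub> x))"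
            using x by (simp add: mul sum_distrib_right)
          also have "\<dots> = (\<Sum>a\<in>carrier G. \<Sum>b\<in>carrier G. f a * g (inv\<^bsub>G\<^esub> a \<otimes>\<^bsub>G\<^esub> b) * h (inv\<^bsub>G\<^esub> b \<otimes>\<^bsub>G\<^esub> x))"
            by (rule sum.swap)
          also have "\<dots> = (\<Sum>a\<in>carrier G. f a * (\<Sum>c\<in>carrier G. g c * h (inv\<^bsub>G\<^esub> c \<otimes>\<^bsub>G\<^esub> (inv\<^bsub>G\<^esub> a \<otimes>\<^bsub>G\<^esub> x))))"
          proof (rule sum.cong[OF refl])
            fix a assume a: "a \<in> carrier G"
            have "(\<Sum>b\<in>carrier G. f a * g (inv\<^bsub>G\<^esub> a \<otimes>\<^bsub>G\<^esub> b) * h (inv\<^bsub>G\<^esub> b \<otimes>\<^bsub>G\<^esub> x))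
               = (\<Sum>c\<in>carrier G. f a * g (inv\<^bsub>G\<^esub> a \<otimes>\<^bsub>G\<^esub> (a \<otimes>\<^bsub>G\<^esub> c)) * h (inv\<^bsub>G\<^esub> (a \<otimes>\<^bsub>G\<^esub> c) \<otimes>\<^bsub>G\<^esub> x))"
              by (rule shift[OF a])
            also have "\<dots> = (\<Sum>c\<in>carrier G. f a * (g c * h (inv\<^bsub>G\<^esub> c \<otimes>\<^bsub>G\<^esub> (inv\<^bsub>G\<^esub> a \<otimes>\<^bsub>G\<^esub> x))))"
              by (rule sum.cong) (use a x in \<open>simp_all add: G.m_assoc[symmetric] G.inv_mult_group mult.assoc\<close>)
            finally show "(\<Sum>b\<in>carrier G. f a * g (inv\<^bsub>G\<^esub> a \<otimes>\<^bsub>G\<^esub> b) * h (inv\<^bsub>G\<^esub> b \<otimes>\<^bsub>G\<^esub> x))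
               = f a * (\<Sum>c\<in>carrier G. g c * h (inv\<^bsub>G\<^esub> c \<otimes>\<^bsub>G\<^esub> (inv\<^bsub>G\<^esub> a \<otimes>\<^bsub>G\<^esub> x)))"
              by (simp add: sum_distrib_left)
          qed
          also have "\<dots> = (f \<otimes>\<^bsub>?R\<^esub> (g \<otimes>\<^bsub>?R\<^esub> h)) x" using x by (simp add: mul)
          finally show ?thesis .
        qed (simp add: mul)
      qed
    next
      fix f assume f: "f \<in> carrier ?R"
      show "\<one>\<^bsub>?R\<^esub> \<otimes>\<^bsub>?R\<^esub> f = f"
      proof
        fix x
        have "(\<Sum>a\<in>carrier G. (if a = \<one>\<^bsub>G\<^esub> then 1 else 0) * f (inv\<^bsub>G\<^esub> a \<otimes>\<^bsub>G\<^esub> x))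
            = (\<Sum>a\<in>carrier G. if a = \<one>\<^bsub>G\<^esub> then f (inv\<^bsub>G\<^esub> a \<otimes>\<^bsub>G\<^esub> x) else 0)"
          by (rule sum.cong) auto
        thus "(\<one>\<^bsub>?R\<^esub> \<otimes>\<^bsub>?R\<^esub> f) x = f x" using f fin by (auto simp: mul one car)
      qed
      show "f \<otimes>\<^bsub>?R\<^esub> \<one>\<^bsub>?R\<^esub> = f"
      proof
        fix x
        have "(\<Sum>a\<in>carrier G. f a * (if inv\<^bsub>G\<^esub> a \<otimes>\<^bsub>G\<^esub> x = \<one>\<^bsub>G\<^esub> then 1 else 0))
            = (\<Sum>a\<in>carrier G. if a = x then f a else 0)" if "x \<in> carrier G"
        proof (rule sum.cong[OF refl])
          fix a assume a: "a \<in> carrier G"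
          have "inv\<^bsub>G\<^esub> a \<otimes>\<^bsub>G\<^esub> x = \<one>\<^bsub>G\<^esub> \<longleftrightarrow> a = x"
          proof
            assume h: "inv\<^bsub>G\<^esub> a \<otimes>\<^bsub>G\<^esub> x = \<one>\<^bsub>G\<^esub>"
            have "x = a \<otimes>\<^bsub>G\<^esub> (inv\<^bsub>G\<^esub> a \<otimes>\<^bsub>G\<^esub> x)" using a that by (simp add: G.m_assoc[symmetric])
            thus "a = x" using h a by simp
          qed (use a in simp)
          thus "f a * (if inv\<^bsub>G\<^esub> a \<otimes>\<^bsub>G\<^esub> x = \<one>\<^bsub>G\<^esub> then 1 else 0) = (if a = x then f a else 0)" by simp
        qed
        thus "(f \<otimes>\<^bsub>?R\<^esub> \<one>\<^bsub>?R\<^esub>) x = f x" using f fin by (auto simp: mul one car)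
      qed
    qed (auto simp: car mul one)
  next
    fix f g h :: "'a \<Rightarrow> 'f"
    show "(f \<oplus>\<^bsub>?R\<^esub> g) \<otimes>\<^bsub>?R\<^esub> h = f \<otimes>\<^bsub>?R\<^esub> h \<oplus>\<^bsub>?R\<^esub> g \<otimes>\<^bsub>?R\<^esub> h"
      by (auto simp: mul add fun_eq_iff sum.distrib distrib_right)
    show "h \<otimes>\<^bsub>?R\<^esub> (f \<oplus>\<^bsub>?R\<^esub> g) = h \<otimes>\<^bsub>?R\<^esub> f \<oplus>\<^bsub>?R\<^esub> h \<otimes>\<^bsub>?R\<^esub> g"
      by (auto simp: mul add fun_eq_iff sum.distrib distrib_left)
  qed
qed

context quat
begin

subsection \<open>The finite levels\<close>

abbreviation "G1 \<equiv> U1grp D"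

lemma G1_simps [simp]: "carrier G1 = U 1" "x \<otimes>\<^bsub>G1\<^esub> y = x * y" "\<one>\<^bsub>G1\<^esub> = 1"
  by (simp_all add: U1grp_def)

lemma G1_group: "group G1"
proof (rule groupI)
  fix x assume x: "x \<in> carrier G1"
  show "\<exists>y\<in>carrier G1. y \<otimes>\<^bsub>G1\<^esub> x = \<one>\<^bsub>G1\<^esub>"
    using x U_inv[of x 1] U_nz[of x 1] by (intro bexI[of _ "inverse x"]) simp_all
qed (simp_all add: U_mult mult.assoc)

lemma G1_inv: "x \<in> U 1 \<Longrightarrow> inv\<^bsub>G1\<^esub> x = inverse x"
  using group.inv_equality[OF G1_group, of "inverse x" x] U_inv U_nz by simp

lemma Z_U1: "z \<in> ZD1 D \<Longrightarrow> z \<in> U 1" by (simp add: ZD1_def)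
lemma Z_comm: "z \<in> ZD1 D \<Longrightarrow> z * x = x * z" by (simp add: ZD1_def centre_def)
lemma Z_1 [simp]: "1 \<in> ZD1 D" by (simp add: ZD1_def centre_def)
lemma Z_mult: "z \<in> ZD1 D \<Longrightarrow> w \<in> ZD1 D \<Longrightarrow> z * w \<in> ZD1 D"
proof -
  assume z: "z \<in> ZD1 D" and w: "w \<in> ZD1 D"
  have "z * w * x = x * (z * w)" for x
  proof -
    have "z * w * x = z * (x * w)" by (simp only: mult.assoc Z_comm[OF w])
    also have "\<dots> = z * x * w" by (simp only: mult.assoc)
    also have "\<dots> = x * z * w" by (simp only: Z_comm[OF z])
    finally show ?thesis by (simp only: mult.assoc)
  qed
  thus ?thesis using U_mult[OF Z_U1[OF z] Z_U1[OF w]] by (simp add: ZD1_def centre_def)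
qed
lemma Z_inv: "z \<in> ZD1 D \<Longrightarrow> inverse z \<in> ZD1 D"
proof -
  assume z: "z \<in> ZD1 D"
  have nz: "z \<noteq> 0" using U_nz Z_U1[OF z] by blast
  have "inverse z * x = x * inverse z" for x
  proof -
    have "x * inverse z = inverse z * (z * x) * inverse z" using nz by (simp add: mult.assoc[symmetric])
    also have "\<dots> = inverse z * (x * z) * inverse z" by (simp only: Z_comm[OF z])
    also have "\<dots> = inverse z * x" using nz by (simp add: mult.assoc)
    finally show ?thesis ..
  qed
  thus ?thesis using U_inv[of z 1] Z_U1[OF z] by (simp add: ZD1_def centre_def)
qed

lemma Nlev_iff: "w \<in> Nlev D n \<longleftrightarrow> (\<exists>u\<in>U (Suc n). \<exists>z\<in>ZD1 D. w = u * z)"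
  by (auto simp: Nlev_def set_mult_def)

lemma Nlev_U1: "w \<in> Nlev D n \<Longrightarrow> w \<in> U 1"
  using Nlev_iff U_mult Z_U1 U_mono[of _ "Suc n" 1] by auto
lemma U_Nlev: "u \<in> U (Suc n) \<Longrightarrow> u \<in> Nlev D n" unfolding Nlev_iff by (intro bexI[of _ u] bexI[of _ 1]) auto
lemma Z_Nlev: "z \<in> ZD1 D \<Longrightarrow> z \<in> Nlev D n" unfolding Nlev_iff by (intro bexI[of _ 1] bexI[of _ z]) auto
lemma Nlev_1 [simp]: "1 \<in> Nlev D n" using U_Nlev by simp
lemma Nlev_mult: "w \<in> Nlev D n \<Longrightarrow> w' \<in> Nlev D n \<Longrightarrow> w * w' \<in> Nlev D n"
proof -
  assume "w \<in> Nlev D n" "w' \<in> Nlev D n"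
  then obtain u z u' z' where *: "u \<in> U (Suc n)" "z \<in> ZD1 D" "w = u * z" "u' \<in> U (Suc n)" "z' \<in> ZD1 D" "w' = u' * z'"
    unfolding Nlev_iff by blast
  have "w * w' = u * (z * u') * z'" by (simp add: * mult.assoc)
  also have "\<dots> = (u * u') * (z * z')" by (simp add: Z_comm[OF *(2), of u'] mult.assoc)
  finally show ?thesis unfolding Nlev_iff using * U_mult Z_mult by blast
qed
lemma Nlev_inv: "w \<in> Nlev D n \<Longrightarrow> inverse w \<in> Nlev D n"
proof -
  assume "w \<in> Nlev D n"
  then obtain u z where *: "u \<in> U (Suc n)" "z \<in> ZD1 D" "w = u * z" unfolding Nlev_iff by blast
  have "inverse w = inverse z * inverse u" using U_nz[OF *(1)] U_nz[OF Z_U1[OF *(2)]]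
    by (simp add: *(3) nonzero_inverse_mult_distrib)
  also have "\<dots> = inverse u * inverse z" by (rule Z_comm[OF Z_inv[OF *(2)]])
  finally show ?thesis unfolding Nlev_iff using * U_inv[of u "Suc n"] Z_inv by auto
qed
lemma Nlev_conj: "w \<in> Nlev D n \<Longrightarrow> g \<in> U 1 \<Longrightarrow> g * w * inverse g \<in> Nlev D n"
proof -
  assume w: "w \<in> Nlev D n" and g: "g \<in> U 1"
  then obtain u z where *: "u \<in> U (Suc n)" "z \<in> ZD1 D" "w = u * z" unfolding Nlev_iff by blast
  have "g * w * inverse g = g * u * (z * inverse g)" by (simp add: * mult.assoc)
  also have "\<dots> = (g * u * inverse g) * z" by (simp add: Z_comm[OF *(2)] mult.assoc)
  finally show ?thesis unfolding Nlev_iff using * U_conj'[OF *(1) g] by blast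
qed
lemma Nlev_conj': "w \<in> Nlev D n \<Longrightarrow> g \<in> U 1 \<Longrightarrow> inverse g * w * g \<in> Nlev D n"
  using Nlev_conj[of w n "inverse g"] U_inv[of g 1] by simp
lemma Nlev_Suc: "w \<in> Nlev D (Suc n) \<Longrightarrow> w \<in> Nlev D n"
  using U_mono[of _ "Suc (Suc n)" "Suc n"] unfolding Nlev_iff by auto
lemma Nlev_0: "Nlev D 0 = U 1"
  using Nlev_U1[of _ 0] U_Nlev[of _ 0, folded One_nat_def] by auto

lemma Nlev_normal: "Nlev D n \<lhd> G1"
proof -
  have "subgroup (Nlev D n) G1"
    by (rule group.subgroupI[OF G1_group])
      (auto simp: Nlev_U1 G1_inv[OF Nlev_U1] Nlev_inv Nlev_mult intro: Nlev_1)
  thus ?thesis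
    using Nlev_conj by (subst group.normal_inv_iff[OF G1_group]) (auto simp: G1_inv)
qed

abbreviation "lev n \<equiv> levgrp D n"
definition cs :: "nat \<Rightarrow> 'd \<Rightarrow> 'd set" where "cs n g = Nlev D n #>\<^bsub>G1\<^esub> g"

text \<open>Cosets are right cosets by definition; normality gives the left form, which suits
  functions invariant under right translation.\<close>

lemma cs_mem: "g \<in> U 1 \<Longrightarrow> x \<in> cs n g \<longleftrightarrow> (\<exists>w\<in>Nlev D n. x = g * w)"
proof -
  assume g: "g \<in> U 1"
  have nz: "g \<noteq> 0" using U_nz[OF g] by simp
  have "x \<in> cs n g \<longleftrightarrow> (\<exists>w\<in>Nlev D n. x = w * g)" by (auto simp: cs_def r_coset_def)
  also have "\<dots> \<longleftrightarrow> (\<exists>w\<in>Nlev D n. x = g * w)"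
  proof
    assume "\<exists>w\<in>Nlev D n. x = w * g"
    then obtain w where w: "w \<in> Nlev D n" "x = w * g" by blast
    have "x = g * (inverse g * w * g)" using nz w(2) by (simp add: mult.assoc[symmetric])
    thus "\<exists>w\<in>Nlev D n. x = g * w" using Nlev_conj'[OF w(1) g] by blast
  next
    assume "\<exists>w\<in>Nlev D n. x = g * w"
    then obtain w where w: "w \<in> Nlev D n" "x = g * w" by blast
    have "x = (g * w * inverse g) * g" using nz w(2) by (simp add: mult.assoc)
    thus "\<exists>w\<in>Nlev D n. x = w * g" using Nlev_conj[OF w(1) g] by blast
  qed
  finally show ?thesis .
qed

lemma cs_self [simp]: "g \<in> U 1 \<Longrightarrow> g \<in> cs n g" unfolding cs_mem by (rule bexI[of _ 1]) auto
lemma cs_U1: "g \<in> U 1 \<Longrightarrow> x \<in> cs n g \<Longrightarrow> x \<in> U 1"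
proof -
  assume g: "g \<in> U 1" and "x \<in> cs n g"
  then obtain w where "w \<in> Nlev D n" "x = g * w" using cs_mem[OF g] by blast
  thus ?thesis using U_mult[OF g Nlev_U1] by simp
qed
lemma cs_eq: "g \<in> U 1 \<Longrightarrow> x \<in> cs n g \<Longrightarrow> cs n x = cs n g"
  using group.repr_independence[OF G1_group, of x "Nlev D n" g] Nlev_normal[of n]
  by (simp add: cs_def normal_imp_subgroup)
lemma cs_mult_N: "g \<in> U 1 \<Longrightarrow> w \<in> Nlev D n \<Longrightarrow> cs n (g * w) = cs n g"
  by (rule cs_eq) (auto simp: cs_mem)
lemma cs_eq_iff: "g \<in> U 1 \<Longrightarrow> h \<in> U 1 \<Longrightarrow> cs n g = cs n h \<longleftrightarrow> g \<in> cs n h"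
proof
  assume g: "g \<in> U 1" and e: "cs n g = cs n h"
  show "g \<in> cs n h" using cs_self[OF g, of n] unfolding e .
qed (rule cs_eq)

lemma lev_carrier: "carrier (lev n) = cs n ` U 1"
  by (auto simp: FactGroup_def RCOSETS_def cs_def)
lemma lev_mult: "g \<in> U 1 \<Longrightarrow> h \<in> U 1 \<Longrightarrow> cs n g \<otimes>\<^bsub>lev n\<^esub> cs n h = cs n (g * h)"
  using normal.rcos_sum[OF Nlev_normal[of n], of g h] by (simp add: FactGroup_def cs_def)
lemma lev_one: "\<one>\<^bsub>lev n\<^esub> = cs n 1"
  using group.coset_join2[OF G1_group, of 1 "Nlev D n"] Nlev_normal[of n]
  by (simp add: FactGroup_def cs_def normal_imp_subgroup)
lemma lev_group: "group (lev n)" by (rule normal.factorgroup_is_group[OF Nlev_normal])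
lemma lev_inv: "g \<in> U 1 \<Longrightarrow> inv\<^bsub>lev n\<^esub> (cs n g) = cs n (inverse g)"
proof (rule group.inv_equality[OF lev_group])
  assume g: "g \<in> U 1"
  hence i: "inverse g \<in> U 1" "g \<noteq> 0" using U_inv[of g 1] U_nz[of g 1] by simp_all
  show "cs n (inverse g) \<otimes>\<^bsub>lev n\<^esub> cs n g = \<one>\<^bsub>lev n\<^esub>" by (simp only: lev_mult[OF i(1) g] lev_one left_inverse[OF i(2)])
  show "cs n g \<in> carrier (lev n)" "cs n (inverse g) \<in> carrier (lev n)" using g i by (auto simp: lev_carrier)
qed

lemma lev_rep: "C \<in> carrier (lev n) \<Longrightarrow> rep C \<in> U 1 \<and> cs n (rep C) = C \<and> rep C \<in> C"
proof -
  assume "C \<in> carrier (lev n)"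
  then obtain g where g: "g \<in> U 1" "C = cs n g" unfolding lev_carrier by blast
  have rC: "rep C \<in> C" unfolding g(2) by (rule rep_in[OF cs_self[OF g(1)]])
  hence r: "rep C \<in> cs n g" by (simp only: g(2)[symmetric])
  show ?thesis using cs_U1[OF g(1) r] trans[OF cs_eq[OF g(1) r] g(2)[symmetric]] rC by (intro conjI)
qed
lemma lev_mem: "C \<in> carrier (lev n) \<Longrightarrow> x \<in> C \<Longrightarrow> x \<in> U 1 \<and> cs n x = C"
proof -
  assume "C \<in> carrier (lev n)" and x: "x \<in> C"
  then obtain g where g: "g \<in> U 1" "C = cs n g" unfolding lev_carrier by blast
  have x': "x \<in> cs n g" using x g(2) by simp
  show ?thesis unfolding g(2) using cs_U1[OF g(1) x'] cs_eq[OF g(1) x'] by (rule conjI)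
qed
lemma cs_lev: "g \<in> U 1 \<Longrightarrow> cs n g \<in> carrier (lev n)" by (simp add: lev_carrier)

section \<open>Representatives of the layers and finiteness of the levels\<close>

definition teich_set :: "'d set" where "teich_set = insert 0 ((\<lambda>i. zeta ^ i) ` {..<q - 1})"

lemma teich_set_O: "t \<in> teich_set \<Longrightarrow> t \<in> Od" by (auto simp: teich_set_def)
lemma teich_set_fin [simp]: "finite teich_set" by (simp add: teich_set_def)
lemma teich_set_ex: "x \<in> Od \<Longrightarrow> \<exists>t\<in>teich_set. x - t \<in> PP 1"
proof -
  assume x: "x \<in> Od"
  show ?thesis
  proof (cases "rd x = 0")
    case True thus ?thesis using PP_1[OF x] by (intro bexI[of _ 0]) (auto simp: teich_set_def)
  next
    case False
    hence "rd x \<in> residue_units D" using x by (auto simp: residue_units_def)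
    then obtain i where i: "i < q - 1" "rd x = tau ^ i" unfolding residue_units_eq mu_eq by auto
    have "rd (x - zeta ^ i) = 0" using x i by (simp add: rd_diff rd_zeta_pow)
    hence "x - zeta ^ i \<in> PP 1" using x PP_1[of "x - zeta ^ i"] by (simp add: O_diff)
    thus ?thesis using i by (auto simp: teich_set_def)
  qed
qed

lemma U_step:
  assumes "u \<in> U k" "k \<ge> 1"
  shows "\<exists>t\<in>teich_set. \<exists>u'\<in>U (Suc k). u = (1 + \<pi> ^ k * t) * u'"
proof -
  obtain x where x: "x \<in> Od" "u - 1 = \<pi> ^ k * x" using assms by (auto simp: U_iff PP_def)
  obtain t where t: "t \<in> teich_set" "x - t \<in> PP 1" using teich_set_ex[OF x(1)] by blast
  have "\<pi> ^ k \<in> PP k" by (auto simp: PP_def intro!: exI[of _ 1])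
  hence "\<pi> ^ k * (x - t) \<in> PP (k + 1)" using t(2) by (rule PP_mult)
  moreover have "u - (1 + \<pi> ^ k * t) = \<pi> ^ k * (x - t)" using x(2) by (simp add: algebra_simps)
  ultimately have d: "u - (1 + \<pi> ^ k * t) \<in> PP (Suc k)" by (simp only: Suc_eq_plus1)
  have "1 + \<pi> ^ k * t \<in> U k" using t(1) teich_set_O by (auto simp: U_iff PP_def)
  hence "1 + \<pi> ^ k * t \<in> U 1" "u \<in> U 1" using U_mono[OF _ assms(2)] assms(1) by blast+
  from U_cong(1)[OF this(2,1) d] show ?thesis using t(1) by blast
qed

text \<open>Representatives of \<open>U 1\<close> modulo \<open>U (Suc k)\<close> are multiplied by
  the finitely many representatives of the next layer.\<close>

lemma lev_finite [simp]: "finite (carrier (lev n))"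
proof -
  have ex: "\<exists>R. finite R \<and> R \<subseteq> U 1 \<and> (\<forall>g\<in>U 1. \<exists>r\<in>R. \<exists>u\<in>U (Suc k). g = r * u)" for k
  proof (induction k)
    case 0 show ?case by (intro exI[of _ "{1}"]) (auto simp: One_nat_def)
  next
    case (Suc k)
    then obtain R where R: "finite R" "R \<subseteq> U 1" "\<forall>g\<in>U 1. \<exists>r\<in>R. \<exists>u\<in>U (Suc k). g = r * u"
      by (elim exE conjE)
    let ?R = "(\<lambda>(r, t). r * (1 + \<pi> ^ Suc k * t)) ` (R \<times> teich_set)"
    have "1 + \<pi> ^ Suc k * t \<in> U 1" if "t \<in> teich_set" for t
    proof -
      have "1 + \<pi> ^ Suc k * t \<in> U (Suc k)" using that teich_set_O by (auto simp: U_iff PP_def)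
      thus ?thesis by (rule U_mono) simp
    qed
    hence A: "?R \<subseteq> U 1" using R(2) by (auto intro!: U_mult)
    have B: "\<exists>r\<in>?R. \<exists>u\<in>U (Suc (Suc k)). g = r * u" if g: "g \<in> U 1" for g
    proof -
      obtain r u where ru: "r \<in> R" "u \<in> U (Suc k)" "g = r * u" using bspec[OF R(3) g] by (elim bexE)
      have "\<exists>t\<in>teich_set. \<exists>u'\<in>U (Suc (Suc k)). u = (1 + \<pi> ^ Suc k * t) * u'"
        by (rule U_step[OF ru(2)]) simp
      then obtain t u' where t: "t \<in> teich_set" "u' \<in> U (Suc (Suc k))" "u = (1 + \<pi> ^ Suc k * t) * u'"
        by (elim bexE)
      have "g = (r * (1 + \<pi> ^ Suc k * t)) * u'" by (simp only: ru(3) t(3) mult.assoc)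
      moreover have "r * (1 + \<pi> ^ Suc k * t) \<in> ?R"
        by (rule image_eqI[of _ _ "(r, t)"]) (use ru(1) t(1) in simp_all)
      ultimately show ?thesis using t(2) by (intro bexI[of _ "r * (1 + \<pi> ^ Suc k * t)"] bexI[of _ u'])
    qed
    show ?case
    proof (rule exI[of _ ?R], intro conjI ballI)
      show "finite ?R" using R(1) by (intro finite_imageI finite_cartesian_product teich_set_fin)
      show "?R \<subseteq> U 1" by (rule A)
      fix g assume "g \<in> U 1"
      thus "\<exists>r\<in>?R. \<exists>u\<in>U (Suc (Suc k)). g = r * u" by (rule B)
    qed
  qed
  obtain R where R: "finite R" "R \<subseteq> U 1" "\<forall>g\<in>U 1. \<exists>r\<in>R. \<exists>u\<in>U (Suc n). g = r * u"
    using ex[of n] by (elim exE conjE)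
  have "carrier (lev n) \<subseteq> cs n ` R"
  proof
    fix C assume "C \<in> carrier (lev n)"
    then obtain g where g: "g \<in> U 1" "C = cs n g" unfolding lev_carrier by (elim imageE)
    obtain r u where ru: "r \<in> R" "u \<in> U (Suc n)" "g = r * u" using bspec[OF R(3) g(1)] by (elim bexE)
    have "C = cs n r" unfolding g(2) ru(3) by (rule cs_mult_N[OF _ U_Nlev[OF ru(2)]]) (rule subsetD[OF R(2) ru(1)])
    thus "C \<in> cs n ` R" using ru(1) by (rule image_eqI)
  qed
  thus ?thesis by (rule finite_surj[OF R(1)])
qed

end

section \<open>Invariant vectors of pro-p groups in characteristic p\<close>

lemma power_p_add:
  fixes x y :: "'a::comm_ring_1"
  assumes "prime p" "(of_nat p :: 'a) = 0"
  shows "(x + y) ^ p = x ^ p + y ^ p"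
proof -
  have p: "p > 0" using assms(1) by (rule prime_gt_0_nat)
  have "(x + y) ^ p = (\<Sum>k\<le>p. of_nat (p choose k) * x ^ k * y ^ (p - k))" by (rule binomial_ring)
  also have "\<dots> = (\<Sum>k\<in>{0, p}. of_nat (p choose k) * x ^ k * y ^ (p - k))"
  proof (rule sum.mono_neutral_right)
    show "\<forall>i\<in>{..p} - {0, p}. of_nat (p choose i) * x ^ i * y ^ (p - i) = 0"
    proof
      fix i assume "i \<in> {..p} - {0, p}"
      hence "p dvd (p choose i)" using assms(1) by (intro dvd_choose_prime) auto
      then obtain m where "p choose i = p * m" by (auto simp: dvd_def)
      thus "of_nat (p choose i) * x ^ i * y ^ (p - i) = 0" using assms(2) by simp
    qed
  qed auto
  finally show ?thesis using p by (simp add: add.commute)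
qed

lemma (in group) inv_mult_cancel:
  assumes "x \<in> carrier G" "y \<in> carrier G"
  shows "x \<otimes> (inv x \<otimes> y) = y" "inv x \<otimes> (x \<otimes> y) = y"
  using assms by (simp_all add: m_assoc[symmetric])

text \<open>Powers of a single operator commute, so the expansion has the coefficients of the
  polynomial \<open>(X - 1) ^ p\<close>, which is \<open>X ^ p - 1\<close> in characteristic
  \<open>p\<close>; \<open>p\<close> being odd fixes the sign of the constant term.\<close>

lemma (in vector_space) linear_power_p_minus_one:
  assumes "prime p" "odd p" "(of_nat p :: 'a) = 0" and lin: "Vector_Spaces.linear scale scale T"
  shows "((\<lambda>x. T x - x) ^^ p) v = (T ^^ p) v - v"
proof -
  interpret T: Vector_Spaces.linear scale scale T by fact
  define c :: "nat \<Rightarrow> nat \<Rightarrow> 'a" where "c n = Polynomial.coeff ([:-1, 1:] ^ n)" for n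
  have c_Suc: "c (Suc n) j = (case j of 0 \<Rightarrow> 0 | Suc i \<Rightarrow> c n i) - c n j" for n j
    unfolding c_def by (simp add: coeff_pCons split: nat.split)
  have deg: "c n j = 0" if "j > n" for n j
    unfolding c_def using that degree_linear_power[of "-1 :: 'a" n] by (intro coeff_eq_0) simp
  have "((\<lambda>x. T x - x) ^^ n) v = (\<Sum>j\<le>n. scale (c n j) ((T ^^ j) v))" for n
  proof (induction n)
    case 0 show ?case by (simp add: c_def)
  next
    case (Suc n)
    have "((\<lambda>x. T x - x) ^^ Suc n) v = (\<Sum>j\<le>n. scale (c n j) ((T ^^ Suc j) v)) - (\<Sum>j\<le>n. scale (c n j) ((T ^^ j) v))"
      by (simp add: Suc T.sum T.scale)
    also have "(\<Sum>j\<le>n. scale (c n j) ((T ^^ j) v)) = (\<Sum>j\<le>Suc n. scale (c n j) ((T ^^ j) v))"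
      using deg[of n "Suc n"] by simp
    also have "(\<Sum>j\<le>n. scale (c n j) ((T ^^ Suc j) v))
        = (\<Sum>j\<le>Suc n. scale (case j of 0 \<Rightarrow> 0 | Suc i \<Rightarrow> c n i) ((T ^^ j) v))"
      by (subst sum.atMost_Suc_shift) simp
    finally show ?case by (simp only: sum_subtractf[symmetric] c_Suc scale_left_diff_distrib)
  qed
  hence s: "((\<lambda>x. T x - x) ^^ p) v = (\<Sum>j\<le>p. scale (c p j) ((T ^^ j) v))" .
  have p: "p > 0" using assms(1) by (rule prime_gt_0_nat)
  have "([:-1, 1:] :: 'a poly) ^ p = ([:0, 1:] + [:-1:]) ^ p" by simp
  also have "\<dots> = [:0, 1:] ^ p + [:-1:] ^ p"
    using assms(1,3) by (intro power_p_add) (simp_all add: of_nat_poly)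
  also have "[:0, 1:] ^ p = (Polynomial.monom 1 p :: 'a poly)" by (simp add: monom_altdef)
  also have "([:-1:] :: 'a poly) ^ p = [:-1:]" using assms(2) by (simp add: poly_const_pow)
  finally have "c p j = (if j = p then 1 else 0) - (if j = 0 then 1 else 0)" for j
    by (auto simp: c_def coeff_pCons split: nat.split)
  hence "(\<Sum>j\<le>p. scale (c p j) ((T ^^ j) v))
      = (\<Sum>j\<le>p. if j = p then (T ^^ j) v else 0) - (\<Sum>j\<le>p. if j = 0 then (T ^^ j) v else 0)"
    by (simp only: sum_subtractf[symmetric]) (rule sum.cong, auto simp: p)
  also have "\<dots> = (T ^^ p) v - v" by simp
  finally show ?thesis using s by simp
qed

lemma function_space_vs: "vector_space (\<lambda>(c::'f::field) (f::'a \<Rightarrow> 'f) x. c * f x)"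
  by unfold_locales (auto simp: fun_eq_iff plus_fun_def zero_fun_def algebra_simps)

context quat
begin

lemma odd_p: "odd p" using prime_p p_ge_5 by (intro prime_odd_nat) auto

text \<open>The additive commutator of \<open>h\<close> and \<open>g\<close> is that of
  \<open>h - 1\<close> and \<open>g - 1\<close>, of valuation at least \<open>2 * k\<close>, hence
  at least \<open>k + 1\<close>.\<close>

lemma U_commutator:
  assumes "g \<in> U k" "h \<in> U k" "k \<ge> 1"
  shows "\<exists>c\<in>U (Suc k). h * g = (g * h) * c"
proof -
  have "(h - 1) * (g - 1) - (g - 1) * (h - 1) \<in> PP (k + k)"
    using assms(1,2) unfolding U_iff by (intro PP_diff[OF PP_mult PP_mult])
  hence "(h - 1) * (g - 1) - (g - 1) * (h - 1) \<in> PP (Suc k)" by (rule PP_mono) (use assms(3) in simp)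
  moreover have "h * g - g * h = (h - 1) * (g - 1) - (g - 1) * (h - 1)" by (simp add: algebra_simps)
  ultimately have d: "h * g - g * h \<in> PP (Suc k)" by simp
  have "h * g \<in> U 1" "g * h \<in> U 1" using U_mono[OF U_mult[OF assms(2,1)] assms(3)] U_mono[OF U_mult[OF assms(1,2)] assms(3)] .
  from U_cong(1)[OF this d] show ?thesis .
qed

text \<open>
  The group acts through a pro-\<open>p\<close>-group on a vector space of characteristic \<open>p\<close>, so a nonzero
  quotient has a nonzero invariant vector; the invariance is achieved one layer of the filtration
  \<open>U n\<close> at a time.
\<close>

lemma invariant_vector:
  fixes sc :: "'f \<Rightarrow> 'v::ab_group_add \<Rightarrow> 'v"
  assumes vs: "vector_space sc"
    and lin: "\<And>g. g \<in> U 1 \<Longrightarrow> Vector_Spaces.linear sc sc (act g)"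
    and one: "\<And>v. act 1 v = v"
    and mul: "\<And>g h v. g \<in> U 1 \<Longrightarrow> h \<in> U 1 \<Longrightarrow> act (g * h) v = act g (act h v)"
    and P: "\<And>g v. g \<in> U 1 \<Longrightarrow> v \<in> P \<Longrightarrow> act g v - v \<in> P"
    and P'_diff: "\<And>x y. x \<in> P' \<Longrightarrow> y \<in> P' \<Longrightarrow> x - y \<in> P'"
    and P'_act: "\<And>g x. g \<in> U 1 \<Longrightarrow> x \<in> P' \<Longrightarrow> act g x \<in> P'"
    and w: "w \<in> P" "w \<notin> P'"
    and N: "N \<ge> 1" "\<And>u v. u \<in> U N \<Longrightarrow> v \<in> P \<Longrightarrow> act u v - v \<in> P'"
  shows "\<exists>v\<in>P. v \<notin> P' \<and> (\<forall>g\<in>U 1. act g v - v \<in> P')"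
proof -
  have P'_0: "0 \<in> P'" using P'_diff[OF N(2)[OF U_1 w(1)] N(2)[OF U_1 w(1)]] by simp
  have P'_add: "x + y \<in> P'" if "x \<in> P'" "y \<in> P'" for x y
  proof -
    have "x - (0 - y) \<in> P'" by (intro P'_diff P'_0 that)
    thus ?thesis by simp
  qed
  have adiff: "act g (x - y) = act g x - act g y" if "g \<in> U 1" for g x y
  proof -
    interpret T: Vector_Spaces.linear sc sc "act g" by (rule lin[OF that])
    show ?thesis by (rule T.diff)
  qed
  define K where "K v = {g \<in> U 1. act g v - v \<in> P'}" for v
  have K_mult: "g * h \<in> K v" if g: "g \<in> K v" and h: "h \<in> K v" for g h v
  proof -
    have u: "g \<in> U 1" "h \<in> U 1" using g h by (auto simp: K_def)
    have "act g (act h v - v) + (act g v - v) \<in> P'"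
      using g h u by (intro P'_add P'_act) (auto simp: K_def)
    moreover have "act g (act h v - v) + (act g v - v) = act (g * h) v - v"
      by (simp only: adiff[OF u(1)] mul[OF u]) simp
    ultimately show ?thesis using U_mult[OF u] by (simp add: K_def)
  qed
  have layer: "\<exists>v\<in>P. v \<notin> P' \<and> U k \<subseteq> K v" if k: "k \<ge> 1" and IH: "\<exists>v\<in>P. v \<notin> P' \<and> U (Suc k) \<subseteq> K v" for k
  proof -
    have "\<exists>v\<in>P. v \<notin> P' \<and> U (Suc k) \<subseteq> K v \<and> S \<subseteq> K v" if "finite S" "S \<subseteq> U k" for S
      using that
    proof (induction S)
      case empty thus ?case using IH by simp
    next
      case (insert g S)
      then obtain v where v: "v \<in> P" "v \<notin> P'" "U (Suc k) \<subseteq> K v" "S \<subseteq> K v" by auto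
      have gk: "g \<in> U k" and Sk: "S \<subseteq> U k" using insert.prems by auto
      have g: "g \<in> U 1" using gk k by (rule U_mono)
      let ?\<Delta> = "\<lambda>x. act g x - x"
      \<comment> \<open>Vectors of \<open>P\<close> that are invariant modulo \<open>P'\<close>
        under \<open>U (Suc k)\<close> and under the elements treated so far. Applying
        \<open>act g - 1\<close> preserves this, because commutators with \<open>g\<close> lie in
        \<open>U (Suc k)\<close>.\<close>
      define Q where "Q x \<longleftrightarrow> x \<in> P \<and> U (Suc k) \<subseteq> K x \<and> S \<subseteq> K x" for x
      have Q_step: "Q (?\<Delta> x)" if x: "Q x" for x
      proof -
        have "h \<in> K (?\<Delta> x)" if h: "h \<in> U (Suc k) \<union> S" for h
        proof -
          have hk: "h \<in> U k" using h Sk U_mono[of h "Suc k" k] by auto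
          have h1: "h \<in> U 1" using hk k by (rule U_mono)
          obtain c where c: "c \<in> U (Suc k)" "h * g = (g * h) * c" using U_commutator[OF gk hk k] by (elim bexE)
          have hK: "h \<in> K x" using h x by (auto simp: Q_def)
          have "c \<in> K x" using c(1) x by (auto simp: Q_def)
          hence "act (h * c) x - x \<in> P'" using K_mult[OF hK] by (simp add: K_def)
          hence "act g (act (h * c) x - x) - (act h x - x) \<in> P'"
            using hK by (intro P'_diff[OF P'_act[OF g]]) (simp_all add: K_def)
          moreover have "act g (act (h * c) x - x) - (act h x - x) = act h (?\<Delta> x) - ?\<Delta> x"
          proof -
            have c1: "c \<in> U 1" by (rule U_mono[OF c(1)]) simp
            have "act g (act (h * c) x) = act (h * g) x"
              using mul[OF g U_mult[OF h1 c1], of x] c(2) by (simp only: mult.assoc)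
            also have "\<dots> = act h (act g x)" by (rule mul[OF h1 g])
            finally show ?thesis by (simp add: adiff[OF g] adiff[OF h1])
          qed
          ultimately show ?thesis using h1 by (simp add: K_def)
        qed
        thus ?thesis using x P[OF g, of x] unfolding Q_def by blast
      qed
      have Q_iter: "Q ((?\<Delta> ^^ j) v)" for j
        by (induction j) (use v Q_step in \<open>auto simp: Q_def\<close>)
      have pow: "(act g ^^ n) x = act (g ^ n) x" for n x
        by (induction n) (simp_all add: one mul[OF g U_power[OF g]])
      \<comment> \<open>Nilpotency: \<open>g ^ p\<close> lies in a deeper layer, under which
        \<open>v\<close> is invariant modulo \<open>P'\<close>. The last iterate of
        \<open>?\<Delta>\<close> outside \<open>P'\<close> is the vector sought.\<close>
      have "(?\<Delta> ^^ p) v = act (g ^ p) v - v"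
        using vector_space.linear_power_p_minus_one[OF vs prime_p odd_p of_nat_p_f lin[OF g], of v] pow by simp
      moreover have "g ^ p \<in> U (Suc k)" using U_power_p[OF gk k] by (rule U_mono) simp
      ultimately have ex: "(?\<Delta> ^^ p) v \<in> P'" using v(3) by (auto simp: K_def)
      define j where "j = (LEAST j. (?\<Delta> ^^ j) v \<in> P')"
      have j: "(?\<Delta> ^^ j) v \<in> P'" unfolding j_def by (rule LeastI[of "\<lambda>j. (?\<Delta> ^^ j) v \<in> P'", OF ex])
      have "j \<noteq> 0" using j v(2) by (metis funpow_0)
      then obtain i where i: "j = Suc i" by (cases j) auto
      define v' where "v' = (?\<Delta> ^^ i) v"
      have "v' \<notin> P'" unfolding v'_def
        using not_less_Least[of i "\<lambda>j. (?\<Delta> ^^ j) v \<in> P'"] i by (simp add: j_def)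
      moreover have "g \<in> K v'" using j g by (simp add: i v'_def K_def)
      ultimately show ?case using Q_iter[of i] by (intro bexI[of _ v']) (auto simp: Q_def v'_def)
    qed
    moreover have "(\<lambda>t. 1 + \<pi> ^ k * t) ` teich_set \<subseteq> U k"
      using teich_set_O by (auto simp: U_iff PP_def)
    ultimately have "\<exists>v\<in>P. v \<notin> P' \<and> U (Suc k) \<subseteq> K v \<and> (\<lambda>t. 1 + \<pi> ^ k * t) ` teich_set \<subseteq> K v"
      by simp
    then obtain v where
      v: "v \<in> P" "v \<notin> P'" "U (Suc k) \<subseteq> K v" "(\<lambda>t. 1 + \<pi> ^ k * t) ` teich_set \<subseteq> K v"
      by (elim bexE conjE)
    have "U k \<subseteq> K v"
    proof
      fix u assume u: "u \<in> U k"
      obtain t u' where t: "t \<in> teich_set" "u' \<in> U (Suc k)" "u = (1 + \<pi> ^ k * t) * u'"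
        using U_step[OF u k] by (elim bexE)
      show "u \<in> K v" unfolding t(3)
        by (rule K_mult[OF subsetD[OF v(4) imageI[OF t(1)]] subsetD[OF v(3) t(2)]])
    qed
    thus ?thesis using v by blast
  qed
  have "\<exists>v\<in>P. v \<notin> P' \<and> U 1 \<subseteq> K v"
    using N(1)
  proof (induction rule: inc_induct)
    case base
    have "U N \<subseteq> K w" using N w(1) U_mono[of _ N 1] by (auto simp: K_def)
    thus ?case using w by blast
  next
    case (step n) show ?case by (rule layer[OF step.hyps(1) step.IH])
  qed
  thus ?thesis unfolding K_def by blast
qed

subsection \<open>Integration against elements of the group algebras\<close>

abbreviation GA :: "nat \<Rightarrow> ('d set \<Rightarrow> 'f) ring" where "GA n \<equiv> group_algebra (lev n)"

text \<open>Integral of a function on the group against an element of a finite group algebra. The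
  function is evaluated at representatives, so the value is meaningful for functions with
  \<open>linv n\<close>. Identities in the Iwasawa algebra are proved by testing against such
  functions.\<close>

definition lint :: "nat \<Rightarrow> ('d set \<Rightarrow> 'f) \<Rightarrow> ('d \<Rightarrow> 'f) \<Rightarrow> 'f" where
  "lint n a F = (\<Sum>C\<in>carrier (lev n). a C * F (rep C))"

definition linv :: "nat \<Rightarrow> ('d \<Rightarrow> 'f) \<Rightarrow> bool" where
  "linv n F \<longleftrightarrow> (\<forall>g\<in>U 1. \<forall>w\<in>Nlev D n. F (g * w) = F g)"

lemma linvD: "linv n F \<Longrightarrow> g \<in> U 1 \<Longrightarrow> x \<in> cs n g \<Longrightarrow> F x = F g"
proof -
  assume F: "linv n F" and g: "g \<in> U 1" and "x \<in> cs n g"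
  then obtain w where "w \<in> Nlev D n" "x = g * w" using cs_mem[OF g] by blast
  thus ?thesis using F g by (simp add: linv_def)
qed

lemma linv_Suc: "linv n F \<Longrightarrow> linv (Suc n) F"
  unfolding linv_def using Nlev_Suc by blast

lemma linv_le: "m \<le> n \<Longrightarrow> linv m F \<Longrightarrow> linv n F"
  by (induction rule: dec_induct) (auto intro: linv_Suc)

lemma linv_const [simp]: "linv n (\<lambda>_. c)" by (simp add: linv_def)

lemma lint_cong: "(\<And>g. g \<in> U 1 \<Longrightarrow> F g = F' g) \<Longrightarrow> lint n a F = lint n a F'"
  unfolding lint_def by (rule sum.cong[OF refl]) (use lev_rep in metis)

lemma lint_add_l: "lint n (\<lambda>C. a C + b C) F = lint n a F + lint n b F"
  by (simp add: lint_def distrib_right sum.distrib)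
lemma lint_uminus_l: "lint n (\<lambda>C. - a C) F = - lint n a F"
  by (simp add: lint_def sum_negf)
lemma lint_scale_l: "lint n (\<lambda>C. c * a C) F = c * lint n a F"
  by (simp add: lint_def sum_distrib_left mult.assoc)
lemma lint_add_r: "lint n a (\<lambda>x. F x + F' x) = lint n a F + lint n a F'"
  by (simp add: lint_def distrib_left sum.distrib)
lemma lint_diff_r: "lint n a (\<lambda>x. F x - F' x) = lint n a F - lint n a F'"
  by (simp add: lint_def right_diff_distrib sum_subtractf)
lemma lint_scale_r: "lint n a (\<lambda>x. c * F x) = c * lint n a F"
  by (simp add: lint_def sum_distrib_left mult.left_commute)
lemma lint_0_r [simp]: "lint n a (\<lambda>x. 0) = 0" by (simp add: lint_def)
lemma lint_0_l [simp]: "lint n (\<lambda>x. 0) F = 0" by (simp add: lint_def)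

lemma GA_carrier: "a \<in> carrier (GA n) \<longleftrightarrow> (\<forall>C. C \<notin> carrier (lev n) \<longrightarrow> a C = 0)"
  by (simp add: group_algebra_def)
lemma GA_mult: "C \<in> carrier (lev n) \<Longrightarrow> (a \<otimes>\<^bsub>GA n\<^esub> b) C = (\<Sum>A\<in>carrier (lev n). a A * b (inv\<^bsub>lev n\<^esub> A \<otimes>\<^bsub>lev n\<^esub> C))"
  by (simp add: group_algebra_def)
lemma GA_add: "a \<oplus>\<^bsub>GA n\<^esub> b = (\<lambda>C. a C + b C)" by (simp add: group_algebra_def)
lemma GA_zero: "\<zero>\<^bsub>GA n\<^esub> = (\<lambda>C. 0)" by (simp add: group_algebra_def)
lemma GA_one: "\<one>\<^bsub>GA n\<^esub> = (\<lambda>C. if C = cs n 1 then 1 else 0)" 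
proof -
  have "Nlev D n = cs n 1" using lev_one[of n] by (simp add: FactGroup_def)
  thus ?thesis by (simp add: group_algebra_def)
qed
lemma GA_ring: "ring (GA n)" by (rule group_algebra_ring[OF lev_group lev_finite])

text \<open>Convolution becomes an iterated integral after a substitution in the finite group;
  invariance of \<open>F\<close> allows the representative of a product to be replaced by the
  product of the representatives.\<close>

lemma lint_mult:
  assumes F: "linv n F"
  shows "lint n (a \<otimes>\<^bsub>GA n\<^esub> b) F = lint n a (\<lambda>x. lint n b (\<lambda>y. F (x * y)))"
proof -
  interpret L: group "lev n" by (rule lev_group)
  let ?c = "carrier (lev n)"
  have "lint n (a \<otimes>\<^bsub>GA n\<^esub> b) F = (\<Sum>C\<in>?c. \<Sum>A\<in>?c. a A * b (inv\<^bsub>lev n\<^esub> A \<otimes>\<^bsub>lev n\<^esub> C) * F (rep C))"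
    unfolding lint_def by (rule sum.cong[OF refl]) (simp only: GA_mult sum_distrib_right)
  also have "\<dots> = (\<Sum>A\<in>?c. \<Sum>C\<in>?c. a A * b (inv\<^bsub>lev n\<^esub> A \<otimes>\<^bsub>lev n\<^esub> C) * F (rep C))" by (rule sum.swap)
  also have "\<dots> = (\<Sum>A\<in>?c. a A * (\<Sum>B\<in>?c. b B * F (rep A * rep B)))"
  proof (rule sum.cong[OF refl])
    fix A assume A: "A \<in> ?c"
    have "(\<Sum>C\<in>?c. a A * b (inv\<^bsub>lev n\<^esub> A \<otimes>\<^bsub>lev n\<^esub> C) * F (rep C)) = (\<Sum>B\<in>?c. a A * (b B * F (rep A * rep B)))"
    proof (rule sum.reindex_bij_witness[of _ "\<lambda>B. A \<otimes>\<^bsub>lev n\<^esub> B" "\<lambda>C. inv\<^bsub>lev n\<^esub> A \<otimes>\<^bsub>lev n\<^esub> C"])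
      fix C assume C: "C \<in> ?c"
      show "A \<otimes>\<^bsub>lev n\<^esub> (inv\<^bsub>lev n\<^esub> A \<otimes>\<^bsub>lev n\<^esub> C) = C" by (rule L.inv_mult_cancel[OF A C])
      show B: "inv\<^bsub>lev n\<^esub> A \<otimes>\<^bsub>lev n\<^esub> C \<in> ?c" by (intro L.m_closed L.inv_closed A C)
      let ?B = "inv\<^bsub>lev n\<^esub> A \<otimes>\<^bsub>lev n\<^esub> C"
      have r: "rep A \<in> U 1" "cs n (rep A) = A" "rep ?B \<in> U 1" "cs n (rep ?B) = ?B"
        using lev_rep[OF A] lev_rep[OF B] by auto
      have rr: "rep A * rep ?B \<in> U 1" using r by (intro U_mult)
      have "cs n (rep A * rep ?B) = A \<otimes>\<^bsub>lev n\<^esub> ?B" using lev_mult[OF r(1,3), of n] by (simp only: r(2,4))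
      also have "\<dots> = C" by (rule L.inv_mult_cancel[OF A C])
      finally have "rep C \<in> cs n (rep A * rep ?B)" using lev_rep[OF C] by simp
      hence "F (rep C) = F (rep A * rep ?B)" by (rule linvD[OF F rr])
      thus "a A * (b ?B * F (rep A * rep ?B)) = a A * b ?B * F (rep C)" by simp
    next
      fix B assume B: "B \<in> ?c"
      show "inv\<^bsub>lev n\<^esub> A \<otimes>\<^bsub>lev n\<^esub> (A \<otimes>\<^bsub>lev n\<^esub> B) = B" by (rule L.inv_mult_cancel[OF A B])
      show "A \<otimes>\<^bsub>lev n\<^esub> B \<in> ?c" by (intro L.m_closed A B)
    qed
    thus "(\<Sum>C\<in>?c. a A * b (inv\<^bsub>lev n\<^esub> A \<otimes>\<^bsub>lev n\<^esub> C) * F (rep C)) = a A * (\<Sum>B\<in>?c. b B * F (rep A * rep B))"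
      by (simp only: sum_distrib_left)
  qed
  finally show ?thesis by (simp only: lint_def)
qed

definition proj :: "nat \<Rightarrow> ('d set \<Rightarrow> 'f) \<Rightarrow> 'd set \<Rightarrow> 'f" where
  "proj n a C = (\<Sum>C' | C' \<in> carrier (lev (Suc n)) \<and> C' \<subseteq> C. a C')"

lemma cs_Suc_subset: "g \<in> U 1 \<Longrightarrow> cs (Suc n) g \<subseteq> cs n g"
  using cs_mem Nlev_Suc by blast

text \<open>The transition map adds coefficients over smaller cosets inside a coset on which
  \<open>F\<close> is constant.\<close>

lemma lint_proj:
  assumes F: "linv n F"
  shows "lint n (proj n a) F = lint (Suc n) a F"
proof -
  let ?c = "carrier (lev n)" and ?c' = "carrier (lev (Suc n))"
  let ?g = "\<lambda>C'. cs n (rep C')"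
  have sub: "C' \<subseteq> C \<longleftrightarrow> ?g C' = C" if C': "C' \<in> ?c'" and C: "C \<in> ?c" for C C'
  proof
    assume "C' \<subseteq> C"
    hence "rep C' \<in> C" using lev_rep[OF C'] by blast
    thus "?g C' = C" using lev_mem[OF C] by blast
  next
    assume e: "?g C' = C"
    have "C' = cs (Suc n) (rep C')" using lev_rep[OF C'] by simp
    also have "\<dots> \<subseteq> cs n (rep C')" by (rule cs_Suc_subset) (use lev_rep[OF C'] in simp)
    finally show "C' \<subseteq> C" by (simp only: e)
  qed
  have "lint n (proj n a) F = (\<Sum>C\<in>?c. \<Sum>C'\<in>{C'\<in>?c'. ?g C' = C}. a C' * F (rep C'))"
    unfolding lint_def
  proof (rule sum.cong[OF refl])
    fix C assume C: "C \<in> ?c"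
    have "{C'. C' \<in> ?c' \<and> C' \<subseteq> C} = {C'\<in>?c'. ?g C' = C}" using sub[OF _ C] by auto
    hence "proj n a C * F (rep C) = (\<Sum>C'\<in>{C'\<in>?c'. ?g C' = C}. a C' * F (rep C))"
      by (simp only: proj_def sum_distrib_right)
    also have "\<dots> = (\<Sum>C'\<in>{C'\<in>?c'. ?g C' = C}. a C' * F (rep C'))"
    proof (rule sum.cong[OF refl])
      fix C' assume C': "C' \<in> {C'\<in>?c'. ?g C' = C}"
      have "rep C' \<in> C" using C' lev_rep[of C' "Suc n"] cs_self[of "rep C'" n] by auto
      hence "rep C' \<in> cs n (rep C)" using lev_rep[OF C] by simp
      hence "F (rep C') = F (rep C)" by (rule linvD[OF F conjunct1[OF lev_rep[OF C]]])
      thus "a C' * F (rep C) = a C' * F (rep C')" by simp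
    qed
    finally show "proj n a C * F (rep C) = (\<Sum>C'\<in>{C'\<in>?c'. ?g C' = C}. a C' * F (rep C'))" .
  qed
  also have "\<dots> = (\<Sum>C'\<in>?c'. a C' * F (rep C'))"
    by (rule sum.group) (use lev_rep cs_lev in auto)
  finally show ?thesis by (simp only: lint_def)
qed

definition ind :: "'d set \<Rightarrow> 'd \<Rightarrow> 'f" where "ind C x = (if x \<in> C then 1 else 0)"

lemma linv_ind:
  assumes "C \<in> carrier (lev n)"
  shows "linv n (ind C)"
  unfolding linv_def
proof (intro ballI)
  fix g w assume gw: "g \<in> U 1" "w \<in> Nlev D n"
  have e: "cs n (g * w) = cs n g" using gw by (rule cs_mult_N)
  have u: "g * w \<in> U 1" using U_mult[OF gw(1) Nlev_U1[OF gw(2)]] .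
  have "g * w \<in> C \<longleftrightarrow> g \<in> C"
    using lev_mem[OF assms] cs_self[OF u, of n] cs_self[OF gw(1), of n] e by metis
  thus "ind C (g * w) = ind C g" by (simp add: ind_def)
qed

lemma lint_ind: "C \<in> carrier (lev n) \<Longrightarrow> lint n a (ind C) = a C"
proof -
  assume C: "C \<in> carrier (lev n)"
  have "lint n a (ind C) = (\<Sum>C'\<in>carrier (lev n). if C' = C then a C' else 0)"
    unfolding lint_def
  proof (rule sum.cong[OF refl])
    fix C' assume C': "C' \<in> carrier (lev n)"
    have "rep C' \<in> C \<longleftrightarrow> C' = C" using lev_rep[OF C'] lev_mem[OF C, of "rep C'"] by auto
    thus "a C' * ind C (rep C') = (if C' = C then a C' else 0)" by (simp add: ind_def)
  qed
  also have "\<dots> = a C" using C by (simp add: sum.delta)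
  finally show ?thesis .
qed

text \<open>Integrals of the indicator functions of cosets recover the coefficients.\<close>

lemma GA_eqI:
  assumes "a \<in> carrier (GA n)" "b \<in> carrier (GA n)" "\<And>F. linv n F \<Longrightarrow> lint n a F = lint n b F"
  shows "a = b"
proof
  fix C show "a C = b C"
  proof (cases "C \<in> carrier (lev n)")
    case True thus ?thesis using assms(3)[OF linv_ind[OF True]] by (simp add: lint_ind)
  next
    case False thus ?thesis using assms(1,2) by (simp add: GA_carrier)
  qed
qed

end

lemma linear_functionsI:
  assumes "\<And>f g x. L (\<lambda>y. f y + g y) x = L f x + L g x" "\<And>c f x. L (\<lambda>y. c * f y) x = c * L f x"
  shows "Vector_Spaces.linear (\<lambda>(c::'f::field) (f::'a \<Rightarrow> 'f) x. c * f x) (\<lambda>c (f::'b \<Rightarrow> 'f) x. c * f x) L"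
proof -
  show ?thesis unfolding Vector_Spaces.linear_iff
    by (intro conjI function_space_vs) (auto simp: fun_eq_iff plus_fun_def assms)
qed

context quat
begin

subsection \<open>The Iwasawa algebra\<close>

abbreviation "\<Lambda> \<equiv> Lam D :: ('d, 'f) lam ring"

lemma Lam_iff: "\<mu> \<in> carrier \<Lambda> \<longleftrightarrow> (\<forall>n. \<mu> n \<in> carrier (GA n)) \<and> (\<forall>n. \<forall>C\<in>carrier (lev n). \<mu> n C = proj n (\<mu> (Suc n)) C)"
  by (simp add: Lam_def completed_group_algebra_def proj_def)
lemma Lam_mult: "\<mu> \<otimes>\<^bsub>\<Lambda>\<^esub> \<nu> = (\<lambda>n. \<mu> n \<otimes>\<^bsub>GA n\<^esub> \<nu> n)" by (simp add: Lam_def completed_group_algebra_def)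
lemma Lam_add: "\<mu> \<oplus>\<^bsub>\<Lambda>\<^esub> \<nu> = (\<lambda>n C. \<mu> n C + \<nu> n C)" by (simp add: Lam_def completed_group_algebra_def GA_add)
lemma Lam_zero: "\<zero>\<^bsub>\<Lambda>\<^esub> = (\<lambda>n C. 0)" by (simp add: Lam_def completed_group_algebra_def GA_zero)
lemma Lam_one: "\<one>\<^bsub>\<Lambda>\<^esub> = (\<lambda>n. \<one>\<^bsub>GA n\<^esub>)" by (simp add: Lam_def completed_group_algebra_def)

lemma Lam_GA: "\<mu> \<in> carrier \<Lambda> \<Longrightarrow> \<mu> n \<in> carrier (GA n)" by (simp add: Lam_iff)

lemma Lam_off: "\<mu> \<in> carrier \<Lambda> \<Longrightarrow> C \<notin> carrier (lev n) \<Longrightarrow> \<mu> n C = 0"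
  using Lam_GA[of \<mu> n] unfolding GA_carrier by blast

lemma Lam_lint:
  assumes "\<mu> \<in> carrier \<Lambda>" "linv n F"
  shows "lint (Suc n) (\<mu> (Suc n)) F = lint n (\<mu> n) F"
proof -
  have "lint n (\<mu> n) F = lint n (proj n (\<mu> (Suc n))) F"
    unfolding lint_def by (rule sum.cong[OF refl]) (use assms(1) in \<open>simp add: Lam_iff\<close>)
  thus ?thesis using lint_proj[OF assms(2)] by simp
qed

lemma Lam_lint_le:
  assumes "\<mu> \<in> carrier \<Lambda>" "linv m F" "m \<le> n"
  shows "lint n (\<mu> n) F = lint m (\<mu> m) F"
  using assms(3)
proof (induction rule: dec_induct)
  case (step n)
  have "linv n F" using step(1) assms(2) by (rule linv_le)
  thus ?case using Lam_lint[OF assms(1)] step by simp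
qed simp

text \<open>Indicator functions of cosets translate the compatibility of coefficients into
  compatibility of integrals, which is easier to verify for products and inverses.\<close>

lemma LamI:
  assumes "\<And>n. \<mu> n \<in> carrier (GA n)" "\<And>n F. linv n F \<Longrightarrow> lint (Suc n) (\<mu> (Suc n)) F = lint n (\<mu> n) F"
  shows "\<mu> \<in> carrier \<Lambda>"
proof -
  have "\<mu> n C = proj n (\<mu> (Suc n)) C" if C: "C \<in> carrier (lev n)" for n C
  proof -
    have "\<mu> n C = lint n (\<mu> n) (ind C)" using C by (simp add: lint_ind)
    also have "\<dots> = lint (Suc n) (\<mu> (Suc n)) (ind C)" using assms(2)[OF linv_ind[OF C]] by simp
    also have "\<dots> = lint n (proj n (\<mu> (Suc n))) (ind C)" using lint_proj[OF linv_ind[OF C]] by simp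
    also have "\<dots> = proj n (\<mu> (Suc n)) C" using C by (simp add: lint_ind)
    finally show ?thesis .
  qed
  thus ?thesis using assms(1) by (simp add: Lam_iff)
qed

lemma linv_mult_left: "linv n F \<Longrightarrow> x \<in> U 1 \<Longrightarrow> linv n (\<lambda>y. F (x * y))"
  unfolding linv_def by (simp add: mult.assoc[symmetric] U_mult)

lemma linv_mult_right:
  assumes F: "linv n F" and y: "y \<in> U 1"
  shows "linv n (\<lambda>x. F (x * y))"
  unfolding linv_def
proof (intro ballI)
  fix g w assume g: "g \<in> U 1" and w: "w \<in> Nlev D n"
  have "g * w * y = (g * y) * (inverse y * w * y)"
    using U_nz[OF y] by (simp add: mult.assoc[symmetric]) (simp add: mult.assoc)
  thus "F (g * w * y) = F (g * y)"
    using F U_mult[OF g y] Nlev_conj'[OF w y] by (simp add: linv_def)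
qed

lemma linv_lint:
  assumes F: "linv n F"
  shows "linv n (\<lambda>x. lint m a (\<lambda>y. F (x * y)))"
  unfolding linv_def
proof (intro ballI)
  fix g w assume g: "g \<in> U 1" and w: "w \<in> Nlev D n"
  show "lint m a (\<lambda>y. F (g * w * y)) = lint m a (\<lambda>y. F (g * y))"
    by (rule lint_cong) (use linv_mult_right[OF F] g w in \<open>simp add: linv_def\<close>)
qed

lemma Lam_lint_mult:
  assumes "linv n F"
  shows "lint n ((\<mu> \<otimes>\<^bsub>\<Lambda>\<^esub> \<nu>) n) F = lint n (\<mu> n) (\<lambda>x. lint n (\<nu> n) (\<lambda>y. F (x * y)))"
  using lint_mult[OF assms] by (simp add: Lam_mult)

lemma lint_delta:
  assumes g: "g \<in> U 1" and F: "linv n F"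
  shows "lint n (delta D g n) F = F g"
proof -
  have "lint n (delta D g n) F = (\<Sum>C\<in>carrier (lev n). if C = cs n g then F (rep C) else 0)"
    unfolding lint_def
  proof (rule sum.cong[OF refl])
    fix C assume C: "C \<in> carrier (lev n)"
    have "g \<in> C \<longleftrightarrow> C = cs n g" using lev_mem[OF C, of g] cs_self[OF g, of n] by blast
    thus "delta D g n C * F (rep C) = (if C = cs n g then F (rep C) else 0)"
      using C by (simp add: delta_def)
  qed
  also have "\<dots> = F (rep (cs n g))" using cs_lev[OF g] by (simp add: sum.delta)
  also have "\<dots> = F g"
    by (rule linvD[OF F g]) (use lev_rep[OF cs_lev[OF g]] in blast)
  finally show ?thesis .
qed

lemma delta_one: "delta D 1 n = \<one>\<^bsub>GA n\<^esub>"
proof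
  fix C
  have "1 \<in> C \<longleftrightarrow> C = cs n 1" if "C \<in> carrier (lev n)"
    using lev_mem[OF that, of 1] cs_self[of 1 n] by auto
  thus "delta D 1 n C = \<one>\<^bsub>GA n\<^esub> C" using cs_lev[of 1 n] by (auto simp: delta_def GA_one)
qed

lemma lint_one: "linv n F \<Longrightarrow> lint n \<one>\<^bsub>GA n\<^esub> F = F 1"
  using lint_delta[of 1] by (simp add: delta_one)

lemma delta_Lam [simp]: "g \<in> U 1 \<Longrightarrow> delta D g \<in> carrier \<Lambda>"
proof (rule LamI)
  show "delta D g n \<in> carrier (GA n)" for n by (simp add: GA_carrier delta_def)
  fix n F assume "g \<in> U 1" "linv n F"
  thus "lint (Suc n) (delta D g (Suc n)) F = lint n (delta D g n) F"
    using lint_delta linv_Suc by simp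
qed

lemma Lam_one_closed: "\<one>\<^bsub>\<Lambda>\<^esub> \<in> carrier \<Lambda>"
proof -
  have "\<one>\<^bsub>\<Lambda>\<^esub> = delta D 1" by (rule ext) (simp only: Lam_one delta_one)
  thus ?thesis by (simp only: delta_Lam[OF U_1])
qed

lemma Lam_add_closed: "\<mu> \<in> carrier \<Lambda> \<Longrightarrow> \<nu> \<in> carrier \<Lambda> \<Longrightarrow> (\<lambda>n C. \<mu> n C + \<nu> n C) \<in> carrier \<Lambda>"
proof (rule LamI)
  assume m: "\<mu> \<in> carrier \<Lambda>" "\<nu> \<in> carrier \<Lambda>"
  show "(\<lambda>C. \<mu> n C + \<nu> n C) \<in> carrier (GA n)" for n by (simp add: GA_carrier Lam_off[OF m(1)] Lam_off[OF m(2)])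
  show "lint (Suc n) (\<lambda>C. \<mu> (Suc n) C + \<nu> (Suc n) C) F = lint n (\<lambda>C. \<mu> n C + \<nu> n C) F" if "linv n F" for n F
    by (simp only: lint_add_l Lam_lint[OF m(1) that] Lam_lint[OF m(2) that])
qed

lemma Lam_uminus_closed: "\<mu> \<in> carrier \<Lambda> \<Longrightarrow> (\<lambda>n C. - \<mu> n C) \<in> carrier \<Lambda>"
proof (rule LamI)
  assume m: "\<mu> \<in> carrier \<Lambda>"
  show "(\<lambda>C. - \<mu> n C) \<in> carrier (GA n)" for n by (simp add: GA_carrier Lam_off[OF m])
  show "lint (Suc n) (\<lambda>C. - \<mu> (Suc n) C) F = lint n (\<lambda>C. - \<mu> n C) F" if "linv n F" for n F
    by (simp only: lint_uminus_l Lam_lint[OF m that])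
qed

lemma Lam_scale_closed: "\<mu> \<in> carrier \<Lambda> \<Longrightarrow> lam_scale c \<mu> \<in> carrier \<Lambda>"
  unfolding lam_scale_def[abs_def]
proof (rule LamI)
  assume m: "\<mu> \<in> carrier \<Lambda>"
  show "(\<lambda>C. c * \<mu> n C) \<in> carrier (GA n)" for n by (simp add: GA_carrier Lam_off[OF m])
  show "lint (Suc n) (\<lambda>C. c * \<mu> (Suc n) C) F = lint n (\<lambda>C. c * \<mu> n C) F" if "linv n F" for n F
    by (simp only: lint_scale_l Lam_lint[OF m that])
qed

lemma Lam_mult_closed:
  assumes "\<mu> \<in> carrier \<Lambda>" "\<nu> \<in> carrier \<Lambda>"
  shows "\<mu> \<otimes>\<^bsub>\<Lambda>\<^esub> \<nu> \<in> carrier \<Lambda>"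
proof (rule LamI)
  fix n
  show "(\<mu> \<otimes>\<^bsub>\<Lambda>\<^esub> \<nu>) n \<in> carrier (GA n)"
    using ring.ring_simprules(5)[OF GA_ring] Lam_GA assms by (simp add: Lam_mult)
  fix F :: "'d \<Rightarrow> 'f" assume F: "linv n F"
  have "lint (Suc n) ((\<mu> \<otimes>\<^bsub>\<Lambda>\<^esub> \<nu>) (Suc n)) F
      = lint (Suc n) (\<mu> (Suc n)) (\<lambda>x. lint (Suc n) (\<nu> (Suc n)) (\<lambda>y. F (x * y)))"
    by (rule Lam_lint_mult[OF linv_Suc[OF F]])
  also have "\<dots> = lint (Suc n) (\<mu> (Suc n)) (\<lambda>x. lint n (\<nu> n) (\<lambda>y. F (x * y)))"
    by (rule lint_cong) (rule Lam_lint[OF assms(2) linv_mult_left[OF F]])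
  also have "\<dots> = lint n (\<mu> n) (\<lambda>x. lint n (\<nu> n) (\<lambda>y. F (x * y)))"
    by (rule Lam_lint[OF assms(1) linv_lint[OF F]])
  finally show "lint (Suc n) ((\<mu> \<otimes>\<^bsub>\<Lambda>\<^esub> \<nu>) (Suc n)) F = lint n ((\<mu> \<otimes>\<^bsub>\<Lambda>\<^esub> \<nu>) n) F"
    using Lam_lint_mult[OF F] by simp
qed

lemma Lam_ring: "ring \<Lambda>"
proof (rule ringI)
  note r = ring.ring_simprules[OF GA_ring]
  show "abelian_group \<Lambda>"
  proof (rule abelian_groupI)
    fix x assume x: "x \<in> carrier \<Lambda>"
    show "\<exists>y\<in>carrier \<Lambda>. y \<oplus>\<^bsub>\<Lambda>\<^esub> x = \<zero>\<^bsub>\<Lambda>\<^esub>"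
      by (rule bexI[OF _ Lam_uminus_closed[OF x]]) (simp add: Lam_add Lam_zero)
    show "\<zero>\<^bsub>\<Lambda>\<^esub> \<oplus>\<^bsub>\<Lambda>\<^esub> x = x" by (simp add: Lam_add Lam_zero)
  next
    show "\<zero>\<^bsub>\<Lambda>\<^esub> \<in> carrier \<Lambda>" unfolding Lam_zero by (rule LamI) (simp_all add: GA_carrier)
  qed (simp_all add: Lam_add Lam_add_closed add_ac)
  show "monoid \<Lambda>"
  proof (rule monoidI)
    fix x y z assume "x \<in> carrier \<Lambda>" "y \<in> carrier \<Lambda>" "z \<in> carrier \<Lambda>"
    hence "x n \<otimes>\<^bsub>GA n\<^esub> y n \<otimes>\<^bsub>GA n\<^esub> z n = x n \<otimes>\<^bsub>GA n\<^esub> (y n \<otimes>\<^bsub>GA n\<^esub> z n)" for n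
      by (intro monoid.m_assoc[OF ring.is_monoid[OF GA_ring]] Lam_GA)
    thus "x \<otimes>\<^bsub>\<Lambda>\<^esub> y \<otimes>\<^bsub>\<Lambda>\<^esub> z = x \<otimes>\<^bsub>\<Lambda>\<^esub> (y \<otimes>\<^bsub>\<Lambda>\<^esub> z)" by (simp add: Lam_mult)
  next
    fix x assume x: "x \<in> carrier \<Lambda>"
    have "\<one>\<^bsub>GA n\<^esub> \<otimes>\<^bsub>GA n\<^esub> x n = x n" "x n \<otimes>\<^bsub>GA n\<^esub> \<one>\<^bsub>GA n\<^esub> = x n" for n
      by (rule monoid.l_one[OF ring.is_monoid[OF GA_ring] Lam_GA[OF x]],
          rule monoid.r_one[OF ring.is_monoid[OF GA_ring] Lam_GA[OF x]])
    thus "\<one>\<^bsub>\<Lambda>\<^esub> \<otimes>\<^bsub>\<Lambda>\<^esub> x = x" "x \<otimes>\<^bsub>\<Lambda>\<^esub> \<one>\<^bsub>\<Lambda>\<^esub> = x" by (simp_all only: Lam_mult Lam_one)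
  qed (simp_all add: Lam_one_closed Lam_mult_closed)
next
  fix x y z assume xyz: "x \<in> carrier \<Lambda>" "y \<in> carrier \<Lambda>" "z \<in> carrier \<Lambda>"
  note G = xyz[THEN Lam_GA]
  have "(x n \<oplus>\<^bsub>GA n\<^esub> y n) \<otimes>\<^bsub>GA n\<^esub> z n = x n \<otimes>\<^bsub>GA n\<^esub> z n \<oplus>\<^bsub>GA n\<^esub> y n \<otimes>\<^bsub>GA n\<^esub> z n" for n
    by (rule ring.ring_simprules(13)[OF GA_ring]) (rule G)+
  thus "(x \<oplus>\<^bsub>\<Lambda>\<^esub> y) \<otimes>\<^bsub>\<Lambda>\<^esub> z = x \<otimes>\<^bsub>\<Lambda>\<^esub> z \<oplus>\<^bsub>\<Lambda>\<^esub> y \<otimes>\<^bsub>\<Lambda>\<^esub> z" by (simp add: Lam_add Lam_mult GA_add)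
  have "z n \<otimes>\<^bsub>GA n\<^esub> (x n \<oplus>\<^bsub>GA n\<^esub> y n) = z n \<otimes>\<^bsub>GA n\<^esub> x n \<oplus>\<^bsub>GA n\<^esub> z n \<otimes>\<^bsub>GA n\<^esub> y n" for n
    by (rule ring.ring_simprules(23)[OF GA_ring]) (rule G)+
  thus "z \<otimes>\<^bsub>\<Lambda>\<^esub> (x \<oplus>\<^bsub>\<Lambda>\<^esub> y) = z \<otimes>\<^bsub>\<Lambda>\<^esub> x \<oplus>\<^bsub>\<Lambda>\<^esub> z \<otimes>\<^bsub>\<Lambda>\<^esub> y" by (simp add: Lam_add Lam_mult GA_add)
qed

section \<open>The augmentation and the maximal ideal\<close>

definition aug :: "('d, 'f) lam \<Rightarrow> 'f" where "aug \<mu> = lint 0 (\<mu> 0) (\<lambda>_. 1)"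

text \<open>\<open>aug\<close> is read at level 0, where the quotient group is trivial; by
  compatibility every level has the same total mass.\<close>

lemma aug_lint: "\<mu> \<in> carrier \<Lambda> \<Longrightarrow> lint n (\<mu> n) (\<lambda>_. c) = c * aug \<mu>"
proof -
  assume "\<mu> \<in> carrier \<Lambda>"
  hence "lint n (\<mu> n) (\<lambda>_. 1) = aug \<mu>" unfolding aug_def by (intro Lam_lint_le) simp_all
  thus ?thesis using lint_scale_r[of n "\<mu> n" c "\<lambda>_. 1"] by simp
qed
lemma aug_add: "aug (\<mu> \<oplus>\<^bsub>\<Lambda>\<^esub> \<nu>) = aug \<mu> + aug \<nu>" by (simp add: aug_def Lam_add lint_add_l)
lemma aug_mult: "aug (\<mu> \<otimes>\<^bsub>\<Lambda>\<^esub> \<nu>) = aug \<mu> * aug \<nu>"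
proof -
  have "aug (\<mu> \<otimes>\<^bsub>\<Lambda>\<^esub> \<nu>) = lint 0 (\<mu> 0) (\<lambda>x. lint 0 (\<nu> 0) (\<lambda>y. 1))"
    unfolding aug_def by (rule Lam_lint_mult) simp
  also have "\<dots> = lint 0 (\<mu> 0) (\<lambda>x. aug \<nu> * 1)" by (simp only: aug_def mult_1_right)
  also have "\<dots> = aug \<nu> * aug \<mu>" by (simp only: lint_scale_r aug_def)
  finally show ?thesis by (simp only: mult.commute)
qed
lemma aug_one [simp]: "aug \<one>\<^bsub>\<Lambda>\<^esub> = 1" by (simp add: aug_def Lam_one lint_one)
lemma aug_delta [simp]: "g \<in> U 1 \<Longrightarrow> aug (delta D g) = 1" by (simp add: aug_def lint_delta)

text \<open>The elements whose product with \<open>a\<close> from the left is zero form a space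
  stable under right translation. If it is nonzero, \<open>invariant_vector\<close> yields a nonzero
  translation-invariant element in it, that is, a constant function; but \<open>a\<close> times a
  constant is that constant times the total mass of \<open>a\<close>.\<close>

lemma GA_left_mult_inj:
  assumes a: "lint n a (\<lambda>_. 1) \<noteq> 0" and b: "b \<in> carrier (GA n)" "a \<otimes>\<^bsub>GA n\<^esub> b = \<zero>\<^bsub>GA n\<^esub>"
  shows "b = \<zero>\<^bsub>GA n\<^esub>"
proof (rule ccontr)
  assume nz: "b \<noteq> \<zero>\<^bsub>GA n\<^esub>"
  interpret L: group "lev n" by (rule lev_group)
  let ?c = "carrier (lev n)"
  define P where "P = {b \<in> carrier (GA n). a \<otimes>\<^bsub>GA n\<^esub> b = \<zero>\<^bsub>GA n\<^esub>}"
  define act where "act g b = (\<lambda>C. if C \<in> ?c then b (C \<otimes>\<^bsub>lev n\<^esub> cs n g) else b C)" for g and b :: "'d set \<Rightarrow> 'f"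
  have Cg: "C \<otimes>\<^bsub>lev n\<^esub> cs n g \<in> ?c" if "C \<in> ?c" "g \<in> U 1" for C g
    by (intro L.m_closed that(1) cs_lev that(2))
  have "\<exists>v\<in>P. v \<notin> {0} \<and> (\<forall>g\<in>U 1. act g v - v \<in> {0})"
  proof (rule invariant_vector[OF function_space_vs])
    fix g assume "g \<in> U 1"
    show "Vector_Spaces.linear (\<lambda>(c::'f) f x. c * f x) (\<lambda>c f x. c * f x) (act g)"
      by (rule linear_functionsI) (auto simp: act_def)
  next
    fix v :: "'d set \<Rightarrow> 'f"
    have "C \<otimes>\<^bsub>lev n\<^esub> cs n 1 = C" if "C \<in> ?c" for C
      using L.r_one[OF that] by (simp only: lev_one)
    thus "act 1 v = v" by (auto simp: act_def fun_eq_iff simp del: FactGroup_def)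
  next
    fix g h and v :: "'d set \<Rightarrow> 'f" assume g: "g \<in> U 1" and h: "h \<in> U 1"
    have "C \<otimes>\<^bsub>lev n\<^esub> cs n (g * h) = C \<otimes>\<^bsub>lev n\<^esub> cs n g \<otimes>\<^bsub>lev n\<^esub> cs n h" if "C \<in> ?c" for C
      using L.m_assoc[OF that cs_lev[OF g] cs_lev[OF h]] lev_mult[OF g h, of n] by simp
    thus "act (g * h) v = act g (act h v)"
      using Cg[OF _ g] by (auto simp: act_def fun_eq_iff)
  next
    fix g and v assume g: "g \<in> U 1" and v: "v \<in> P"
    have vc: "v \<in> carrier (GA n)" and av: "a \<otimes>\<^bsub>GA n\<^esub> v = \<zero>\<^bsub>GA n\<^esub>" using v by (auto simp: P_def)
    have "act g v - v \<in> carrier (GA n)" using vc by (simp add: GA_carrier act_def fun_diff_def)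
    moreover have "a \<otimes>\<^bsub>GA n\<^esub> (act g v - v) = \<zero>\<^bsub>GA n\<^esub>"
    proof
      fix C
      show "(a \<otimes>\<^bsub>GA n\<^esub> (act g v - v)) C = \<zero>\<^bsub>GA n\<^esub> C"
      proof (cases "C \<in> ?c")
        case C: True
        have "(a \<otimes>\<^bsub>GA n\<^esub> (act g v - v)) C
            = (\<Sum>A\<in>?c. a A * v (inv\<^bsub>lev n\<^esub> A \<otimes>\<^bsub>lev n\<^esub> (C \<otimes>\<^bsub>lev n\<^esub> cs n g))) - (\<Sum>A\<in>?c. a A * v (inv\<^bsub>lev n\<^esub> A \<otimes>\<^bsub>lev n\<^esub> C))"
          unfolding GA_mult[OF C] sum_subtractf[symmetric]
        proof (rule sum.cong[OF refl])
          fix A assume A: "A \<in> ?c"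
          have "inv\<^bsub>lev n\<^esub> A \<otimes>\<^bsub>lev n\<^esub> C \<in> ?c" by (intro L.m_closed L.inv_closed A C)
          moreover have "inv\<^bsub>lev n\<^esub> A \<otimes>\<^bsub>lev n\<^esub> C \<otimes>\<^bsub>lev n\<^esub> cs n g = inv\<^bsub>lev n\<^esub> A \<otimes>\<^bsub>lev n\<^esub> (C \<otimes>\<^bsub>lev n\<^esub> cs n g)"
            by (rule L.m_assoc[OF L.inv_closed[OF A] C cs_lev[OF g]])
          ultimately show "a A * (act g v - v) (inv\<^bsub>lev n\<^esub> A \<otimes>\<^bsub>lev n\<^esub> C)
             = a A * v (inv\<^bsub>lev n\<^esub> A \<otimes>\<^bsub>lev n\<^esub> (C \<otimes>\<^bsub>lev n\<^esub> cs n g)) - a A * v (inv\<^bsub>lev n\<^esub> A \<otimes>\<^bsub>lev n\<^esub> C)"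
            unfolding fun_diff_def act_def by (simp only: if_True right_diff_distrib)
        qed
        also have "\<dots> = (a \<otimes>\<^bsub>GA n\<^esub> v) (C \<otimes>\<^bsub>lev n\<^esub> cs n g) - (a \<otimes>\<^bsub>GA n\<^esub> v) C"
          by (simp only: GA_mult[OF C] GA_mult[OF Cg[OF C g]])
        also have "\<dots> = 0" by (simp only: av GA_zero diff_self)
        finally show ?thesis by (simp only: GA_zero)
      next
        case False thus ?thesis by (simp add: group_algebra_def)
      qed
    qed
    ultimately show "act g v - v \<in> P" by (simp add: P_def)
  next
    fix g assume g: "g \<in> U 1"
    show "act g x \<in> {0}" if "x \<in> {0}" for x :: "'d set \<Rightarrow> 'f" using that by (auto simp: act_def fun_eq_iff)
  next
    show "b \<in> P" using b by (simp add: P_def)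
    show "b \<notin> {0}" using nz by (simp add: GA_zero zero_fun_def)
    show "(1::nat) \<le> Suc n" by (simp add: One_nat_def)
  next
    fix u v assume u: "u \<in> U (Suc n)" and v: "v \<in> P"
    have u1: "u \<in> U 1" using u by (rule U_mono) (simp add: One_nat_def)
    have "cs n u = cs n 1" using cs_mult_N[OF U_1 U_Nlev[OF u]] by simp
    hence "C \<otimes>\<^bsub>lev n\<^esub> cs n u = C" if "C \<in> ?c" for C using L.r_one[OF that] by (simp only: lev_one)
    hence "act u v C = v C" for C by (cases "C \<in> ?c") (simp_all only: act_def if_True if_False)
    hence "act u v = v" by (rule ext)
    thus "act u v - v \<in> {0}" by simp
  qed (simp add: fun_eq_iff)
  then obtain v where v: "v \<in> P" "v \<noteq> 0" "\<And>g. g \<in> U 1 \<Longrightarrow> act g v = v" by auto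
  have vc: "v \<in> carrier (GA n)" and av: "a \<otimes>\<^bsub>GA n\<^esub> v = \<zero>\<^bsub>GA n\<^esub>" using v by (auto simp: P_def)
  define e where "e = v (cs n 1)"
  have const: "v C = e" if C: "C \<in> ?c" for C
  proof -
    have r: "rep C \<in> U 1" "cs n (rep C) = C" using lev_rep[OF C] by auto
    have "cs n 1 \<otimes>\<^bsub>lev n\<^esub> cs n (rep C) = C" unfolding lev_mult[OF U_1 r(1)] using r(2) by simp
    hence "act (rep C) v (cs n 1) = v C" using cs_lev[OF U_1, of n] by (simp only: act_def if_True)
    thus ?thesis using v(3)[OF r(1)] by (simp add: e_def)
  qed
  have "0 = (a \<otimes>\<^bsub>GA n\<^esub> v) (cs n 1)" unfolding av GA_zero by simp
  also have "\<dots> = (\<Sum>A\<in>?c. a A * e)" unfolding GA_mult[OF cs_lev[OF U_1]]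
    by (rule sum.cong[OF refl], subst const, intro L.m_closed L.inv_closed cs_lev[OF U_1]) auto
  also have "\<dots> = lint n a (\<lambda>_. 1) * e" by (simp add: lint_def sum_distrib_right)
  finally have "e = 0" using a by simp
  hence "v = 0" using const vc by (auto simp: fun_eq_iff GA_carrier)
  thus False using v(2) by simp
qed

lemma GA_finite: "finite (carrier (GA n))"
proof -
  have "finite {f :: 'd set \<Rightarrow> 'f. \<forall>x. (x \<in> carrier (lev n) \<longrightarrow> f x \<in> UNIV) \<and> (x \<notin> carrier (lev n) \<longrightarrow> f x = 0)}"
    by (rule finite_set_of_finite_funs) simp_all
  thus ?thesis by (simp add: group_algebra_def)
qed

text \<open>The group algebra is a finite set, so injectivity of left multiplication gives
  surjectivity. Uniqueness is included because it makes the inverses at different levels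
  compatible.\<close>

lemma GA_right_inverse:
  assumes a: "a \<in> carrier (GA n)" "lint n a (\<lambda>_. 1) \<noteq> 0"
  shows "\<exists>!b. b \<in> carrier (GA n) \<and> a \<otimes>\<^bsub>GA n\<^esub> b = \<one>\<^bsub>GA n\<^esub>"
proof -
  interpret R: ring "GA n" by (rule GA_ring)
  have inj: "inj_on (\<lambda>b. a \<otimes>\<^bsub>GA n\<^esub> b) (carrier (GA n))"
  proof (rule inj_onI)
    fix b c assume bc: "b \<in> carrier (GA n)" "c \<in> carrier (GA n)" "a \<otimes>\<^bsub>GA n\<^esub> b = a \<otimes>\<^bsub>GA n\<^esub> c"
    have "a \<otimes>\<^bsub>GA n\<^esub> (b \<ominus>\<^bsub>GA n\<^esub> c) = a \<otimes>\<^bsub>GA n\<^esub> b \<ominus>\<^bsub>GA n\<^esub> a \<otimes>\<^bsub>GA n\<^esub> c"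
      unfolding R.minus_eq using a bc(1,2) by (simp only: R.r_distr R.a_inv_closed R.r_minus)
    also have "\<dots> = \<zero>\<^bsub>GA n\<^esub>" unfolding bc(3) R.minus_eq using a bc(2) by (intro R.r_neg R.m_closed)
    finally have "b \<ominus>\<^bsub>GA n\<^esub> c = \<zero>\<^bsub>GA n\<^esub>" using GA_left_mult_inj[OF a(2)] bc(1,2) R.minus_closed by blast
    thus "b = c" using bc(1,2) by (rule R.r_right_minus_eq[THEN iffD1, rotated 2])
  qed
  have "(\<lambda>b. a \<otimes>\<^bsub>GA n\<^esub> b) ` carrier (GA n) = carrier (GA n)"
    by (rule endo_inj_surj[OF GA_finite _ inj]) (use a in \<open>auto intro: R.m_closed\<close>)
  hence "\<one>\<^bsub>GA n\<^esub> \<in> (\<lambda>b. a \<otimes>\<^bsub>GA n\<^esub> b) ` carrier (GA n)" using R.one_closed by (simp only:)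
  then obtain b where b: "b \<in> carrier (GA n)" "\<one>\<^bsub>GA n\<^esub> = a \<otimes>\<^bsub>GA n\<^esub> b" by (elim imageE)
  show ?thesis
  proof (rule ex1I[of _ b])
    show "b \<in> carrier (GA n) \<and> a \<otimes>\<^bsub>GA n\<^esub> b = \<one>\<^bsub>GA n\<^esub>" by (rule conjI[OF b(1) b(2)[symmetric]])
    fix c assume c: "c \<in> carrier (GA n) \<and> a \<otimes>\<^bsub>GA n\<^esub> c = \<one>\<^bsub>GA n\<^esub>"
    show "c = b"
      by (rule inj_onD[OF inj _ conjunct1[OF c] b(1)]) (rule trans[OF conjunct2[OF c] b(2)])
  qed
qed

lemma Lam_right_inverse:
  assumes \<mu>: "\<mu> \<in> carrier \<Lambda>" "aug \<mu> \<noteq> 0"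
  shows "\<exists>\<nu>\<in>carrier \<Lambda>. \<mu> \<otimes>\<^bsub>\<Lambda>\<^esub> \<nu> = \<one>\<^bsub>\<Lambda>\<^esub>"
proof -
  have nz: "lint n (\<mu> n) (\<lambda>_. 1) \<noteq> 0" for n using aug_lint[OF \<mu>(1), of n 1] \<mu>(2) by simp
  note ex1 = GA_right_inverse[OF Lam_GA[OF \<mu>(1)] nz]
  define \<nu> where "\<nu> n = (THE b. b \<in> carrier (GA n) \<and> \<mu> n \<otimes>\<^bsub>GA n\<^esub> b = \<one>\<^bsub>GA n\<^esub>)" for n
  have \<nu>: "\<nu> n \<in> carrier (GA n)" "\<mu> n \<otimes>\<^bsub>GA n\<^esub> \<nu> n = \<one>\<^bsub>GA n\<^esub>" for n
    using theI'[OF ex1[of n]] by (auto simp: \<nu>_def)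
  have "\<nu> \<in> carrier \<Lambda>"
  proof (rule LamI[OF \<nu>(1)])
    fix n and F :: "'d \<Rightarrow> 'f" assume F: "linv n F"
    \<comment> \<open>The image at level \<open>n\<close> of the inverse at level
      \<open>n + 1\<close>, set to 0 off the carrier. It is again a right inverse, hence equal to
      \<open>\<nu> n\<close>.\<close>
    define b where "b C = (if C \<in> carrier (lev n) then proj n (\<nu> (Suc n)) C else 0)" for C
    have lb: "lint n b F = lint (Suc n) (\<nu> (Suc n)) F" if "linv n F" for F
    proof -
      have "lint n b F = lint n (proj n (\<nu> (Suc n))) F"
        unfolding lint_def by (rule sum.cong) (simp_all add: b_def)
      thus ?thesis using lint_proj[OF that] by simp
    qed
    have bc: "b \<in> carrier (GA n)" by (simp add: GA_carrier b_def)
    have "\<mu> n \<otimes>\<^bsub>GA n\<^esub> b = \<one>\<^bsub>GA n\<^esub>"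
    proof (rule GA_eqI)
      show "\<mu> n \<otimes>\<^bsub>GA n\<^esub> b \<in> carrier (GA n)"
        by (intro monoid.m_closed[OF ring.is_monoid[OF GA_ring]] Lam_GA \<mu>(1) bc)
      show "\<one>\<^bsub>GA n\<^esub> \<in> carrier (GA n)" by (rule monoid.one_closed[OF ring.is_monoid[OF GA_ring]])
      fix F :: "'d \<Rightarrow> 'f" assume F: "linv n F"
      have "lint n (\<mu> n \<otimes>\<^bsub>GA n\<^esub> b) F = lint n (\<mu> n) (\<lambda>x. lint n b (\<lambda>y. F (x * y)))" by (rule lint_mult[OF F])
      also have "\<dots> = lint n (\<mu> n) (\<lambda>x. lint (Suc n) (\<nu> (Suc n)) (\<lambda>y. F (x * y)))"
        by (rule lint_cong) (rule lb[OF linv_mult_left[OF F]])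
      also have "\<dots> = lint (Suc n) (\<mu> (Suc n)) (\<lambda>x. lint (Suc n) (\<nu> (Suc n)) (\<lambda>y. F (x * y)))"
        by (rule Lam_lint[OF \<mu>(1) linv_lint[OF F], symmetric])
      also have "\<dots> = lint (Suc n) (\<mu> (Suc n) \<otimes>\<^bsub>GA (Suc n)\<^esub> \<nu> (Suc n)) F"
        by (rule lint_mult[OF linv_Suc[OF F], symmetric])
      also have "\<dots> = F 1" unfolding \<nu>(2) by (rule lint_one[OF linv_Suc[OF F]])
      finally show "lint n (\<mu> n \<otimes>\<^bsub>GA n\<^esub> b) F = lint n \<one>\<^bsub>GA n\<^esub> F" using lint_one[OF F] by simp
    qed
    hence "b = \<nu> n" using ex1[of n] bc \<nu>[of n] by blast
    thus "lint (Suc n) (\<nu> (Suc n)) F = lint n (\<nu> n) F" using lb[OF F] by simp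
  qed
  moreover have "\<mu> \<otimes>\<^bsub>\<Lambda>\<^esub> \<nu> = \<one>\<^bsub>\<Lambda>\<^esub>" by (simp add: Lam_mult Lam_one \<nu>(2))
  ultimately show ?thesis by blast
qed

definition Aug :: "('d, 'f) lam set" where "Aug = {\<mu> \<in> carrier \<Lambda>. aug \<mu> = 0}"

lemma Lam_uminus: "\<mu> \<in> carrier \<Lambda> \<Longrightarrow> \<ominus>\<^bsub>\<Lambda>\<^esub> \<mu> = (\<lambda>n C. - \<mu> n C)"
proof -
  assume \<mu>: "\<mu> \<in> carrier \<Lambda>"
  interpret ring \<Lambda> by (rule Lam_ring)
  show ?thesis
    by (rule minus_equality[OF _ \<mu> Lam_uminus_closed[OF \<mu>]]) (simp add: Lam_add Lam_zero)
qed
lemma Lam_minus: "\<mu> \<in> carrier \<Lambda> \<Longrightarrow> \<nu> \<in> carrier \<Lambda> \<Longrightarrow> \<mu> \<ominus>\<^bsub>\<Lambda>\<^esub> \<nu> = (\<lambda>n C. \<mu> n C - \<nu> n C)"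
  by (simp add: a_minus_def Lam_uminus Lam_add)
lemma aug_minus: "\<mu> \<in> carrier \<Lambda> \<Longrightarrow> \<nu> \<in> carrier \<Lambda> \<Longrightarrow> aug (\<mu> \<ominus>\<^bsub>\<Lambda>\<^esub> \<nu>) = aug \<mu> - aug \<nu>"
  by (simp add: a_minus_def aug_add) (simp add: Lam_uminus aug_def lint_uminus_l)

lemma Aug_ideal: "ideal Aug \<Lambda>"
proof -
  interpret ring \<Lambda> by (rule Lam_ring)
  show ?thesis
  proof (rule idealI[OF Lam_ring])
    show "subgroup Aug (add_monoid \<Lambda>)"
    proof (rule add.subgroupI)
      show "Aug \<subseteq> carrier \<Lambda>" by (auto simp: Aug_def)
      have "\<zero>\<^bsub>\<Lambda>\<^esub> \<in> Aug" by (simp add: Aug_def) (simp add: aug_def Lam_zero)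
      thus "Aug \<noteq> {}" by blast
      fix a assume a: "a \<in> Aug"
      thus "\<ominus>\<^bsub>\<Lambda>\<^esub> a \<in> Aug" by (simp add: Aug_def) (simp add: Lam_uminus aug_def lint_uminus_l)
      fix b assume "b \<in> Aug"
      thus "a \<oplus>\<^bsub>\<Lambda>\<^esub> b \<in> Aug" using a by (simp add: Aug_def aug_add)
    qed
  qed (simp_all add: Aug_def aug_mult)
qed

text \<open>An element of nonzero augmentation has a right inverse, so a proper two-sided ideal
  contains none.\<close>

lemma ideal_sub_Aug:
  assumes "ideal I \<Lambda>" "I \<noteq> carrier \<Lambda>"
  shows "I \<subseteq> Aug"
proof
  interpret I: ideal I \<Lambda> by fact
  fix \<mu> assume m: "\<mu> \<in> I"
  have mc: "\<mu> \<in> carrier \<Lambda>" by (rule I.Icarr[OF m])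
  show "\<mu> \<in> Aug"
  proof (rule ccontr)
    assume "\<mu> \<notin> Aug"
    hence "aug \<mu> \<noteq> 0" using mc by (simp add: Aug_def)
    then obtain \<nu> where "\<nu> \<in> carrier \<Lambda>" "\<mu> \<otimes>\<^bsub>\<Lambda>\<^esub> \<nu> = \<one>\<^bsub>\<Lambda>\<^esub>" using Lam_right_inverse[OF mc] by blast
    hence "\<one>\<^bsub>\<Lambda>\<^esub> \<in> I" using I.I_r_closed[OF m] by metis
    thus False using I.one_imp_carrier assms(2) by blast
  qed
qed

lemma Aug_proper: "Aug \<noteq> carrier \<Lambda>"
proof
  assume "Aug = carrier \<Lambda>"
  hence "\<one>\<^bsub>\<Lambda>\<^esub> \<in> Aug" using Lam_one_closed by (simp only:)
  hence "aug \<one>\<^bsub>\<Lambda>\<^esub> = 0" unfolding Aug_def by blast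
  thus False by simp
qed

text \<open>This justifies the definite description in \<open>mD\<close>: the augmentation ideal is
  maximal, and every proper ideal lies in it.\<close>

lemma mD_eq: "mD D = Aug"
  unfolding mD_def
proof (rule the_equality)
  show "maximalideal Aug \<Lambda>"
  proof (rule maximalidealI[OF Aug_ideal])
    show "carrier \<Lambda> \<noteq> Aug" using Aug_proper by blast
    fix J assume "ideal J \<Lambda>" "Aug \<subseteq> J" "J \<subseteq> carrier \<Lambda>"
    thus "J = Aug \<or> J = carrier \<Lambda>" using ideal_sub_Aug by blast
  qed
  fix I assume I: "maximalideal I \<Lambda>"
  interpret I: maximalideal I \<Lambda> by fact
  have "I \<subseteq> Aug" using ideal_sub_Aug[OF I.is_ideal] I.I_notcarr by blast
  moreover have "Aug \<subseteq> carrier \<Lambda>" by (auto simp: Aug_def)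
  ultimately show "I = Aug" using I.I_maximal[OF Aug_ideal] Aug_proper by blast
qed

lemma mD_pow_ideal: "ideal (mD_pow D n) \<Lambda>"
proof (induction n)
  case 0 show ?case by (simp add: ring.oneideal[OF Lam_ring])
next
  case (Suc n) thus ?case using ring.ideal_prod_is_ideal[OF Lam_ring Aug_ideal] by (simp add: mD_eq)
qed

lemma mD_pow_mult:
  assumes y: "y \<in> mD_pow D j"
  shows "x \<in> mD_pow D i \<Longrightarrow> x \<otimes>\<^bsub>\<Lambda>\<^esub> y \<in> mD_pow D (i + j)"
proof (induction i arbitrary: x)
  case 0
  thus ?case using ideal.I_l_closed[OF mD_pow_ideal y] by simp
next
  case (Suc i)
  interpret ring \<Lambda> by (rule Lam_ring)
  have yc: "y \<in> carrier \<Lambda>" by (rule ideal.Icarr[OF mD_pow_ideal y])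
  have "x \<in> mD D \<cdot>\<^bsub>\<Lambda>\<^esub> mD_pow D i" using Suc.prems by simp
  thus ?case
  proof (induction x rule: ideal_prod.induct)
    case (prod a b)
    have c: "a \<in> carrier \<Lambda>" "b \<in> carrier \<Lambda>" using prod ideal.Icarr[OF mD_pow_ideal] by (auto simp: mD_eq Aug_def)
    have "a \<otimes>\<^bsub>\<Lambda>\<^esub> (b \<otimes>\<^bsub>\<Lambda>\<^esub> y) \<in> mD_pow D (Suc i + j)"
      using ideal_prod.prod[OF prod(1) Suc.IH[OF prod(2)]] by simp
    thus ?case using c yc by (simp add: m_assoc)
  next
    case (sum a b)
    have "x \<in> carrier \<Lambda>" if "x \<in> mD D \<cdot>\<^bsub>\<Lambda>\<^esub> mD_pow D i" for x
      using that ideal.Icarr[OF mD_pow_ideal[of "Suc i"]] by simp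
    hence "(a \<oplus>\<^bsub>\<Lambda>\<^esub> b) \<otimes>\<^bsub>\<Lambda>\<^esub> y = a \<otimes>\<^bsub>\<Lambda>\<^esub> y \<oplus>\<^bsub>\<Lambda>\<^esub> b \<otimes>\<^bsub>\<Lambda>\<^esub> y" using sum yc by (simp add: l_distr)
    show ?case unfolding \<open>(a \<oplus>\<^bsub>\<Lambda>\<^esub> b) \<otimes>\<^bsub>\<Lambda>\<^esub> y = _\<close>
      by (rule additive_subgroup.a_closed[OF ideal.axioms(1)[OF mD_pow_ideal] sum.IH])
  qed
qed

lemma Lam_filtered: "filtered_ring \<Lambda> (mD_pow D)"
proof (intro filtered_ring.intro filtered_ring_axioms.intro Lam_ring)
  fix n
  show "mD_pow D 0 = carrier \<Lambda>" by simp
  show "additive_subgroup (mD_pow D n) \<Lambda>" using ideal.axioms(1)[OF mD_pow_ideal] .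
  show "mD_pow D (Suc n) \<subseteq> mD_pow D n"
    using ring.ideal_prod_inter[OF Lam_ring Aug_ideal mD_pow_ideal] by (simp add: mD_eq)
qed (rule mD_pow_mult)

lemma grLam_ring: "ring (grLam D :: ('d, 'f) grlam ring)"
  unfolding grLam_def by (rule filtered_ring.gr_ring_is_ring[OF Lam_filtered])

end

context quat
begin

subsection \<open>Polynomial functions on the group and their symbols\<close>

text \<open>The leading coordinate of a unit: a homomorphism from \<open>U 1\<close> to the additive
  group of the residue field, with kernel \<open>U 2\<close>.\<close>

definition T :: "'d \<Rightarrow> 'f" where "T g = rd (inverse \<pi> * (g - 1))"

lemma U1_pi: "g \<in> U 1 \<Longrightarrow> inverse \<pi> * (g - 1) \<in> Od \<and> g - 1 = \<pi> * (inverse \<pi> * (g - 1))"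
  by (auto simp: U_iff PP_def mult.assoc[symmetric])

lemma T_mult:
  assumes g: "g \<in> U 1" and h: "h \<in> U 1"
  shows "T (g * h) = T g + T h"
proof -
  define x y where "x = inverse \<pi> * (g - 1)" and "y = inverse \<pi> * (h - 1)"
  have x: "x \<in> Od" "g - 1 = \<pi> * x" and y: "y \<in> Od" "h - 1 = \<pi> * y"
    using U1_pi[OF g] U1_pi[OF h] by (auto simp: x_def y_def)
  have "g * h - 1 = (g - 1) * (h - 1) + (g - 1) + (h - 1)" by (simp add: algebra_simps)
  also have "\<dots> = \<pi> * (x * (\<pi> * y) + x + y)" by (simp only: x(2) y(2) distrib_left mult.assoc)
  finally have "inverse \<pi> * (g * h - 1) = x * (\<pi> * y) + x + y" by (simp add: mult.assoc[symmetric])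
  hence "T (g * h) = rd (x * (\<pi> * y) + x + y)" by (simp add: T_def)
  also have "\<dots> = rd x + rd y" using x y by (simp add: rd_add rd_mult O_add O_mult)
  finally show ?thesis by (simp add: T_def x_def y_def)
qed

lemma T_1 [simp]: "T 1 = 0" by (simp add: T_def)
lemma T_gg: "t \<in> Od \<Longrightarrow> T (gg t) = rd t" by (simp add: T_def gg_def mult.assoc[symmetric])

fun E :: "nat \<Rightarrow> 'f \<Rightarrow> ('d \<Rightarrow> 'f) \<Rightarrow> bool" where
  "E 0 c F \<longleftrightarrow> (\<forall>g\<in>U 1. F g = c)"
| "E (Suc d) c F \<longleftrightarrow> (\<forall>h\<in>U 1. E d (c * T h) (\<lambda>g. F (h * g) - F g))"

lemma E_cong: "(\<And>g. g \<in> U 1 \<Longrightarrow> F g = F' g) \<Longrightarrow> E d c F \<Longrightarrow> E d c F'"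
proof (induction d arbitrary: c F F')
  case (Suc d)
  show ?case unfolding E.simps
  proof
    fix h assume h: "h \<in> U 1"
    show "E d (c * T h) (\<lambda>g. F' (h * g) - F' g)"
    proof (rule Suc.IH)
      show "E d (c * T h) (\<lambda>g. F (h * g) - F g)" using Suc.prems(2) h by simp
      show "F (h * g) - F g = F' (h * g) - F' g" if "g \<in> U 1" for g
        using Suc.prems(1)[OF that] Suc.prems(1)[OF U_mult[OF h that]] by simp
    qed
  qed
qed simp

lemma E_add: "E d c F \<Longrightarrow> E d c' F' \<Longrightarrow> E d (c + c') (\<lambda>g. F g + F' g)"
proof (induction d arbitrary: c c' F F')
  case (Suc d)
  show ?case unfolding E.simps
  proof
    fix h assume h: "h \<in> U 1"
    have "E d (c * T h + c' * T h) (\<lambda>g. (F (h * g) - F g) + (F' (h * g) - F' g))"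
      using Suc.prems h by (intro Suc.IH) simp_all
    thus "E d ((c + c') * T h) (\<lambda>g. F (h * g) + F' (h * g) - (F g + F' g))"
      by (simp add: algebra_simps)
  qed
qed simp

lemma E_scale: "E d c F \<Longrightarrow> E d (a * c) (\<lambda>g. a * F g)"
proof (induction d arbitrary: c F)
  case (Suc d)
  show ?case unfolding E.simps
  proof
    fix h assume h: "h \<in> U 1"
    have "E d (a * (c * T h)) (\<lambda>g. a * (F (h * g) - F g))" using Suc.prems h by (intro Suc.IH) simp
    thus "E d (a * c * T h) (\<lambda>g. a * F (h * g) - a * F g)" by (simp add: algebra_simps)
  qed
qed simp

lemma E_zero: "E d 0 (\<lambda>_. 0)" by (induction d) simp_all

lemma E_sum: "(\<And>i. i \<in> A \<Longrightarrow> E d (c i) (F i)) \<Longrightarrow> E d (\<Sum>i\<in>A. c i) (\<lambda>g. \<Sum>i\<in>A. F i g)"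
proof (induction A rule: infinite_finite_induct)
  case (insert a A)
  have "E d (c a + (\<Sum>i\<in>A. c i)) (\<lambda>g. F a g + (\<Sum>i\<in>A. F i g))"
    using insert by (intro E_add) simp_all
  thus ?case using insert(1,2) by simp
qed (simp_all add: E_zero)

lemma E_Suc: "E d c F \<Longrightarrow> E (Suc d) 0 F"
proof (induction d arbitrary: c F)
  case 0 thus ?case using U_mult by simp
next
  case (Suc d)
  show ?case unfolding E.simps(2)[of "Suc d"]
  proof
    fix h assume h: "h \<in> U 1"
    have "E d (c * T h) (\<lambda>g. F (h * g) - F g)" using Suc.prems h by simp
    from Suc.IH[OF this] show "E (Suc d) (0 * T h) (\<lambda>g. F (h * g) - F g)" by simp
  qed
qed

lemma E_less: "d < d' \<Longrightarrow> E d c F \<Longrightarrow> E d' 0 F"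
proof (induction d' arbitrary: c)
  case (Suc d')
  show ?case
  proof (cases "d = d'")
    case True thus ?thesis using E_Suc[OF Suc.prems(2)] by simp
  next
    case False
    hence "E d' 0 F" using Suc by simp
    thus ?thesis by (rule E_Suc)
  qed
qed simp

lemma E_const: "d > 0 \<Longrightarrow> E d 0 (\<lambda>_. c)" using E_less[of 0 d c] by simp

lemma E_unique:
  assumes "E d c F" "E d c' F"
  shows "c = c'"
  using assms
proof (induction d arbitrary: c c' F)
  case 0 thus ?case using bspec[of _ _ 1, OF _ U_1] unfolding E.simps by (metis U_1)
next
  case (Suc d)
  have g: "gg 1 \<in> U 1" by (rule gg_U) simp
  have "E d (c * T (gg 1)) (\<lambda>g. F (gg 1 * g) - F g)" "E d (c' * T (gg 1)) (\<lambda>g. F (gg 1 * g) - F g)"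
    using Suc.prems g by (simp_all only: E.simps)
  from Suc.IH[OF this] show ?case by (simp add: T_gg)
qed

lemma E_translate: "E d c F \<Longrightarrow> h \<in> U 1 \<Longrightarrow> E d c (\<lambda>g. F (h * g))"
proof (cases d)
  case 0 thus "E d c F \<Longrightarrow> h \<in> U 1 \<Longrightarrow> ?thesis" using U_mult by simp
next
  case (Suc d')
  assume E: "E d c F" and h: "h \<in> U 1"
  have "E d' (c * T h) (\<lambda>g. F (h * g) - F g)" using E h Suc by simp
  hence "E d 0 (\<lambda>g. F (h * g) - F g)" unfolding Suc by (rule E_Suc)
  from E_add[OF E this] show ?thesis by simp
qed

text \<open>The binomial theorem gives \<open>d!\<close> as the leading coefficient of
  \<open>T ^ d\<close>; it vanishes in characteristic \<open>p\<close> as soon as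
  \<open>d \<ge> p\<close>.\<close>

lemma E_power: "j \<le> d \<Longrightarrow> E d (if j = d then of_nat (fact d) else 0) (\<lambda>g. T g ^ j)"
proof (induction d arbitrary: j)
  case (Suc d)
  show ?case unfolding E.simps
  proof
    fix h assume h: "h \<in> U 1"
    let ?c = "\<lambda>i. of_nat (j choose i) * T h ^ (j - i)"
    have "E d (\<Sum>i<j. ?c i * (if i = d then of_nat (fact d) else 0)) (\<lambda>g. \<Sum>i<j. ?c i * T g ^ i)"
      by (intro E_sum E_scale Suc.IH) (use Suc.prems in auto)
    moreover have "(\<Sum>i<j. ?c i * (if i = d then of_nat (fact d) else 0)) = (if j = Suc d then of_nat (fact (Suc d)) else 0) * T h"
    proof (cases "j = Suc d")
      case True
      have "(\<Sum>i<j. ?c i * (if i = d then of_nat (fact d) else 0)) = (\<Sum>i<j. if i = d then ?c i * of_nat (fact d) else 0)"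
        by (rule sum.cong) auto
      also have "\<dots> = of_nat (Suc d) * T h * of_nat (fact d)" using True by (simp add: sum.delta)
      finally show ?thesis using True by (simp add: algebra_simps)
    next
      case False
      have "(\<Sum>i<j. ?c i * (if i = d then of_nat (fact d) else 0)) = (\<Sum>i<j. 0)"
        by (rule sum.cong) (use False Suc.prems in auto)
      thus ?thesis using False by simp
    qed
    ultimately have "E d ((if j = Suc d then of_nat (fact (Suc d)) else 0) * T h) (\<lambda>g. \<Sum>i<j. ?c i * T g ^ i)" by simp
    thus "E d ((if j = Suc d then of_nat (fact (Suc d)) else 0) * T h) (\<lambda>g. T (h * g) ^ j - T g ^ j)"
    proof (rule E_cong[rotated])
      fix g assume g: "g \<in> U 1"
      have "T (h * g) ^ j = (\<Sum>i\<le>j. of_nat (j choose i) * T g ^ i * T h ^ (j - i))"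
        using T_mult[OF h g] binomial_ring[of "T g" "T h" j] by (simp add: add.commute)
      also have "\<dots> = (\<Sum>i<j. ?c i * T g ^ i) + T g ^ j"
        by (simp add: lessThan_Suc_atMost[symmetric] mult_ac)
      finally show "(\<Sum>i<j. ?c i * T g ^ i) = T (h * g) ^ j - T g ^ j" by simp
    qed
  qed
qed simp

text \<open>\<open>T ^ p\<close> is additive because Frobenius is, so it has degree only 1. This is
  why another function is constructed for degree \<open>p\<close>.\<close>

lemma E_frob: "d \<ge> 2 \<Longrightarrow> E d 0 (\<lambda>g. T g ^ p)"
proof -
  have "E 2 0 (\<lambda>g. T g ^ p)"
    unfolding numeral_2_eq_2 E.simps(2)[of "Suc 0"]
  proof
    fix h assume h: "h \<in> U 1"
    have "E (Suc 0) 0 (\<lambda>g. T h ^ p)" by (rule E_const) simp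
    hence "E (Suc 0) (0 * T h) (\<lambda>g. T h ^ p)" by (simp only: mult_zero_left)
    thus "E (Suc 0) (0 * T h) (\<lambda>g. T (h * g) ^ p - T g ^ p)"
      by (rule E_cong[rotated]) (simp add: T_mult[OF h] frobenius_add)
  qed
  moreover assume "d \<ge> 2"
  ultimately show ?thesis using E_less[of 2 d 0] by (cases "d = 2") auto
qed

lemma E_frob_sq: "d \<ge> 3 \<Longrightarrow> E d 0 (\<lambda>g. (T g ^ p) ^ 2)"
proof -
  have "E 3 0 (\<lambda>g. (T g ^ p) ^ 2)"
    unfolding numeral_3_eq_3 E.simps(2)[of "Suc (Suc 0)"]
  proof
    fix h assume h: "h \<in> U 1"
    have "E (Suc (Suc 0)) (2 * T h ^ p * 0 + 0) (\<lambda>g. 2 * T h ^ p * T g ^ p + (T h ^ p) ^ 2)"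
      by (intro E_add E_scale E_frob E_const) simp_all
    hence "E (Suc (Suc 0)) (0 * T h) (\<lambda>g. 2 * T h ^ p * T g ^ p + (T h ^ p) ^ 2)" by simp
    thus "E (Suc (Suc 0)) (0 * T h) (\<lambda>g. (T (h * g) ^ p) ^ 2 - (T g ^ p) ^ 2)"
      by (rule E_cong[rotated]) (simp add: T_mult[OF h] frobenius_add power2_eq_square algebra_simps)
  qed
  moreover assume "d \<ge> 3"
  ultimately show ?thesis using E_less[of 3 d 0] by (cases "d = 3") auto
qed

text \<open>Right action of the Iwasawa algebra on functions, averaging left translates. Level 3 is
  fixed because the function \<open>phi\<close> of degree \<open>p\<close> is invariant at that
  level.\<close>

definition opF :: "('d, 'f) lam \<Rightarrow> ('d \<Rightarrow> 'f) \<Rightarrow> 'd \<Rightarrow> 'f" where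
  "opF \<mu> F g = lint 3 (\<mu> 3) (\<lambda>x. F (x * g))"

text \<open>A symbol of degree \<open>j\<close>: \<open>\<mu>\<close> lowers degrees by
  \<open>j\<close> and multiplies leading coefficients by \<open>s\<close>. Symbols multiply; that
  of \<open>Yelt\<close> will be -1 and that of \<open>Zelt\<close> will be 0.\<close>

definition symb :: "nat \<Rightarrow> ('d, 'f) lam \<Rightarrow> 'f \<Rightarrow> bool" where
  "symb j \<mu> s \<longleftrightarrow> (\<forall>d c F. linv 3 F \<longrightarrow> E (d + j) c F \<longrightarrow> E d (c * s) (opF \<mu> F))"

lemma linv_opF: "linv 3 F \<Longrightarrow> linv 3 (opF \<mu> F)"
  unfolding linv_def
proof (intro ballI)
  fix g w assume F: "\<forall>g\<in>U 1. \<forall>w\<in>Nlev D 3. F (g * w) = F g" and g: "g \<in> U 1" and w: "w \<in> Nlev D 3"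
  show "opF \<mu> F (g * w) = opF \<mu> F g"
    unfolding opF_def by (rule lint_cong) (use F w U_mult[OF _ g] in \<open>simp add: mult.assoc[symmetric]\<close>)
qed

lemma lint_swap: "lint n a (\<lambda>x. lint m b (\<lambda>y. G x y)) = lint m b (\<lambda>y. lint n a (\<lambda>x. G x y))"
proof -
  have "lint n a (\<lambda>x. lint m b (\<lambda>y. G x y)) = (\<Sum>A\<in>carrier (lev n). \<Sum>B\<in>carrier (lev m). a A * (b B * G (rep A) (rep B)))"
    by (simp only: lint_def sum_distrib_left)
  also have "\<dots> = (\<Sum>B\<in>carrier (lev m). \<Sum>A\<in>carrier (lev n). a A * (b B * G (rep A) (rep B)))" by (rule sum.swap)
  finally show ?thesis by (simp only: lint_def sum_distrib_left mult.left_commute)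
qed

lemma opF_mult:
  assumes F: "linv 3 F" and g: "g \<in> U 1"
  shows "opF (\<mu> \<otimes>\<^bsub>\<Lambda>\<^esub> \<nu>) F g = opF \<nu> (opF \<mu> F) g"
proof -
  have "opF (\<mu> \<otimes>\<^bsub>\<Lambda>\<^esub> \<nu>) F g = lint 3 (\<mu> 3) (\<lambda>x. lint 3 (\<nu> 3) (\<lambda>y. F (x * y * g)))"
    unfolding opF_def by (rule Lam_lint_mult[OF linv_mult_right[OF F g]])
  also have "\<dots> = lint 3 (\<nu> 3) (\<lambda>y. lint 3 (\<mu> 3) (\<lambda>x. F (x * y * g)))" by (rule lint_swap)
  finally show ?thesis by (simp add: opF_def mult.assoc)
qed

lemma symb_mult:
  assumes "symb i \<mu> s" "symb j \<nu> s'"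
  shows "symb (i + j) (\<mu> \<otimes>\<^bsub>\<Lambda>\<^esub> \<nu>) (s * s')"
  unfolding symb_def
proof (intro allI impI)
  fix d c F assume F: "linv 3 F" and E: "E (d + (i + j)) c F"
  have "E (d + j) (c * s) (opF \<mu> F)" using assms(1) F E by (simp add: symb_def add_ac)
  hence "E d (c * s * s') (opF \<nu> (opF \<mu> F))" using assms(2) linv_opF[OF F] by (simp add: symb_def)
  hence "E d (c * s * s') (opF (\<mu> \<otimes>\<^bsub>\<Lambda>\<^esub> \<nu>) F)" by (rule E_cong[rotated]) (simp add: opF_mult[OF F])
  thus "E d (c * (s * s')) (opF (\<mu> \<otimes>\<^bsub>\<Lambda>\<^esub> \<nu>) F)" by (simp add: mult.assoc)
qed

lemma symb_add:
  assumes "symb j \<mu> s" "symb j \<nu> s'"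
  shows "symb j (\<mu> \<oplus>\<^bsub>\<Lambda>\<^esub> \<nu>) (s + s')"
  unfolding symb_def
proof (intro allI impI)
  fix d c F assume F: "linv 3 F" "E (d + j) c F"
  have "E d (c * s + c * s') (\<lambda>g. opF \<mu> F g + opF \<nu> F g)"
    using assms F by (intro E_add) (simp_all add: symb_def)
  thus "E d (c * (s + s')) (opF (\<mu> \<oplus>\<^bsub>\<Lambda>\<^esub> \<nu>) F)"
    by (simp add: opF_def[abs_def] Lam_add lint_add_l distrib_left)
qed

lemma symb_uminus: "\<mu> \<in> carrier \<Lambda> \<Longrightarrow> symb j \<mu> s \<Longrightarrow> symb j (\<ominus>\<^bsub>\<Lambda>\<^esub> \<mu>) (- s)"
  unfolding symb_def
proof (intro allI impI)
  fix d c F assume m: "\<mu> \<in> carrier \<Lambda>" and s: "\<forall>d c F. linv 3 F \<longrightarrow> E (d + j) c F \<longrightarrow> E d (c * s) (opF \<mu> F)"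
    and F: "linv 3 F" "E (d + j) c F"
  have "E d (-1 * (c * s)) (\<lambda>g. -1 * opF \<mu> F g)" using s F by (intro E_scale) blast
  thus "E d (c * - s) (opF (\<ominus>\<^bsub>\<Lambda>\<^esub> \<mu>) F)" by (simp add: opF_def[abs_def] Lam_uminus[OF m] lint_uminus_l)
qed

lemma symb_aug: "symb 0 \<mu> (lint 3 (\<mu> 3) (\<lambda>_. 1))"
  unfolding symb_def
proof (intro allI impI)
  fix d c F assume "linv 3 F" "E (d + 0) c F"
  hence "E d (\<Sum>C\<in>carrier (lev 3). \<mu> 3 C * c) (\<lambda>g. \<Sum>C\<in>carrier (lev 3). \<mu> 3 C * F (rep C * g))"
    by (intro E_sum E_scale E_translate) (simp_all add: lev_rep)
  thus "E d (c * lint 3 (\<mu> 3) (\<lambda>_. 1)) (opF \<mu> F)"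
    by (simp add: opF_def[abs_def] lint_def sum_distrib_left mult.commute)
qed

text \<open>As the total mass vanishes, \<open>F (h * g)\<close> may be replaced by
  \<open>F (h * g) - F g\<close>, which has degree one less and leading coefficient
  \<open>c * T h\<close>.\<close>

lemma symb_Aug:
  assumes "\<mu> \<in> Aug"
  shows "symb 1 \<mu> (lint 3 (\<mu> 3) T)"
  unfolding symb_def
proof (intro allI impI)
  fix d c F assume "linv 3 F" "E (d + 1) c F"
  hence E: "E d (c * T h) (\<lambda>g. F (h * g) - F g)" if "h \<in> U 1" for h
    using that by (simp add: One_nat_def)
  have "E d (\<Sum>C\<in>carrier (lev 3). \<mu> 3 C * (c * T (rep C))) (\<lambda>g. \<Sum>C\<in>carrier (lev 3). \<mu> 3 C * (F (rep C * g) - F g))"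
    by (intro E_sum E_scale E) (simp add: lev_rep)
  moreover have "(\<Sum>C\<in>carrier (lev 3). \<mu> 3 C * (c * T (rep C))) = c * lint 3 (\<mu> 3) T"
    by (simp add: lint_def sum_distrib_left mult.left_commute)
  moreover have "(\<lambda>g. \<Sum>C\<in>carrier (lev 3). \<mu> 3 C * (F (rep C * g) - F g)) = opF \<mu> F"
  proof
    fix g
    have "lint 3 (\<mu> 3) (\<lambda>_. F g) = 0" using assms aug_lint[of \<mu> 3 "F g"] by (simp add: Aug_def)
    hence "opF \<mu> F g = lint 3 (\<mu> 3) (\<lambda>x. F (x * g) - F g)" by (simp add: opF_def lint_diff_r)
    thus "(\<Sum>C\<in>carrier (lev 3). \<mu> 3 C * (F (rep C * g) - F g)) = opF \<mu> F g" by (simp only: lint_def)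
  qed
  ultimately show "E d (c * lint 3 (\<mu> 3) T) (opF \<mu> F)" by simp
qed

lemma symb_ex: "\<mu> \<in> mD_pow D j \<Longrightarrow> \<exists>s. symb j \<mu> s"
proof (induction j arbitrary: \<mu>)
  case 0 thus ?case using symb_aug by blast
next
  case (Suc j)
  have "\<mu> \<in> mD D \<cdot>\<^bsub>\<Lambda>\<^esub> mD_pow D j" using Suc.prems by simp
  thus ?case
  proof (induction \<mu> rule: ideal_prod.induct)
    case (prod a b)
    obtain s where "symb j b s" using Suc.IH[OF prod(2)] by blast
    from symb_mult[OF symb_Aug this, of a] prod(1) show ?case by (auto simp: mD_eq One_nat_def)
  next
    case (sum a b) thus ?case using symb_add by blast
  qed
qed

text \<open>Kernel of the symbol in degree \<open>k\<close>. It contains the next power of the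
  maximal ideal, so vanishing of the symbol is a property of classes in the graded ring.\<close>

definition SS :: "nat \<Rightarrow> ('d, 'f) lam set" where "SS k = {\<mu> \<in> carrier \<Lambda>. symb k \<mu> 0}"

lemma SS_sub: "additive_subgroup (SS k) \<Lambda>"
proof -
  interpret ring \<Lambda> by (rule Lam_ring)
  show ?thesis
  proof (rule additive_subgroup.intro, rule add.subgroupI)
    show "SS k \<subseteq> carrier \<Lambda>" by (auto simp: SS_def)
    have "symb k \<zero>\<^bsub>\<Lambda>\<^esub> 0" by (simp add: symb_def opF_def[abs_def] Lam_zero E_zero)
    thus "SS k \<noteq> {}" using zero_closed by (auto simp: SS_def)
    show "\<ominus>\<^bsub>\<Lambda>\<^esub> a \<in> SS k" if "a \<in> SS k" for a using that symb_uminus[of a k 0] by (simp add: SS_def)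
    show "a \<oplus>\<^bsub>\<Lambda>\<^esub> b \<in> SS k" if "a \<in> SS k" "b \<in> SS k" for a b
      using that symb_add[of k a 0 b 0] by (simp add: SS_def)
  qed
qed

text \<open>A function of degree \<open>d + k\<close> counts as one of degree
  \<open>d + k + 1\<close> with leading coefficient 0, and a symbol of degree \<open>k + 1\<close>
  sends it to degree \<open>d\<close> with coefficient 0.\<close>

lemma mD_pow_SS: "mD_pow D (Suc k) \<subseteq> SS k"
proof
  fix \<mu> assume m: "\<mu> \<in> mD_pow D (Suc k)"
  obtain s where s: "symb (Suc k) \<mu> s" using symb_ex[OF m] by blast
  have "symb k \<mu> 0" unfolding symb_def
  proof (intro allI impI)
    fix d c F assume F: "linv 3 F" "E (d + k) c F"
    have "E (d + Suc k) 0 F" using E_Suc[OF F(2)] by simp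
    hence "E d (0 * s) (opF \<mu> F)" using s F(1) unfolding symb_def by blast
    thus "E d (c * 0) (opF \<mu> F)" by simp
  qed
  thus "\<mu> \<in> SS k" using ideal.Icarr[OF mD_pow_ideal m] by (simp add: SS_def)
qed

text \<open>A two-sided ideal of elements with vanishing symbols. Degrees above \<open>N\<close> are
  left free, so that \<open>y ^ (p + 2)\<close> lies in \<open>JJ p\<close> although
  \<open>y ^ p\<close> does not.\<close>

definition JJ :: "nat \<Rightarrow> ('d, 'f) grlam set" where
  "JJ N = {a \<in> carrier (grLam D). \<forall>k\<le>N. a k \<subseteq> SS k}"

lemma SS_prod:
  assumes "x \<in> mD_pow D i" "y \<in> mD_pow D j" "x \<in> SS i \<or> y \<in> SS j"
  shows "x \<otimes>\<^bsub>\<Lambda>\<^esub> y \<in> SS (i + j)"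
proof -
  obtain s s' where s: "symb i x s" "symb j y s'" using symb_ex assms(1,2) by blast
  have "symb (i + j) (x \<otimes>\<^bsub>\<Lambda>\<^esub> y) 0"
    using assms(3) symb_mult[of i x 0 j y s'] symb_mult[of i x s j y 0] s by (auto simp: SS_def)
  thus ?thesis using assms(1,2) ideal.Icarr[OF mD_pow_ideal] by (auto simp: SS_def intro!: Lam_mult_closed)
qed

lemma grLam_carrier: "carrier (grLam D) = gr_carrier \<Lambda> (mD_pow D)" by (simp add: grLam_def gr_ring_def)

lemma grLam_rep:
  assumes "a \<in> carrier (grLam D)"
  shows "rep (a k) \<in> mD_pow D k" "rep (a k) \<in> a k" "a k = mD_pow D (Suc k) +>\<^bsub>\<Lambda>\<^esub> rep (a k)"
proof -
  interpret F: filtered_ring \<Lambda> "mD_pow D" by (rule Lam_filtered)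
  obtain x where x: "x \<in> mD_pow D k" "a k = mD_pow D (Suc k) +>\<^bsub>\<Lambda>\<^esub> x"
    using assms unfolding grLam_carrier gr_carrier_def by blast
  have xc: "x \<in> carrier \<Lambda>" using F.Fil_carrier[OF x(1)] .
  note r = F.R.a_coset_rep[OF F.Fil_sub[of "Suc k"] xc]
  have "rep (a k) \<ominus>\<^bsub>\<Lambda>\<^esub> x \<in> mD_pow D k" using r(2)[folded x(2)] F.Fil_Suc[of k] by (rule subsetD[rotated])
  hence "(rep (a k) \<ominus>\<^bsub>\<Lambda>\<^esub> x) \<oplus>\<^bsub>\<Lambda>\<^esub> x \<in> mD_pow D k" using x(1) additive_subgroup.a_closed[OF F.Fil_sub[of k]] by blast
  thus "rep (a k) \<in> mD_pow D k" using r(1) xc x(2) by (simp add: F.R.minus_eq F.R.a_assoc F.R.l_neg)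
  show e: "a k = mD_pow D (Suc k) +>\<^bsub>\<Lambda>\<^esub> rep (a k)" using r(3) x(2) by simp
  have "rep (a k) \<ominus>\<^bsub>\<Lambda>\<^esub> rep (a k) \<in> mD_pow D (Suc k)"
    using r(1) x(2) additive_subgroup.zero_closed[OF F.Fil_sub[of "Suc k"]] by (simp add: F.R.minus_eq F.R.r_neg)
  hence "rep (a k) \<in> mD_pow D (Suc k) +>\<^bsub>\<Lambda>\<^esub> rep (a k)"
    using r(1) x(2) by (subst F.R.a_mem_coset_iff[OF F.Fil_sub]) simp_all
  thus "rep (a k) \<in> a k" by (simp only: e[symmetric])
qed

lemma coset_SS: "x \<in> SS k \<Longrightarrow> mD_pow D (Suc k) +>\<^bsub>\<Lambda>\<^esub> x \<subseteq> SS k"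
  using mD_pow_SS[of k] additive_subgroup.a_closed[OF SS_sub[of k]]
  by (auto simp: a_r_coset_def' )

lemma JJ_prod:
  assumes a: "a \<in> carrier (grLam D)" and b: "b \<in> carrier (grLam D)" and J: "a \<in> JJ N \<or> b \<in> JJ N"
  shows "a \<otimes>\<^bsub>grLam D\<^esub> b \<in> JJ N"
proof -
  interpret F: filtered_ring \<Lambda> "mD_pow D" by (rule Lam_filtered)
  interpret R: ring "grLam D :: ('d, 'f) grlam ring" by (rule grLam_ring)
  have "(a \<otimes>\<^bsub>grLam D\<^esub> b) k \<subseteq> SS k" if k: "k \<le> N" for k
  proof -
    have "rep (a i) \<otimes>\<^bsub>\<Lambda>\<^esub> rep (b (k - i)) \<in> SS k" if "i \<in> {..k}" for i
    proof -
      have "rep (a i) \<in> SS i \<or> rep (b (k - i)) \<in> SS (k - i)"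
        using J
      proof
        assume "a \<in> JJ N"
        hence "a i \<subseteq> SS i" using k that by (simp add: JJ_def)
        thus ?thesis using grLam_rep(2)[OF a, of i] by blast
      next
        assume "b \<in> JJ N"
        hence "b (k - i) \<subseteq> SS (k - i)" using k that by (simp add: JJ_def)
        thus ?thesis using grLam_rep(2)[OF b, of "k - i"] by blast
      qed
      from SS_prod[OF grLam_rep(1)[OF a] grLam_rep(1)[OF b] this] show ?thesis using that by simp
    qed
    hence "(\<Oplus>\<^bsub>\<Lambda>\<^esub>i\<in>{..k}. rep (a i) \<otimes>\<^bsub>\<Lambda>\<^esub> rep (b (k - i))) \<in> SS k"
      by (intro F.R.finsum_mem[OF SS_sub]) simp_all
    from coset_SS[OF this] show ?thesis by (simp add: grLam_def gr_ring_def gr_prod_def)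
  qed
  thus ?thesis using R.m_closed[OF a b] by (simp add: JJ_def)
qed

lemma JJ_ideal: "ideal (JJ N) (grLam D)"
proof -
  interpret R: ring "grLam D :: ('d, 'f) grlam ring" by (rule grLam_ring)
  show ?thesis
  proof (rule idealI[OF grLam_ring])
    show "subgroup (JJ N) (add_monoid (grLam D))"
    proof (rule R.add.subgroupI)
      show "JJ N \<subseteq> carrier (grLam D)" by (auto simp: JJ_def)
      have "\<zero>\<^bsub>grLam D\<^esub> \<in> JJ N"
        using mD_pow_SS R.zero_closed by (auto simp: JJ_def) (auto simp: grLam_def gr_ring_def gr_zero_def)
      thus "JJ N \<noteq> {}" by blast
      fix a assume a: "a \<in> JJ N"
      hence ac: "a \<in> carrier (grLam D)" by (simp add: JJ_def)
      have "(\<ominus>\<^bsub>grLam D\<^esub> \<one>\<^bsub>grLam D\<^esub>) \<otimes>\<^bsub>grLam D\<^esub> a \<in> JJ N" using a ac by (intro JJ_prod) simp_all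
      thus "\<ominus>\<^bsub>grLam D\<^esub> a \<in> JJ N" using ac by (simp add: R.l_minus)
      fix b assume b: "b \<in> JJ N"
      have "(a \<oplus>\<^bsub>grLam D\<^esub> b) k \<subseteq> SS k" if "k \<le> N" for k
        using a b that additive_subgroup.a_closed[OF SS_sub[of k]]
        by (auto simp: JJ_def grLam_def gr_ring_def gr_add_def set_add_def') blast
      thus "a \<oplus>\<^bsub>grLam D\<^esub> b \<in> JJ N" using a b by (simp add: JJ_def)
    qed
    fix a x assume a: "a \<in> JJ N" and x: "x \<in> carrier (grLam D)"
    have ac: "a \<in> carrier (grLam D)" using a by (simp add: JJ_def)
    show "x \<otimes>\<^bsub>grLam D\<^esub> a \<in> JJ N" by (rule JJ_prod[OF x ac disjI2[OF a]])
    show "a \<otimes>\<^bsub>grLam D\<^esub> x \<in> JJ N" by (rule JJ_prod[OF ac x disjI1[OF a]])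
  qed
qed

lemma gr_class_JJ:
  assumes "x \<in> mD_pow D k" "k \<le> N \<Longrightarrow> x \<in> SS k"
  shows "gr_class \<Lambda> (mD_pow D) k x \<in> JJ N"
proof -
  interpret F: filtered_ring \<Lambda> "mD_pow D" by (rule Lam_filtered)
  interpret A: filtered_action \<Lambda> "mD_pow D" \<Lambda> "mD_pow D" "\<lambda>x y. x \<otimes>\<^bsub>\<Lambda>\<^esub> y" by (rule F.regular_action)
  have "gr_class \<Lambda> (mD_pow D) k x \<in> carrier (grLam D)"
    using A.gr_class_mem[OF assms(1)] by (simp add: grLam_carrier gr_component_def)
  moreover have "gr_class \<Lambda> (mD_pow D) k x j \<subseteq> SS j" if "j \<le> N" for j
    using mD_pow_SS[of j] coset_SS[of x k] assms(2) that by (auto simp: gr_class_def gr_zero_def)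
  ultimately show ?thesis by (simp add: JJ_def)
qed

end

context quat
begin

subsection \<open>A function of degree \<open>p\<close> detecting \<open>p\<close>-th powers\<close>

abbreviation "OL \<equiv> Ld \<inter> Od"

lemma OL_mult: "x \<in> OL \<Longrightarrow> y \<in> OL \<Longrightarrow> x * y \<in> OL" using L_mult O_mult by simp
lemma OL_add: "x \<in> OL \<Longrightarrow> y \<in> OL \<Longrightarrow> x + y \<in> OL" using L_add O_add by simp
lemma OL_diff: "x \<in> OL \<Longrightarrow> y \<in> OL \<Longrightarrow> x - y \<in> OL" using L_diff O_diff by simp
lemma OL_cj: "x \<in> OL \<Longrightarrow> cj x \<in> OL" by simp
lemma OL_power: "x \<in> OL \<Longrightarrow> x ^ n \<in> OL" using L_power O_power by simp
lemma OL_of_nat: "of_nat n \<in> OL" by simp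
lemma OL_comm: "x \<in> OL \<Longrightarrow> y \<in> OL \<Longrightarrow> x * y = y * x" using L_comm by simp

definition dec :: "'d \<Rightarrow> 'd \<times> 'd" where
  "dec g = (SOME ab. fst ab \<in> OL \<and> snd ab \<in> OL \<and> g = fst ab + \<pi> * snd ab)"
definition ac :: "'d \<Rightarrow> 'd" where "ac g = fst (dec g)"
definition bc :: "'d \<Rightarrow> 'd" where "bc g = snd (dec g)"

lemma dec:
  assumes "g \<in> Od"
  shows "ac g \<in> OL" "bc g \<in> OL" "g = ac g + \<pi> * bc g"
proof -
  obtain a b where "a \<in> OL" "b \<in> OL" "g = a + \<pi> * b" using O_decomp[OF assms] by (elim bexE)
  hence "\<exists>ab. fst ab \<in> OL \<and> snd ab \<in> OL \<and> g = fst ab + \<pi> * snd ab" by (intro exI[of _ "(a, b)"]) simp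
  from someI_ex[OF this] show "ac g \<in> OL" "bc g \<in> OL" "g = ac g + \<pi> * bc g"
    unfolding ac_def bc_def dec_def by blast+
qed

lemma dec_eq:
  assumes a: "a \<in> OL" "b \<in> OL" and g: "g = a + \<pi> * b"
  shows "ac g = a" "bc g = b"
proof -
  have gO: "g \<in> Od" using a unfolding g by (simp add: O_add O_mult)
  note d = dec[OF gO]
  have e: "ac g - a = \<pi> * (b - bc g)" using d(3) g by (simp add: algebra_simps)
  have "b - bc g = 0" by (rule L_pi_L[OF _ _ e]) (use a d in \<open>simp_all add: L_diff\<close>)
  thus "bc g = b" by simp
  thus "ac g = a" using e by simp
qed

text \<open>\<open>ac g - 1\<close> reduces to 0 inside the unramified subfield, hence is divisible
  by \<open>p\<close>, the square of the uniformizer. It does not affect \<open>T\<close>, which is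
  therefore the reduction of \<open>bc g\<close>.\<close>

lemma ac_bc_U1:
  assumes g: "g \<in> U 1"
  shows "ac g \<in> OL" "bc g \<in> OL" "rd (ac g) = 1" "rd (bc g) = T g" "inverse (ac g) \<in> OL" "ac g \<noteq> 0"
    "rd (inverse (ac g)) = 1"
proof -
  note d = dec[OF U_O[OF g]]
  show a: "ac g \<in> OL" "bc g \<in> OL" using d by simp_all
  have "rd g = rd (ac g) + rd (\<pi> * bc g)"
    using a by (subst d(3)) (rule rd_add, simp_all add: O_mult)
  thus r: "rd (ac g) = 1" using a U_rd[OF g] by simp
  thus nz: "ac g \<noteq> 0" by auto
  show i: "inverse (ac g) \<in> OL" using a r L_inverse unit_inv[of "ac g"] by simp
  have "rd (ac g * inverse (ac g)) = 1" using nz by simp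
  thus "rd (inverse (ac g)) = 1" using a(1) i r by (simp add: rd_mult)
  have "rd (ac g - 1) = 0" using a r by (simp add: rd_diff)
  then obtain e where e: "e \<in> OL" "ac g - 1 = of_nat p * e"
    using L_div_p[of "ac g - 1"] a by (auto simp: L_diff O_diff)
  have "g - 1 = (ac g - 1) + \<pi> * bc g" using d(3) by simp
  also have "\<dots> = \<pi> * (\<pi> * e + bc g)" by (simp only: e(2) pi_sq[symmetric] distrib_left mult.assoc)
  finally have "inverse \<pi> * (g - 1) = \<pi> * e + bc g" by (simp add: mult.assoc[symmetric])
  thus "rd (bc g) = T g" using a e by (simp add: T_def rd_add O_mult)
qed

lemma ac_bc_mult:
  assumes g: "g \<in> Od" and h: "h \<in> Od"
  shows "ac (g * h) = ac g * ac h + of_nat p * (cj (bc g) * bc h)"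
    "bc (g * h) = cj (ac g) * bc h + bc g * ac h"
proof -
  note dg = dec[OF g] and dh = dec[OF h]
  have "g * h = (ac g + \<pi> * bc g) * (ac h + \<pi> * bc h)" using dg(3) dh(3) by simp
  also have "\<dots> = ac g * ac h + ac g * \<pi> * bc h + \<pi> * (bc g * ac h) + \<pi> * (bc g * \<pi>) * bc h"
    by (simp add: algebra_simps)
  also have "\<dots> = (ac g * ac h + of_nat p * (cj (bc g) * bc h)) + \<pi> * (cj (ac g) * bc h + bc g * ac h)"
    by (simp only: mult_pi[of "ac g"] mult_pi[of "bc g"] pi_sq[symmetric] distrib_left mult.assoc add_ac)
  finally have e: "g * h = (ac g * ac h + of_nat p * (cj (bc g) * bc h)) + \<pi> * (cj (ac g) * bc h + bc g * ac h)" .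
  show "ac (g * h) = ac g * ac h + of_nat p * (cj (bc g) * bc h)"
    "bc (g * h) = cj (ac g) * bc h + bc g * ac h"
    by (rule dec_eq[OF _ _ e]; intro OL_add OL_mult OL_cj OL_of_nat dg(1,2) dh(1,2))+
qed

text \<open>The ratio of the two coordinates: insensitive to central factors, and a lift of
  \<open>T\<close> to characteristic zero.\<close>

definition tt :: "'d \<Rightarrow> 'd" where "tt g = bc g * inverse (ac g)"

lemma tt:
  assumes g: "g \<in> U 1"
  shows "tt g \<in> OL" "rd (tt g) = T g"
  unfolding tt_def by (rule OL_mult[OF ac_bc_U1(2,5)[OF g]]) (simp add: rd_mult ac_bc_U1[OF g, simplified])

text \<open>The \<open>p\<close>-derivation attached to the Frobenius lift \<open>cj\<close> on the
  unramified integers. The division by \<open>p\<close> is what yields a function of degree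
  \<open>p\<close>, in the role of \<open>T ^ p / p!\<close> up to a scalar.\<close>

definition delt :: "'d \<Rightarrow> 'd" where "delt t = (SOME d. d \<in> OL \<and> cj t - t ^ p = of_nat p * d)"

lemma delt:
  assumes t: "t \<in> OL"
  shows "delt t \<in> OL" "of_nat p * delt t = cj t - t ^ p"
proof -
  have "rd (cj t - t ^ p) = 0" using t by (simp add: rd_diff O_power rd_cj rd_power)
  moreover have "cj t - t ^ p \<in> OL" using t by (intro OL_diff OL_cj OL_power)
  ultimately have "\<exists>d. d \<in> OL \<and> cj t - t ^ p = of_nat p * d"
    using L_div_p[of "cj t - t ^ p"] by blast
  from someI_ex[OF this] show "delt t \<in> OL" "of_nat p * delt t = cj t - t ^ p"
    unfolding delt_def by simp_all
qed

definition phi :: "'d \<Rightarrow> 'f" where "phi g = rd (delt (tt g))"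

lemma p_times_PP: "of_nat p * x \<in> PP 4 \<Longrightarrow> x \<in> Od \<Longrightarrow> rd x = 0"
proof -
  assume "of_nat p * x \<in> PP 4" and x: "x \<in> Od"
  then obtain y where y: "y \<in> Od" "of_nat p * x = \<pi> ^ 4 * y" by (auto simp: PP_def)
  have "\<pi> ^ 4 = of_nat p * (\<pi> * \<pi>)" using pi_pow2[of 2] by (simp add: pi_sq power2_eq_square)
  hence "of_nat p * x = of_nat p * (\<pi> * (\<pi> * y))" using y(2) by (simp add: mult.assoc)
  hence "x = \<pi> * (\<pi> * y)" using p_pos by simp
  thus "rd x = 0" using y(1) by (simp add: O_mult)
qed

text \<open>Every term beyond \<open>y ^ p\<close> contains the difference, together with a factor
  \<open>p\<close> or in the power \<open>d ^ p\<close>.\<close>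

lemma power_p_cong:
  assumes x: "x \<in> Od" "y \<in> Od" "x * y = y * x" and d: "x - y \<in> PP k" and k: "k \<ge> 1"
  shows "x ^ p - y ^ p \<in> PP (k + 2)"
proof -
  define d where "d = x - y"
  have dk: "d \<in> PP k" using assms(4) by (simp add: d_def)
  have "d * y = y * d" using x(3) by (simp add: d_def algebra_simps)
  hence "(d + y) ^ p = (\<Sum>i\<le>p. of_nat (p choose i) * (d ^ i * y ^ (p - i)))" by (rule binomial_commuting)
  also have "\<dots> = (\<Sum>i\<in>insert 0 {1..p}. of_nat (p choose i) * (d ^ i * y ^ (p - i)))"
    by (rule sum.cong) auto
  also have "\<dots> = y ^ p + (\<Sum>i\<in>{1..p}. of_nat (p choose i) * (d ^ i * y ^ (p - i)))"
    by (subst sum.insert) auto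
  finally have e: "x ^ p - y ^ p = (\<Sum>i\<in>{1..p}. of_nat (p choose i) * (d ^ i * y ^ (p - i)))"
    by (simp add: d_def)
  have "of_nat (p choose i) * (d ^ i * y ^ (p - i)) \<in> PP (k + 2)" if i: "i \<in> {1..p}" for i
  proof (cases "i = p")
    case True
    have "5 * k \<le> p * k" using p_ge_5 by simp
    hence "k + 2 \<le> p * k" using k by linarith
    thus ?thesis using True PP_mono[OF PP_power[OF dk, of p], of "k + 2"] by simp
  next
    case False
    hence "p dvd (p choose i)" using i prime_p by (intro dvd_choose_prime) auto
    then obtain m where m: "p choose i = p * m" by (auto simp: dvd_def)
    have "1 * k \<le> i * k" using i by (intro mult_right_mono) auto
    hence "k + 2 \<le> Suc (Suc (i * k))" by simp
    moreover have "of_nat p * (of_nat m * (d ^ i * y ^ (p - i))) \<in> PP (Suc (Suc (i * k)))"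
      using PP_power[OF dk, of i] x(2) by (intro PP_p PP_mult_l PP_mult_r O_power) simp_all
    ultimately show ?thesis using PP_mono by (simp add: m mult.assoc)
  qed
  thus ?thesis unfolding e by (intro PP_sum)
qed

text \<open>The \<open>p\<close>-th power does not change modulo \<open>p ^ 2\<close> when a
  multiple of \<open>p\<close> is added, so only the conjugate of \<open>r\<close> survives, and it
  reduces to a \<open>p\<close>-th power.\<close>

lemma delt_add_p:
  assumes w: "w \<in> OL" and r: "r \<in> OL"
  shows "rd (delt (w + of_nat p * r)) = rd (delt w) + rd r ^ p"
proof -
  let ?x = "w + of_nat p * r"
  have x: "?x \<in> OL" by (intro OL_add OL_mult OL_of_nat w r)
  have pr: "of_nat p * r \<in> PP 2" using PP_p[of r 0] r by (simp add: PP_zero numeral_2_eq_2)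
  have "?x ^ p - w ^ p \<in> PP (2 + 2)"
    using x w OL_comm[OF x w] pr by (intro power_p_cong) simp_all
  hence P4: "?x ^ p - w ^ p \<in> PP 4" by simp
  have "of_nat p * (delt w + cj r - delt ?x) = cj w - w ^ p + of_nat p * cj r - (cj ?x - ?x ^ p)"
    by (simp only: distrib_left right_diff_distrib delt(2)[OF w] delt(2)[OF x])
  also have "\<dots> = ?x ^ p - w ^ p" by (simp add: cj_add cj_mult)
  finally have "of_nat p * (delt w + cj r - delt ?x) \<in> PP 4" using P4 by simp
  moreover have O: "delt w \<in> Od" "cj r \<in> Od" "delt ?x \<in> Od" using delt(1)[OF w] delt(1)[OF x] r by simp_all
  ultimately have "rd (delt w + cj r - delt ?x) = 0" using p_times_PP O_add O_diff by blast
  hence "rd (delt w) + rd (cj r) - rd (delt ?x) = 0" using O by (simp add: rd_diff rd_add O_add)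
  thus ?thesis using r by (simp add: rd_cj)
qed

text \<open>The cross terms of \<open>(x + y) ^ p\<close> are divisible by \<open>p\<close>; after
  the division they form the polynomial known from the addition of Witt vectors.\<close>

lemma delt_add:
  assumes x: "x \<in> OL" and y: "y \<in> OL"
  shows "rd (delt (x + y)) = rd (delt x) + rd (delt y)
     - (\<Sum>k\<in>{1..<p}. of_nat ((p choose k) div p) * (rd x ^ k * rd y ^ (p - k)))"
proof -
  let ?S = "\<Sum>k\<in>{1..<p}. of_nat ((p choose k) div p) * (x ^ k * y ^ (p - k))"
  have xy: "x + y \<in> OL" using x y by (rule OL_add)
  have "(x + y) ^ p = (\<Sum>k\<le>p. of_nat (p choose k) * (x ^ k * y ^ (p - k)))"
    by (rule binomial_commuting[OF OL_comm[OF x y]])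
  also have "\<dots> = (\<Sum>k\<in>insert 0 (insert p {1..<p}). of_nat (p choose k) * (x ^ k * y ^ (p - k)))"
    by (rule sum.cong) auto
  also have "\<dots> = y ^ p + (x ^ p + (\<Sum>k\<in>{1..<p}. of_nat (p choose k) * (x ^ k * y ^ (p - k))))"
    using p_pos by (subst sum.insert, simp, simp)+ simp
  also have "(\<Sum>k\<in>{1..<p}. of_nat (p choose k) * (x ^ k * y ^ (p - k))) = of_nat p * ?S"
    unfolding sum_distrib_left
  proof (rule sum.cong[OF refl])
    fix k assume "k \<in> {1..<p}"
    hence "p dvd (p choose k)" using prime_p by (intro dvd_choose_prime) auto
    hence "of_nat (p choose k) = (of_nat p * of_nat ((p choose k) div p) :: 'd)"
      by (simp flip: of_nat_mult)
    thus "of_nat (p choose k) * (x ^ k * y ^ (p - k))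
        = of_nat p * (of_nat ((p choose k) div p) * (x ^ k * y ^ (p - k)))" by (simp add: mult.assoc)
  qed
  finally have b: "(x + y) ^ p = y ^ p + (x ^ p + of_nat p * ?S)" .
  have "of_nat p * delt (x + y) = of_nat p * (delt x + delt y - ?S)"
    by (simp only: distrib_left right_diff_distrib delt(2)[OF x] delt(2)[OF y] delt(2)[OF xy] b cj_add) simp
  hence "delt (x + y) = delt x + delt y - ?S" using p_pos by simp
  moreover have S: "?S \<in> Od" using x y by (intro O_sum O_mult O_power O_of_nat) auto
  moreover have "rd ?S = (\<Sum>k\<in>{1..<p}. of_nat ((p choose k) div p) * (rd x ^ k * rd y ^ (p - k)))"
    using x y by (subst rd_sum) (auto simp: rd_mult rd_power O_mult O_power)
  ultimately show ?thesis using delt(1)[OF x] delt(1)[OF y] by (simp add: rd_diff rd_add O_add)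
qed

text \<open>\<open>tt\<close> is additive modulo \<open>p\<close>, and \<open>r\<close> records the
  deviation: the part with \<open>e\<close> comes from \<open>cj (ac h)\<close> differing from
  \<open>ac h\<close>, the other from the denominator \<open>ac (h * g)\<close>. The two addition
  rules for \<open>delt\<close> then give the formula.\<close>

lemma phi_mult:
  assumes h: "h \<in> U 1"
  shows "\<exists>e. \<forall>g\<in>U 1. phi (h * g) = phi h + phi g
     - (\<Sum>k\<in>{1..<p}. of_nat ((p choose k) div p) * (T h ^ k * T g ^ (p - k)))
     + (e * T g - T h ^ p * T g * (T h + T g)) ^ p"
proof -
  note H = ac_bc_U1[OF h]
  let ?a = "ac h" and ?b = "bc h" and ?i = "inverse (ac h)"
  have "rd (cj ?a * ?i - 1) = 0" using H by (simp add: rd_diff rd_mult O_mult rd_cj)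
  moreover have "cj ?a * ?i - 1 \<in> OL" using H by (intro OL_diff OL_mult OL_cj) simp_all
  ultimately obtain e where e: "e \<in> OL" "cj ?a * ?i - 1 = of_nat p * e" using L_div_p by auto
  have "phi (h * g) = phi h + phi g
     - (\<Sum>k\<in>{1..<p}. of_nat ((p choose k) div p) * (T h ^ k * T g ^ (p - k)))
     + (rd e * T g - T h ^ p * T g * (T h + T g)) ^ p" if g: "g \<in> U 1" for g
  proof -
    note G = ac_bc_U1[OF g] and HG = ac_bc_U1[OF U_mult[OF h g]]
    let ?a' = "ac g" and ?b' = "bc g" and ?i' = "inverse (ac g)"
    define X where "X = tt (h * g)"
    define s where "s = cj ?b * ?b' * (?i * ?i')"
    define r where "r = e * tt g - X * s"
    have XO: "X \<in> OL" and rX: "rd X = T h + T g"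
      using tt[OF U_mult[OF h g]] T_mult[OF h g] by (simp_all add: X_def)
    have sO: "s \<in> OL" unfolding s_def by (intro OL_mult OL_cj H G)
    have rs: "rd s = T h ^ p * T g" unfolding s_def using H G by (simp add: rd_mult O_mult rd_cj)
    have rO: "r \<in> OL" unfolding r_def by (intro OL_diff OL_mult e(1) tt(1)[OF g] XO sO)
    have "X * (?a * ?a' + of_nat p * (cj ?b * ?b')) = cj ?a * ?b' + ?b * ?a'"
      unfolding X_def tt_def ac_bc_mult[OF U_O[OF h] U_O[OF g], symmetric] using HG(6) by (simp add: mult.assoc)
    hence "X * (?a * ?a' + of_nat p * (cj ?b * ?b')) * (?i * ?i') = (cj ?a * ?b' + ?b * ?a') * (?i * ?i')" by simp
    moreover have "?a * ?a' * (?i * ?i') = 1"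
    proof -
      have "?a * ?a' * (?i * ?i') = ?a * (?a' * ?i) * ?i'" by (simp only: mult.assoc)
      also have "?a' * ?i = ?i * ?a'" by (rule OL_comm[OF G(1) H(5)])
      finally show ?thesis using H(6) G(6) by (simp add: mult.assoc)
    qed
    moreover have "cj ?a * ?b' * (?i * ?i') = cj ?a * ?i * tt g"
    proof -
      have "cj ?a * ?b' * (?i * ?i') = cj ?a * (?b' * ?i) * ?i'" by (simp only: mult.assoc)
      also have "?b' * ?i = ?i * ?b'" by (rule OL_comm[OF G(2) H(5)])
      finally show ?thesis by (simp add: tt_def mult.assoc)
    qed
    moreover have "?b * ?a' * (?i * ?i') = tt h"
    proof -
      have "?b * ?a' * (?i * ?i') = ?b * (?a' * ?i) * ?i'" by (simp only: mult.assoc)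
      also have "?a' * ?i = ?i * ?a'" by (rule OL_comm[OF G(1) H(5)])
      finally show ?thesis using G(6) by (simp add: tt_def mult.assoc)
    qed
    ultimately have "X + X * (of_nat p * s) = cj ?a * ?i * tt g + tt h"
      by (simp add: distrib_left distrib_right mult.assoc s_def)
    moreover have "cj ?a * ?i = 1 + of_nat p * e" using e(2) by (simp add: algebra_simps)
    moreover have "X * (of_nat p * s) = of_nat p * (X * s)" by (metis mult.assoc of_nat_p_comm)
    ultimately have "X + of_nat p * (X * s) = (1 + of_nat p * e) * tt g + tt h" by simp
    hence X_eq: "X = (tt h + tt g) + of_nat p * r"
      by (simp add: r_def algebra_simps)
    have "phi (h * g) = rd (delt ((tt h + tt g) + of_nat p * r))" by (simp add: phi_def X_eq[symmetric] X_def)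
    also have "\<dots> = rd (delt (tt h + tt g)) + rd r ^ p"
      by (rule delt_add_p[OF OL_add[OF tt(1)[OF h] tt(1)[OF g]] rO])
    also have "rd (delt (tt h + tt g)) = phi h + phi g
       - (\<Sum>k\<in>{1..<p}. of_nat ((p choose k) div p) * (T h ^ k * T g ^ (p - k)))"
      unfolding delt_add[OF tt(1)[OF h] tt(1)[OF g]] by (simp add: phi_def tt(2)[OF h] tt(2)[OF g])
    also have "rd r = rd e * T g - T h ^ p * T g * (T h + T g)"
      unfolding r_def using e(1) tt[OF g] XO sO rX rs by (simp add: rd_diff rd_mult O_mult mult.commute)
    finally show ?thesis .
  qed
  thus ?thesis by blast
qed

text \<open>For \<open>u\<close> in \<open>U 4\<close> the ratio \<open>tt u\<close> is divisible by
  \<open>p ^ 2\<close>, so both \<open>phi\<close> and \<open>T\<close> vanish at \<open>u\<close>;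
  a central factor cancels in the ratio.\<close>

lemma linv_phi: "linv 3 phi"
  unfolding linv_def
proof (intro ballI)
  fix g w assume g: "g \<in> U 1" and "w \<in> Nlev D 3"
  then obtain u z where u: "u \<in> U 4" and z: "z \<in> ZD1 D" and w: "w = u * z" by (auto simp: Nlev_iff)
  have u1: "u \<in> U 1" using u by (rule U_mono) simp
  have "phi (g * u) = phi g"
  proof -
    obtain x where x: "x \<in> Od" "u - 1 = \<pi> ^ 4 * x" using u by (auto simp: U_iff PP_def)
    obtain a b where ab: "a \<in> OL" "b \<in> OL" "x = a + \<pi> * b" using O_decomp[OF x(1)] by (elim bexE)
    have "u = 1 + of_nat p ^ 2 * x" using x(2) pi_pow2[of 2] by (simp add: algebra_simps)
    also have "\<dots> = (1 + of_nat p ^ 2 * a) + \<pi> * (of_nat p ^ 2 * b)"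
      by (simp only: ab(3) distrib_left p_pow_left[of 2 \<pi> b] add.assoc)
    finally have bu: "bc u = of_nat p ^ 2 * b"
      by (rule dec_eq(2)[rotated 2]) (use ab in \<open>simp_all add: L_add L_mult O_add O_mult\<close>)
    define c where "c = of_nat p * (b * inverse (ac u))"
    have bi: "b * inverse (ac u) \<in> OL" using ab(2) ac_bc_U1(5)[OF u1] by (rule OL_mult)
    have cO: "c \<in> OL" unfolding c_def by (intro OL_mult OL_of_nat bi)
    have ttu: "tt u = 0 + of_nat p * c" by (simp add: tt_def bu c_def mult.assoc power2_eq_square)
    have "delt 0 = 0"
      using delt(2)[of 0] p_pos by (simp add: power_0_left)
    hence pu: "phi u = 0"
      unfolding phi_def ttu using delt_add_p[OF _ cO, of 0] bi p_pos by (simp add: c_def rd_mult power_0_left)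
    have Tu: "T u = 0" using tt(2)[OF u1] cO unfolding ttu by (simp add: rd_mult)
    obtain e where e: "\<forall>g'\<in>U 1. phi (g * g') = phi g + phi g'
     - (\<Sum>k\<in>{1..<p}. of_nat ((p choose k) div p) * (T g ^ k * T g' ^ (p - k)))
     + (e * T g' - T g ^ p * T g' * (T g + T g')) ^ p" using phi_mult[OF g] by blast
    have "(\<Sum>k\<in>{1..<p}. of_nat ((p choose k) div p) * (T g ^ k * 0 ^ (p - k))) = (0::'f)"
      by (rule sum.neutral) (auto simp: power_0_left)
    thus ?thesis using bspec[OF e u1] Tu pu p_pos by (simp add: power_0_left)
  qed
  moreover have "phi (g * u * z) = phi (g * u)"
  proof -
    have gu: "g * u \<in> U 1" using U_mult[OF g u1] .
    note G = ac_bc_U1[OF gu]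
    have z1: "z \<in> U 1" using Z_U1[OF z] .
    obtain c where c: "z = emb c" using z emb_range by (auto simp: ZD1_def)
    have zL: "z \<in> OL" using U_O[OF z1] c by simp
    have znz: "z \<noteq> 0" using U_nz[OF z1] by simp
    have e: "g * u * z = ac (g * u) * z + \<pi> * (bc (g * u) * z)"
      by (subst dec(3)[OF U_O[OF gu]]) (simp add: distrib_right mult.assoc)
    note d = dec_eq[OF OL_mult[OF G(1) zL] OL_mult[OF G(2) zL] e]
    have "tt (g * u * z) = bc (g * u) * z * (inverse z * inverse (ac (g * u)))"
      unfolding tt_def d using G(6) znz by (simp add: nonzero_inverse_mult_distrib)
    also have "\<dots> = tt (g * u)" using znz by (simp add: tt_def mult.assoc) (simp add: mult.assoc[symmetric])
    finally show ?thesis by (simp add: phi_def)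
  qed
  ultimately show "phi (g * w) = phi g" by (simp add: w mult.assoc)
qed

text \<open>Leading coefficient of \<open>phi\<close>: the term \<open>k = 1\<close> of the binomial
  sum is \<open>T h * T g ^ (p - 1)\<close>, it enters with a minus sign, and
  \<open>T ^ (p - 1)\<close> contributes \<open>(p - 1)!\<close>.\<close>

definition c0 :: 'f where "c0 = - of_nat (fact (p - 1))"

lemma c0_nz: "c0 \<noteq> 0"
proof -
  have "\<not> p dvd fact (p - 1)" using prime_p p_ge_5 by (simp add: prime_dvd_fact_iff)
  hence "(of_nat (fact (p - 1)) :: 'f) \<noteq> 0" by (simp only: of_nat_f_eq_0 not_False_eq_True)
  thus ?thesis by (simp add: c0_def)
qed

lemma E_phi: "E p c0 phi"
proof -
  obtain d where d: "p = Suc d" using p_pos by (cases p) auto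
  \<comment> \<open>The other terms are a constant, \<open>T ^ p\<close> and its square, of degrees
    0, 1 and 2, all below \<open>d = p - 1\<close>.\<close>
  have d4: "d \<ge> 4" using p_ge_5 d by simp
  have "E (Suc d) c0 phi"
    unfolding E.simps
  proof
    fix h assume h: "h \<in> U 1"
    obtain e where e: "\<forall>g\<in>U 1. phi (h * g) = phi h + phi g
     - (\<Sum>k\<in>{1..<p}. of_nat ((p choose k) div p) * (T h ^ k * T g ^ (p - k)))
     + (e * T g - T h ^ p * T g * (T h + T g)) ^ p" using phi_mult[OF h] by blast
    let ?c = "\<lambda>k. - (of_nat ((p choose k) div p) * T h ^ k)"
    define \<alpha> \<beta> where "\<alpha> = (e - T h ^ p * T h) ^ p" and "\<beta> = - ((T h ^ p) ^ p)"
    have "E d (\<Sum>k\<in>{1..<p}. ?c k * (if p - k = d then of_nat (fact d) else 0)) (\<lambda>g. \<Sum>k\<in>{1..<p}. ?c k * T g ^ (p - k))"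
      by (intro E_sum E_scale E_power) (use d in auto)
    moreover have "(\<Sum>k\<in>{1..<p}. ?c k * (if p - k = d then of_nat (fact d) else 0)) = c0 * T h"
    proof -
      have "(\<Sum>k\<in>{1..<p}. ?c k * (if p - k = d then of_nat (fact d) else 0)) = (\<Sum>k\<in>{1..<p}. if k = 1 then ?c k * of_nat (fact d) else 0)"
        by (rule sum.cong) (use d in \<open>auto simp: One_nat_def\<close>)
      also have "\<dots> = ?c 1 * of_nat (fact d)" using p_ge_5 by (simp add: sum.delta)
      also have "\<dots> = c0 * T h"
      proof -
        have "(p choose 1) div p = 1" using p_pos by (simp add: choose_one)
        moreover have "d = p - 1" using d by simp
        ultimately show ?thesis by (simp add: c0_def mult.commute)
      qed
      finally show ?thesis .
    qed
    ultimately have "E d (c0 * T h) (\<lambda>g. \<Sum>k\<in>{1..<p}. ?c k * T g ^ (p - k))" by simp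
    moreover have "E d 0 (\<lambda>_. phi h)" using d4 by (intro E_const) simp
    moreover have "E d (\<alpha> * 0) (\<lambda>g. \<alpha> * T g ^ p)" using d4 by (intro E_scale E_frob) simp
    moreover have "E d (\<beta> * 0) (\<lambda>g. \<beta> * (T g ^ p) ^ 2)" using d4 by (intro E_scale E_frob_sq) simp
    ultimately have "E d (c0 * T h + (0 + (\<alpha> * 0 + \<beta> * 0)))
        (\<lambda>g. (\<Sum>k\<in>{1..<p}. ?c k * T g ^ (p - k)) + (phi h + (\<alpha> * T g ^ p + \<beta> * (T g ^ p) ^ 2)))"
      by (intro E_add)
    hence "E d (c0 * T h)
        (\<lambda>g. (\<Sum>k\<in>{1..<p}. ?c k * T g ^ (p - k)) + (phi h + (\<alpha> * T g ^ p + \<beta> * (T g ^ p) ^ 2)))" by simp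
    thus "E d (c0 * T h) (\<lambda>g. phi (h * g) - phi g)"
    proof (rule E_cong[rotated])
      fix g assume g: "g \<in> U 1"
      have "e * T g - T h ^ p * T g * (T h + T g) = (e - T h ^ p * T h) * T g - T h ^ p * T g ^ 2"
        by (simp add: algebra_simps power2_eq_square)
      moreover have "(T g ^ 2) ^ p = (T g ^ p) ^ 2" by (simp only: power_mult[symmetric] mult.commute)
      ultimately have "(e * T g - T h ^ p * T g * (T h + T g)) ^ p = \<alpha> * T g ^ p + \<beta> * (T g ^ p) ^ 2" 
        by (simp only: frobenius_diff power_mult_distrib \<alpha>_def \<beta>_def) simp
      moreover have "(\<Sum>k\<in>{1..<p}. ?c k * T g ^ (p - k))
          = - (\<Sum>k\<in>{1..<p}. of_nat ((p choose k) div p) * (T h ^ k * T g ^ (p - k)))"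
        by (simp add: sum_negf mult.assoc)
      ultimately show "(\<Sum>k\<in>{1..<p}. ?c k * T g ^ (p - k)) + (phi h + (\<alpha> * T g ^ p + \<beta> * (T g ^ p) ^ 2))
          = phi (h * g) - phi g" using bspec[OF e g] by simp
    qed
  qed
  thus ?thesis using d by simp
qed

text \<open>\<open>phi\<close> has degree \<open>p\<close> and a nonzero leading coefficient, so it
  tests symbols of every degree up to \<open>p\<close>.\<close>

lemma symb_unique:
  assumes "symb j \<mu> s" "symb j \<mu> s'" "j \<le> p"
  shows "s = s'"
proof -
  have "E (p - j + j) c0 phi" using E_phi assms(3) by simp
  hence "E (p - j) (c0 * s) (opF \<mu> phi)" "E (p - j) (c0 * s') (opF \<mu> phi)"
    using assms(1,2) linv_phi unfolding symb_def by blast+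
  hence "c0 * s = c0 * s'" by (rule E_unique)
  thus ?thesis using c0_nz by simp
qed

end

section \<open>The classes y and z and their p-th powers\<close>

declare mD_pow.simps(2) [simp del]

context quat
begin

lemma sum_residue_units: "(\<Sum>l\<in>residue_units D. F l) = (\<Sum>i<q - 1. F (tau ^ i))"
  unfolding residue_units_eq mu_eq by (subst sum.reindex[OF tau_inj]) simp

lemma sum_root_of_unity:
  assumes "(r::'f) ^ (q - 1) = 1" "r \<noteq> 1"
  shows "(\<Sum>i<q - 1. r ^ i) = 0"
proof -
  have "(r - 1) * (\<Sum>i<q - 1. r ^ i) = r ^ (q - 1) - 1" by (rule power_diff_1_eq[symmetric])
  thus ?thesis using assms by simp
qed

lemma of_nat_q_minus_1: "(of_nat (q - 1) :: 'f) = - 1"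
proof -
  have "(of_nat (q - 1) :: 'f) + 1 = of_nat (Suc (q - 1))" by (simp only: of_nat_Suc add.commute)
  also have "\<dots> = 0" unfolding q_gt(4) by (simp add: power2_eq_square)
  finally show ?thesis by (simp add: eq_neg_iff_add_eq_0)
qed

definition wsum :: "('f \<Rightarrow> 'f) \<Rightarrow> ('d, 'f) lam" where
  "wsum w n C = (\<Sum>i<q - 1. w (tau ^ i) * delta D (gg (zeta ^ i)) n C)"

lemma Yelt_wsum: "Yelt p D = wsum inverse"
  by (intro ext) (simp add: Yelt_def wsum_def sum_residue_units teich_tau gg_def)
lemma Zelt_wsum: "Zelt p D = wsum (\<lambda>l. inverse (l ^ p))"
  by (intro ext) (simp add: Zelt_def wsum_def sum_residue_units teich_tau gg_def)

lemma gg_zeta_U: "gg (zeta ^ i) \<in> U 1" by (intro gg_U zeta_pow_O)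

lemma lint_sum_l: "lint n (\<lambda>C. \<Sum>i\<in>A. c i * a i C) F = (\<Sum>i\<in>A. c i * lint n (a i) F)"
  unfolding lint_def by (simp add: sum_distrib_right sum_distrib_left mult.assoc) (rule sum.swap)

lemma lint_wsum: "linv n F \<Longrightarrow> lint n (wsum w n) F = (\<Sum>i<q - 1. w (tau ^ i) * F (gg (zeta ^ i)))"
  unfolding wsum_def[abs_def] lint_sum_l by (simp add: lint_delta[OF gg_zeta_U])

lemma wsum_Lam: "wsum w \<in> carrier \<Lambda>"
proof (rule LamI)
  show "wsum w n \<in> carrier (GA n)" for n by (simp add: GA_carrier wsum_def delta_def)
  show "lint (Suc n) (wsum w (Suc n)) F = lint n (wsum w n) F" if "linv n F" for n F
    by (simp only: lint_wsum[OF that] lint_wsum[OF linv_Suc[OF that]])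
qed

lemma mD_pow_1: "mD_pow D (Suc 0) = Aug"
  by (simp add: mD_pow.simps mD_eq ring.ideal_prod_one[OF Lam_ring Aug_ideal])

text \<open>Sums of characters of the residue units: a nontrivial one gives 0, the trivial one
  \<open>q - 1\<close>, which is -1. The first two sums are the augmentations of \<open>Yelt\<close>
  and \<open>Zelt\<close>, the other two the integrals of \<open>T\<close> against
  \<open>Zelt\<close> and \<open>Yelt\<close>.\<close>

lemma tau_inverse_pow_sum: "(\<Sum>i<q - 1. inverse (tau ^ i)) = 0" "(\<Sum>i<q - 1. inverse ((tau ^ i) ^ p)) = 0"
    "(\<Sum>i<q - 1. inverse ((tau ^ i) ^ p) * tau ^ i) = 0" "(\<Sum>i<q - 1. inverse (tau ^ i) * tau ^ i) = - 1"
proof -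
  have tau1: "tau \<noteq> 1" using tau_p_neq by auto
  have tp1: "tau ^ p \<noteq> 1"
  proof
    assume "tau ^ p = 1"
    hence "tau = 1" using tau_pp by simp
    thus False using tau1 by simp
  qed
  have r: "(inverse tau) ^ (q - 1) = 1" by (simp only: power_inverse tau_pow inverse_1)
  have rp: "(inverse (tau ^ p)) ^ (q - 1) = 1" by (simp only: power_inverse tau_pow_q inverse_1)
  have 1: "(\<Sum>i<q - 1. (inverse tau) ^ i) = 0" by (rule sum_root_of_unity[OF r]) (use tau1 in simp)
  thus "(\<Sum>i<q - 1. inverse (tau ^ i)) = 0" by (simp only: power_inverse)
  have 2: "(\<Sum>i<q - 1. (inverse (tau ^ p)) ^ i) = 0" by (rule sum_root_of_unity[OF rp]) (use tp1 in simp)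
  have sw: "(tau ^ i) ^ p = (tau ^ p) ^ i" for i by (simp only: power_mult[symmetric] mult.commute)
  show "(\<Sum>i<q - 1. inverse ((tau ^ i) ^ p)) = 0" using 2 by (simp only: power_inverse sw)
  have "inverse (tau ^ p) * tau \<noteq> 1" using tau_p_neq by (simp add: field_simps)
  moreover have "(inverse (tau ^ p) * tau) ^ (q - 1) = 1"
    by (simp only: power_mult_distrib rp tau_pow mult_1_right)
  ultimately have "(\<Sum>i<q - 1. (inverse (tau ^ p) * tau) ^ i) = 0" by (intro sum_root_of_unity)
  thus "(\<Sum>i<q - 1. inverse ((tau ^ i) ^ p) * tau ^ i) = 0"
    by (simp only: power_mult_distrib power_inverse sw)
  have "(\<Sum>i<q - 1. inverse (tau ^ i) * tau ^ i) = of_nat (q - 1)" by simp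
  thus "(\<Sum>i<q - 1. inverse (tau ^ i) * tau ^ i) = - 1" by (simp only: of_nat_q_minus_1)
qed

lemma Yelt_Aug: "Yelt p D \<in> Aug" and Zelt_Aug: "Zelt p D \<in> Aug"
proof -
  have "aug (wsum w) = (\<Sum>i<q - 1. w (tau ^ i) * 1)" for w
    unfolding aug_def by (rule lint_wsum) simp
  thus "Yelt p D \<in> Aug" "Zelt p D \<in> Aug"
    by (simp_all add: Aug_def Yelt_wsum Zelt_wsum wsum_Lam tau_inverse_pow_sum)
qed

lemma Y_mD: "Yelt p D \<in> mD_pow D (Suc 0)" and Z_mD: "Zelt p D \<in> mD_pow D (Suc 0)"
  using Yelt_Aug Zelt_Aug by (simp_all only: mD_pow_1)

lemma linv_T: "linv 3 T"
  unfolding linv_def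
proof (intro ballI)
  fix g w assume g: "g \<in> U 1" and w: "w \<in> Nlev D 3"
  obtain u z where u: "u \<in> U 4" and z: "z \<in> ZD1 D" and uz: "w = u * z" using w by (auto simp: Nlev_iff)
  have u1: "u \<in> U 1" using u by (rule U_mono) simp
  obtain x where x: "x \<in> Od" "u - 1 = \<pi> ^ 4 * x" using u by (auto simp: U_iff PP_def)
  have pw: "\<pi> ^ 4 * x = \<pi> * (\<pi> * (\<pi> * (\<pi> * x)))" by (simp only: power4_eq_xxxx mult.assoc)
  have "inverse \<pi> * (u - 1) = \<pi> * (\<pi> * (\<pi> * x))" unfolding x(2) pw by (simp add: mult.assoc[symmetric])
  hence "T u = 0" using x(1) by (simp add: T_def O_mult)
  moreover have "T z = 0"
  proof -
    obtain c where "z = emb c" using z emb_range by (auto simp: ZD1_def)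
    hence "bc z = 0" using U_O[OF Z_U1[OF z]] by (intro dec_eq(2)[of z 0]) simp_all
    thus ?thesis using ac_bc_U1(4)[OF Z_U1[OF z]] by simp
  qed
  ultimately have "T w = 0" using T_mult[OF u1 Z_U1[OF z]] uz by simp
  thus "T (g * w) = T g" using T_mult[OF g Nlev_U1[OF w]] by simp
qed

lemma lint_T: "lint 3 (Yelt p D 3) T = - 1" "lint 3 (Zelt p D 3) T = 0"
  using tau_inverse_pow_sum(3,4)
  by (simp_all only: Yelt_wsum Zelt_wsum lint_wsum[OF linv_T] T_gg[OF zeta_pow_O] rd_zeta_pow)

abbreviation "Rg \<equiv> grLam D :: ('d, 'f) grlam ring"
abbreviation "mp \<equiv> mD_pow D :: nat \<Rightarrow> ('d, 'f) lam set"
abbreviation "cl \<equiv> gr_class \<Lambda> mp"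

lemma reg: "filtered_action \<Lambda> mp \<Lambda> mp (\<lambda>x y. x \<otimes>\<^bsub>\<Lambda>\<^esub> y)"
  by (rule filtered_ring.regular_action[OF Lam_filtered])

lemma cl_mult: "x \<in> mp i \<Longrightarrow> y \<in> mp j \<Longrightarrow> cl i x \<otimes>\<^bsub>Rg\<^esub> cl j y = cl (i + j) (x \<otimes>\<^bsub>\<Lambda>\<^esub> y)"
  using filtered_action.gr_prod_class[OF reg] by (simp add: grLam_def gr_ring_def)

lemma cl_closed: "x \<in> mp k \<Longrightarrow> cl k x \<in> carrier Rg"
  using filtered_action.gr_class_mem[OF reg, of x k] by (simp add: grLam_carrier gr_component_def)

lemma cl_one: "cl 0 \<one>\<^bsub>\<Lambda>\<^esub> = \<one>\<^bsub>Rg\<^esub>" by (simp add: grLam_def gr_ring_def)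
lemma cl_zero: "x \<in> mp (Suc k) \<Longrightarrow> cl k x = \<zero>\<^bsub>Rg\<^esub>"
  using filtered_action.gr_class_zero[OF reg] by (simp add: grLam_def gr_ring_def)
lemma cl_add: "x \<in> mp k \<Longrightarrow> y \<in> mp k \<Longrightarrow> cl k x \<oplus>\<^bsub>Rg\<^esub> cl k y = cl k (x \<oplus>\<^bsub>\<Lambda>\<^esub> y)"
  using filtered_action.gr_add_class[OF reg] by (simp add: grLam_def gr_ring_def)

lemma mp_carrier: "x \<in> mp k \<Longrightarrow> x \<in> carrier \<Lambda>" by (rule ideal.Icarr[OF mD_pow_ideal])

lemma mp_pow: "x \<in> mp (Suc 0) \<Longrightarrow> x [^]\<^bsub>\<Lambda>\<^esub> k \<in> mp k"
proof (induction k)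
  case 0 thus ?case using Lam_one_closed by (simp add: monoid.nat_pow_0[OF ring.is_monoid[OF Lam_ring]])
next
  case (Suc k)
  have "x [^]\<^bsub>\<Lambda>\<^esub> k \<otimes>\<^bsub>\<Lambda>\<^esub> x \<in> mp (k + Suc 0)" by (rule mD_pow_mult[OF Suc.prems Suc.IH[OF Suc.prems]])
  thus ?case by (simp add: monoid.nat_pow_Suc[OF ring.is_monoid[OF Lam_ring]])
qed

lemma cl_pow: "x \<in> mp (Suc 0) \<Longrightarrow> cl (Suc 0) x [^]\<^bsub>Rg\<^esub> k = cl k (x [^]\<^bsub>\<Lambda>\<^esub> k)"
proof (induction k)
  case 0 show ?case
    by (simp add: monoid.nat_pow_0[OF ring.is_monoid[OF Lam_ring]] monoid.nat_pow_0[OF ring.is_monoid[OF grLam_ring]] cl_one)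
next
  case (Suc k)
  have "cl k (x [^]\<^bsub>\<Lambda>\<^esub> k) \<otimes>\<^bsub>Rg\<^esub> cl (Suc 0) x = cl (k + Suc 0) (x [^]\<^bsub>\<Lambda>\<^esub> k \<otimes>\<^bsub>\<Lambda>\<^esub> x)"
    by (rule cl_mult[OF mp_pow[OF Suc.prems] Suc.prems])
  thus ?case using Suc
    by (simp add: monoid.nat_pow_Suc[OF ring.is_monoid[OF Lam_ring]] monoid.nat_pow_Suc[OF ring.is_monoid[OF grLam_ring]])
qed

lemma y_cl: "y_elt p D = cl (Suc 0) (Yelt p D)" and z_cl: "z_elt p D = cl (Suc 0) (Zelt p D)"
  by (simp_all add: y_elt_def z_elt_def One_nat_def)

definition I1 :: "('d, 'f) grlam set" where
  "I1 = Idl\<^bsub>Rg\<^esub> {z_elt p D, y_elt p D [^]\<^bsub>Rg\<^esub> (p + 2)}"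
definition I2 :: "('d, 'f) grlam set" where
  "I2 = Idl\<^bsub>Rg\<^esub> {y_elt p D, z_elt p D [^]\<^bsub>Rg\<^esub> (p + 2)}"

lemma yz_carrier: "{z_elt p D, y_elt p D [^]\<^bsub>Rg\<^esub> (n::nat)} \<subseteq> carrier Rg" "{y_elt p D, z_elt p D [^]\<^bsub>Rg\<^esub> (n::nat)} \<subseteq> carrier Rg"
  unfolding y_cl z_cl using cl_closed[OF Y_mD] cl_closed[OF Z_mD]
  by (simp_all add: monoid.nat_pow_closed[OF ring.is_monoid[OF grLam_ring]])

lemma I1_ideal: "ideal I1 Rg" and I2_ideal: "ideal I2 Rg"
  unfolding I1_def I2_def by (rule ring.genideal_ideal[OF grLam_ring yz_carrier(1)],
      rule ring.genideal_ideal[OF grLam_ring yz_carrier(2)])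

lemma I1_gens: "z_elt p D \<in> I1" "y_elt p D [^]\<^bsub>Rg\<^esub> (p + 2) \<in> I1"
  using ring.genideal_self[OF grLam_ring yz_carrier(1)] unfolding I1_def by blast+
lemma I2_gens: "y_elt p D \<in> I2" "z_elt p D [^]\<^bsub>Rg\<^esub> (p + 2) \<in> I2"
  using ring.genideal_self[OF grLam_ring yz_carrier(2)] unfolding I2_def by blast+

lemma symb_pow:
  assumes "symb 1 x s" "x \<in> mp (Suc 0)"
  shows "symb k (x [^]\<^bsub>\<Lambda>\<^esub> k) (s ^ k)"
proof (induction k)
  case 0
  have "aug (\<one>\<^bsub>\<Lambda>\<^esub> :: ('d, 'f) lam) = 1" by simp
  hence "lint 3 (\<one>\<^bsub>\<Lambda>\<^esub> 3) (\<lambda>_. 1) = (1 :: 'f)" using aug_lint[OF Lam_one_closed, of 3 1] by simp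
  thus ?case using symb_aug[of "\<one>\<^bsub>\<Lambda>\<^esub>"] by (simp add: monoid.nat_pow_0[OF ring.is_monoid[OF Lam_ring]])
next
  case (Suc k)
  have "symb (Suc k) (x [^]\<^bsub>\<Lambda>\<^esub> k \<otimes>\<^bsub>\<Lambda>\<^esub> x) (s ^ k * s)"
    using symb_mult[OF Suc assms(1)] by (simp only: Suc_eq_plus1)
  thus ?case by (simp only: monoid.nat_pow_Suc[OF ring.is_monoid[OF Lam_ring]] power_Suc2)
qed

text \<open>Both generators of \<open>I1\<close> lie in \<open>JJ p\<close>: \<open>z\<close> has
  symbol 0 and \<open>y ^ (p + 2)\<close> has degree beyond \<open>p\<close>. But
  \<open>y ^ p\<close> has the nonzero symbol \<open>(- 1) ^ p\<close>, and symbols are unique in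
  degree \<open>p\<close>.\<close>

lemma y_power_not_mem: "y_elt p D [^]\<^bsub>Rg\<^esub> p \<notin> I1"
proof
  assume mem: "y_elt p D [^]\<^bsub>Rg\<^esub> p \<in> I1"
  have sY: "symb 1 (Yelt p D) (- 1)" using symb_Aug[OF Yelt_Aug] by (simp only: lint_T)
  have sZ: "symb 1 (Zelt p D) 0" using symb_Aug[OF Zelt_Aug] by (simp only: lint_T)
  have "z_elt p D \<in> JJ p" unfolding z_cl
    by (rule gr_class_JJ[OF Z_mD]) (use sZ mp_carrier[OF Z_mD] in \<open>simp add: SS_def One_nat_def\<close>)
  moreover have "y_elt p D [^]\<^bsub>Rg\<^esub> (p + 2) \<in> JJ p" unfolding y_cl cl_pow[OF Y_mD]
    by (rule gr_class_JJ[OF mp_pow[OF Y_mD]]) simp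
  ultimately have "I1 \<subseteq> JJ p" unfolding I1_def
    by (intro ring.genideal_minimal[OF grLam_ring JJ_ideal]) simp
  hence "cl p (Yelt p D [^]\<^bsub>\<Lambda>\<^esub> p) \<in> JJ p" using mem unfolding y_cl cl_pow[OF Y_mD] by blast
  hence sub: "cl p (Yelt p D [^]\<^bsub>\<Lambda>\<^esub> p) p \<subseteq> SS p" by (simp add: JJ_def)
  interpret F: filtered_ring \<Lambda> mp by (rule Lam_filtered)
  have Yp: "Yelt p D [^]\<^bsub>\<Lambda>\<^esub> p \<in> mp p" by (rule mp_pow[OF Y_mD])
  have "Yelt p D [^]\<^bsub>\<Lambda>\<^esub> p \<in> mp (Suc p) +>\<^bsub>\<Lambda>\<^esub> Yelt p D [^]\<^bsub>\<Lambda>\<^esub> p"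
    using F.R.a_mem_coset_iff[OF F.Fil_sub mp_carrier[OF Yp] mp_carrier[OF Yp]]
      additive_subgroup.zero_closed[OF F.Fil_sub[of "Suc p"]] F.R.r_neg[OF mp_carrier[OF Yp]] by (simp add: F.R.minus_eq)
  moreover have "cl p (Yelt p D [^]\<^bsub>\<Lambda>\<^esub> p) p = mp (Suc p) +>\<^bsub>\<Lambda>\<^esub> Yelt p D [^]\<^bsub>\<Lambda>\<^esub> p" by (simp add: gr_class_def)
  ultimately have "Yelt p D [^]\<^bsub>\<Lambda>\<^esub> p \<in> SS p" using sub by blast
  hence "symb p (Yelt p D [^]\<^bsub>\<Lambda>\<^esub> p) 0" by (simp add: SS_def)
  from symb_unique[OF this symb_pow[OF sY Y_mD] order_refl] show False by simp
qed

text \<open>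
  Composing the embedding of the residue field with the Frobenius map gives another instance of
  the setting, in which \<open>y\<close> and \<open>z\<close> are exchanged.
\<close>

lemma z_power_not_mem: "z_elt p D [^]\<^bsub>Rg\<^esub> p \<notin> I2"
proof -
  define D' where "D' = D\<lparr>red := \<lambda>x. rd x ^ p\<rparr>"
  have sel: "qp_abs D' = nrm" "qp_emb D' = emb" "max_ord D' = Od" "unram D' = Ld" "frob D' = frob D"
    "unif D' = \<pi>" "red D' = (\<lambda>x. rd x ^ p)" by (simp_all add: D'_def)
  have "quat_setting p D'"
  proof -
    have qs: "qp_scale D' = qp_scale D" by (intro ext) (simp add: qp_scale_def sel)
    have "is_order D' S = is_order D S" for S by (simp add: is_order_def qs sel)
    hence 1: "is_maximal_order D' Od = is_maximal_order D Od" by (simp add: is_maximal_order_def)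
    have 2: "is_nonsplit_quaternion_algebra D' = is_nonsplit_quaternion_algebra D"
      by (simp add: is_nonsplit_quaternion_algebra_def qs sel)
    have 3: "is_unramified_quadratic p D' Ld = is_unramified_quadratic p D Ld"
      by (simp add: is_unramified_quadratic_def qs sel)
    have 4: "is_nontrivial_automorphism D' Ld (frob D) = is_nontrivial_automorphism D Ld (frob D)"
      by (simp add: is_nontrivial_automorphism_def sel)
    show ?thesis
      using setting unfolding quat_setting_def sel 1 2 3 4
      by (simp add: frobenius_add power_mult_distrib)
  qed
  then interpret Q: quat p D' using prime_p p_ge_5 char_f by unfold_locales
  have U': "UD D' = U" by (intro ext) (simp add: UD_def sel)
  have Z': "ZD1 D' = ZD1 D" by (simp add: ZD1_def U')
  have G': "U1grp D' = G1" by (simp add: U1grp_def U')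
  have N': "Nlev D' = Nlev D" by (intro ext) (simp add: Nlev_def U' Z' G')
  have L': "Lam D' = (\<Lambda> :: ('d, 'f) lam ring)" by (simp add: Lam_def G' N')
  have m': "mD D' = (mD D :: ('d, 'f) lam set)" by (simp add: mD_def L')
  have mp': "mD_pow D' n = mp n" for n by (induction n) (simp_all add: mD_pow.simps L' m')
  have R': "grLam D' = Rg" by (simp add: grLam_def L' mp' ext[of "mD_pow D'" mp])
  have d': "delta D' = (delta D :: 'd \<Rightarrow> ('d, 'f) lam)" by (intro ext) (simp add: delta_def G' N')
  have z': "Q.zeta = zeta" by (simp add: Q.zeta_def zeta_def sel)
  have t': "Q.tau = tau ^ p" by (simp add: Q.tau_def z' tau_def sel)
  have g': "Q.gg = gg" by (intro ext) (simp add: Q.gg_def gg_def sel)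
  have sw: "((tau ^ p) ^ i) = (tau ^ i) ^ p" for i by (simp only: power_mult[symmetric] mult.commute)
  have sw2: "((tau ^ i) ^ p) ^ p = tau ^ i" for i
  proof -
    have "((tau ^ i) ^ p) ^ p = ((tau ^ p) ^ p) ^ i" by (simp only: power_mult[symmetric] mult_ac)
    thus ?thesis by (simp only: tau_pp)
  qed
  have "Yelt p D' = Zelt p D"
    unfolding Q.Yelt_wsum Zelt_wsum
    by (intro ext) (simp add: Q.wsum_def wsum_def d' z' t' g' sw)
  moreover have "Zelt p D' = Yelt p D"
    unfolding Q.Zelt_wsum Yelt_wsum
    by (intro ext) (simp add: Q.wsum_def wsum_def d' z' t' g' sw sw2)
  ultimately have yz: "y_elt p D' = z_elt p D" "z_elt p D' = y_elt p D"
    by (simp_all add: y_elt_def z_elt_def L' ext[of "mD_pow D'" mp, OF mp'])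
  show ?thesis using Q.y_power_not_mem unfolding Q.I1_def I2_def R' yz .
qed

end

context quat
begin

subsection \<open>Conjugation on the Iwasawa algebra\<close>

lemma unit_conj_inv: "g \<in> Od \<Longrightarrow> rd g \<noteq> 0 \<Longrightarrow> inverse g \<in> Od \<and> rd (inverse g) \<noteq> 0"
proof -
  assume g: "g \<in> Od" "rd g \<noteq> 0"
  have i: "inverse g \<in> Od" using unit_inv[OF g] .
  have "g \<noteq> 0" using g(2) by auto
  hence "rd g * rd (inverse g) = 1" using rd_mult[OF g(1) i] by simp
  thus ?thesis using i by auto
qed

lemma Nlev_conj_unit:
  assumes w: "w \<in> Nlev D n" and g: "g \<in> Od" "rd g \<noteq> 0"
  shows "g * w * inverse g \<in> Nlev D n"
proof -
  obtain u z where *: "u \<in> U (Suc n)" "z \<in> ZD1 D" "w = u * z" using w unfolding Nlev_iff by blast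
  have "g * w * inverse g = g * u * (z * inverse g)" by (simp add: * mult.assoc)
  also have "\<dots> = (g * u * inverse g) * z" by (simp add: Z_comm[OF *(2)] mult.assoc)
  finally show ?thesis unfolding Nlev_iff using *(2) U_conj[OF *(1) g] by blast
qed

lemma conj_cs:
  assumes h: "h \<in> U 1" and g: "g \<in> Od" "rd g \<noteq> 0"
  shows "(\<lambda>x. g * x * inverse g) ` cs n h = cs n (g * h * inverse g)"
proof -
  have nz: "g \<noteq> 0" using g(2) by auto
  have h': "g * h * inverse g \<in> U 1" by (rule U_conj[OF h g])
  have sub: "(\<lambda>x. g * x * inverse g) ` cs n h \<subseteq> cs n (g * h * inverse g)"
    if h: "h \<in> U 1" and g: "g \<in> Od" "rd g \<noteq> 0" for g h
  proof (rule image_subsetI)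
    fix x assume "x \<in> cs n h"
    then obtain w where w: "w \<in> Nlev D n" "x = h * w" using cs_mem[OF h] by blast
    have "g \<noteq> 0" using g(2) by auto
    hence "g * x * inverse g = (g * h * inverse g) * (g * w * inverse g)"
      by (simp add: w(2) mult.assoc) (simp add: mult.assoc[symmetric])
    thus "g * x * inverse g \<in> cs n (g * h * inverse g)"
      using cs_mem[OF U_conj[OF h g]] Nlev_conj_unit[OF w(1) g] by blast
  qed
  have "cs n (g * h * inverse g) \<subseteq> (\<lambda>x. g * x * inverse g) ` cs n h"
  proof
    fix y assume y: "y \<in> cs n (g * h * inverse g)"
    have i: "inverse g \<in> Od" "rd (inverse g) \<noteq> 0" using unit_conj_inv[OF g] by auto
    have "inverse g * y * inverse (inverse g) \<in> cs n (inverse g * (g * h * inverse g) * inverse (inverse g))"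
      using subsetD[OF sub[OF h' i] imageI[OF y]] .
    moreover have "inverse g * (g * h * inverse g) * inverse (inverse g) = h"
      using nz by (simp add: mult.assoc) (simp add: mult.assoc[symmetric])
    ultimately have "inverse g * y * g \<in> cs n h" by simp
    moreover have "y = g * (inverse g * y * g) * inverse g"
      using nz by (simp add: mult.assoc) (simp add: mult.assoc[symmetric])
    ultimately show "y \<in> (\<lambda>x. g * x * inverse g) ` cs n h" by (rule_tac image_eqI)
  qed
  thus ?thesis using sub[OF h g] by blast
qed

text \<open>Change of variables: conjugation by a unit permutes the cosets of each level.\<close>

lemma lint_conj:
  assumes g: "g \<in> Od" "rd g \<noteq> 0" and F: "linv n F"
  shows "lint n (lam_conj g \<mu> n) F = lint n (\<mu> n) (\<lambda>x. F (g * x * inverse g))"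
proof -
  have nz: "g \<noteq> 0" using g(2) by auto
  have i: "inverse g \<in> Od" "rd (inverse g) \<noteq> 0" using unit_conj_inv[OF g] by auto
  let ?c = "\<lambda>C. (\<lambda>x. g * x * inverse g) ` C" and ?c' = "\<lambda>C. (\<lambda>x. inverse g * x * g) ` C"
  have inv1: "?c (?c' C) = C" "?c' (?c C) = C" for C
    using nz by (simp_all add: image_image mult.assoc) (simp_all add: mult.assoc[symmetric])
  have cl: "?c C \<in> carrier (lev n)" "?c' C \<in> carrier (lev n)" if C: "C \<in> carrier (lev n)" for C
  proof -
    have r: "rep C \<in> U 1" "cs n (rep C) = C" using lev_rep[OF C] by auto
    show "?c C \<in> carrier (lev n)"
      using conj_cs[OF r(1) g, of n] cs_lev[OF U_conj[OF r(1) g], of n] by (simp only: r(2))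
    show "?c' C \<in> carrier (lev n)"
      using conj_cs[OF r(1) i, of n] cs_lev[OF U_conj[OF r(1) i], of n] by (simp only: r(2) inverse_inverse_eq)
  qed
  show ?thesis unfolding lint_def
  proof (rule sum.reindex_bij_witness[of _ ?c ?c'])
    fix C assume C: "C \<in> carrier (lev n)"
    have C': "?c' C \<in> carrier (lev n)" by (rule cl(2)[OF C])
    have r': "rep (?c' C) \<in> U 1" "rep (?c' C) \<in> ?c' C" using lev_rep[OF C'] by auto
    have "g * rep (?c' C) * inverse g \<in> ?c (?c' C)" using r'(2) by (rule imageI)
    hence "g * rep (?c' C) * inverse g \<in> C" by (simp only: inv1)
    hence "g * rep (?c' C) * inverse g \<in> cs n (rep C)" using lev_rep[OF C] by simp
    hence "F (g * rep (?c' C) * inverse g) = F (rep C)"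
      by (rule linvD[OF F conjunct1[OF lev_rep[OF C]]])
    thus "\<mu> n (?c' C) * F (g * rep (?c' C) * inverse g) = lam_conj g \<mu> n C * F (rep C)"
      by (simp add: lam_conj_def)
  qed (use inv1 cl in auto)
qed

lemma linv_conj:
  assumes g: "g \<in> Od" "rd g \<noteq> 0" and F: "linv n F"
  shows "linv n (\<lambda>x. F (g * x * inverse g))"
  unfolding linv_def
proof (intro ballI)
  fix x w assume x: "x \<in> U 1" and w: "w \<in> Nlev D n"
  have "g \<noteq> 0" using g(2) by auto
  hence "g * (x * w) * inverse g = (g * x * inverse g) * (g * w * inverse g)"
    by (simp add: mult.assoc) (simp add: mult.assoc[symmetric])
  thus "F (g * (x * w) * inverse g) = F (g * x * inverse g)"
    using F U_conj[OF x g] Nlev_conj_unit[OF w g] by (simp add: linv_def)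
qed

lemma lam_conj_Lam:
  assumes g: "g \<in> Od" "rd g \<noteq> 0" and m: "\<mu> \<in> carrier \<Lambda>"
  shows "lam_conj g \<mu> \<in> carrier \<Lambda>"
proof (rule LamI)
  fix n
  have i: "inverse g \<in> Od" "rd (inverse g) \<noteq> 0" using unit_conj_inv[OF g] by auto
  have nz: "g \<noteq> 0" using g(2) by auto
  have "lam_conj g \<mu> n C = 0" if C: "C \<notin> carrier (lev n)" for C
  proof -
    have "(\<lambda>x. inverse g * x * g) ` C \<notin> carrier (lev n)"
    proof
      assume C': "(\<lambda>x. inverse g * x * g) ` C \<in> carrier (lev n)"
      obtain h where h: "h \<in> U 1" "(\<lambda>x. inverse g * x * g) ` C = cs n h" using C' unfolding lev_carrier by blast
      have "(\<lambda>x. g * x * inverse g) ` ((\<lambda>x. inverse g * x * g) ` C) = C"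
        using nz by (simp add: image_image mult.assoc) (simp add: mult.assoc[symmetric])
      hence "C = cs n (g * h * inverse g)" using conj_cs[OF h(1) g, of n] h(2) by simp
      thus False using C cs_lev[OF U_conj[OF h(1) g]] by simp
    qed
    thus ?thesis using Lam_off[OF m] by (simp add: lam_conj_def)
  qed
  thus "lam_conj g \<mu> n \<in> carrier (GA n)" by (simp add: GA_carrier)
  fix F :: "'d \<Rightarrow> 'f" assume F: "linv n F"
  show "lint (Suc n) (lam_conj g \<mu> (Suc n)) F = lint n (lam_conj g \<mu> n) F"
    by (simp only: lint_conj[OF g F] lint_conj[OF g linv_Suc[OF F]] Lam_lint[OF m linv_conj[OF g F]])
qed

lemma Lam_eqI:
  assumes "\<mu> \<in> carrier \<Lambda>" "\<nu> \<in> carrier \<Lambda>" "\<And>n F. linv n F \<Longrightarrow> lint n (\<mu> n) F = lint n (\<nu> n) F"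
  shows "\<mu> = \<nu>"
  by (rule ext, rule GA_eqI[OF Lam_GA[OF assms(1)] Lam_GA[OF assms(2)] assms(3)])

lemma lam_conj_mult:
  assumes g: "g \<in> Od" "rd g \<noteq> 0" and m: "\<mu> \<in> carrier \<Lambda>" "\<nu> \<in> carrier \<Lambda>"
  shows "lam_conj g (\<mu> \<otimes>\<^bsub>\<Lambda>\<^esub> \<nu>) = lam_conj g \<mu> \<otimes>\<^bsub>\<Lambda>\<^esub> lam_conj g \<nu>"
proof (rule Lam_eqI)
  fix n and F :: "'d \<Rightarrow> 'f" assume F: "linv n F"
  have nz: "g \<noteq> 0" using g(2) by auto
  have dist: "g * (x * y) * inverse g = (g * x * inverse g) * (g * y * inverse g)" for x y
    using nz by (simp add: mult.assoc) (simp add: mult.assoc[symmetric])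
  have "lint n (lam_conj g (\<mu> \<otimes>\<^bsub>\<Lambda>\<^esub> \<nu>) n) F
      = lint n (\<mu> n) (\<lambda>x. lint n (\<nu> n) (\<lambda>y. F ((g * x * inverse g) * (g * y * inverse g))))"
    by (simp only: lint_conj[OF g F] Lam_lint_mult[OF linv_conj[OF g F]] dist)
  also have "\<dots> = lint n (\<mu> n) (\<lambda>x. lint n (lam_conj g \<nu> n) (\<lambda>y. F ((g * x * inverse g) * y)))"
    by (rule lint_cong) (rule lint_conj[OF g linv_mult_left[OF F U_conj[OF _ g]], symmetric])
  also have "\<dots> = lint n (lam_conj g \<mu> n) (\<lambda>x. lint n (lam_conj g \<nu> n) (\<lambda>y. F (x * y)))"
    by (rule lint_conj[OF g linv_lint[OF F], symmetric])
  also have "\<dots> = lint n ((lam_conj g \<mu> \<otimes>\<^bsub>\<Lambda>\<^esub> lam_conj g \<nu>) n) F"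
    by (rule Lam_lint_mult[OF F, symmetric])
  finally show "lint n (lam_conj g (\<mu> \<otimes>\<^bsub>\<Lambda>\<^esub> \<nu>) n) F = lint n ((lam_conj g \<mu> \<otimes>\<^bsub>\<Lambda>\<^esub> lam_conj g \<nu>) n) F" .
qed (intro lam_conj_Lam[OF g] Lam_mult_closed m)+

lemma lam_conj_add: "lam_conj g (\<mu> \<oplus>\<^bsub>\<Lambda>\<^esub> \<nu>) = lam_conj g \<mu> \<oplus>\<^bsub>\<Lambda>\<^esub> lam_conj g \<nu>"
  by (intro ext) (simp add: lam_conj_def Lam_add)

lemma aug_conj: "g \<in> Od \<Longrightarrow> rd g \<noteq> 0 \<Longrightarrow> aug (lam_conj g \<mu>) = aug \<mu>"
  unfolding aug_def by (subst lint_conj) simp_all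

lemma lam_conj_mp:
  assumes g: "g \<in> Od" "rd g \<noteq> 0"
  shows "\<mu> \<in> mp n \<Longrightarrow> lam_conj g \<mu> \<in> mp n"
proof (induction n arbitrary: \<mu>)
  case 0 thus ?case using lam_conj_Lam[OF g] by simp
next
  case (Suc n)
  have "\<mu> \<in> mD D \<cdot>\<^bsub>\<Lambda>\<^esub> mp n" using Suc.prems by (simp add: mD_pow.simps)
  thus ?case
  proof (induction \<mu> rule: ideal_prod.induct)
    case (prod a b)
    have a: "a \<in> carrier \<Lambda>" "aug a = 0" using prod(1) by (simp_all add: mD_eq Aug_def)
    have "lam_conj g a \<in> mD D" using lam_conj_Lam[OF g a(1)] aug_conj[OF g] a(2) by (simp add: mD_eq Aug_def)
    from ideal_prod.prod[OF this Suc.IH[OF prod(2)]] show ?case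
      by (simp only: lam_conj_mult[OF g a(1) mp_carrier[OF prod(2)]] mD_pow.simps)
  next
    case (sum a b)
    show ?case unfolding lam_conj_add
      by (rule additive_subgroup.a_closed[OF ideal.axioms(1)[OF mD_pow_ideal] sum.IH(1) sum.IH(2)])
  qed
qed

lemma lam_conj_inv: "g \<noteq> 0 \<Longrightarrow> lam_conj g (lam_conj (inverse g) \<mu>) = \<mu>"
proof (intro ext)
  fix n C assume "g \<noteq> 0"
  hence "(\<lambda>x. inverse (inverse g) * x * inverse g) ` ((\<lambda>x. inverse g * x * g) ` C) = C"
    by (simp add: image_image mult.assoc) (simp add: mult.assoc[symmetric])
  thus "lam_conj g (lam_conj (inverse g) \<mu>) n C = \<mu> n C" by (simp add: lam_conj_def)
qed

lemma gr_conj_closed: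
  assumes g: "g \<in> Od" "rd g \<noteq> 0" and a: "a \<in> carrier Rg"
  shows "gr_conj g a \<in> carrier Rg" "gr_conj g a k = lam_conj g ` (a k)"
proof -
  interpret F: filtered_ring \<Lambda> mp by (rule Lam_filtered)
  have i: "inverse g \<in> Od" "rd (inverse g) \<noteq> 0" using unit_conj_inv[OF g] by auto
  have nz: "g \<noteq> 0" using g(2) by auto
  show "gr_conj g a k = lam_conj g ` (a k)" by (simp add: gr_conj_def)
  have st: "lam_conj g ` mp n = mp n" for n
  proof
    show "lam_conj g ` mp n \<subseteq> mp n" using lam_conj_mp[OF g] by (rule image_subsetI)
    show "mp n \<subseteq> lam_conj g ` mp n"
    proof
      fix x assume "x \<in> mp n"
      hence "lam_conj (inverse g) x \<in> mp n" by (rule lam_conj_mp[OF i])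
      thus "x \<in> lam_conj g ` mp n" by (rule rev_image_eqI) (simp add: lam_conj_inv[OF nz])
    qed
  qed
  have co: "lam_conj g ` (mp n +>\<^bsub>\<Lambda>\<^esub> x) = mp n +>\<^bsub>\<Lambda>\<^esub> lam_conj g x" for n x
  proof -
    have "lam_conj g ` (mp n +>\<^bsub>\<Lambda>\<^esub> x) = (\<lambda>h. h \<oplus>\<^bsub>\<Lambda>\<^esub> lam_conj g x) ` (lam_conj g ` mp n)"
      by (auto simp: a_r_coset_def' lam_conj_add image_iff)
    thus ?thesis unfolding st by (auto simp: a_r_coset_def')
  qed
  have "\<exists>x\<in>mp n. gr_conj g a n = mp (Suc n) +>\<^bsub>\<Lambda>\<^esub> x" for n
  proof (rule bexI)
    show "gr_conj g a n = mp (Suc n) +>\<^bsub>\<Lambda>\<^esub> lam_conj g (rep (a n))"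
      unfolding gr_conj_def co[symmetric] grLam_rep(3)[OF a, of n, symmetric] ..
    show "lam_conj g (rep (a n)) \<in> mp n" by (rule lam_conj_mp[OF g grLam_rep(1)[OF a]])
  qed
  moreover have "{n. gr_conj g a n \<noteq> mp (Suc n)} \<subseteq> {n. a n \<noteq> mp (Suc n)}"
    using st by (auto simp: gr_conj_def)
  hence "finite {n. gr_conj g a n \<noteq> mp (Suc n)}"
    by (rule finite_subset) (use a in \<open>simp add: grLam_carrier gr_carrier_def\<close>)
  ultimately show "gr_conj g a \<in> carrier Rg" by (simp add: grLam_carrier gr_carrier_def)
qed

text \<open>Constant term of a graded element, as the common augmentation of the members of its
  degree 0 coset. Twists and quotient modules are defined through \<open>rep\<close>, and constant
  terms can be computed without knowing that choice.\<close>

definition av :: "('d, 'f) grlam \<Rightarrow> 'f \<Rightarrow> bool" where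
  "av a t \<longleftrightarrow> a \<in> carrier Rg \<and> (\<forall>x\<in>a 0. aug x = t)"

lemma aug_mp_Suc: "x \<in> mp (Suc k) \<Longrightarrow> aug x = 0"
  using subsetD[OF filtered_ring.Fil_mono[OF Lam_filtered, of "Suc 0" "Suc k"]] by (simp add: mD_pow_1 Aug_def)

lemma aug_coset: "y \<in> mp (Suc k) +>\<^bsub>\<Lambda>\<^esub> x \<Longrightarrow> aug y = aug x"
  by (auto simp: a_r_coset_def' aug_add aug_mp_Suc)

lemma av_cl0: "\<mu> \<in> carrier \<Lambda> \<Longrightarrow> av (cl 0 \<mu>) (aug \<mu>)"
  using cl_closed[of \<mu> 0] by (auto simp: av_def gr_class_def dest: aug_coset)

lemma av_add: "av a s \<Longrightarrow> av b t \<Longrightarrow> av (a \<oplus>\<^bsub>Rg\<^esub> b) (s + t)"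
  using abelian_monoid.a_closed[OF abelian_group.axioms(1)[OF ring.is_abelian_group[OF grLam_ring]]]
  by (auto simp: av_def) (auto simp: grLam_def gr_ring_def gr_add_def set_add_def' aug_add)

lemma av_mult:
  assumes a: "av a s" and b: "av b t"
  shows "av (a \<otimes>\<^bsub>Rg\<^esub> b) (s * t)"
proof -
  interpret L: ring \<Lambda> by (rule Lam_ring)
  have ac: "a \<in> carrier Rg" "b \<in> carrier Rg" using a b by (simp_all add: av_def)
  have c: "rep (a 0) \<in> carrier \<Lambda>" "rep (b 0) \<in> carrier \<Lambda>"
    using mp_carrier[OF grLam_rep(1)[OF ac(1)]] mp_carrier[OF grLam_rep(1)[OF ac(2)]] .
  have "(a \<otimes>\<^bsub>Rg\<^esub> b) 0 = mp (Suc 0) +>\<^bsub>\<Lambda>\<^esub> (rep (a 0) \<otimes>\<^bsub>\<Lambda>\<^esub> rep (b 0))"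
    using c by (simp add: grLam_def gr_ring_def gr_prod_def)
  moreover have "aug (rep (a 0)) = s" "aug (rep (b 0)) = t"
    using a b grLam_rep(2)[OF ac(1), of 0] grLam_rep(2)[OF ac(2), of 0] by (simp_all add: av_def)
  ultimately show ?thesis
    using monoid.m_closed[OF ring.is_monoid[OF grLam_ring] ac] by (auto simp: av_def aug_mult dest: aug_coset)
qed

lemma av_unique: "av a s \<Longrightarrow> av a t \<Longrightarrow> s = t"
  using grLam_rep(2)[of a 0] by (auto simp: av_def)

lemma av_conj:
  assumes "g \<in> Od" "rd g \<noteq> 0" "av a t"
  shows "av (gr_conj g a) t"
  using assms gr_conj_closed[OF assms(1,2), of a] by (auto simp: av_def aug_conj)

lemma av_JJ: "a \<in> JJ N \<Longrightarrow> av a 0"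
proof -
  assume a: "a \<in> JJ N"
  have "aug x = 0" if x: "x \<in> a 0" for x
  proof -
    have "x \<in> SS 0" using a x by (auto simp: JJ_def)
    hence "symb 0 x 0" "x \<in> carrier \<Lambda>" by (simp_all add: SS_def)
    hence "lint 3 (x 3) (\<lambda>_. 1) = 0" using symb_unique[OF symb_aug] by blast
    thus ?thesis using aug_lint[OF \<open>x \<in> carrier \<Lambda>\<close>, of 3 1] by simp
  qed
  thus ?thesis using a by (simp add: av_def JJ_def)
qed

text \<open>The generators have positive degree, so both ideals are contained in
  \<open>JJ 0\<close>, whose elements have constant term 0.\<close>

lemma av_ideal: "a \<in> I1 \<Longrightarrow> av a 0" "a \<in> I2 \<Longrightarrow> av a 0"
proof -
  have "cl (Suc k) x \<in> JJ 0" if "x \<in> mp (Suc k)" for k x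
    by (rule gr_class_JJ[OF that]) simp
  hence "{z_elt p D, y_elt p D [^]\<^bsub>Rg\<^esub> (p + 2)} \<subseteq> JJ 0" "{y_elt p D, z_elt p D [^]\<^bsub>Rg\<^esub> (p + 2)} \<subseteq> JJ 0"
    unfolding y_cl z_cl cl_pow[OF Y_mD] cl_pow[OF Z_mD]
    using Y_mD Z_mD mp_pow[OF Y_mD, of "Suc (Suc p)"] mp_pow[OF Z_mD, of "Suc (Suc p)"] by simp_all
  hence "I1 \<subseteq> JJ 0" "I2 \<subseteq> JJ 0" unfolding I1_def I2_def
    using ring.genideal_minimal[OF grLam_ring JJ_ideal[of 0]] by simp_all
  thus "a \<in> I1 \<Longrightarrow> av a 0" "a \<in> I2 \<Longrightarrow> av a 0" using av_JJ by blast+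
qed

end

subsection \<open>The dual of a smooth representation\<close>

lemma field_self_vs: "vector_space ((*) :: 'f::field \<Rightarrow> 'f \<Rightarrow> 'f)"
  by unfold_locales (simp_all add: algebra_simps)

locale smrep = quat p D
  for p :: nat and D :: "('k::field_char_0, 'd::division_ring, 'f::{finite,field}) quat_datum" +
  fixes sc :: "'f \<Rightarrow> 'v::ab_group_add \<Rightarrow> 'v" and act :: "'d \<Rightarrow> 'v \<Rightarrow> 'v"
  assumes smooth: "smooth_rep D sc act"
begin

lemma sc_vs: "vector_space sc" using smooth by (simp add: smooth_rep_def)
lemma act_lin: "g \<noteq> 0 \<Longrightarrow> Vector_Spaces.linear sc sc (act g)" using smooth by (simp add: smooth_rep_def)
lemma act_1 [simp]: "act 1 v = v" using smooth by (simp add: smooth_rep_def)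
lemma act_mult: "g \<noteq> 0 \<Longrightarrow> h \<noteq> 0 \<Longrightarrow> act (g * h) v = act g (act h v)" using smooth by (simp add: smooth_rep_def)
lemma act_Z: "z \<in> ZD1 D \<Longrightarrow> act z v = v" using smooth by (simp add: smooth_rep_def)
lemma act_add: "g \<noteq> 0 \<Longrightarrow> act g (v + w) = act g v + act g w"
  using act_lin[of g] unfolding Vector_Spaces.linear_iff by blast
lemma act_sc: "g \<noteq> 0 \<Longrightarrow> act g (sc c v) = sc c (act g v)"
  using act_lin[of g] unfolding Vector_Spaces.linear_iff by blast

text \<open>Indexed by the level: \<open>fixd n\<close> refers to \<open>U (Suc n)\<close>, the
  group that defines \<open>Nlev D n\<close>.\<close>

definition fixd :: "nat \<Rightarrow> 'v \<Rightarrow> bool" where "fixd n v \<longleftrightarrow> (\<forall>u\<in>U (Suc n). act u v = v)"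

lemma U_Suc_nz: "u \<in> U (Suc n) \<Longrightarrow> u \<noteq> 0" by (erule U_nz) (simp add: One_nat_def)
lemma U1_nz: "u \<in> U 1 \<Longrightarrow> u \<noteq> 0" by (erule U_nz) simp

lemma fixd_ex: "\<exists>n. fixd n v"
proof -
  have "\<exists>n\<ge>1. \<forall>u\<in>U n. act u v = v" using smooth by (simp add: smooth_rep_def)
  then obtain n where n: "n \<ge> 1" "\<forall>u\<in>U n. act u v = v" by blast
  have "Suc (n - 1) = n" using n(1) by (simp add: One_nat_def)
  thus ?thesis using n(2) by (intro exI[of _ "n - 1"]) (simp only: fixd_def)
qed
lemma fixd_le: "fixd m v \<Longrightarrow> m \<le> n \<Longrightarrow> fixd n v"
  unfolding fixd_def using U_mono[of _ "Suc n" "Suc m"] by blast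
lemma fixd_N: "fixd n v \<Longrightarrow> w \<in> Nlev D n \<Longrightarrow> act w v = v"
proof -
  assume f: "fixd n v" and "w \<in> Nlev D n"
  then obtain u z where *: "u \<in> U (Suc n)" "z \<in> ZD1 D" "w = u * z" unfolding Nlev_iff by blast
  have "act w v = act u (act z v)" unfolding *(3) by (rule act_mult[OF U_Suc_nz[OF *(1)] U1_nz[OF Z_U1[OF *(2)]]])
  thus ?thesis using f *(1) by (simp add: act_Z[OF *(2)] fixd_def)
qed
lemma fixd_act: "fixd n v \<Longrightarrow> g \<in> Od \<Longrightarrow> rd g \<noteq> 0 \<Longrightarrow> fixd n (act g v)"
  unfolding fixd_def
proof
  fix u assume f: "\<forall>u\<in>U (Suc n). act u v = v" and g: "g \<in> Od" "rd g \<noteq> 0" and u: "u \<in> U (Suc n)"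
  have nz: "g \<noteq> 0" using g(2) by auto
  have i: "inverse g \<in> Od" "rd (inverse g) \<noteq> 0" using unit_conj_inv[OF g] by auto
  have u': "inverse g * u * inverse (inverse g) \<in> U (Suc n)" by (rule U_conj[OF u i])
  have "u * g = g * (inverse g * u * inverse (inverse g))" using nz by (simp add: mult.assoc[symmetric])
  hence "act u (act g v) = act g (act (inverse g * u * inverse (inverse g)) v)"
    using act_mult[OF U_Suc_nz[OF u] nz] act_mult[OF nz U_Suc_nz[OF u']] by simp
  thus "act u (act g v) = act g v" using f u' by simp
qed
lemma fixd_act1: "fixd n v \<Longrightarrow> g \<in> U 1 \<Longrightarrow> fixd n (act g v)"
  using fixd_act[OF _ U_O, of n v g 1] U_rd[of g 1] by simp
lemma fixd_add: "fixd n v \<Longrightarrow> fixd n w \<Longrightarrow> fixd n (v + w)"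
  unfolding fixd_def by (simp add: act_add U_Suc_nz)
lemma fixd_sc: "fixd n v \<Longrightarrow> fixd n (sc c v)"
  unfolding fixd_def by (simp add: act_sc U_Suc_nz)

text \<open>Matrix coefficient of the dual action. For \<open>v\<close> fixed at level
  \<open>n\<close> it is a test function of that level, which reduces computations in the dual to
  integrals.\<close>

definition fn :: "('v \<Rightarrow> 'f) \<Rightarrow> 'v \<Rightarrow> 'd \<Rightarrow> 'f" where "fn f v g = f (act (inverse g) v)"

lemma linv_fn: "fixd n v \<Longrightarrow> linv n (fn f v)"
  unfolding linv_def
proof (intro ballI)
  fix g w assume f: "fixd n v" and g: "g \<in> U 1" and w: "w \<in> Nlev D n"
  have nz: "g \<noteq> 0" "w \<noteq> 0" using U1_nz g Nlev_U1[OF w] by auto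
  have w': "g * inverse w * inverse g \<in> Nlev D n" by (rule Nlev_conj[OF Nlev_inv[OF w] g])
  have "inverse (g * w) = inverse g * (g * inverse w * inverse g)"
    using nz by (simp add: nonzero_inverse_mult_distrib mult.assoc[symmetric])
  hence "act (inverse (g * w)) v = act (inverse g) (act (g * inverse w * inverse g) v)"
    using act_mult[of "inverse g" "g * inverse w * inverse g" v] nz by simp
  thus "fn f v (g * w) = fn f v g" by (simp only: fn_def fixd_N[OF f w'])
qed

abbreviation "M \<equiv> dual_module D sc act"
abbreviation "lact \<equiv> lam_dual_act D act"
abbreviation "FM \<equiv> dual_filtration D sc act"

text \<open>The definition evaluates at the least level fixing \<open>v\<close>; compatibility of
  \<open>\<mu>\<close> allows any level that fixes \<open>v\<close>. Formulas with several vectors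
  need a common level.\<close>

lemma lact_eq:
  assumes m: "\<mu> \<in> carrier \<Lambda>" and f: "fixd n v"
  shows "lact \<mu> f v = lint n (\<mu> n) (fn f v)"
proof -
  let ?l = "LEAST n. fixd n v"
  have l: "fixd ?l v" by (rule LeastI[of "\<lambda>n. fixd n v", OF f])
  have le: "?l \<le> n" by (rule Least_le[of "\<lambda>n. fixd n v", OF f])
  have "lact \<mu> f v = lint ?l (\<mu> ?l) (fn f v)"
    unfolding lam_dual_act_def Let_def fixd_def[symmetric] lint_def dual_act_def fn_def ..
  thus ?thesis using Lam_lint_le[OF m linv_fn[OF l] le] by simp
qed

lemma M_iff: "f \<in> carrier M \<longleftrightarrow> (\<forall>x y. f (x + y) = f x + f y) \<and> (\<forall>c x. f (sc c x) = c * f x)"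
  by (simp add: dual_module_def Vector_Spaces.linear_iff sc_vs field_self_vs)
lemma M_ops [simp]: "\<zero>\<^bsub>M\<^esub> = (\<lambda>v. 0)" "f \<oplus>\<^bsub>M\<^esub> g = (\<lambda>v. f v + g v)" "x \<odot>\<^bsub>M\<^esub> f = lact x f"
  by (simp_all add: dual_module_def)

lemma M_abelian: "abelian_group M"
proof (rule abelian_groupI)
  fix f assume "f \<in> carrier M"
  thus "\<exists>g\<in>carrier M. g \<oplus>\<^bsub>M\<^esub> f = \<zero>\<^bsub>M\<^esub>" by (intro bexI[of _ "\<lambda>v. - f v"]) (auto simp: M_iff)
qed (auto simp: M_iff algebra_simps)

lemma M_uminus: "f \<in> carrier M \<Longrightarrow> \<ominus>\<^bsub>M\<^esub> f = (\<lambda>v. - f v)"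
  by (rule abelian_group.minus_equality[OF M_abelian]) (auto simp: M_iff)
lemma M_minus: "f \<in> carrier M \<Longrightarrow> g \<in> carrier M \<Longrightarrow> f \<ominus>\<^bsub>M\<^esub> g = (\<lambda>v. f v - g v)"
  by (simp add: a_minus_def M_uminus)

lemma lact_closed:
  assumes f: "f \<in> carrier M" and m: "\<mu> \<in> carrier \<Lambda>"
  shows "lact \<mu> f \<in> carrier M"
  unfolding M_iff
proof (intro conjI allI)
  fix x y
  obtain a b where "fixd a x" "fixd b y" using fixd_ex by blast
  hence n: "fixd (max a b) x" "fixd (max a b) y" using fixd_le by (meson max.cobounded1 max.cobounded2)+
  let ?n = "max a b"
  have "lact \<mu> f (x + y) = lint ?n (\<mu> ?n) (fn f (x + y))" by (rule lact_eq[OF m fixd_add[OF n]])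
  also have "\<dots> = lint ?n (\<mu> ?n) (\<lambda>g. fn f x g + fn f y g)"
    by (rule lint_cong) (use f U1_nz in \<open>simp add: fn_def act_add M_iff\<close>)
  also have "\<dots> = lact \<mu> f x + lact \<mu> f y" by (simp only: lint_add_r lact_eq[OF m n(1)] lact_eq[OF m n(2)])
  finally show "lact \<mu> f (x + y) = lact \<mu> f x + lact \<mu> f y" .
  fix c
  have "lact \<mu> f (sc c x) = lint ?n (\<mu> ?n) (fn f (sc c x))" by (rule lact_eq[OF m fixd_sc[OF n(1)]])
  also have "\<dots> = lint ?n (\<mu> ?n) (\<lambda>g. c * fn f x g)"
    by (rule lint_cong) (use f U1_nz in \<open>simp add: fn_def act_sc M_iff\<close>)
  also have "\<dots> = c * lact \<mu> f x" by (simp only: lint_scale_r lact_eq[OF m n(1)])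
  finally show "lact \<mu> f (sc c x) = c * lact \<mu> f x" .
qed

lemma lact_mult:
  assumes m: "\<mu> \<in> carrier \<Lambda>" "\<nu> \<in> carrier \<Lambda>"
  shows "lact (\<mu> \<otimes>\<^bsub>\<Lambda>\<^esub> \<nu>) f = lact \<mu> (lact \<nu> f)"
proof
  fix v
  obtain n where n: "fixd n v" using fixd_ex by blast
  have "lact (\<mu> \<otimes>\<^bsub>\<Lambda>\<^esub> \<nu>) f v = lint n (\<mu> n) (\<lambda>x. lint n (\<nu> n) (\<lambda>y. fn f v (x * y)))"
    by (simp only: lact_eq[OF Lam_mult_closed[OF m] n] Lam_lint_mult[OF linv_fn[OF n]])
  also have "\<dots> = lint n (\<mu> n) (fn (lact \<nu> f) v)"
  proof (rule lint_cong)
    fix x assume x: "x \<in> U 1"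
    have fx: "fixd n (act (inverse x) v)" by (rule fixd_act1[OF n U_inv[OF x order_refl]])
    have "lint n (\<nu> n) (\<lambda>y. fn f v (x * y)) = lint n (\<nu> n) (fn f (act (inverse x) v))"
    proof (rule lint_cong)
      fix y assume y: "y \<in> U 1"
      have nz: "x \<noteq> 0" "y \<noteq> 0" using U1_nz x y by auto
      show "fn f v (x * y) = fn f (act (inverse x) v) y"
        using nz act_mult[of "inverse y" "inverse x" v] by (simp add: fn_def nonzero_inverse_mult_distrib)
    qed
    thus "lint n (\<nu> n) (\<lambda>y. fn f v (x * y)) = fn (lact \<nu> f) v x"
      by (simp only: fn_def[of "lact \<nu> f"] lact_eq[OF m(2) fx])
  qed
  finally show "lact (\<mu> \<otimes>\<^bsub>\<Lambda>\<^esub> \<nu>) f v = lact \<mu> (lact \<nu> f) v" by (simp only: lact_eq[OF m(1) n])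
qed

lemma lact_add_l: "\<mu> \<in> carrier \<Lambda> \<Longrightarrow> \<nu> \<in> carrier \<Lambda> \<Longrightarrow> lact (\<mu> \<oplus>\<^bsub>\<Lambda>\<^esub> \<nu>) f = (\<lambda>v. lact \<mu> f v + lact \<nu> f v)"
proof
  fix v assume m: "\<mu> \<in> carrier \<Lambda>" "\<nu> \<in> carrier \<Lambda>"
  obtain n where n: "fixd n v" using fixd_ex by blast
  have "\<mu> \<oplus>\<^bsub>\<Lambda>\<^esub> \<nu> \<in> carrier \<Lambda>" unfolding Lam_add by (rule Lam_add_closed[OF m])
  from lact_eq[OF this n] show "lact (\<mu> \<oplus>\<^bsub>\<Lambda>\<^esub> \<nu>) f v = lact \<mu> f v + lact \<nu> f v"
    by (simp only: Lam_add lint_add_l lact_eq[OF m(1) n] lact_eq[OF m(2) n])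
qed

lemma lact_add_r: "\<mu> \<in> carrier \<Lambda> \<Longrightarrow> lact \<mu> (\<lambda>v. f v + g v) = (\<lambda>v. lact \<mu> f v + lact \<mu> g v)"
proof
  fix v assume m: "\<mu> \<in> carrier \<Lambda>"
  obtain n where n: "fixd n v" using fixd_ex by blast
  have "fn (\<lambda>v. f v + g v) v = (\<lambda>x. fn f v x + fn g v x)" by (simp add: fn_def[abs_def])
  thus "lact \<mu> (\<lambda>v. f v + g v) v = lact \<mu> f v + lact \<mu> g v"
    by (simp only: lint_add_r lact_eq[OF m n])
qed

lemma lact_scale_r: "\<mu> \<in> carrier \<Lambda> \<Longrightarrow> lact \<mu> (\<lambda>v. c * f v) = (\<lambda>v. c * lact \<mu> f v)"
proof
  fix v assume m: "\<mu> \<in> carrier \<Lambda>"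
  obtain n where n: "fixd n v" using fixd_ex by blast
  have "fn (\<lambda>v. c * f v) v = (\<lambda>x. c * fn f v x)" by (simp add: fn_def[abs_def])
  thus "lact \<mu> (\<lambda>v. c * f v) v = c * lact \<mu> f v" by (simp only: lint_scale_r lact_eq[OF m n])
qed

lemma lact_scale: "\<mu> \<in> carrier \<Lambda> \<Longrightarrow> lact (lam_scale c \<mu>) f = (\<lambda>v. c * lact \<mu> f v)"
proof
  fix v assume m: "\<mu> \<in> carrier \<Lambda>"
  obtain n where n: "fixd n v" using fixd_ex by blast
  show "lact (lam_scale c \<mu>) f v = c * lact \<mu> f v"
    unfolding lact_eq[OF Lam_scale_closed[OF m] n] lact_eq[OF m n]
    by (simp only: lam_scale_def[abs_def] lint_scale_l)
qed

lemma lact_delta: "g \<in> U 1 \<Longrightarrow> lact (delta D g) f = dual_act act g f"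
proof
  fix v assume g: "g \<in> U 1"
  obtain n where n: "fixd n v" using fixd_ex by blast
  show "lact (delta D g) f v = dual_act act g f v"
    by (simp only: lact_eq[OF delta_Lam[OF g] n] lint_delta[OF g linv_fn[OF n]] fn_def dual_act_def)
qed

lemma lact_one: "lact \<one>\<^bsub>\<Lambda>\<^esub> f = f"
proof -
  have "\<one>\<^bsub>\<Lambda>\<^esub> = delta D 1" by (rule ext) (simp only: Lam_one delta_one)
  thus ?thesis using lact_delta[of 1 f] by (simp add: dual_act_def[abs_def])
qed

lemma FM_eq: "FM n = generate (add_monoid M) {lact \<mu> f | \<mu> f. \<mu> \<in> mp n \<and> f \<in> carrier M}"
  by (simp add: dual_filtration_def Let_def)

lemma FM_gens_M: "{lact \<mu> f | \<mu> f. \<mu> \<in> mp n \<and> f \<in> carrier M} \<subseteq> carrier (add_monoid M)"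
  using lact_closed mp_carrier by auto

lemma FM_sub: "additive_subgroup (FM n) M"
  unfolding FM_eq
  by (intro additive_subgroup.intro group.generate_is_subgroup FM_gens_M abelian_group.a_group[OF M_abelian])

lemma FM_gen: "\<mu> \<in> mp n \<Longrightarrow> f \<in> carrier M \<Longrightarrow> lact \<mu> f \<in> FM n"
  unfolding FM_eq by (rule generate.incl) blast

lemma FM_minimal:
  assumes "additive_subgroup K M" "\<And>\<mu> f. \<mu> \<in> mp n \<Longrightarrow> f \<in> carrier M \<Longrightarrow> lact \<mu> f \<in> K"
  shows "FM n \<subseteq> K"
  unfolding FM_eq
  by (rule group.generate_subgroup_incl[OF abelian_group.a_group[OF M_abelian] _ additive_subgroup.a_subgroup[OF assms(1)]])
    (use assms(2) in auto)

lemma M_subgroupI: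
  assumes "K \<subseteq> carrier M" "(\<lambda>v. 0) \<in> K" "\<And>f g. f \<in> K \<Longrightarrow> g \<in> K \<Longrightarrow> (\<lambda>v. f v + g v) \<in> K"
    "\<And>f. f \<in> K \<Longrightarrow> (\<lambda>v. - f v) \<in> K"
  shows "additive_subgroup K M"
proof (rule additive_subgroup.intro, rule group.subgroupI[OF abelian_group.a_group[OF M_abelian]])
  show "K \<subseteq> carrier (add_monoid M)" "K \<noteq> {}" using assms by auto
  fix a assume a: "a \<in> K"
  have "inv\<^bsub>add_monoid M\<^esub> a = (\<lambda>v. - a v)"
    using M_uminus[of a] a assms(1) by (auto simp: a_inv_def)
  thus "inv\<^bsub>add_monoid M\<^esub> a \<in> K" using assms(4)[OF a] by simp
  fix b assume "b \<in> K" thus "a \<otimes>\<^bsub>add_monoid M\<^esub> b \<in> K" using assms(3)[OF a] by simp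
qed

lemma FM_M: "f \<in> FM n \<Longrightarrow> f \<in> carrier M" using additive_subgroup.a_subset[OF FM_sub] by blast
lemma FM_add: "f \<in> FM n \<Longrightarrow> g \<in> FM n \<Longrightarrow> (\<lambda>v. f v + g v) \<in> FM n"
  using additive_subgroup.a_closed[OF FM_sub] by simp
lemma FM_zero: "(\<lambda>v. 0) \<in> FM n" using additive_subgroup.zero_closed[OF FM_sub] by simp
lemma FM_uminus: "f \<in> FM n \<Longrightarrow> (\<lambda>v. - f v) \<in> FM n"
  using additive_subgroup.a_inv_closed[OF FM_sub, of f n] M_uminus[OF FM_M[of f n]] by simp

lemma lact_uminus_r: "\<mu> \<in> carrier \<Lambda> \<Longrightarrow> lact \<mu> (\<lambda>v. - f v) = (\<lambda>v. - lact \<mu> f v)"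
  using lact_scale_r[of \<mu> "- 1" f] by simp

lemma lact_zero_r: "\<mu> \<in> carrier \<Lambda> \<Longrightarrow> lact \<mu> (\<lambda>v. 0) = (\<lambda>v. 0)"
  using lact_scale_r[of \<mu> 0 "\<lambda>v. 0"] by simp

lemma lact_FM:
  assumes x: "x \<in> mp i" and y: "y \<in> FM j"
  shows "lact x y \<in> FM (i + j)"
proof -
  have xc: "x \<in> carrier \<Lambda>" by (rule mp_carrier[OF x])
  let ?K = "{y \<in> carrier M. lact x y \<in> FM (i + j)}"
  have "additive_subgroup ?K M"
    by (rule M_subgroupI) (auto simp: lact_add_r[OF xc] lact_uminus_r[OF xc] lact_zero_r[OF xc]
        FM_add FM_zero FM_uminus M_iff distrib_left)
  moreover have "lact \<mu> f \<in> ?K" if "\<mu> \<in> mp j" "f \<in> carrier M" for \<mu> f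
    using that lact_closed[OF that(2) mp_carrier[OF that(1)]]
      FM_gen[OF mD_pow_mult[OF that(1) x] that(2)] lact_mult[OF xc mp_carrier[OF that(1)], of f] by simp
  ultimately have "FM j \<subseteq> ?K" by (rule FM_minimal)
  thus ?thesis using y by blast
qed

lemma M_action: "filtered_action \<Lambda> mp M FM lact"
proof (intro filtered_action.intro filtered_action_axioms.intro Lam_filtered M_abelian FM_sub lact_FM)
  show "FM (Suc n) \<subseteq> FM n" for n
    by (rule FM_minimal[OF FM_sub])
      (use filtered_ring.Fil_Suc[OF Lam_filtered, of n] in \<open>auto intro: FM_gen\<close>)
qed (auto simp: lact_closed lact_add_l lact_add_r)

lemma FM_0: "FM 0 = carrier M"
  using FM_M FM_gen[of "\<one>\<^bsub>\<Lambda>\<^esub>" 0] Lam_one_closed by (auto simp: lact_one)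

lemma FM_scale: "f \<in> FM n \<Longrightarrow> (\<lambda>v. c * f v) \<in> FM n"
proof -
  assume f: "f \<in> FM n"
  have "lact (lam_scale c \<one>\<^bsub>\<Lambda>\<^esub>) f \<in> FM (0 + n)"
    by (rule lact_FM[OF _ f]) (simp add: Lam_scale_closed Lam_one_closed)
  thus ?thesis by (simp add: lact_scale[OF Lam_one_closed] lact_one)
qed

abbreviation "th g \<equiv> dual_act act g"

lemma th_M: "g \<noteq> 0 \<Longrightarrow> f \<in> carrier M \<Longrightarrow> th g f \<in> carrier M"
  by (simp add: M_iff dual_act_def act_add act_sc)

lemma th_lact:
  assumes g: "g \<in> Od" "rd g \<noteq> 0" and m: "\<mu> \<in> carrier \<Lambda>"
  shows "th g (lact \<mu> f) = lact (lam_conj g \<mu>) (th g f)"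
proof
  fix v
  have nz: "g \<noteq> 0" using g(2) by auto
  have i: "inverse g \<in> Od" "rd (inverse g) \<noteq> 0" using unit_conj_inv[OF g] by auto
  obtain n where n: "fixd n v" using fixd_ex by blast
  have "th g (lact \<mu> f) v = lint n (\<mu> n) (fn f (act (inverse g) v))"
    by (simp only: dual_act_def lact_eq[OF m fixd_act[OF n i]])
  also have "\<dots> = lint n (\<mu> n) (\<lambda>x. fn (th g f) v (g * x * inverse g))"
  proof (rule lint_cong)
    fix x assume x: "x \<in> U 1"
    have nx: "x \<noteq> 0" using U1_nz[OF x] .
    have "inverse (g * x * inverse g) = g * (inverse x * inverse g)"
      using nz nx by (simp add: nonzero_inverse_mult_distrib mult.assoc)
    hence "act (inverse g) (act (inverse (g * x * inverse g)) v) = act (inverse g * (g * (inverse x * inverse g))) v"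
      using act_mult[of "inverse g" "g * (inverse x * inverse g)" v] nz nx by simp
    also have "inverse g * (g * (inverse x * inverse g)) = inverse x * inverse g"
      using nz by (simp add: mult.assoc[symmetric])
    also have "act (inverse x * inverse g) v = act (inverse x) (act (inverse g) v)"
      using act_mult[of "inverse x" "inverse g" v] nz nx by simp
    finally show "fn f (act (inverse g) v) x = fn (th g f) v (g * x * inverse g)"
      by (simp add: fn_def dual_act_def)
  qed
  also have "\<dots> = lact (lam_conj g \<mu>) (th g f) v"
    by (simp only: lint_conj[OF g linv_fn[OF n], symmetric] lact_eq[OF lam_conj_Lam[OF g m] n])
  finally show "th g (lact \<mu> f) v = lact (lam_conj g \<mu>) (th g f) v" .
qed

lemma th_FM:
  assumes g: "g \<in> Od" "rd g \<noteq> 0"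
  shows "f \<in> FM n \<Longrightarrow> th g f \<in> FM n"
proof -
  have nz: "g \<noteq> 0" using g(2) by auto
  let ?K = "{f \<in> carrier M. th g f \<in> FM n}"
  have "additive_subgroup ?K M"
    by (rule M_subgroupI) (auto simp: dual_act_def[abs_def] FM_add FM_zero FM_uminus M_iff distrib_left)
  moreover have "lact \<mu> f \<in> ?K" if "\<mu> \<in> mp n" "f \<in> carrier M" for \<mu> f
    using FM_gen[OF lam_conj_mp[OF g that(1)] th_M[OF nz that(2)]] lact_closed[OF that(2) mp_carrier[OF that(1)]]
    by (simp add: th_lact[OF g mp_carrier[OF that(1)]])
  ultimately have "FM n \<subseteq> ?K" by (rule FM_minimal)
  thus "f \<in> FM n \<Longrightarrow> th g f \<in> FM n" by blast
qed

lemma th_th_inverse: "g \<noteq> 0 \<Longrightarrow> th g (th (inverse g) f) = f"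
  by (rule ext) (simp add: dual_act_def act_mult[symmetric])

abbreviation "clM \<equiv> gr_class M FM"

lemma hact_class:
  assumes g: "g \<in> Od" "rd g \<noteq> 0" and x: "x \<in> carrier M"
  shows "(\<lambda>n. th g ` clM 0 x n) = clM 0 (th g x)"
proof -
  have nz: "g \<noteq> 0" using g(2) by auto
  have i: "inverse g \<in> Od" "rd (inverse g) \<noteq> 0" using unit_conj_inv[OF g] by auto
  have st: "th g ` FM n = FM n" for n
  proof
    show "th g ` FM n \<subseteq> FM n" using th_FM[OF g] by (rule image_subsetI)
    show "FM n \<subseteq> th g ` FM n"
    proof
      fix f assume "f \<in> FM n"
      hence "th (inverse g) f \<in> FM n" by (rule th_FM[OF i])
      thus "f \<in> th g ` FM n" by (rule rev_image_eqI) (simp add: th_th_inverse[OF nz])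
    qed
  qed
  have "th g ` (FM n +>\<^bsub>M\<^esub> x) = (\<lambda>h v. h v + th g x v) ` (th g ` FM n)" for n
    by (auto simp: a_r_coset_def' dual_act_def[abs_def] image_iff)
  hence "th g ` (FM n +>\<^bsub>M\<^esub> x) = FM n +>\<^bsub>M\<^esub> th g x" for n
    unfolding st by (auto simp: a_r_coset_def')
  thus ?thesis using st by (auto simp: gr_class_def gr_zero_def fun_eq_iff)
qed

end

subsection \<open>How far the unit groups raise the filtration\<close>

lemma sum_fun_eval: "(\<Sum>i\<in>I. F i) v = (\<Sum>i\<in>I. F i v)"
  by (induction I rule: infinite_finite_induct) simp_all

context smrep
begin

text \<open>Functionals are viewed in the space of all functions with pointwise operations, where
  sums and kernels of the various filtrations can be formed as subspaces.\<close>

definition fsc :: "'f \<Rightarrow> ('v \<Rightarrow> 'f) \<Rightarrow> 'v \<Rightarrow> 'f" where "fsc c f v = c * f v"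

end

sublocale smrep \<subseteq> fs: vector_space fsc
  by unfold_locales (simp_all add: fun_eq_iff fsc_def algebra_simps)

context smrep
begin

lemma M_sub: "fs.subspace (carrier M)"
  by (simp add: fs.subspace_def M_iff fsc_def algebra_simps)

lemma FM_subspace: "fs.subspace (FM n)"
proof -
  have "f + g = (\<lambda>v. f v + g v)" "fsc c f = (\<lambda>v. c * f v)" "(0 :: 'v \<Rightarrow> 'f) = (\<lambda>v. 0)" for f g :: "'v \<Rightarrow> 'f" and c
    by (simp_all add: fun_eq_iff fsc_def)
  thus ?thesis using FM_add FM_zero FM_scale by (simp add: fs.subspace_def)
qed

lemma FM_mono: "m \<le> n \<Longrightarrow> f \<in> FM n \<Longrightarrow> f \<in> FM m"
  using filtered_action.FA_mono[OF M_action, of m n] by blast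

lemma lact_add: "\<mu> \<in> carrier \<Lambda> \<Longrightarrow> lact \<mu> (f + g) = lact \<mu> f + lact \<mu> g"
  using lact_add_r[of \<mu> f g] by (simp add: plus_fun_def)
lemma lact_fsc: "\<mu> \<in> carrier \<Lambda> \<Longrightarrow> lact \<mu> (fsc c f) = fsc c (lact \<mu> f)"
  using lact_scale_r[of \<mu> c f] by (simp add: fsc_def[abs_def])
lemma lact_diff: "\<mu> \<in> carrier \<Lambda> \<Longrightarrow> lact \<mu> (f - g) = lact \<mu> f - lact \<mu> g"
  using lact_add[of \<mu> "f - g" g] by simp

lemma th_add: "th g (f + h) = th g f + th g h"
  and th_diff: "th g (f - h) = th g f - th g h"
  and th_fsc: "th g (fsc c f) = fsc c (th g f)"
  by (simp_all add: fun_eq_iff dual_act_def fsc_def)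

lemma th_one: "th 1 f = f"
  by (rule ext) (simp add: dual_act_def)

lemma th_sum: "th g (\<Sum>i\<in>I. F i) = (\<Sum>i\<in>I. th g (F i))"
  by (simp add: fun_eq_iff dual_act_def sum_fun_eval)

lemma th_mult: "g \<noteq> 0 \<Longrightarrow> h \<noteq> 0 \<Longrightarrow> th (g * h) f = th g (th h f)"
  by (rule ext) (simp add: dual_act_def nonzero_inverse_mult_distrib act_mult)

lemma th_power: "g \<noteq> 0 \<Longrightarrow> (th g ^^ m) f = th (g ^ m) f"
  by (induction m) (simp_all add: th_one th_mult)

lemma th_linear: "Vector_Spaces.linear fsc fsc (th g)"
  by (simp add: Vector_Spaces.linear_iff fs.vector_space_axioms th_add th_fsc)

lemma U1_unit: "g \<in> U 1 \<Longrightarrow> g \<in> Od" "g \<in> U 1 \<Longrightarrow> rd g \<noteq> 0" "g \<in> U 1 \<Longrightarrow> g \<noteq> 0"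
  using U_O U_rd[of g 1] U1_nz by auto

text \<open>Modulo this space the group acts through a finite quotient, so that approximation by
  \<open>p\<close>-th powers terminates.\<close>

definition KM :: "nat \<Rightarrow> ('v \<Rightarrow> 'f) set" where
  "KM n = {f \<in> carrier M. \<forall>v. fixd n v \<longrightarrow> f v = 0}"

definition V :: "nat \<Rightarrow> nat \<Rightarrow> ('v \<Rightarrow> 'f) set" where
  "V n j = {f + k | f k. f \<in> FM j \<and> k \<in> KM n}"

lemma KM_sub: "fs.subspace (KM n)"
  using M_sub by (simp add: fs.subspace_def KM_def fsc_def)

lemma V_sub: "fs.subspace (V n j)"
  unfolding V_def by (rule fs.subspace_sums[OF FM_subspace KM_sub])

lemmas V_add = fs.subspace_add[OF V_sub]
  and V_diff = fs.subspace_diff[OF V_sub]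
  and V_fsc = fs.subspace_scale[OF V_sub]
  and V_zero = fs.subspace_0[OF V_sub]
  and V_sum = fs.subspace_sum[OF V_sub]
  and V_neg = fs.subspace_neg[OF V_sub]

lemma FM_V: "f \<in> FM j \<Longrightarrow> f \<in> V n j"
  unfolding V_def using fs.subspace_0[OF KM_sub, of n] by (intro CollectI exI[of _ f] exI[of _ 0]) simp
lemma KM_V: "f \<in> KM n \<Longrightarrow> f \<in> V n j"
  unfolding V_def using fs.subspace_0[OF FM_subspace, of j] by (intro CollectI exI[of _ 0] exI[of _ f]) simp
lemma V_mono: "f \<in> V n k \<Longrightarrow> j \<le> k \<Longrightarrow> f \<in> V n j"
  unfolding V_def using FM_mono[of j k] by blast
lemma V_M: "f \<in> V n j \<Longrightarrow> f \<in> carrier M"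
  unfolding V_def KM_def using FM_M fs.subspace_add[OF M_sub] by blast
lemma M_V: "f \<in> carrier M \<Longrightarrow> f \<in> V n 0"
  by (rule FM_V) (simp add: FM_0)

lemma KM_th: "g \<in> Od \<Longrightarrow> rd g \<noteq> 0 \<Longrightarrow> f \<in> KM n \<Longrightarrow> th g f \<in> KM n"
proof -
  assume g: "g \<in> Od" "rd g \<noteq> 0" and f: "f \<in> KM n"
  have i: "inverse g \<in> Od" "rd (inverse g) \<noteq> 0" using unit_conj_inv[OF g] by auto
  have "g \<noteq> 0" using g(2) by auto
  thus ?thesis using f th_M fixd_act[OF _ i] by (simp add: KM_def dual_act_def)
qed

lemma th_V: "g \<in> Od \<Longrightarrow> rd g \<noteq> 0 \<Longrightarrow> f \<in> V n j \<Longrightarrow> th g f \<in> V n j"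
proof -
  assume g: "g \<in> Od" "rd g \<noteq> 0" and "f \<in> V n j"
  then obtain h k where *: "h \<in> FM j" "k \<in> KM n" "f = h + k" unfolding V_def by blast
  show ?thesis unfolding *(3) th_add
    by (rule V_add[OF FM_V[OF th_FM[OF g *(1)]] KM_V[OF KM_th[OF g *(2)]]])
qed

lemma th_V1: "g \<in> U 1 \<Longrightarrow> f \<in> V n j \<Longrightarrow> th g f \<in> V n j"
  by (rule th_V[OF U1_unit(1,2)])

text \<open>\<open>delta D g - 1\<close> has augmentation 0 and thus lies in the maximal ideal,
  while \<open>KM n\<close> is stable under the group.\<close>

lemma raise_1:
  assumes g: "g \<in> U 1" and f: "f \<in> V n j"
  shows "th g f - f \<in> V n (j + 1)"
proof -
  interpret A: filtered_action \<Lambda> mp M FM lact by (rule M_action)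
  obtain h k where *: "h \<in> FM j" "k \<in> KM n" "f = h + k" using f unfolding V_def by blast
  have o: "\<one>\<^bsub>\<Lambda>\<^esub> \<in> carrier \<Lambda>" and d: "delta D g \<in> carrier \<Lambda>" by (rule Lam_one_closed, rule delta_Lam[OF g])
  have h: "h \<in> carrier M" by (rule FM_M[OF *(1)])
  have m: "delta D g \<ominus>\<^bsub>\<Lambda>\<^esub> \<one>\<^bsub>\<Lambda>\<^esub> \<in> mp (Suc 0)"
    using abelian_group.minus_closed[OF ring.is_abelian_group[OF Lam_ring] d o]
    by (simp add: mD_pow_1 Aug_def aug_minus[OF d o] aug_delta[OF g])
  have "lact (delta D g \<ominus>\<^bsub>\<Lambda>\<^esub> \<one>\<^bsub>\<Lambda>\<^esub>) h = (\<lambda>v. th g h v - h v)"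
    using A.act_minus_l[OF d o h] M_minus[OF lact_closed[OF h d] lact_closed[OF h o]]
    by (simp only: lact_delta[OF g] lact_one)
  hence "th g h - h = lact (delta D g \<ominus>\<^bsub>\<Lambda>\<^esub> \<one>\<^bsub>\<Lambda>\<^esub>) h" by (simp add: fun_eq_iff)
  hence 1: "th g h - h \<in> FM (j + 1)" using lact_FM[OF m *(1)] by (simp add: One_nat_def)
  have 2: "th g k - k \<in> KM n" by (rule fs.subspace_diff[OF KM_sub KM_th[OF U1_unit(1,2)[OF g] *(2)] *(2)])
  have "th g f - f = (th g h - h) + (th g k - k)" by (simp add: *(3) th_add)
  thus ?thesis using V_add[OF FM_V[OF 1, of n] KM_V[OF 2]] by simp
qed

lemma raise_base:
  assumes u: "u \<in> U (Suc n)" and f: "f \<in> carrier M"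
  shows "th u f - f \<in> KM n"
proof -
  have "inverse u \<in> U (Suc n)" by (rule U_inv[OF u]) (simp add: One_nat_def)
  thus ?thesis using fs.subspace_diff[OF M_sub th_M[OF U_Suc_nz[OF u] f] f]
    by (simp add: KM_def dual_act_def fixd_def)
qed

definition raises :: "nat \<Rightarrow> 'd \<Rightarrow> nat \<Rightarrow> bool" where
  "raises n g a \<longleftrightarrow> (\<forall>j. \<forall>f\<in>V n j. th g f - f \<in> V n (j + a))"

lemma raisesD: "raises n g a \<Longrightarrow> f \<in> V n j \<Longrightarrow> th g f - f \<in> V n (j + a)"
  by (simp add: raises_def)

lemma raises_mult:
  assumes nz: "g \<noteq> 0" "h \<noteq> 0" and r: "raises n g a" "raises n h a"
  shows "raises n (g * h) a"
  unfolding raises_def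
proof (intro allI ballI)
  fix j f assume f: "f \<in> V n j"
  have d: "th h f - f \<in> V n (j + a)" by (rule raisesD[OF r(2) f])
  have "f + (th h f - f) \<in> V n j" by (rule V_add[OF f V_mono[OF d]]) simp
  hence "th h f \<in> V n j" by simp
  from V_add[OF raisesD[OF r(1) this] d]
  show "th (g * h) f - f \<in> V n (j + a)" by (simp add: th_mult[OF nz])
qed

lemma raises_iterate:
  assumes "raises n g a" "f \<in> V n j"
  shows "((\<lambda>x. th g x - x) ^^ m) f \<in> V n (j + m * a)"
proof (induction m)
  case (Suc m)
  have "j + Suc m * a = j + m * a + a" by simp
  with raisesD[OF assms(1) Suc.IH] show "((\<lambda>x. th g x - x) ^^ Suc m) f \<in> V n (j + Suc m * a)"
    by (simp only: funpow.simps(2) o_apply)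
qed (simp add: assms(2))

lemma th_power_p: "g \<noteq> 0 \<Longrightarrow> th (g ^ p) f - f = ((\<lambda>x. th g x - x) ^^ p) (f :: 'v \<Rightarrow> 'f)"
proof -
  assume g: "g \<noteq> 0"
  show ?thesis
    using fs.linear_power_p_minus_one[OF prime_p odd_p of_nat_p_f th_linear[of g], of f] th_power[OF g, of p f]
    by (simp only:)
qed

text \<open>In characteristic \<open>p\<close> the operator of \<open>g ^ p\<close> minus 1 is the
  \<open>p\<close>-fold iterate of the operator of \<open>g\<close> minus 1.\<close>

lemma raises_power_p:
  assumes nz: "g \<noteq> 0" and r: "raises n g a"
  shows "raises n (g ^ p) (p * a)"
  unfolding raises_def
proof (intro allI ballI)
  fix j f assume f: "f \<in> V n j"
  show "th (g ^ p) f - f \<in> V n (j + p * a)"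
    unfolding th_power_p[OF nz] by (rule raises_iterate[OF r f])
qed

text \<open>Modulo \<^term>\<open>KM n\<close> the subgroup at level \<^term>\<open>n\<close> acts trivially, so one may descend from it.\<close>

lemma raises_descent:
  assumes k0: "3 \<le> k0" and r: "\<And>g. g \<in> U (k0 - 2) \<Longrightarrow> raises n g a"
  shows "k0 \<le> k \<Longrightarrow> u \<in> U k \<Longrightarrow> raises n u (p * a)"
proof (induction "Suc n - k" arbitrary: k u rule: less_induct)
  case less
  show ?case
  proof (cases "Suc n \<le> k")
    case True
    have "u \<in> U (Suc n)" by (rule U_mono[OF less.prems(2) True])
    thus ?thesis unfolding raises_def using KM_V[OF raise_base] V_M by blast
  next
    case False
    have k3: "k \<ge> 3" using k0 less.prems(1) by simp
    obtain g u' where *: "g \<in> U (k - 2)" "u' \<in> U (Suc k)" "u = g ^ p * u'"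
      using U_root_approx[OF less.prems(2) k3] by blast
    have "1 \<le> k - 2" using k3 by simp
    hence nz: "g \<noteq> 0" by (rule U_nz[OF *(1)])
    have g: "raises n g a" by (rule r, rule U_mono[OF *(1)]) (use less.prems(1) in simp)
    have u': "raises n u' (p * a)" by (rule less.hyps[OF _ _ *(2)]) (use False less.prems(1) in simp_all)
    show ?thesis unfolding *(3)
      by (rule raises_mult[OF _ U_Suc_nz[OF *(2)] raises_power_p[OF nz g] u']) (simp add: nz)
  qed
qed

lemma raises_U1: "g \<in> U 1 \<Longrightarrow> raises n g 1"
  unfolding raises_def using raise_1 by blast

lemma raises_U3: "u \<in> U 3 \<Longrightarrow> raises n u p"
proof -
  assume u: "u \<in> U 3"
  have r: "raises n g 1" if "g \<in> U (3 - 2)" for g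
    using that raises_U1[of g n] by (simp add: One_nat_def)
  show ?thesis using raises_descent[OF order_refl r order_refl u] by simp
qed

text \<open>By \<open>U2_decomp\<close> a unit of level 2 is a commutator of elements of
  \<open>U 1\<close>, up to the centre, which acts trivially, and up to \<open>U 3\<close>, which
  raises by \<open>p\<close>. A commutator of elements whose differences with 1 raise by 1 raises by
  2.\<close>

lemma raises_U2:
  assumes u: "u \<in> U 2"
  shows "raises n u 2"
  unfolding raises_def
proof (intro allI ballI)
  fix j f assume f: "f \<in> V n j"
  obtain a b z u' where *: "a \<in> U 1" "b \<in> U 1" "z \<in> ZD1 D" "u' \<in> U 3" "u * (b * a) = (a * b) * z * u'"
    using U2_decomp[OF u] by blast
  have nz: "a \<noteq> 0" "b \<noteq> 0" "z \<noteq> 0" "u' \<noteq> 0" "u \<noteq> 0"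
    using U1_nz[OF *(1)] U1_nz[OF *(2)] U1_nz[OF Z_U1[OF *(3)]] U_nz[OF *(4)] U_nz[OF u] by simp_all
  have i: "inverse a \<in> U 1" "inverse b \<in> U 1" using U_inv[OF *(1)] U_inv[OF *(2)] by simp_all
  \<comment> \<open>Chosen with \<open>th b (th a h) = f\<close>, so that the relation between the
    two products applies to \<open>h\<close>.\<close>
  define h where "h = th (inverse a) (th (inverse b) f)"
  have hV: "h \<in> V n j" unfolding h_def by (intro th_V1 i f)
  have fh: "f = th b (th a h)" by (simp only: h_def th_th_inverse[OF nz(1)] th_th_inverse[OF nz(2)])
  have z: "th z x = x" for x :: "'v \<Rightarrow> 'f"
    using Z_inv[OF *(3)] by (simp add: fun_eq_iff dual_act_def act_Z)
  have "th u f = th u (th b (th a h))" by (simp only: fh[symmetric])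
  also have "\<dots> = th (u * (b * a)) h"
    using nz th_mult[of u "b * a" h] th_mult[of b a h] by simp
  also have "\<dots> = th ((a * b) * z * u') h" by (simp only: *(5))
  also have "\<dots> = th a (th b (th u' h))"
    using nz th_mult[of "a * b * z" u' h] th_mult[of "a * b" z "th u' h"] th_mult[of a b "th u' h"] z by simp
  finally have e: "th u f = th a (th b (th u' h))" .
  have d: "th u' h - h \<in> V n (j + 2)"
    by (rule V_mono[OF raisesD[OF raises_U3[OF *(4)] hV]]) (use p_ge_5 in simp)
  have A: "th a h - h \<in> V n (j + 1)" and B: "th b h - h \<in> V n (j + 1)"
    using raise_1[OF *(1) hV] raise_1[OF *(2) hV] .
  have AB: "th a (th b h - h) - (th b h - h) \<in> V n (j + 2)"
    and BA: "th b (th a h - h) - (th a h - h) \<in> V n (j + 2)"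
    using raise_1[OF *(1) B] raise_1[OF *(2) A] by (simp_all only: add.assoc one_add_one)
  have "th u f - f = th a (th b (th u' h - h))
      + ((th a (th b h - h) - (th b h - h)) - (th b (th a h - h) - (th a h - h)))"
    unfolding e th_diff by (subst fh) simp
  also have "\<dots> \<in> V n (j + 2)"
    by (intro V_add V_diff AB BA th_V1 *(1) *(2) d)
  finally show "th u f - f \<in> V n (j + 2)" .
qed

text \<open>Elements of \<open>U 4\<close> are approximated by \<open>p\<close>-th powers of
  elements of \<open>U 2\<close>, which raise by 2; this doubles the gain known for
  \<open>U 3\<close>.\<close>

lemma raises_U4: "u \<in> U 4 \<Longrightarrow> raises n u (p * 2)"
proof -
  assume u: "u \<in> U 4"
  have r: "raises n g 2" if "g \<in> U (4 - 2)" for g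
    using that raises_U2[of g n] by simp
  show ?thesis by (rule raises_descent[OF _ r order_refl u]) simp
qed

text \<open>On vectors fixed at level \<open>n\<close> the measure acts through its component at
  that level; its total mass being 0, each group element may be replaced by its difference with
  1.\<close>

lemma Aug_lact:
  assumes a: "a \<in> Aug" and h: "h \<in> carrier M"
  shows "lact a h - (\<Sum>C\<in>carrier (lev n). fsc (a n C) (th (rep C) h - h)) \<in> KM n"
proof -
  have ac: "a \<in> carrier \<Lambda>" "aug a = 0" using a by (simp_all add: Aug_def)
  have "lact a h - (\<Sum>C\<in>carrier (lev n). fsc (a n C) (th (rep C) h - h)) \<in> carrier M"
    using lev_rep U1_nz th_M h lact_closed[OF h ac(1)]
    by (intro fs.subspace_diff[OF M_sub] fs.subspace_sum[OF M_sub] fs.subspace_scale[OF M_sub]) blast+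
  moreover have "lact a h v = (\<Sum>C\<in>carrier (lev n). fsc (a n C) (th (rep C) h - h)) v" if v: "fixd n v" for v
  proof -
    have "lact a h v = lint n (a n) (\<lambda>g. (fn h v g - h v) + h v)"
      unfolding lact_eq[OF ac(1) v] by (rule lint_cong) simp
    also have "\<dots> = lint n (a n) (\<lambda>g. fn h v g - h v)"
      by (simp only: lint_add_r aug_lint[OF ac(1)] ac(2) mult_zero_right add_0_right)
    finally show ?thesis by (simp add: lint_def sum_fun_eval fsc_def fn_def dual_act_def)
  qed
  ultimately show ?thesis by (simp add: KM_def)
qed

text \<open>The next filtration step is generated by augmentation elements applied to the present
  one, and modulo \<open>KM n\<close> these are combinations of differences \<open>g - 1\<close>.
  The criterion bounds the filtration from above, both for the expansion in generators and for
  Nakayama's lemma.\<close>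

lemma V_Suc_subset:
  assumes S: "fs.subspace S" and KS: "KM n \<subseteq> S"
    and st: "\<And>f g. f \<in> V n j \<Longrightarrow> g \<in> U 1 \<Longrightarrow> th g f - f \<in> S"
  shows "V n (Suc j) \<subseteq> S"
proof -
  have Aug: "lact a h \<in> S" if a: "a \<in> Aug" and h: "h \<in> FM j" for a h
  proof -
    let ?s = "\<Sum>C\<in>carrier (lev n). fsc (a n C) (th (rep C) h - h)"
    have "?s \<in> S"
      using lev_rep st[OF FM_V[OF h]] by (intro fs.subspace_sum[OF S] fs.subspace_scale[OF S]) blast
    moreover have "lact a h - ?s \<in> S" using Aug_lact[OF a FM_M[OF h], of n] KS by blast
    ultimately have "(lact a h - ?s) + ?s \<in> S" by (intro fs.subspace_add[OF S])
    thus ?thesis by simp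
  qed
  let ?K = "S \<inter> carrier M"
  have sub: "fs.subspace ?K" by (rule fs.subspace_inter[OF S M_sub])
  have "additive_subgroup ?K M"
  proof (rule M_subgroupI)
    show "(\<lambda>v. 0) \<in> ?K" using fs.subspace_0[OF sub] by (simp add: zero_fun_def)
    show "(\<lambda>v. f v + g v) \<in> ?K" if "f \<in> ?K" "g \<in> ?K" for f g
      using fs.subspace_add[OF sub that] by (simp add: plus_fun_def)
    show "(\<lambda>v. - f v) \<in> ?K" if "f \<in> ?K" for f
      using fs.subspace_neg[OF sub that] by (simp add: fun_Compl_def)
  qed blast
  moreover have "lact \<mu> f \<in> ?K" if m: "\<mu> \<in> mp (Suc j)" and f: "f \<in> carrier M" for \<mu> f
  proof -
    have "\<mu> \<in> mD D \<cdot>\<^bsub>\<Lambda>\<^esub> mp j" using m by (simp only: mD_pow.simps)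
    hence "\<mu> \<in> carrier \<Lambda> \<and> lact \<mu> f \<in> ?K"
    proof (induction \<mu> rule: ideal_prod.induct)
      case (prod a b)
      have a: "a \<in> Aug" "a \<in> carrier \<Lambda>" using prod(1) by (simp_all add: mD_eq Aug_def)
      have b: "b \<in> carrier \<Lambda>" by (rule mp_carrier[OF prod(2)])
      show ?case unfolding lact_mult[OF a(2) b]
        using Aug[OF a(1) FM_gen[OF prod(2) f]] lact_closed[OF lact_closed[OF f b] a(2)]
          Lam_mult_closed[OF a(2) b] by blast
    next
      case (sum a b)
      have "lact (a \<oplus>\<^bsub>\<Lambda>\<^esub> b) f = lact a f + lact b f"
        using lact_add_l[of a b f] sum.IH by (simp add: plus_fun_def)
      moreover have "a \<oplus>\<^bsub>\<Lambda>\<^esub> b \<in> carrier \<Lambda>" unfolding Lam_add using Lam_add_closed sum.IH by blast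
      ultimately show "a \<oplus>\<^bsub>\<Lambda>\<^esub> b \<in> carrier \<Lambda> \<and> lact (a \<oplus>\<^bsub>\<Lambda>\<^esub> b) f \<in> ?K"
        using fs.subspace_add[OF sub, of "lact a f" "lact b f"] sum.IH by (simp only: simp_thms)
    qed
    thus ?thesis by blast
  qed
  ultimately have "FM (Suc j) \<subseteq> ?K" by (rule FM_minimal)
  thus ?thesis unfolding V_def using KS fs.subspace_add[OF S] by blast
qed

section \<open>Y and Z as leading terms of the group action\<close>

abbreviation "Yo \<equiv> lact (Yelt p D)"
abbreviation "Zo \<equiv> lact (Zelt p D)"

lemma Yelt_Lam: "Yelt p D \<in> carrier \<Lambda>" and Zelt_Lam: "Zelt p D \<in> carrier \<Lambda>"
  using mp_carrier[OF Y_mD] mp_carrier[OF Z_mD] .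

lemma lact_wsum: "lact (wsum w) f = (\<Sum>i<q - 1. fsc (w (tau ^ i)) (th (gg (zeta ^ i)) f))"
proof
  fix v
  obtain n where n: "fixd n v" using fixd_ex by blast
  show "lact (wsum w) f v = (\<Sum>i<q - 1. fsc (w (tau ^ i)) (th (gg (zeta ^ i)) f)) v"
    unfolding lact_eq[OF wsum_Lam n] lint_wsum[OF linv_fn[OF n]]
    by (simp add: sum_fun_eval fsc_def fn_def dual_act_def)
qed

lemma Yo_eq: "Yo f = (\<Sum>i<q - 1. fsc (inverse (tau ^ i)) (th (gg (zeta ^ i)) f))"
  and Zo_eq: "Zo f = (\<Sum>i<q - 1. fsc (inverse ((tau ^ i) ^ p)) (th (gg (zeta ^ i)) f))"
  unfolding Yelt_wsum Zelt_wsum by (rule lact_wsum)+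

definition ph :: "('v \<Rightarrow> 'f) \<Rightarrow> 'd \<Rightarrow> 'v \<Rightarrow> 'f" where "ph f t = th (gg t) f - f"

lemma ph_V: "f \<in> V n j \<Longrightarrow> t \<in> Od \<Longrightarrow> ph f t \<in> V n (j + 1)"
  unfolding ph_def by (rule raise_1[OF gg_U])

lemma ph_0: "ph f 0 = 0"
  by (simp add: ph_def gg_def th_one)

text \<open>\<open>gg\<close> is additive modulo \<open>U 2\<close>, which raises by 2; the product
  of two differences raises by 2 as well.\<close>

lemma ph_add:
  assumes f: "f \<in> V n j" and O: "s \<in> Od" "t \<in> Od" "r \<in> Od" and rd: "rd r = rd s + rd t"
  shows "ph f r - (ph f s + ph f t) \<in> V n (j + 2)"
proof -
  obtain u where u: "u \<in> U 2" "gg s * gg t = gg r * u" using gg_add[OF O rd] by blast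
  have nz: "gg s \<noteq> 0" "gg t \<noteq> 0" "gg r \<noteq> 0" "u \<noteq> 0"
    using U1_nz gg_U O U_nz[OF u(1)] by auto
  have "th (gg s * gg t) f = th (gg r * u) f" by (simp only: u(2))
  hence e: "th (gg s) (th (gg t) f) = th (gg r) (th u f)" using nz by (simp add: th_mult)
  have d: "th u f - f \<in> V n (j + 2)" by (rule raisesD[OF raises_U2[OF u(1)] f])
  have "th (gg s) (ph f t) - ph f t \<in> V n (j + 1 + 1)" by (rule raise_1[OF gg_U[OF O(1)] ph_V[OF f O(2)]])
  hence c: "th (gg s) (ph f t) - ph f t \<in> V n (j + 2)" by (simp only: add.assoc one_add_one)
  have "ph f r - (ph f s + ph f t) = (th (gg s) (ph f t) - ph f t) - th (gg r) (th u f - f)"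
    unfolding ph_def th_diff e[symmetric] by simp
  thus ?thesis using V_diff[OF c th_V1[OF gg_U[OF O(3)] d]] by (simp only:)
qed

lemma ph_rd_0: "f \<in> V n j \<Longrightarrow> t \<in> Od \<Longrightarrow> rd t = 0 \<Longrightarrow> ph f t \<in> V n (j + 2)"
  using V_neg[OF ph_add[of f n j t t t]] by simp

lemma V_congruent: "a - b \<in> V n j \<Longrightarrow> b - c \<in> V n j \<Longrightarrow> a - c \<in> V n j"
  using V_add[of "a - b" n j "b - c"] by simp

lemma ph_of_nat:
  assumes f: "f \<in> V n j" and t: "t \<in> Od"
  shows "ph f (of_nat m * t) - fsc (of_nat m) (ph f t) \<in> V n (j + 2)"
proof (induction m)
  case 0
  show "ph f (of_nat 0 * t) - fsc (of_nat 0) (ph f t) \<in> V n (j + 2)" by (simp add: ph_0 V_zero)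
next
  case (Suc m)
  have e: "of_nat (Suc m) * t = of_nat m * t + t" by (simp add: algebra_simps)
  have O: "of_nat m * t \<in> Od" "of_nat (Suc m) * t \<in> Od" using O_mult[OF O_of_nat t] by blast+
  have "ph f (of_nat (Suc m) * t) - (ph f (of_nat m * t) + ph f t) \<in> V n (j + 2)"
    by (rule ph_add[OF f O(1) t O(2)]) (simp only: e rd_add[OF O(1) t])
  moreover have "ph f (of_nat m * t) - fsc (of_nat m) (ph f t) \<in> V n (j + 2)" by (rule Suc.IH)
  ultimately have "(ph f (of_nat (Suc m) * t) - (ph f (of_nat m * t) + ph f t))
      + (ph f (of_nat m * t) - fsc (of_nat m) (ph f t)) \<in> V n (j + 2)" by (rule V_add)
  thus "ph f (of_nat (Suc m) * t) - fsc (of_nat (Suc m)) (ph f t) \<in> V n (j + 2)"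
    by (simp only: of_nat_Suc fs.scale_left_distrib fs.scale_one) (simp add: algebra_simps)
qed

lemma ph_sum:
  assumes f: "f \<in> V n j"
  shows "ph f (\<Sum>i<N. of_nat (m i) * zeta ^ i) - (\<Sum>i<N. fsc (of_nat (m i)) (ph f (zeta ^ i))) \<in> V n (j + 2)"
proof (induction N)
  case 0
  show "ph f (\<Sum>i<0. of_nat (m i) * zeta ^ i) - (\<Sum>i<0. fsc (of_nat (m i)) (ph f (zeta ^ i))) \<in> V n (j + 2)"
    by (simp add: ph_0 V_zero)
next
  case (Suc N)
  have O: "(\<Sum>i<N. of_nat (m i) * zeta ^ i) \<in> Od" for N by (intro O_sum O_mult O_of_nat zeta_pow_O)
  have O': "of_nat (m N) * zeta ^ N \<in> Od" by (intro O_mult O_of_nat zeta_pow_O)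
  have "ph f (\<Sum>i<Suc N. of_nat (m i) * zeta ^ i)
      - (ph f (\<Sum>i<N. of_nat (m i) * zeta ^ i) + ph f (of_nat (m N) * zeta ^ N)) \<in> V n (j + 2)"
    by (rule ph_add[OF f O O' O]) (simp only: sum.lessThan_Suc rd_add[OF O O'])
  moreover have "ph f (\<Sum>i<N. of_nat (m i) * zeta ^ i) - (\<Sum>i<N. fsc (of_nat (m i)) (ph f (zeta ^ i))) \<in> V n (j + 2)"
    by (rule Suc.IH)
  ultimately have "(ph f (\<Sum>i<Suc N. of_nat (m i) * zeta ^ i)
      - (ph f (\<Sum>i<N. of_nat (m i) * zeta ^ i) + ph f (of_nat (m N) * zeta ^ N)))
      + (ph f (\<Sum>i<N. of_nat (m i) * zeta ^ i) - (\<Sum>i<N. fsc (of_nat (m i)) (ph f (zeta ^ i)))) \<in> V n (j + 2)"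
    by (rule V_add)
  from V_add[OF this ph_of_nat[OF f zeta_pow_O, of "m N" N]]
  show "ph f (\<Sum>i<Suc N. of_nat (m i) * zeta ^ i) - (\<Sum>i<Suc N. fsc (of_nat (m i)) (ph f (zeta ^ i))) \<in> V n (j + 2)"
    by (simp only: sum.lessThan_Suc[of "\<lambda>i. fsc (of_nat (m i)) (ph f (zeta ^ i))"] diff_diff_eq[symmetric]
        add_diff_eq diff_add_cancel add_diff_cancel diff_add_eq)
qed

text \<open>Fourier inversion for the additive map induced by \<^term>\<open>ph f\<close> on the field with
  \<^term>\<open>q\<close> elements: the traces of the \<^term>\<open>tau ^ k * inverse (tau ^ i)\<close> lie in the prime field, and
  \<^term>\<open>tau ^ k\<close> is minus the sum of their multiples by the \<^term>\<open>tau ^ i\<close>.\<close>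

lemma ph_eq:
  assumes f: "f \<in> V n j" and t: "t \<in> Od"
  shows "ph f t + (fsc (rd t) (Yo f) + fsc (rd t ^ p) (Zo f)) \<in> V n (j + 2)"
proof (cases "rd t = 0")
  case True
  have "(0::'f) ^ p = 0" using p_pos by (simp add: power_0_left)
  thus ?thesis using ph_rd_0[OF f t True] by (simp only: True fs.scale_zero_left add_0_right)
next
  case False
  then obtain k where k: "rd t = tau ^ k" using rd_cases[OF t] by blast
  have pp: "((tau ^ i) ^ p) ^ p = tau ^ i" for i
  proof -
    have "((tau ^ i) ^ p) ^ p = ((tau ^ p) ^ p) ^ i" by (simp only: power_mult[symmetric] mult_ac)
    thus ?thesis by (simp only: tau_pp)
  qed
  define x where "x i = tau ^ k * inverse (tau ^ i)" for i
  have xp: "x i ^ p = (tau ^ k) ^ p * inverse ((tau ^ i) ^ p)" for i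
    by (simp only: x_def power_mult_distrib power_inverse)
  have "(x i ^ p) ^ p = x i" for i
    by (simp only: xp power_mult_distrib power_inverse pp x_def)
  hence "(x i + x i ^ p) ^ p = x i + x i ^ p" for i by (simp only: frobenius_add add.commute)
  hence "\<forall>i. \<exists>m::nat. x i + x i ^ p = of_nat m" using prime_subfield by blast
  then obtain m :: "nat \<Rightarrow> nat" where m: "\<And>i. x i + x i ^ p = of_nat (m i)" by metis
  have m': "of_nat (m i) = tau ^ k * inverse (tau ^ i) + (tau ^ k) ^ p * inverse ((tau ^ i) ^ p)" for i
    by (simp only: m[symmetric] xp) (simp only: x_def)
  define s where "s = (\<Sum>i<q - 1. of_nat (m i) * zeta ^ i)"
  have sO: "s \<in> Od" unfolding s_def by (intro O_sum O_mult O_of_nat zeta_pow_O)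
  have "rd s = (\<Sum>i<q - 1. of_nat (m i) * tau ^ i)"
    unfolding s_def by (subst rd_sum) (simp_all add: O_mult rd_mult rd_zeta_pow)
  also have "\<dots> = tau ^ k * (\<Sum>i<q - 1. inverse (tau ^ i) * tau ^ i)
      + (tau ^ k) ^ p * (\<Sum>i<q - 1. inverse ((tau ^ i) ^ p) * tau ^ i)"
    by (simp only: m' sum_distrib_left sum.distrib distrib_right mult.assoc)
  finally have "rd s = - (tau ^ k)" unfolding tau_inverse_pow_sum by simp
  hence "rd 0 = rd t + rd s" by (simp add: k)
  from ph_add[OF f t sO O_0 this] have 1: "- (ph f t + ph f s) \<in> V n (j + 2)" by (simp add: ph_0)
  have 2: "ph f s - (\<Sum>i<q - 1. fsc (of_nat (m i)) (ph f (zeta ^ i))) \<in> V n (j + 2)"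
    unfolding s_def by (rule ph_sum[OF f])
  have "(\<Sum>i<q - 1. of_nat (m i)) = tau ^ k * (\<Sum>i<q - 1. inverse (tau ^ i))
      + (tau ^ k) ^ p * (\<Sum>i<q - 1. inverse ((tau ^ i) ^ p))"
    by (simp only: m' sum_distrib_left sum.distrib)
  hence m0: "(\<Sum>i<q - 1. of_nat (m i) :: 'f) = 0" unfolding tau_inverse_pow_sum by simp
  have "(\<Sum>i<q - 1. fsc (of_nat (m i)) (ph f (zeta ^ i)))
      = (\<Sum>i<q - 1. fsc (of_nat (m i)) (th (gg (zeta ^ i)) f)) - fsc (\<Sum>i<q - 1. of_nat (m i)) f"
    by (simp only: ph_def fs.scale_right_diff_distrib sum_subtractf fs.scale_sum_left)
  also have "\<dots> = (\<Sum>i<q - 1. fsc (of_nat (m i)) (th (gg (zeta ^ i)) f))" by (simp add: m0)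
  also have "\<dots> = fsc (tau ^ k) (Yo f) + fsc ((tau ^ k) ^ p) (Zo f)"
    by (simp only: Yo_eq Zo_eq m' fs.scale_sum_right fs.scale_scale fs.scale_left_distrib sum.distrib)
  finally have 3: "(\<Sum>i<q - 1. fsc (of_nat (m i)) (ph f (zeta ^ i))) = fsc (rd t) (Yo f) + fsc (rd t ^ p) (Zo f)"
    by (simp only: k)
  from V_neg[OF V_add[OF 1 2]] show ?thesis unfolding 3 by (simp add: algebra_simps)
qed

end

subsection \<open>Eigenvectors of the Teichmueller units\<close>

lemma periodic_sum_shift:
  fixes F :: "nat \<Rightarrow> 'a::ab_group_add"
  assumes "\<And>i. F (i + n) = F i"
  shows "(\<Sum>i<n. F (i + k)) = (\<Sum>i<n. F i)"
proof (induction k)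
  case (Suc k)
  have "F k + (\<Sum>i<n. F (i + Suc k)) = (\<Sum>i<Suc n. F (i + k))"
    by (subst sum.lessThan_Suc_shift) simp
  also have "\<dots> = F k + (\<Sum>i<n. F (i + k))" using assms[of k] by (simp add: add.commute)
  finally show ?case using Suc.IH by simp
qed simp

context smrep
begin

text \<open>The value of \<alpha> at \<open>zeta\<close>, a root of unity of order
  \<open>p + 1\<close>. Eigenvalues are compared through exponents of it modulo
  \<open>p + 1\<close>.\<close>

definition Aa :: 'f where "Aa = tau ^ (p - 1)"

lemma th_neg: "th g (- f) = - th g (f :: 'v \<Rightarrow> 'f)"
  by (rule ext) (simp add: dual_act_def)

lemma zeta_unit: "zeta ^ i \<in> Od" "rd (zeta ^ i) \<noteq> 0" "zeta ^ i \<noteq> 0"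
  by (simp_all add: rd_zeta_pow)
lemma zeta_unit_1: "zeta \<in> Od" "rd zeta \<noteq> 0"
  using zeta_unit[of 1] by simp_all

lemma gg_nz: "t \<in> Od \<Longrightarrow> gg t \<noteq> 0" by (rule U1_nz[OF gg_U])

lemma th_zeta_gg: "th zeta (th (gg (zeta ^ i)) f) = th (gg (zeta ^ (i + (p - 1)))) (th zeta f)"
proof -
  have "zeta * gg (zeta ^ i) = (zeta * gg (zeta ^ i) * inverse zeta) * zeta"
    by (simp add: mult.assoc)
  hence "zeta * gg (zeta ^ i) = gg (zeta ^ (i + (p - 1))) * zeta"
    by (simp only: zeta_gg add.commute)
  hence "th (zeta * gg (zeta ^ i)) f = th (gg (zeta ^ (i + (p - 1))) * zeta) f" by (simp only:)
  thus ?thesis by (simp only: th_mult[OF zeta_nz gg_nz[OF zeta_pow_O]] th_mult[OF gg_nz[OF zeta_pow_O] zeta_nz])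
qed

lemma tau_shift: "tau ^ (i + (q - 1)) = tau ^ i" "zeta ^ (i + (q - 1)) = zeta ^ i"
  by (simp_all only: power_add tau_pow zeta(2) mult_1_right)

text \<open>Conjugation by \<open>zeta\<close> shifts the summation index by \<open>p - 1\<close>;
  the sum is periodic, and the shift of the coefficients produces the factor. For \<open>Zo\<close>
  the factor is \<open>Aa ^ p\<close>, the inverse of \<open>Aa\<close>.\<close>

lemma th_Yo: "th zeta (Yo f) = fsc Aa (Yo (th zeta f))"
proof -
  define F where "F j = fsc (inverse (tau ^ j)) (th (gg (zeta ^ j)) (th zeta f))" for j
  have c: "inverse (tau ^ i) = Aa * inverse (tau ^ (i + (p - 1)))" for i
    by (simp add: Aa_def power_add)
  have "th zeta (Yo f) = (\<Sum>i<q - 1. fsc (inverse (tau ^ i)) (th (gg (zeta ^ (i + (p - 1)))) (th zeta f)))"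
    by (simp only: Yo_eq th_sum th_fsc th_zeta_gg)
  also have "\<dots> = (\<Sum>i<q - 1. fsc Aa (F (i + (p - 1))))"
    by (intro sum.cong refl) (simp only: F_def fs.scale_scale c[symmetric])
  also have "\<dots> = fsc Aa (\<Sum>i<q - 1. F (i + (p - 1)))" by (simp only: fs.scale_sum_right)
  also have "(\<Sum>i<q - 1. F (i + (p - 1))) = (\<Sum>i<q - 1. F i)"
    by (rule periodic_sum_shift) (simp only: F_def tau_shift)
  finally show ?thesis by (simp only: Yo_eq F_def)
qed

lemma th_Zo: "th zeta (Zo f) = fsc (Aa ^ p) (Zo (th zeta f))"
proof -
  define F where "F j = fsc (inverse ((tau ^ j) ^ p)) (th (gg (zeta ^ j)) (th zeta f))" for j
  have c: "inverse ((tau ^ i) ^ p) = Aa ^ p * inverse ((tau ^ (i + (p - 1))) ^ p)" for i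
    by (simp add: Aa_def power_add power_mult_distrib)
  have "th zeta (Zo f) = (\<Sum>i<q - 1. fsc (inverse ((tau ^ i) ^ p)) (th (gg (zeta ^ (i + (p - 1)))) (th zeta f)))"
    by (simp only: Zo_eq th_sum th_fsc th_zeta_gg)
  also have "\<dots> = (\<Sum>i<q - 1. fsc (Aa ^ p) (F (i + (p - 1))))"
    by (intro sum.cong refl) (simp only: F_def fs.scale_scale c[symmetric])
  also have "\<dots> = fsc (Aa ^ p) (\<Sum>i<q - 1. F (i + (p - 1)))" by (simp only: fs.scale_sum_right)
  also have "(\<Sum>i<q - 1. F (i + (p - 1))) = (\<Sum>i<q - 1. F i)"
    by (rule periodic_sum_shift) (simp only: F_def tau_shift)
  finally show ?thesis by (simp only: Zo_eq F_def)
qed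

lemma q_factor: "(p - 1) * (p + 1) = q - 1"
proof -
  obtain r where "p = Suc r" using p_pos gr0_implies_Suc by blast
  thus ?thesis by (simp add: power2_eq_square One_nat_def)
qed

lemma Aa_order: "Aa ^ (p + 1) = 1"
  by (simp only: Aa_def power_mult[symmetric] q_factor tau_pow)

lemma Aa_nz: "Aa \<noteq> 0" by (simp add: Aa_def)

lemma Aa_mod: "Aa ^ x = Aa ^ (x mod (p + 1))"
proof -
  have "Aa ^ x = Aa ^ ((p + 1) * (x div (p + 1)) + x mod (p + 1))" by simp
  also have "\<dots> = Aa ^ (x mod (p + 1))" 
    by (simp only: power_add[of Aa "(p + 1) * (x div (p + 1))"] power_mult Aa_order power_one mult_1_left)
  finally show ?thesis .
qed

lemma Aa_neq: assumes "r < s" "s < p + 1" shows "Aa ^ r \<noteq> Aa ^ s"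
proof
  assume "Aa ^ r = Aa ^ s"
  moreover have "Aa ^ s = Aa ^ r * Aa ^ (s - r)" using assms(1) power_add[of Aa r "s - r"] by simp
  ultimately have "Aa ^ r * 1 = Aa ^ r * Aa ^ (s - r)" by (metis mult_1_right)
  hence "tau ^ ((p - 1) * (s - r)) = 1" using Aa_nz by (simp add: Aa_def power_mult)
  moreover have "0 < (p - 1) * (s - r)" using assms p_ge_5 by simp
  moreover have "(p - 1) * (s - r) < (p - 1) * (p + 1)" by (rule mult_strict_left_mono) (use assms p_ge_5 in auto)
  ultimately show False using tau_order[of "(p - 1) * (s - r)"] by (simp add: q_factor)
qed

lemma Aa_eqD: "Aa ^ x = Aa ^ y \<Longrightarrow> x mod (p + 1) = y mod (p + 1)"
proof -
  assume "Aa ^ x = Aa ^ y"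
  hence e: "Aa ^ (x mod (p + 1)) = Aa ^ (y mod (p + 1))" by (simp only: Aa_mod[symmetric])
  have "x mod (p + 1) < p + 1" "y mod (p + 1) < p + 1" by simp_all
  thus ?thesis using e Aa_neq[of "x mod (p + 1)" "y mod (p + 1)"] Aa_neq[of "y mod (p + 1)" "x mod (p + 1)"]
    by (cases "x mod (p + 1)" "y mod (p + 1)" rule: linorder_cases) auto
qed

lemma Aa_q: "(Aa ^ x) ^ (q - 1) = 1"
  unfolding Aa_def power_mult[symmetric] by (simp only: mult.commute[of _ "q - 1"] power_mult tau_pow power_one)

text \<open>Projector onto the \<open>l\<close>-eigenspace of \<open>zeta\<close>; the sign is the
  factor \<open>1 / (q - 1)\<close>, which is -1 in characteristic \<open>p\<close>.\<close>

definition Ep :: "'f \<Rightarrow> ('v \<Rightarrow> 'f) \<Rightarrow> 'v \<Rightarrow> 'f" where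
  "Ep l f = - (\<Sum>i<q - 1. fsc (inverse (l ^ i)) (th (zeta ^ i) f))"

lemma Ep_add: "Ep l (f + g) = Ep l f + Ep l g"
  by (simp only: Ep_def th_add fs.scale_right_distrib sum.distrib minus_add_distrib)
lemma Ep_fsc: "Ep l (fsc c f) = fsc c (Ep l f)"
  by (simp only: Ep_def th_fsc fs.scale_scale fs.scale_minus_right fs.scale_sum_right mult.commute)

lemma Ep_V: "f \<in> V n j \<Longrightarrow> Ep l f \<in> V n j"
  unfolding Ep_def by (intro V_neg V_sum V_fsc th_V zeta_unit)

lemma Ep_FM: "f \<in> FM j \<Longrightarrow> Ep l f \<in> FM j"
  unfolding Ep_def
  by (intro fs.subspace_neg[OF FM_subspace] fs.subspace_sum[OF FM_subspace] fs.subspace_scale[OF FM_subspace]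
      th_FM zeta_unit)

lemma Ep_eigenvector:
  assumes l: "l ^ (q - 1) = 1"
  shows "th zeta (Ep l f) = fsc l (Ep l f)"
proof -
  define F where "F j = fsc (inverse (l ^ j)) (th (zeta ^ j) f)" for j
  have nz: "l \<noteq> 0" using l q_gt by (auto simp: power_0_left)
  have c: "inverse (l ^ i) = l * inverse (l ^ (i + 1))" for i using nz by (simp add: power_add field_simps)
  have s: "th zeta (th (zeta ^ i) f) = th (zeta ^ (i + 1)) f" for i
    using th_mult[OF zeta_nz zeta_unit(3)[of i], of f] by (simp only: Suc_eq_plus1[symmetric] power_Suc)
  have "th zeta (Ep l f) = - (\<Sum>i<q - 1. fsc l (F (i + 1)))"
    by (simp only: Ep_def th_neg th_sum th_fsc s F_def fs.scale_scale c[symmetric])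
  also have "\<dots> = fsc l (- (\<Sum>i<q - 1. F (i + 1)))" by (simp only: fs.scale_minus_right fs.scale_sum_right)
  also have "(\<Sum>i<q - 1. F (i + 1)) = (\<Sum>i<q - 1. F i)"
  proof (rule periodic_sum_shift)
    fix i
    have "l ^ (i + (q - 1)) = l ^ i" by (simp only: power_add l mult_1_right)
    thus "F (i + (q - 1)) = F i" by (simp only: F_def tau_shift)
  qed
  finally show ?thesis by (simp only: Ep_def F_def)
qed

lemma Ep_of_eigenvector:
  assumes f: "th zeta f = fsc k f" and k: "k ^ (q - 1) = 1" and l: "l ^ (q - 1) = 1"
  shows "Ep l f = (if k = l then f else 0)"
proof -
  have nz: "l \<noteq> 0" using l q_gt by (auto simp: power_0_left)
  have th: "th (zeta ^ i) f = fsc (k ^ i) f" for i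
  proof (induction i)
    case (Suc i)
    show "th (zeta ^ Suc i) f = fsc (k ^ Suc i) f"
      using th_mult[of zeta "zeta ^ i" f] zeta_unit(3)[of i]
      by (simp add: Suc.IH th_fsc f mult.commute)
  qed (simp add: th_one)
  have "(\<Sum>i<q - 1. inverse (l ^ i) * k ^ i) = (\<Sum>i<q - 1. (k / l) ^ i)"
    by (simp add: power_divide field_simps)
  also have "\<dots> = (if k = l then - 1 else 0)"
    using sum_root_of_unity[of "k / l"] of_nat_q_minus_1 nz k l by (simp add: power_divide)
  finally show ?thesis
    by (simp add: Ep_def th fs.scale_sum_left[symmetric])
qed

text \<open>Each power of \<open>zeta\<close> acts on \<open>f\<close> by the expected scalar modulo
  the first filtration step, so the projector preserves the class of \<open>f\<close>. Approximate
  eigenvectors are thereby corrected to exact ones.\<close>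

lemma Ep_approx:
  assumes f: "th zeta f - fsc l f \<in> FM (Suc 0)" and l: "l ^ (q - 1) = 1"
  shows "Ep l f - f \<in> FM (Suc 0)"
proof -
  have nz: "l \<noteq> 0" using l q_gt by (auto simp: power_0_left)
  have i: "th (zeta ^ i) f - fsc (l ^ i) f \<in> FM (Suc 0)" for i
  proof (induction i)
    case 0
    show "th (zeta ^ 0) f - fsc (l ^ 0) f \<in> FM (Suc 0)"
      using fs.subspace_0[OF FM_subspace] by (simp add: th_one)
  next
    case (Suc i)
    have "th (zeta ^ Suc i) f - fsc (l ^ Suc i) f
        = th zeta (th (zeta ^ i) f - fsc (l ^ i) f) + fsc (l ^ i) (th zeta f - fsc l f)"
      by (simp add: th_mult th_diff th_fsc fs.scale_right_diff_distrib mult.commute)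
    thus "th (zeta ^ Suc i) f - fsc (l ^ Suc i) f \<in> FM (Suc 0)"
      using fs.subspace_add[OF FM_subspace th_FM[OF zeta_unit_1 Suc.IH]
        fs.subspace_scale[OF FM_subspace f, of "l ^ i"]] by (simp only:)
  qed
  have "(\<Sum>i<q - 1. fsc (inverse (l ^ i)) (th (zeta ^ i) f - fsc (l ^ i) f)) \<in> FM (Suc 0)"
    by (intro fs.subspace_sum[OF FM_subspace] fs.subspace_scale[OF FM_subspace] i)
  moreover have "(\<Sum>i<q - 1. fsc (inverse (l ^ i)) (th (zeta ^ i) f - fsc (l ^ i) f)) = - (Ep l f - f)"
  proof -
    have "(\<Sum>i<q - 1. fsc (inverse (l ^ i)) (fsc (l ^ i) f)) = fsc (of_nat (q - 1)) f"
    proof -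
      have "(\<Sum>i<q - 1. inverse (l ^ i) * l ^ i) = of_nat (q - 1)" using nz by (simp del: of_nat_diff)
      thus ?thesis by (simp only: fs.scale_scale fs.scale_sum_left[symmetric])
    qed
    thus ?thesis by (simp add: fs.scale_right_diff_distrib sum_subtractf Ep_def of_nat_q_minus_1 del: of_nat_diff)
  qed
  ultimately have "- (Ep l f - f) \<in> FM (Suc 0)" by simp
  from fs.subspace_neg[OF FM_subspace this] show ?thesis by simp
qed

subsection \<open>The commutator with a unit of level two\<close>

definition XX :: "('v \<Rightarrow> 'f) \<Rightarrow> 'v \<Rightarrow> 'f" where "XX f = th hh f - f"

lemma XX_V: "f \<in> V n j \<Longrightarrow> XX f \<in> V n (j + 2)"
  unfolding XX_def by (rule raisesD[OF raises_U2[OF hh_U]])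
lemma XX_diff: "XX (f - g) = XX f - XX g" and XX_fsc: "XX (fsc c f) = fsc c (XX f)"
  by (simp_all add: XX_def th_diff th_fsc fs.scale_right_diff_distrib)
lemma XX_sum: "XX (\<Sum>i\<in>I. F i) = (\<Sum>i\<in>I. XX (F i))"
  by (simp add: XX_def th_sum sum_subtractf)

lemma hh_nz: "hh \<noteq> 0" by (rule U_nz[OF hh_U]) simp

lemma XX_eigenvector:
  assumes "th zeta f = fsc l f"
  shows "th zeta (XX f) = fsc l (XX f)"
proof -
  have "zeta * hh = (zeta * hh * inverse zeta) * zeta" by (simp add: mult.assoc)
  hence "zeta * hh = hh * zeta" by (simp only: hh_zeta)
  hence "th zeta (th hh f) = th hh (th zeta f)"
    by (simp only: th_mult[OF zeta_nz hh_nz, symmetric] th_mult[OF hh_nz zeta_nz, symmetric])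
  thus ?thesis by (simp add: XX_def th_diff assms th_fsc fs.scale_right_diff_distrib)
qed

text \<open>By \<open>hh_gg\<close> the commutator is \<open>gg (rho * t) ^ p - 1\<close> up to two
  errors: \<open>u\<close> in \<open>U 4\<close> raises by \<open>2 * p\<close>, and replacing
  \<open>th (gg t) (th hh f)\<close> by \<open>f\<close> gains one degree beyond the
  \<open>p\<close> supplied by the \<open>p\<close>-th power.\<close>

lemma XX_gg:
  assumes f: "f \<in> V n k" and t: "t \<in> Ld" "t \<in> Od"
  shows "(XX (th (gg t) f) - th (gg t) (XX f)) - (th (gg (rho * t) ^ p) f - f) \<in> V n (k + p + 1)"
proof -
  obtain u where u: "u \<in> U 4" "hh * gg t = u * (gg (rho * t) ^ p * gg t * hh)"
    using hh_gg[OF t] by blast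
  let ?r = "gg (rho * t)"
  have r: "?r \<in> U 1" by (rule gg_U[OF O_mult[OF rho_O t(2)]])
  have rp: "?r ^ p \<in> U 1" by (rule U_power[OF r])
  have nz: "?r ^ p \<noteq> 0" "gg t \<noteq> 0" "u \<noteq> 0" "?r \<noteq> 0" "?r ^ p * gg t \<noteq> 0"
    using U1_nz[OF rp] gg_nz[OF t(2)] U_nz[OF u(1)] U1_nz[OF r] by simp_all
  have h1: "hh \<in> U 1" by (rule U_mono[OF hh_U]) simp
  define h where "h = th (gg t) (th hh f)"
  have hf: "th hh f \<in> V n k" by (rule th_V1[OF h1 f])
  have hV: "h \<in> V n k" unfolding h_def by (rule th_V1[OF gg_U[OF t(2)] hf])
  have "th (hh * gg t) f = th (u * (?r ^ p * gg t * hh)) f" by (simp only: u(2))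
  hence e: "th hh (th (gg t) f) = th u (th (?r ^ p) h)"
    using nz hh_nz by (simp add: th_mult h_def)
  have hd: "h - f \<in> V n (k + 1)"
  proof -
    have "th hh f - f \<in> V n (k + 1)" by (rule V_mono[OF XX_V[OF f, unfolded XX_def]]) simp
    from V_add[OF raise_1[OF gg_U[OF t(2)] hf] this] show ?thesis by (simp add: h_def)
  qed
  have R: "raises n (?r ^ p) (p * 1)" by (rule raises_power_p[OF nz(4) raises_U1[OF r]])
  have a: "th u (th (?r ^ p) h) - th (?r ^ p) h \<in> V n (k + p + 1)"
    by (rule V_mono[OF raisesD[OF raises_U4[OF u(1)] th_V1[OF rp hV]]]) (use p_ge_5 in simp)
  have b: "th (?r ^ p) (h - f) - (h - f) \<in> V n (k + p + 1)"
    using raisesD[OF R hd] by (simp add: add_ac)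
  have "(XX (th (gg t) f) - th (gg t) (XX f)) - (th (?r ^ p) f - f)
      = (th u (th (?r ^ p) h) - th (?r ^ p) h) + (th (?r ^ p) (h - f) - (h - f))"
    by (simp add: XX_def th_diff e h_def)
  thus ?thesis using V_add[OF a b] by (simp only:)
qed

definition Cz :: "('v \<Rightarrow> 'f) \<Rightarrow> 'v \<Rightarrow> 'f" where "Cz f = XX (Zo f) - Zo (XX f)"

lemma Cz_eq: "Cz f = (\<Sum>i<q - 1. fsc (inverse ((tau ^ i) ^ p))
    (XX (th (gg (zeta ^ i)) f) - th (gg (zeta ^ i)) (XX f)))"
  by (simp only: Cz_def Zo_eq XX_sum XX_fsc fs.scale_right_diff_distrib sum_subtractf)

lemma Cz_V:
  assumes f: "f \<in> V n k"
  shows "Cz f \<in> V n (k + p)"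
  unfolding Cz_eq
proof (intro V_sum V_fsc)
  fix i
  let ?g = "gg (rho * zeta ^ i)"
  have g: "?g \<in> U 1" by (rule gg_U[OF O_mult[OF rho_O zeta_pow_O]])
  have "raises n (?g ^ p) (p * 1)" by (rule raises_power_p[OF U1_nz[OF g] raises_U1[OF g]])
  from raisesD[OF this f] have 1: "th (?g ^ p) f - f \<in> V n (k + p)" by simp
  have 2: "(XX (th (gg (zeta ^ i)) f) - th (gg (zeta ^ i)) (XX f)) - (th (?g ^ p) f - f) \<in> V n (k + p)"
    by (rule V_mono[OF XX_gg[OF f zeta_L(1) zeta_pow_O]]) simp
  from V_add[OF 2 1] show "XX (th (gg (zeta ^ i)) f) - th (gg (zeta ^ i)) (XX f) \<in> V n (k + p)" by simp
qed

lemma KM_Yo: "f \<in> KM n \<Longrightarrow> Yo f \<in> KM n" and KM_Zo: "f \<in> KM n \<Longrightarrow> Zo f \<in> KM n"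
  unfolding Yo_eq Zo_eq
  by (intro fs.subspace_sum[OF KM_sub] fs.subspace_scale[OF KM_sub] KM_th U1_unit(1,2)[OF gg_zeta_U], assumption)+

lemma Yo_V: "f \<in> V n j \<Longrightarrow> Yo f \<in> V n (Suc j)"
  unfolding V_def using lact_FM[OF Y_mD, of _ j] KM_Yo lact_add[OF Yelt_Lam] by fastforce
lemma Zo_V: "f \<in> V n j \<Longrightarrow> Zo f \<in> V n (Suc j)"
  unfolding V_def using lact_FM[OF Z_mD, of _ j] KM_Zo lact_add[OF Zelt_Lam] by fastforce

lemma Zo_power_V: "f \<in> V n j \<Longrightarrow> (Zo ^^ k) f \<in> V n (j + k)"
  by (induction k) (simp_all add: Zo_V)

subsection \<open>Nakayama's lemma at finite level\<close>

lemma M_diff: "f \<in> carrier M \<Longrightarrow> f (x - y) = f x - f y"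
  unfolding M_iff by (metis add_diff_cancel_right' diff_add_cancel)

lemma act_diff: "g \<noteq> 0 \<Longrightarrow> act g (v - w) = act g v - act g w"
  using act_add[of g "v - w" w] by simp

lemma fixd_diff: "fixd n v \<Longrightarrow> fixd n w \<Longrightarrow> fixd n (v - w)"
  unfolding fixd_def by (simp add: act_diff U_Suc_nz)

text \<open>Otherwise some fixed vector is not annihilated by \<open>V n j\<close>, and
  \<open>invariant_vector\<close> finds one that is moreover invariant modulo the annihilator. By
  \<open>V_Suc_subset\<close> the next filtration step annihilates this vector, while
  \<open>V n j\<close> does not.\<close>

lemma V_stationary:
  assumes st: "V n j \<subseteq> V n (Suc j)"
  shows "V n j \<subseteq> KM n"
proof (rule ccontr)
  assume "\<not> V n j \<subseteq> KM n"
  then obtain f0 where f0: "f0 \<in> V n j" "f0 \<notin> KM n" by blast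
  then obtain w0 where w0: "fixd n w0" "f0 w0 \<noteq> 0" using V_M[OF f0(1)] by (auto simp: KM_def)
  let ?P = "{v. fixd n v}" and ?P' = "{v. \<forall>f\<in>V n j. f v = 0}"
  have "\<exists>v\<in>?P. v \<notin> ?P' \<and> (\<forall>g\<in>U 1. act g v - v \<in> ?P')"
  proof (rule invariant_vector[where sc = sc and w = w0 and N = "Suc n"])
    show "vector_space sc" by (rule sc_vs)
    show "Vector_Spaces.linear sc sc (act g)" if "g \<in> U 1" for g by (rule act_lin[OF U1_nz[OF that]])
    show "act 1 v = v" for v by simp
    show "act (g * h) v = act g (act h v)" if "g \<in> U 1" "h \<in> U 1" for g h v
      by (rule act_mult[OF U1_nz[OF that(1)] U1_nz[OF that(2)]])
    show "act g v - v \<in> ?P" if "g \<in> U 1" "v \<in> ?P" for g v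
      using fixd_diff[OF fixd_act1[of n v g]] that by simp
    show "x - y \<in> ?P'" if "x \<in> ?P'" "y \<in> ?P'" for x y
    proof (intro CollectI ballI)
      fix f assume f: "f \<in> V n j"
      have "f x = 0" "f y = 0" using that f by blast+
      thus "f (x - y) = 0" using M_diff[OF V_M[OF f], of x y] by simp
    qed
    show "act g x \<in> ?P'" if g: "g \<in> U 1" and x: "x \<in> ?P'" for g x
    proof (intro CollectI ballI)
      fix f assume "f \<in> V n j"
      from th_V1[OF U_inv[OF g order_refl] this] x have "th (inverse g) f x = 0" by simp
      thus "f (act g x) = 0" by (simp add: dual_act_def)
    qed
    show "w0 \<in> ?P" "w0 \<notin> ?P'" using w0 f0 by auto
    show "1 \<le> Suc n" by (simp add: One_nat_def)
    show "act u v - v \<in> ?P'" if "u \<in> U (Suc n)" "v \<in> ?P" for u v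
    proof (intro CollectI ballI)
      fix f assume f: "f \<in> V n j"
      show "f (act u v - v) = 0" using that M_diff[OF V_M[OF f], of v v] by (simp add: fixd_def)
    qed
  qed
  then obtain v where v: "fixd n v" "v \<notin> ?P'" "\<And>g. g \<in> U 1 \<Longrightarrow> act g v - v \<in> ?P'" by blast
  have "V n (Suc j) \<subseteq> {f. f v = 0}"
  proof (rule V_Suc_subset)
    show "fs.subspace {f. f v = 0}" by (simp add: fs.subspace_def fsc_def)
    show "KM n \<subseteq> {f. f v = 0}" using v(1) by (auto simp: KM_def)
    show "th g f - f \<in> {f. f v = 0}" if f: "f \<in> V n j" and g: "g \<in> U 1" for f g
    proof -
      have "f (act (inverse g) v - v) = 0" using v(3)[OF U_inv[OF g order_refl]] f by blast
      thus ?thesis using M_diff[OF V_M[OF f], of "act (inverse g) v" v] by (simp add: dual_act_def)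
    qed
  qed
  thus False using st v(2) by blast
qed

lemma KM_antimono: "m \<le> n \<Longrightarrow> KM n \<subseteq> KM m"
  unfolding KM_def using fixd_le by blast

text \<open>Every vector is fixed at some level, so the decreasing spaces \<open>KM n\<close> have
  intersection 0.\<close>

lemma KM_avoid:
  assumes "finite S"
  shows "\<exists>n. \<forall>s\<in>S. s \<in> KM n \<longrightarrow> s = 0"
  using assms
proof induction
  case (insert s S)
  then obtain n where n: "\<forall>s\<in>S. s \<in> KM n \<longrightarrow> s = 0" by blast
  show "\<exists>n. \<forall>x\<in>insert s S. x \<in> KM n \<longrightarrow> x = 0"
  proof (cases "s = 0")
    case True
    thus ?thesis using n by (intro exI[of _ n]) simp
  next
    case False
    then obtain v where v: "s v \<noteq> 0" by (auto simp: fun_eq_iff)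
    obtain m where m: "fixd m v" using fixd_ex by blast
    have "s \<notin> KM (max m n)" using v fixd_le[OF m, of "max m n"] by (auto simp: KM_def)
    thus ?thesis using n KM_antimono[of n "max m n"] by (intro exI[of _ "max m n"]) (auto simp: subset_iff)
  qed
qed simp

end

subsection \<open>Characters of the units\<close>

context quat
begin

lemma ord_units_iff: "x \<in> ord_units D \<longleftrightarrow> x \<in> Od \<and> rd x \<noteq> 0"
proof
  assume "x \<in> ord_units D"
  hence x: "x \<in> Od" "x \<noteq> 0" "inverse x \<in> Od" by (simp_all add: ord_units_def)
  hence "rd x * rd (inverse x) = 1" using rd_mult[OF x(1,3)] by simp
  thus "x \<in> Od \<and> rd x \<noteq> 0" using x(1) by auto
next
  assume "x \<in> Od \<and> rd x \<noteq> 0"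
  thus "x \<in> ord_units D" using unit_inv by (auto simp: ord_units_def)
qed

lemma power_p_eq_1: "(x::'f) ^ p ^ N = 1 \<Longrightarrow> x = 1"
proof (induction N arbitrary: x)
  case (Suc N)
  have "(x ^ p) ^ p ^ N = 1" using Suc.prems by (simp add: power_mult[symmetric])
  hence "x ^ p = 1" by (rule Suc.IH)
  hence "(x - 1) ^ p = 0" by (simp add: frobenius_diff)
  thus ?case by simp
qed simp

lemma U_power_p_power: "u \<in> U 1 \<Longrightarrow> u ^ p ^ N \<in> U (1 + 2 * N)"
proof (induction N)
  case (Suc N)
  have "(u ^ p ^ N) ^ p \<in> U (1 + 2 * N + 2)" by (rule U_power_p[OF Suc.IH[OF Suc.prems]]) simp
  moreover have "(u ^ p ^ N) ^ p = u ^ p ^ Suc N" by (simp add: power_mult[symmetric] mult.commute)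
  moreover have "1 + 2 * N + 2 = 1 + 2 * Suc N" by simp
  ultimately show ?case by (simp only:)
qed simp

context
  fixes \<chi> :: "'d \<Rightarrow> 'f"
  assumes \<chi>: "smooth_character D \<chi>"
begin

lemma character_mult: "x \<in> ord_units D \<Longrightarrow> y \<in> ord_units D \<Longrightarrow> \<chi> (x * y) = \<chi> x * \<chi> y"
  and character_nz: "x \<in> ord_units D \<Longrightarrow> \<chi> x \<noteq> 0"
  using \<chi> by (simp_all add: smooth_character_def)

lemma U1_ord_units: "u \<in> U 1 \<Longrightarrow> u \<in> ord_units D"
  unfolding ord_units_iff using U_O U_rd[of u 1] by auto

lemma character_1: "\<chi> 1 = 1"
proof -
  have o: "1 \<in> ord_units D" by (simp add: ord_units_iff)
  show ?thesis using character_mult[OF o o] character_nz[OF o] by simp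
qed

lemma character_power: "x \<in> ord_units D \<Longrightarrow> \<chi> (x ^ k) = \<chi> x ^ k"
proof (induction k)
  case (Suc k)
  have "x ^ k \<in> ord_units D" using Suc.prems by (simp add: ord_units_iff O_power rd_power)
  thus ?case using Suc character_mult[of x "x ^ k"] by simp
qed (simp add: character_1)

text \<open>Iterated \<open>p\<close>-th powers of \<open>u\<close> enter the subgroup where the
  character is trivial, and in characteristic \<open>p\<close> the only root of unity of
  \<open>p\<close>-power order is 1.\<close>

lemma character_U1:
  assumes u: "u \<in> U 1"
  shows "\<chi> u = 1"
proof -
  obtain n where n: "\<forall>u\<in>U n. \<chi> u = 1" using \<chi> unfolding smooth_character_def by blast
  have "u ^ p ^ n \<in> U n" by (rule U_mono[OF U_power_p_power[OF u]]) simp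
  hence "\<chi> u ^ p ^ n = 1" using n character_power[OF U1_ord_units[OF u], of "p ^ n"] by simp
  thus ?thesis by (rule power_p_eq_1)
qed

text \<open>\<open>x\<close> differs from \<open>zeta ^ i\<close> by an element of
  \<open>U 1\<close>, so the character factors through the reduction.\<close>

lemma character_eq:
  assumes x: "x \<in> Od" "rd x = tau ^ i"
  shows "\<chi> x = \<chi> zeta ^ i"
proof -
  have z: "zeta \<in> ord_units D" by (simp add: ord_units_iff tau_def[symmetric])
  have zi: "zeta ^ i \<in> ord_units D" by (simp add: ord_units_iff rd_zeta_pow)
  have i: "inverse (zeta ^ i) \<in> Od" by (rule unit_inv) (simp_all add: rd_zeta_pow)
  define u where "u = inverse (zeta ^ i) * x"
  have uO: "u \<in> Od" unfolding u_def by (rule O_mult[OF i x(1)])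
  have xe: "x = zeta ^ i * u" by (simp add: u_def mult.assoc[symmetric])
  have "tau ^ i = tau ^ i * rd u" using rd_mult[OF zeta_pow_O uO, of i] x(2) by (simp add: xe[symmetric] rd_zeta_pow)
  hence "rd u = 1" by simp
  hence "u - 1 \<in> PP 1" using PP_1[of "u - 1"] rd_diff[OF uO O_1] O_diff[OF uO O_1] by simp
  hence u: "u \<in> U 1" by (simp only: U_iff)
  show ?thesis unfolding xe character_mult[OF zi U1_ord_units[OF u]] character_U1[OF u] character_power[OF z] by simp
qed

lemma character_zeta_q: "\<chi> zeta ^ (q - 1) = 1"
  using character_eq[of 1 "q - 1"] tau_pow character_1 by simp

lemma sigma_conj_zeta: "sigma_conj D \<chi> zeta = \<chi> zeta ^ p"
  using character_eq[of "cj zeta" p] rd_cj_zeta by (simp add: sigma_conj_def cj_def[symmetric])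

text \<open>With \<open>\<chi> zeta = tau ^ m\<close>, the quotient of \<open>\<chi> zeta\<close> by
  its \<open>p\<close>-th power is \<alpha> at \<open>zeta\<close> to the power
  \<open>p * m\<close>, because \<open>tau ^ q = tau\<close>. The exponent is taken modulo
  \<open>p + 1\<close>; the values 0 and \<open>p\<close> would make \<open>\<chi>\<close> equal to
  its conjugate, respectively to the conjugate times the \<open>p\<close>-th power of
  \<alpha>.\<close>

lemma character_exponent:
  assumes ne1: "\<exists>x\<in>ord_units D. \<chi> x \<noteq> sigma_conj D \<chi> x"
    and ne2: "\<exists>x\<in>ord_units D. \<chi> x \<noteq> sigma_conj D \<chi> x * alpha p D x ^ p"
  shows "\<exists>b. 1 \<le> b \<and> b \<le> p - 1 \<and> inverse (\<chi> zeta ^ p) = inverse (\<chi> zeta) * (tau ^ (p - 1)) ^ b"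
proof -
  let ?A = "tau ^ (p - 1)" and ?c = "\<chi> zeta"
  have A: "?A ^ (p + 1) = 1"
  proof -
    obtain r where "p = Suc r" using p_pos gr0_implies_Suc by blast
    hence "(p - 1) * (p + 1) = q - 1" by (simp add: power2_eq_square One_nat_def)
    thus ?thesis by (simp only: power_mult[symmetric] tau_pow)
  qed
  have "?c \<in> {x. x ^ (q - 1) = 1}" using character_zeta_q by simp
  then obtain m where m: "?c = tau ^ m" unfolding mu_eq by blast
  have cnz: "?c \<noteq> 0" by (simp add: m)
  define b where "b = (p * m) mod (p + 1)"
  have "?A ^ (p * m) = ?A ^ ((p + 1) * ((p * m) div (p + 1)) + b)" by (simp add: b_def)
  hence Ab: "?A ^ (p * m) = ?A ^ b" by (simp only: power_add[of ?A "(p + 1) * _"] power_mult[of ?A "p + 1"] A power_one mult_1_left)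
  have "?A ^ (p * m) * ?c ^ p = tau ^ (q * m)"
  proof -
    obtain r where r: "p = Suc r" using p_pos gr0_implies_Suc by blast
    have "(p - 1) * (p * m) + m * p = q * m" by (simp add: r power2_eq_square algebra_simps One_nat_def)
    thus ?thesis unfolding m by (simp only: power_mult[symmetric] power_add[symmetric])
  qed
  moreover have "tau ^ (q * m) = tau ^ m" by (simp only: power_mult tau_q)
  ultimately have key: "?A ^ b * ?c ^ p = ?c" by (simp only: Ab m)
  have vals: "\<chi> x = ?c ^ i" "sigma_conj D \<chi> x = (?c ^ p) ^ i" "alpha p D x ^ p = (?A ^ p) ^ i"
    if x: "x \<in> Od" "rd x = tau ^ i" for x i
  proof -
    show "\<chi> x = ?c ^ i" by (rule character_eq[OF x])
    have "rd (cj x) = tau ^ (p * i)" using rd_cj[OF x(1)] by (simp only: x(2) power_mult[symmetric] mult.commute)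
    hence "\<chi> (cj x) = ?c ^ (p * i)" by (rule character_eq[OF cj_O[OF x(1)]])
    thus "sigma_conj D \<chi> x = (?c ^ p) ^ i" by (simp only: sigma_conj_def cj_def[symmetric] power_mult)
    show "alpha p D x ^ p = (?A ^ p) ^ i" by (simp only: alpha_def x(2) power_mult[symmetric] mult_ac)
  qed
  have b0: "b \<noteq> 0"
  proof
    assume "b = 0"
    hence "?c ^ p = ?c" using key by simp
    hence "\<chi> x = sigma_conj D \<chi> x" if "x \<in> ord_units D" for x
      using that vals[of x] rd_cases[of x] by (auto simp: ord_units_iff)
    thus False using ne1 by blast
  qed
  have bp: "b \<noteq> p"
  proof
    assume "b = p"
    hence k: "?c = ?A ^ p * ?c ^ p" using key by simp
    have "\<chi> x = sigma_conj D \<chi> x * alpha p D x ^ p" if x: "x \<in> ord_units D" for x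
    proof -
      have xO: "x \<in> Od" "rd x \<noteq> 0" using x by (simp_all add: ord_units_iff)
      then obtain i where i: "rd x = tau ^ i" using rd_cases[OF xO(1)] by blast
      have "?c ^ i = (?A ^ p * ?c ^ p) ^ i" by (rule arg_cong[OF k, of "\<lambda>t. t ^ i"])
      also have "\<dots> = (?c ^ p) ^ i * (?A ^ p) ^ i" by (simp only: power_mult_distrib mult.commute)
      finally show ?thesis by (simp only: vals[OF xO(1) i])
    qed
    thus False using ne2 by blast
  qed
  have "b < p + 1" unfolding b_def by (rule mod_less_divisor) simp
  hence "1 \<le> b" "b \<le> p - 1" using b0 bp by linarith+
  moreover have "inverse (?c ^ p) = inverse ?c * ?A ^ b"
  proof -
    have "inverse ?c * ?A ^ b * ?c ^ p = 1" using key cnz by (simp add: mult.assoc)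
    thus ?thesis using cnz by (simp add: field_simps)
  qed
  ultimately show ?thesis by blast
qed

end

end

subsection \<open>Lifting the isomorphism of graded modules\<close>

locale smrep_iso = smrep p D sc act
  for p :: nat and D :: "('k::field_char_0, 'd::division_ring, 'f::{finite,field}) quat_datum"
    and sc :: "'f \<Rightarrow> 'v::ab_group_add \<Rightarrow> 'v" and act :: "'d \<Rightarrow> 'v \<Rightarrow> 'v" +
  fixes \<chi> :: "'d \<Rightarrow> 'f"
    and \<phi> :: "(nat \<Rightarrow> ('v \<Rightarrow> 'f) set) \<Rightarrow> ('d, 'f) grlam set \<times> ('d, 'f) grlam set"
  assumes iso: "graded_iso (grLam D) (Hgrp p D) (gr_dual D sc act)
    (direct_sum
      (twist D (dual_char \<chi>) (grLam_quot D {z_elt p D, y_elt p D [^]\<^bsub>grLam D\<^esub> (p + 2)}))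
      (twist D (dual_char (sigma_conj D \<chi>)) (grLam_quot D {y_elt p D, z_elt p D [^]\<^bsub>grLam D\<^esub> (p + 2)}))) \<phi>"
begin

abbreviation "NN \<equiv> direct_sum
  (twist D (dual_char \<chi>) (grLam_quot D {z_elt p D, y_elt p D [^]\<^bsub>Rg\<^esub> (p + 2)}))
  (twist D (dual_char (sigma_conj D \<chi>)) (grLam_quot D {y_elt p D, z_elt p D [^]\<^bsub>Rg\<^esub> (p + 2)}))"
abbreviation "GD \<equiv> gr_dual D sc act :: (('d, 'f) grlam, nat \<Rightarrow> ('v \<Rightarrow> 'f) set, 'd) graded_module"

lemma NN_simps:
  "component NN k = {I1 +>\<^bsub>Rg\<^esub> a | a. a \<in> gr_component \<Lambda> mp k} \<times> {I2 +>\<^bsub>Rg\<^esub> a | a. a \<in> gr_component \<Lambda> mp k}"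
  "(C1, C2) \<oplus>\<^bsub>NN\<^esub> (C1', C2') = (C1 <+>\<^bsub>Rg\<^esub> C1', C2 <+>\<^bsub>Rg\<^esub> C2')"
  "r \<odot>\<^bsub>NN\<^esub> (C1, C2) = (I1 +>\<^bsub>Rg\<^esub> (r \<otimes>\<^bsub>Rg\<^esub> rep C1), I2 +>\<^bsub>Rg\<^esub> (r \<otimes>\<^bsub>Rg\<^esub> rep C2))"
  "hact NN g (C1, C2) =
    (I1 +>\<^bsub>Rg\<^esub> (gr_scalar D (dual_char \<chi> g) \<otimes>\<^bsub>Rg\<^esub> rep (gr_conj g ` C1)),
     I2 +>\<^bsub>Rg\<^esub> (gr_scalar D (dual_char (sigma_conj D \<chi>) g) \<otimes>\<^bsub>Rg\<^esub> rep (gr_conj g ` C2)))"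
  unfolding I1_def I2_def by (simp_all add: direct_sum_def twist_def grLam_quot_def Let_def)

lemma M_smult: "(\<odot>\<^bsub>M\<^esub>) = lact" by (simp add: dual_module_def)

lemma GD_simps:
  "carrier GD = gr_carrier M FM" "component GD k = gr_component M FM k"
  "a \<oplus>\<^bsub>GD\<^esub> a' = gr_add M a a'" "r \<odot>\<^bsub>GD\<^esub> a = gr_prod M FM lact r a" "hact GD g a = (\<lambda>n. th g ` a n)"
  by (simp_all add: gr_dual_def Let_def M_smult)

lemma phi_inj: "inj_on \<phi> (gr_carrier M FM)"
  using iso unfolding graded_iso_def GD_simps by (blast dest: bij_betw_imp_inj_on)
lemma phi_add: "a \<in> gr_carrier M FM \<Longrightarrow> a' \<in> gr_carrier M FM \<Longrightarrow> \<phi> (gr_add M a a') = \<phi> a \<oplus>\<^bsub>NN\<^esub> \<phi> a'"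
  using iso unfolding graded_iso_def GD_simps by blast
lemma phi_smult: "r \<in> carrier Rg \<Longrightarrow> a \<in> gr_carrier M FM \<Longrightarrow> \<phi> (gr_prod M FM lact r a) = r \<odot>\<^bsub>NN\<^esub> \<phi> a"
  using iso unfolding graded_iso_def GD_simps by blast
lemma phi_component: "\<phi> ` gr_component M FM k = component NN k"
  using iso unfolding graded_iso_def GD_simps by blast
lemma phi_hact: "g \<in> Hgrp p D \<Longrightarrow> a \<in> gr_carrier M FM \<Longrightarrow> \<phi> (\<lambda>n. th g ` a n) = hact NN g (\<phi> a)"
  using iso unfolding graded_iso_def GD_simps by blast

lemma clM_component: "x \<in> FM k \<Longrightarrow> clM k x \<in> gr_component M FM k"
  by (rule filtered_action.gr_class_mem[OF M_action])
lemma clM_carrier: "x \<in> FM k \<Longrightarrow> clM k x \<in> gr_carrier M FM"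
  using clM_component[of x k] by (simp add: gr_component_def)
lemma clM_eq_iff: "x \<in> FM k \<Longrightarrow> y \<in> FM k \<Longrightarrow> clM k x = clM k y \<longleftrightarrow> x - y \<in> FM (Suc k)"
  using filtered_action.gr_class_eq_iff[OF M_action, of x k y] M_minus[OF FM_M[of x k] FM_M[of y k]]
  by (simp add: fun_diff_def)

lemma Rab: "abelian_group Rg" by (rule ring.is_abelian_group[OF grLam_ring])

text \<open>The quotient module multiplies a representative chosen by \<open>rep\<close>; the ideal
  is stable under left multiplication, so any representative will do.\<close>

lemma coset_smult:
  assumes I: "ideal I Rg" and r: "r \<in> carrier Rg" and a: "a \<in> carrier Rg"
  shows "I +>\<^bsub>Rg\<^esub> (r \<otimes>\<^bsub>Rg\<^esub> rep (I +>\<^bsub>Rg\<^esub> a)) = I +>\<^bsub>Rg\<^esub> (r \<otimes>\<^bsub>Rg\<^esub> a)"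
proof -
  interpret I: ideal I Rg by (rule I)
  have s: "additive_subgroup I Rg" by (rule ideal.axioms(1)[OF I])
  have rp: "rep (I +>\<^bsub>Rg\<^esub> a) \<in> carrier Rg" "rep (I +>\<^bsub>Rg\<^esub> a) \<ominus>\<^bsub>Rg\<^esub> a \<in> I"
    using abelian_group.a_coset_rep[OF Rab s a] by auto
  have "(r \<otimes>\<^bsub>Rg\<^esub> rep (I +>\<^bsub>Rg\<^esub> a)) \<ominus>\<^bsub>Rg\<^esub> (r \<otimes>\<^bsub>Rg\<^esub> a) = r \<otimes>\<^bsub>Rg\<^esub> (rep (I +>\<^bsub>Rg\<^esub> a) \<ominus>\<^bsub>Rg\<^esub> a)"
    using r a rp(1) by (simp add: a_minus_def I.r_distr I.r_minus)
  hence "(r \<otimes>\<^bsub>Rg\<^esub> rep (I +>\<^bsub>Rg\<^esub> a)) \<ominus>\<^bsub>Rg\<^esub> (r \<otimes>\<^bsub>Rg\<^esub> a) \<in> I" using I.I_l_closed[OF rp(2) r] by simp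
  thus ?thesis using abelian_group.a_coset_eq_iff[OF Rab s I.m_closed[OF r rp(1)] I.m_closed[OF r a]] by simp
qed

lemma phi_lact:
  assumes m: "\<mu> \<in> mp k" and e: "e \<in> carrier M" and ab: "a \<in> carrier Rg" "b \<in> carrier Rg"
    and phi: "\<phi> (clM 0 e) = (I1 +>\<^bsub>Rg\<^esub> a, I2 +>\<^bsub>Rg\<^esub> b)"
  shows "\<phi> (clM k (lact \<mu> e)) = (I1 +>\<^bsub>Rg\<^esub> (cl k \<mu> \<otimes>\<^bsub>Rg\<^esub> a), I2 +>\<^bsub>Rg\<^esub> (cl k \<mu> \<otimes>\<^bsub>Rg\<^esub> b))"
proof -
  have e0: "e \<in> FM 0" using e by (simp add: FM_0)
  have "gr_prod M FM lact (cl k \<mu>) (clM 0 e) = clM (k + 0) (lact \<mu> e)"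
    by (rule filtered_action.gr_prod_class[OF M_action m e0])
  hence "\<phi> (clM k (lact \<mu> e)) = cl k \<mu> \<odot>\<^bsub>NN\<^esub> \<phi> (clM 0 e)"
    using phi_smult[OF cl_closed[OF m] clM_carrier[OF e0]] by simp
  thus ?thesis
    by (simp only: phi NN_simps coset_smult[OF I1_ideal cl_closed[OF m] ab(1)] coset_smult[OF I2_ideal cl_closed[OF m] ab(2)])
qed

lemma zero_mp: "\<zero>\<^bsub>\<Lambda>\<^esub> \<in> mp k"
  by (rule additive_subgroup.zero_closed[OF ideal.axioms(1)[OF mD_pow_ideal]])

lemma cl_comp: "x \<in> mp k \<Longrightarrow> cl k x \<in> gr_component \<Lambda> mp k"
  by (rule filtered_action.gr_class_mem[OF reg])

lemma generator_exists:
  assumes "\<mu> \<in> mp 0" "\<nu> \<in> mp 0"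
  shows "\<exists>e. e \<in> carrier M \<and> \<phi> (clM 0 e) = (I1 +>\<^bsub>Rg\<^esub> cl 0 \<mu>, I2 +>\<^bsub>Rg\<^esub> cl 0 \<nu>)"
proof -
  have "(I1 +>\<^bsub>Rg\<^esub> cl 0 \<mu>, I2 +>\<^bsub>Rg\<^esub> cl 0 \<nu>) \<in> component NN 0"
    unfolding NN_simps using cl_comp[OF assms(1)] cl_comp[OF assms(2)] by blast
  then obtain \<epsilon> where *: "\<epsilon> \<in> gr_component M FM 0" "(I1 +>\<^bsub>Rg\<^esub> cl 0 \<mu>, I2 +>\<^bsub>Rg\<^esub> cl 0 \<nu>) = \<phi> \<epsilon>"
    unfolding phi_component[symmetric] by blast
  obtain e where "e \<in> FM 0" "\<epsilon> = clM 0 e" using filtered_action.gr_componentD[OF M_action *(1)] by blast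
  thus ?thesis using *(2) by (auto simp: FM_0)
qed

lemma one_mp: "\<one>\<^bsub>\<Lambda>\<^esub> \<in> mp 0" by (simp add: Lam_one_closed)

text \<open>\<open>g1\<close> and \<open>g2\<close> lift the generators of the two summands to the
  dual. They are eigenvectors of \<open>zeta\<close> only modulo the first filtration step.\<close>

definition g1 :: "'v \<Rightarrow> 'f" where
  "g1 = (SOME e. e \<in> carrier M \<and> \<phi> (clM 0 e) = (I1 +>\<^bsub>Rg\<^esub> cl 0 \<one>\<^bsub>\<Lambda>\<^esub>, I2 +>\<^bsub>Rg\<^esub> cl 0 \<zero>\<^bsub>\<Lambda>\<^esub>))"
definition g2 :: "'v \<Rightarrow> 'f" where
  "g2 = (SOME e. e \<in> carrier M \<and> \<phi> (clM 0 e) = (I1 +>\<^bsub>Rg\<^esub> cl 0 \<zero>\<^bsub>\<Lambda>\<^esub>, I2 +>\<^bsub>Rg\<^esub> cl 0 \<one>\<^bsub>\<Lambda>\<^esub>))"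

lemma cl_consts: "cl 0 \<one>\<^bsub>\<Lambda>\<^esub> = \<one>\<^bsub>Rg\<^esub>" "cl k \<zero>\<^bsub>\<Lambda>\<^esub> = \<zero>\<^bsub>Rg\<^esub>"
  using cl_one cl_zero[OF zero_mp] by blast+

lemma g1: "g1 \<in> carrier M" "\<phi> (clM 0 g1) = (I1 +>\<^bsub>Rg\<^esub> \<one>\<^bsub>Rg\<^esub>, I2 +>\<^bsub>Rg\<^esub> \<zero>\<^bsub>Rg\<^esub>)"
  using someI_ex[OF generator_exists[OF one_mp zero_mp], folded g1_def] unfolding cl_consts by blast+
lemma g2: "g2 \<in> carrier M" "\<phi> (clM 0 g2) = (I1 +>\<^bsub>Rg\<^esub> \<zero>\<^bsub>Rg\<^esub>, I2 +>\<^bsub>Rg\<^esub> \<one>\<^bsub>Rg\<^esub>)"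
  using someI_ex[OF generator_exists[OF zero_mp one_mp], folded g2_def] unfolding cl_consts by blast+

lemma I_sub: "additive_subgroup I1 Rg" "additive_subgroup I2 Rg"
  using ideal.axioms(1)[OF I1_ideal] ideal.axioms(1)[OF I2_ideal] .

lemma phi_pair:
  assumes m: "\<mu> \<in> mp k" "\<nu> \<in> mp k"
  shows "\<phi> (clM k (lact \<mu> g1 + lact \<nu> g2)) = (I1 +>\<^bsub>Rg\<^esub> cl k \<mu>, I2 +>\<^bsub>Rg\<^esub> cl k \<nu>)"
proof -
  interpret R: ring Rg by (rule grLam_ring)
  have c: "cl k \<mu> \<in> carrier Rg" "cl k \<nu> \<in> carrier Rg" using cl_closed m by blast+
  have F: "lact \<mu> g1 \<in> FM k" "lact \<nu> g2 \<in> FM k" using FM_gen m g1(1) g2(1) by blast+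
  have 1: "\<phi> (clM k (lact \<mu> g1)) = (I1 +>\<^bsub>Rg\<^esub> cl k \<mu>, I2 +>\<^bsub>Rg\<^esub> \<zero>\<^bsub>Rg\<^esub>)"
    using phi_lact[OF m(1) g1(1) R.one_closed R.zero_closed g1(2)] c by simp
  have 2: "\<phi> (clM k (lact \<nu> g2)) = (I1 +>\<^bsub>Rg\<^esub> \<zero>\<^bsub>Rg\<^esub>, I2 +>\<^bsub>Rg\<^esub> cl k \<nu>)"
    using phi_lact[OF m(2) g2(1) R.zero_closed R.one_closed g2(2)] c by simp
  have "gr_add M (clM k (lact \<mu> g1)) (clM k (lact \<nu> g2)) = clM k (lact \<mu> g1 + lact \<nu> g2)"
    using filtered_action.gr_add_class[OF M_action F] by (simp add: plus_fun_def)
  hence "\<phi> (clM k (lact \<mu> g1 + lact \<nu> g2)) = \<phi> (clM k (lact \<mu> g1)) \<oplus>\<^bsub>NN\<^esub> \<phi> (clM k (lact \<nu> g2))"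
    using phi_add[OF clM_carrier[OF F(1)] clM_carrier[OF F(2)]] by simp
  also have "\<dots> = (I1 +>\<^bsub>Rg\<^esub> (cl k \<mu> \<oplus>\<^bsub>Rg\<^esub> \<zero>\<^bsub>Rg\<^esub>), I2 +>\<^bsub>Rg\<^esub> (\<zero>\<^bsub>Rg\<^esub> \<oplus>\<^bsub>Rg\<^esub> cl k \<nu>))"
    by (simp only: 1 2 NN_simps abelian_group.a_coset_add[OF Rab I_sub(1) c(1) R.zero_closed]
        abelian_group.a_coset_add[OF Rab I_sub(2) R.zero_closed c(2)])
  finally show ?thesis using c by simp
qed

lemma lact_zero: "e \<in> carrier M \<Longrightarrow> lact \<zero>\<^bsub>\<Lambda>\<^esub> e = 0"
  using filtered_action.act_zero_l[OF M_action, of e] by (simp add: zero_fun_def)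

text \<open>Injectivity of the isomorphism on classes, read in the target. Together with generation
  and the approximate eigenvalues, this criterion carries all that is later used of the
  isomorphism.\<close>

lemma pair_FM_iff:
  assumes m: "\<mu> \<in> mp k" "\<nu> \<in> mp k"
  shows "lact \<mu> g1 + lact \<nu> g2 \<in> FM (Suc k) \<longleftrightarrow> cl k \<mu> \<in> I1 \<and> cl k \<nu> \<in> I2"
proof -
  interpret R: ring Rg by (rule grLam_ring)
  have c: "cl k \<mu> \<in> carrier Rg" "cl k \<nu> \<in> carrier Rg" using cl_closed m by blast+
  let ?x = "lact \<mu> g1 + lact \<nu> g2"
  have x: "?x \<in> FM k" using fs.subspace_add[OF FM_subspace FM_gen[OF m(1) g1(1)] FM_gen[OF m(2) g2(1)]] .
  have z: "0 \<in> FM k" by (rule fs.subspace_0[OF FM_subspace])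
  have z2: "\<phi> (clM k 0) = (I1 +>\<^bsub>Rg\<^esub> \<zero>\<^bsub>Rg\<^esub>, I2 +>\<^bsub>Rg\<^esub> \<zero>\<^bsub>Rg\<^esub>)"
    using phi_pair[OF zero_mp zero_mp, of k] lact_zero[OF g1(1)] lact_zero[OF g2(1)] by (simp add: cl_consts)
  have "?x \<in> FM (Suc k) \<longleftrightarrow> clM k ?x = clM k 0" using clM_eq_iff[OF x z] by simp
  also have "\<dots> \<longleftrightarrow> \<phi> (clM k ?x) = \<phi> (clM k 0)"
    using inj_on_eq_iff[OF phi_inj clM_carrier[OF x] clM_carrier[OF z]] by simp
  also have "\<dots> \<longleftrightarrow> cl k \<mu> \<in> I1 \<and> cl k \<nu> \<in> I2"
    unfolding phi_pair[OF m] z2 prod.inject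
      abelian_group.a_coset_eq_iff[OF Rab I_sub(1) c(1) R.zero_closed]
      abelian_group.a_coset_eq_iff[OF Rab I_sub(2) c(2) R.zero_closed]
      abelian_group.a_minus_zero(2)[OF Rab c(1)] abelian_group.a_minus_zero(2)[OF Rab c(2)] ..
  finally show ?thesis .
qed

lemma lact_aug:
  assumes m: "\<mu> \<in> carrier \<Lambda>" and e: "e \<in> carrier M"
  shows "lact \<mu> e - fsc (aug \<mu>) e \<in> FM (Suc 0)"
proof -
  let ?s = "lam_scale (aug \<mu>) \<one>\<^bsub>\<Lambda>\<^esub>"
  have s: "?s \<in> carrier \<Lambda>" by (rule Lam_scale_closed[OF Lam_one_closed])
  have as: "aug ?s = aug \<mu>"
    using aug_one by (simp add: aug_def lam_scale_def[abs_def] lint_scale_l)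
  have "\<mu> \<ominus>\<^bsub>\<Lambda>\<^esub> ?s \<in> mp (Suc 0)"
    using abelian_group.minus_closed[OF ring.is_abelian_group[OF Lam_ring] m s]
    by (simp add: mD_pow_1 Aug_def aug_minus[OF m s] as)
  from FM_gen[OF this e] have "lact (\<mu> \<ominus>\<^bsub>\<Lambda>\<^esub> ?s) e \<in> FM (Suc 0)" .
  moreover have "lact (\<mu> \<ominus>\<^bsub>\<Lambda>\<^esub> ?s) e = lact \<mu> e - fsc (aug \<mu>) e"
    using filtered_action.act_minus_l[OF M_action m s e] M_minus[OF lact_closed[OF e m] lact_closed[OF e s]]
    by (simp add: lact_scale[OF Lam_one_closed] lact_one fun_eq_iff fsc_def)
  ultimately show ?thesis by simp
qed

text \<open>Degree 0 of the target consists of classes of degree 0 elements of the graded ring, and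
  by \<open>lact_aug\<close> such an element acts as its augmentation modulo the first filtration
  step.\<close>

lemma approx_by_generators:
  assumes f: "f \<in> carrier M"
  shows "\<exists>\<mu>\<in>carrier \<Lambda>. \<exists>\<nu>\<in>carrier \<Lambda>. \<phi> (clM 0 f) = (I1 +>\<^bsub>Rg\<^esub> cl 0 \<mu>, I2 +>\<^bsub>Rg\<^esub> cl 0 \<nu>)
    \<and> f - (fsc (aug \<mu>) g1 + fsc (aug \<nu>) g2) \<in> FM (Suc 0)"
proof -
  have f0: "f \<in> FM 0" using f by (simp add: FM_0)
  have "\<phi> (clM 0 f) \<in> component NN 0" using clM_component[OF f0] phi_component by blast
  then obtain a b where ab: "a \<in> gr_component \<Lambda> mp 0" "b \<in> gr_component \<Lambda> mp 0" "\<phi> (clM 0 f) = (I1 +>\<^bsub>Rg\<^esub> a, I2 +>\<^bsub>Rg\<^esub> b)"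
    unfolding NN_simps by blast
  obtain \<mu> \<nu> where m: "\<mu> \<in> mp 0" "a = cl 0 \<mu>" "\<nu> \<in> mp 0" "b = cl 0 \<nu>"
    using filtered_action.gr_componentD[OF reg ab(1)] filtered_action.gr_componentD[OF reg ab(2)] by blast
  have mc: "\<mu> \<in> carrier \<Lambda>" "\<nu> \<in> carrier \<Lambda>" using m mp_carrier by blast+
  let ?x = "lact \<mu> g1 + lact \<nu> g2"
  have x: "?x \<in> FM 0" using fs.subspace_add[OF FM_subspace FM_gen[OF m(1) g1(1)] FM_gen[OF m(3) g2(1)]] .
  have "\<phi> (clM 0 f) = \<phi> (clM 0 ?x)" by (simp only: phi_pair[OF m(1,3)] ab(3) m(2,4))
  hence "clM 0 f = clM 0 ?x" using inj_on_eq_iff[OF phi_inj clM_carrier[OF f0] clM_carrier[OF x]] by simp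
  hence d: "f - ?x \<in> FM (Suc 0)" using clM_eq_iff[OF f0 x] by simp
  have "(f - ?x) + ((lact \<mu> g1 - fsc (aug \<mu>) g1) + (lact \<nu> g2 - fsc (aug \<nu>) g2)) \<in> FM (Suc 0)"
    by (intro fs.subspace_add[OF FM_subspace] d lact_aug mc g1(1) g2(1))
  hence "f - (fsc (aug \<mu>) g1 + fsc (aug \<nu>) g2) \<in> FM (Suc 0)" by (simp add: algebra_simps)
  thus ?thesis using mc ab(3) m by blast
qed

lemma av_scalar: "av (gr_scalar D c) c"
proof -
  have "aug (lam_scale c \<one>\<^bsub>\<Lambda>\<^esub>) = c"
    using aug_one by (simp add: aug_def lam_scale_def[abs_def] lint_scale_l)
  thus ?thesis using av_cl0[OF Lam_scale_closed[OF Lam_one_closed], of c] by (simp add: gr_scalar_def)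
qed

lemma av_coset:
  assumes I: "\<And>i. i \<in> I \<Longrightarrow> av i 0" and a: "av a t" and x: "x \<in> I +>\<^bsub>Rg\<^esub> a"
  shows "av x t"
proof -
  obtain i where "i \<in> I" "x = i \<oplus>\<^bsub>Rg\<^esub> a" using x by (auto simp: a_r_coset_def')
  thus ?thesis using av_add[OF I a] by simp
qed

text \<open>Constant terms are compared on both sides of the equation of cosets. Conjugation
  preserves them and the ideal contributes 0, so only the twisting scalar remains, whatever
  \<open>rep\<close> chooses.\<close>

lemma av_twist:
  assumes I: "additive_subgroup I Rg" "\<And>i. i \<in> I \<Longrightarrow> av i 0" and a: "av a t" and m: "\<mu> \<in> carrier \<Lambda>"
    and e: "I +>\<^bsub>Rg\<^esub> cl 0 \<mu> = I +>\<^bsub>Rg\<^esub> (gr_scalar D c \<otimes>\<^bsub>Rg\<^esub> rep (gr_conj zeta ` (I +>\<^bsub>Rg\<^esub> a)))"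
  shows "aug \<mu> = c * t"
proof -
  interpret R: ring Rg by (rule grLam_ring)
  have ac: "a \<in> carrier Rg" using a by (simp add: av_def)
  have self: "x \<in> I +>\<^bsub>Rg\<^esub> x" if "x \<in> carrier Rg" for x
    using abelian_group.a_mem_coset_iff[OF Rab I(1) that that] additive_subgroup.zero_closed[OF I(1)] that
    by (simp add: R.r_neg a_minus_def)
  have "rep (gr_conj zeta ` (I +>\<^bsub>Rg\<^esub> a)) \<in> gr_conj zeta ` (I +>\<^bsub>Rg\<^esub> a)"
    by (rule rep_in[OF imageI[OF self[OF ac]]])
  then obtain x where x: "x \<in> I +>\<^bsub>Rg\<^esub> a" "rep (gr_conj zeta ` (I +>\<^bsub>Rg\<^esub> a)) = gr_conj zeta x" by blast
  have "av (gr_conj zeta x) t" by (rule av_conj[OF zeta_unit_1 av_coset[OF I(2) a x(1)]])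
  hence r: "av (gr_scalar D c \<otimes>\<^bsub>Rg\<^esub> rep (gr_conj zeta ` (I +>\<^bsub>Rg\<^esub> a))) (c * t)"
    unfolding x(2) by (rule av_mult[OF av_scalar])
  have "cl 0 \<mu> \<in> carrier Rg" by (rule cl_closed) (simp add: m)
  hence "cl 0 \<mu> \<in> I +>\<^bsub>Rg\<^esub> cl 0 \<mu>" by (rule self)
  hence "cl 0 \<mu> \<in> I +>\<^bsub>Rg\<^esub> (gr_scalar D c \<otimes>\<^bsub>Rg\<^esub> rep (gr_conj zeta ` (I +>\<^bsub>Rg\<^esub> a)))" by (simp only: e)
  from av_coset[OF I(2) r this] have "av (cl 0 \<mu>) (c * t)" .
  thus ?thesis by (rule av_unique[OF av_cl0[OF m]])
qed

lemma th_generator: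
  assumes e: "e \<in> carrier M" and ab: "av a s" "av b t" and phi: "\<phi> (clM 0 e) = (I1 +>\<^bsub>Rg\<^esub> a, I2 +>\<^bsub>Rg\<^esub> b)"
  shows "th zeta e - (fsc (dual_char \<chi> zeta * s) g1 + fsc (dual_char (sigma_conj D \<chi>) zeta * t) g2) \<in> FM (Suc 0)"
proof -
  have e0: "e \<in> FM 0" using e by (simp add: FM_0)
  have te: "th zeta e \<in> carrier M" by (rule th_M[OF zeta_nz e])
  obtain \<mu> \<nu> where m: "\<mu> \<in> carrier \<Lambda>" "\<nu> \<in> carrier \<Lambda>"
      "\<phi> (clM 0 (th zeta e)) = (I1 +>\<^bsub>Rg\<^esub> cl 0 \<mu>, I2 +>\<^bsub>Rg\<^esub> cl 0 \<nu>)"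
      "th zeta e - (fsc (aug \<mu>) g1 + fsc (aug \<nu>) g2) \<in> FM (Suc 0)"
    using approx_by_generators[OF te] by blast
  have "\<phi> (clM 0 (th zeta e)) = hact NN zeta (\<phi> (clM 0 e))"
    using phi_hact[OF Hgrp_zeta clM_carrier[OF e0]] by (simp only: hact_class[OF zeta_unit_1 e])
  hence eq: "I1 +>\<^bsub>Rg\<^esub> cl 0 \<mu> = I1 +>\<^bsub>Rg\<^esub> (gr_scalar D (dual_char \<chi> zeta) \<otimes>\<^bsub>Rg\<^esub> rep (gr_conj zeta ` (I1 +>\<^bsub>Rg\<^esub> a)))"
    "I2 +>\<^bsub>Rg\<^esub> cl 0 \<nu> = I2 +>\<^bsub>Rg\<^esub> (gr_scalar D (dual_char (sigma_conj D \<chi>) zeta) \<otimes>\<^bsub>Rg\<^esub> rep (gr_conj zeta ` (I2 +>\<^bsub>Rg\<^esub> b)))"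
    unfolding m(3) phi NN_simps prod.inject by blast+
  have "aug \<mu> = dual_char \<chi> zeta * s" by (rule av_twist[OF I_sub(1) av_ideal(1) ab(1) m(1) eq(1)])
  moreover have "aug \<nu> = dual_char (sigma_conj D \<chi>) zeta * t" by (rule av_twist[OF I_sub(2) av_ideal(2) ab(2) m(2) eq(2)])
  ultimately show ?thesis using m(4) by simp
qed

lemma av_consts: "av \<one>\<^bsub>Rg\<^esub> 1" "av \<zero>\<^bsub>Rg\<^esub> 0"
  using av_cl0[OF Lam_one_closed] av_ideal(1)[OF additive_subgroup.zero_closed[OF I_sub(1)]]
  by (simp_all add: cl_consts)

lemma th_g1: "th zeta g1 - fsc (dual_char \<chi> zeta) g1 \<in> FM (Suc 0)"
  using th_generator[OF g1(1) av_consts g1(2)] by simp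
lemma th_g2: "th zeta g2 - fsc (dual_char (sigma_conj D \<chi>) zeta) g2 \<in> FM (Suc 0)"
  using th_generator[OF g2(1) av_consts(2,1) g2(2)] by simp

lemma lact_congruent:
  assumes m: "\<mu> \<in> mp k" and e: "e' - e \<in> FM (Suc 0)"
  shows "lact \<mu> e' - lact \<mu> e \<in> FM (Suc k)"
  using lact_FM[OF m e] lact_diff[OF mp_carrier[OF m], of e' e] by simp

lemma lact_pow: "x \<in> carrier \<Lambda> \<Longrightarrow> (lact x ^^ k) e = lact (x [^]\<^bsub>\<Lambda>\<^esub> k) e"
proof (induction k arbitrary: e)
  case 0
  show "(lact x ^^ 0) e = lact (x [^]\<^bsub>\<Lambda>\<^esub> (0::nat)) e" by (simp add: lact_one)
next
  case (Suc k)
  interpret L: ring \<Lambda> by (rule Lam_ring)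
  have "(lact x ^^ Suc k) e = (lact x ^^ k) (lact x e)" by (simp only: funpow_Suc_right o_apply)
  also have "\<dots> = lact (x [^]\<^bsub>\<Lambda>\<^esub> k) (lact x e)" by (rule Suc.IH[OF Suc.prems])
  also have "\<dots> = lact (x [^]\<^bsub>\<Lambda>\<^esub> Suc k) e"
    using lact_mult[OF L.nat_pow_closed[OF Suc.prems] Suc.prems, of k e] by simp
  finally show "(lact x ^^ Suc k) e = lact (x [^]\<^bsub>\<Lambda>\<^esub> Suc k) e" .
qed

end

subsection \<open>The contradiction\<close>

text \<open>The consequences of the isomorphism from which the contradiction is derived. The number
  \<open>b\<close> is the difference of the exponents of \<open>Aa\<close> in the eigenvalues of
  \<open>e2\<close> and \<open>e1\<close>; independence is required in degree \<open>p\<close>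
  only.\<close>

locale smrep_pair = smrep p D sc act
  for p :: nat and D :: "('k::field_char_0, 'd::division_ring, 'f::{finite,field}) quat_datum"
    and sc :: "'f \<Rightarrow> 'v::ab_group_add \<Rightarrow> 'v" and act :: "'d \<Rightarrow> 'v \<Rightarrow> 'v" +
  fixes e1 e2 :: "'v \<Rightarrow> 'f" and \<gamma> :: 'f and b :: nat
  assumes e_M: "e1 \<in> carrier M" "e2 \<in> carrier M"
    and generators: "f \<in> carrier M \<Longrightarrow> \<exists>a c. f - (fsc a e1 + fsc c e2) \<in> FM (Suc 0)"
    and e1_eigen: "th zeta e1 = fsc \<gamma> e1" and e2_eigen: "th zeta e2 = fsc (\<gamma> * Aa ^ b) e2"
    and \<gamma>_q: "\<gamma> ^ (q - 1) = 1" and b_bounds: "1 \<le> b" "b \<le> p - 1"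
    and ZY: "Zo ((Yo ^^ k) e1) \<in> FM (Suc (Suc k))" and YZ: "Yo ((Zo ^^ k) e2) \<in> FM (Suc (Suc k))"
    and Y_top: "(Yo ^^ (p + 2)) e1 \<in> FM (Suc (p + 2))" and Z_top: "(Zo ^^ (p + 2)) e2 \<in> FM (Suc (p + 2))"
    and independent: "(Yo ^^ p) e1 - fsc a ((Zo ^^ p) e2) \<notin> FM (Suc p)" "(Zo ^^ p) e2 \<notin> FM (Suc p)"
begin

definition v :: "nat \<Rightarrow> 'v \<Rightarrow> 'f" where "v k = (Yo ^^ k) e1"
definition w :: "nat \<Rightarrow> 'v \<Rightarrow> 'f" where "w k = (Zo ^^ k) e2"

lemma v_simps: "v 0 = e1" "Yo (v k) = v (Suc k)" and w_simps: "w 0 = e2" "Zo (w k) = w (Suc k)"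
  by (simp_all add: v_def w_def)

lemma v_V: "v k \<in> V n k"
proof (induction k)
  case 0 show "v 0 \<in> V n 0" unfolding v_simps by (rule M_V[OF e_M(1)])
next
  case (Suc k) show "v (Suc k) \<in> V n (Suc k)" unfolding v_simps(2)[symmetric] by (rule Yo_V[OF Suc.IH])
qed

lemma w_V: "w k \<in> V n k"
proof (induction k)
  case 0 show "w 0 \<in> V n 0" unfolding w_simps by (rule M_V[OF e_M(2)])
next
  case (Suc k) show "w (Suc k) \<in> V n (Suc k)" unfolding w_simps(2)[symmetric] by (rule Zo_V[OF Suc.IH])
qed

lemma Zo_v: "Zo (v k) \<in> V n (Suc (Suc k))" and Yo_w: "Yo (w k) \<in> V n (Suc (Suc k))"
  unfolding v_def w_def by (rule FM_V[OF ZY], rule FM_V[OF YZ])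

text \<open>Induction on the degree: a factor in \<open>U 2\<close> raises by 2, and
  \<open>gg t - 1\<close> acts as a combination of \<open>Yo\<close> and \<open>Zo\<close> up to the
  same order, while the mixed terms \<open>Zo (v j)\<close> and \<open>Yo (w j)\<close> drop out by
  the relations.\<close>

lemma V_expand: "f \<in> V n j \<Longrightarrow> \<exists>a c. f - (fsc a (v j) + fsc c (w j)) \<in> V n (Suc j)"
proof (induction j arbitrary: f)
  case 0
  obtain a c where "f - (fsc a e1 + fsc c e2) \<in> FM (Suc 0)" using generators[OF V_M[OF 0]] by blast
  thus ?case unfolding v_simps w_simps using FM_V by blast
next
  case (Suc j)
  define S where "S = {f. \<exists>a c. f - (fsc a (v (Suc j)) + fsc c (w (Suc j))) \<in> V n (Suc (Suc j))}"
  have SI: "f \<in> S" if "f - (fsc a (v (Suc j)) + fsc c (w (Suc j))) \<in> V n (Suc (Suc j))" for f a c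
    using that by (auto simp: S_def)
  have V_S: "f \<in> S" if "f \<in> V n (Suc (Suc j))" for f
    by (rule SI[of _ 0 0]) (simp add: that)
  have vw_S: "v (Suc j) \<in> S" "w (Suc j) \<in> S"
    by (rule SI[of _ 1 0], simp add: V_zero, rule SI[of _ 0 1], simp add: V_zero)
  have S: "fs.subspace S"
    unfolding fs.subspace_def
  proof (intro conjI ballI allI)
    show "0 \<in> S" by (rule V_S[OF V_zero])
    fix x assume "x \<in> S"
    then obtain a c where x: "x - (fsc a (v (Suc j)) + fsc c (w (Suc j))) \<in> V n (Suc (Suc j))" by (auto simp: S_def)
    show "fsc k x \<in> S" for k
      by (rule SI[of _ "k * a" "k * c"])
        (use V_fsc[OF x, of k] in \<open>simp add: fs.scale_right_diff_distrib fs.scale_right_distrib\<close>)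
    fix y assume "y \<in> S"
    then obtain a' c' where y: "y - (fsc a' (v (Suc j)) + fsc c' (w (Suc j))) \<in> V n (Suc (Suc j))" by (auto simp: S_def)
    have "(x + y) - (fsc (a + a') (v (Suc j)) + fsc (c + c') (w (Suc j)))
        = (x - (fsc a (v (Suc j)) + fsc c (w (Suc j)))) + (y - (fsc a' (v (Suc j)) + fsc c' (w (Suc j))))"
      by (simp add: fs.scale_left_distrib)
    thus "x + y \<in> S" by (intro SI[of _ "a + a'" "c + c'"]) (simp only: V_add[OF x y])
  qed
  have YZS: "Yo f \<in> S" "Zo f \<in> S" if f: "f \<in> V n j" for f
  proof -
    obtain a c where r: "f - (fsc a (v j) + fsc c (w j)) \<in> V n (Suc j)" using Suc.IH[OF f] by blast
    define r' where "r' = f - (fsc a (v j) + fsc c (w j))"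
    have fe: "f = (fsc a (v j) + fsc c (w j)) + r'" by (simp add: r'_def)
    have r': "r' \<in> V n (Suc j)" using r by (simp only: r'_def)
    have "Yo f = (fsc a (v (Suc j)) + fsc c (Yo (w j))) + Yo r'"
      by (subst fe) (simp only: lact_add[OF Yelt_Lam] lact_fsc[OF Yelt_Lam] v_simps)
    thus "Yo f \<in> S" by (simp only:) (intro fs.subspace_add[OF S] fs.subspace_scale[OF S] vw_S V_S Yo_w Yo_V r')
    have "Zo f = (fsc a (Zo (v j)) + fsc c (w (Suc j))) + Zo r'"
      by (subst fe) (simp only: lact_add[OF Zelt_Lam] lact_fsc[OF Zelt_Lam] w_simps)
    thus "Zo f \<in> S" by (simp only:) (intro fs.subspace_add[OF S] fs.subspace_scale[OF S] vw_S V_S Zo_v Zo_V r')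
  qed
  have "V n (Suc j) \<subseteq> S"
  proof (rule V_Suc_subset[OF S])
    show "KM n \<subseteq> S" using KM_V V_S by blast
    fix f g assume f: "f \<in> V n j" and g: "g \<in> U 1"
    obtain t u where tu: "t \<in> Od" "u \<in> U 2" "g = gg t * u"
      using U_step[OF g order_refl] teich_set_O by (auto simp: gg_def)
    have e: "th g f - f = th (gg t) (th u f - f) + ((ph f t + (fsc (rd t) (Yo f) + fsc (rd t ^ p) (Zo f)))
        - (fsc (rd t) (Yo f) + fsc (rd t ^ p) (Zo f)))"
      using th_mult[OF gg_nz[OF tu(1)] U_nz[OF tu(2)], of f] by (simp add: tu(3) ph_def th_diff)
    have 1: "th (gg t) (th u f - f) \<in> V n (Suc (Suc j))"
      using th_V1[OF gg_U[OF tu(1)] raisesD[OF raises_U2[OF tu(2)] f]] by simp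
    have 2: "ph f t + (fsc (rd t) (Yo f) + fsc (rd t ^ p) (Zo f)) \<in> V n (Suc (Suc j))"
      using ph_eq[OF f tu(1)] by simp
    show "th g f - f \<in> S" unfolding e
      by (intro fs.subspace_add[OF S] fs.subspace_diff[OF S] fs.subspace_scale[OF S] V_S 1 2 YZS f)
  qed
  hence "f \<in> S" using Suc.prems by blast
  thus "\<exists>a c. f - (fsc a (v (Suc j)) + fsc c (w (Suc j))) \<in> V n (Suc (Suc j))" by (simp only: S_def mem_Collect_eq)
qed

text \<open>Both spanning vectors of degree \<open>p + 2\<close> lie one degree deeper, so the
  filtration is stationary there and Nakayama's lemma applies.\<close>

lemma V_top: "V n (p + 2) \<subseteq> KM n"
proof (rule V_stationary, rule subsetI)
  fix f assume "f \<in> V n (p + 2)"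
  then obtain a c where r: "f - (fsc a (v (p + 2)) + fsc c (w (p + 2))) \<in> V n (Suc (p + 2))"
    using V_expand by blast
  have "v (p + 2) \<in> V n (Suc (p + 2))" "w (p + 2) \<in> V n (Suc (p + 2))"
    unfolding v_def w_def by (rule FM_V[OF Y_top], rule FM_V[OF Z_top])
  from V_add[OF r V_add[OF V_fsc[OF this(1), of a] V_fsc[OF this(2), of c]]]
  show "f \<in> V n (Suc (p + 2))" by (simp only: diff_add_cancel)
qed

text \<open>The coefficient field is finite and \<open>v m\<close>, \<open>w m\<close> do not depend
  on the level, so one finite set serves for all \<open>n\<close>. This uniformity is what allows
  \<open>n\<close> to grow.\<close>

lemma finite_approx: "\<exists>S. finite S \<and> (\<forall>n. \<forall>f\<in>carrier M. \<exists>s\<in>S. f - s \<in> V n m)"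
proof (induction m)
  case 0
  show ?case by (intro exI[of _ "{0}"]) (simp add: M_V)
next
  case (Suc m)
  then obtain S where S: "finite S" "\<And>n f. f \<in> carrier M \<Longrightarrow> \<exists>s\<in>S. f - s \<in> V n m" by blast
  let ?S = "(\<lambda>(s, a, c). s + (fsc a (v m) + fsc c (w m))) ` (S \<times> UNIV \<times> UNIV)"
  have "\<exists>s\<in>?S. f - s \<in> V n (Suc m)" if f: "f \<in> carrier M" for n f
  proof -
    obtain s where s: "s \<in> S" "f - s \<in> V n m" using S(2)[OF f] by blast
    obtain a c where "(f - s) - (fsc a (v m) + fsc c (w m)) \<in> V n (Suc m)" using V_expand[OF s(2)] by blast
    hence "f - (s + (fsc a (v m) + fsc c (w m))) \<in> V n (Suc m)" by (simp only: diff_diff_eq)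
    moreover have "s + (fsc a (v m) + fsc c (w m)) \<in> ?S" using s(1) by (intro image_eqI[of _ _ "(s, a, c)"]) auto
    ultimately show ?thesis by blast
  qed
  moreover have "finite ?S" using S(1) by simp
  ultimately show ?case by blast
qed

text \<open>The dual is finite: it is covered by a fixed finite set modulo every \<^term>\<open>KM n\<close>.\<close>

lemma KM_eq_0: "\<exists>n. KM n = {0}"
proof -
  obtain S where S0: "finite S \<and> (\<forall>n. \<forall>f\<in>carrier M. \<exists>s\<in>S. f - s \<in> V n (p + 2))"
    using finite_approx[of "p + 2"] by (rule exE)
  have S: "finite S" "\<And>n f. f \<in> carrier M \<Longrightarrow> \<exists>s\<in>S. f - s \<in> V n (p + 2)"
    using conjunct1[OF S0] bspec[OF spec[OF conjunct2[OF S0]]] .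
  obtain n where n: "\<And>s. s \<in> S \<Longrightarrow> s \<in> KM n \<Longrightarrow> s = 0" using KM_avoid[OF S(1)] by blast
  have "f = 0" if f: "f \<in> KM n" for f
  proof
    fix x
    obtain m where m: "fixd m x" using fixd_ex by blast
    let ?k = "max m n"
    have fM: "f \<in> carrier M" using f by (simp add: KM_def)
    obtain s where s: "s \<in> S" "f - s \<in> V ?k (p + 2)" using S(2)[OF fM] by blast
    have d: "f - s \<in> KM ?k" using s(2) V_top by blast
    have "KM ?k \<subseteq> KM n" by (rule KM_antimono) simp
    hence "f - s \<in> KM n" using d by (rule subsetD)
    from fs.subspace_diff[OF KM_sub f this] have "s \<in> KM n" by simp
    hence "s = 0" by (rule n[OF s(1)])
    hence "f \<in> KM ?k" using d by simp
    thus "f x = 0 x" using fixd_le[OF m, of ?k] by (simp add: KM_def)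
  qed
  thus ?thesis using fs.subspace_0[OF KM_sub, of n] by blast
qed

lemma th_v: "th zeta (v k) = fsc (\<gamma> * Aa ^ k) (v k)"
proof (induction k)
  case 0 show "th zeta (v 0) = fsc (\<gamma> * Aa ^ 0) (v 0)" by (simp add: v_simps e1_eigen)
next
  case (Suc k)
  have "th zeta (v (Suc k)) = fsc Aa (Yo (fsc (\<gamma> * Aa ^ k) (v k)))"
    by (simp only: v_simps(2)[symmetric] th_Yo Suc.IH)
  thus "th zeta (v (Suc k)) = fsc (\<gamma> * Aa ^ Suc k) (v (Suc k))"
    by (simp add: lact_fsc[OF Yelt_Lam] v_simps mult_ac)
qed

lemma th_w: "th zeta (w k) = fsc (\<gamma> * Aa ^ (b + p * k)) (w k)"
proof (induction k)
  case 0 show "th zeta (w 0) = fsc (\<gamma> * Aa ^ (b + p * 0)) (w 0)" by (simp add: w_simps e2_eigen)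
next
  case (Suc k)
  have "th zeta (w (Suc k)) = fsc (Aa ^ p) (Zo (fsc (\<gamma> * Aa ^ (b + p * k)) (w k)))"
    by (simp only: w_simps(2)[symmetric] th_Zo Suc.IH)
  thus "th zeta (w (Suc k)) = fsc (\<gamma> * Aa ^ (b + p * Suc k)) (w (Suc k))"
    by (simp add: lact_fsc[OF Zelt_Lam] w_simps power_add mult_ac)
qed

lemma eigenvalue_q: "(\<gamma> * Aa ^ x) ^ (q - 1) = 1"
  by (simp only: power_mult_distrib \<gamma>_q Aa_q mult_1_left)

lemma \<gamma>_nz: "\<gamma> \<noteq> 0" using \<gamma>_q q_gt by (auto simp: power_0_left)

lemma match_v: "\<gamma> * Aa ^ j = \<gamma> * Aa ^ x \<Longrightarrow> x mod (p + 1) = j mod (p + 1)"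
  using Aa_eqD[of x j] \<gamma>_nz by simp

lemma match_w: "\<gamma> * Aa ^ (b + p * j) = \<gamma> * Aa ^ x \<Longrightarrow> (x + j) mod (p + 1) = b mod (p + 1)"
proof -
  assume "\<gamma> * Aa ^ (b + p * j) = \<gamma> * Aa ^ x"
  hence "Aa ^ (b + p * j) * Aa ^ j = Aa ^ x * Aa ^ j" using \<gamma>_nz by simp
  moreover have "Aa ^ (b + p * j) * Aa ^ j = Aa ^ b * (Aa ^ (p + 1)) ^ j"
    by (simp only: power_mult[symmetric] power_add[symmetric]) (simp add: algebra_simps)
  ultimately have "Aa ^ x * Aa ^ j = Aa ^ b" by (simp only: Aa_order power_one mult_1_right)
  hence "Aa ^ (x + j) = Aa ^ b" by (simp only: power_add)
  thus ?thesis by (rule Aa_eqD)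
qed

text \<open>The projector \<open>Ep\<close> removes from each step of the expansion the
  \<open>v j\<close> and \<open>w j\<close> whose eigenvalue differs from that of \<open>f\<close>.
  If the remaining ones in degrees \<open>i\<close> to \<open>m - 1\<close> are all equal to one
  \<open>g\<close>, a single coefficient is left. When none remains, \<open>g = 0\<close> may be
  taken and \<open>f\<close> lies in \<open>V n m\<close>.\<close>

lemma eigen_expand:
  assumes f: "f \<in> V n i" "th zeta f = fsc (\<gamma> * Aa ^ x) f" and im: "i \<le> m"
    and mv: "\<And>j. i \<le> j \<Longrightarrow> j < m \<Longrightarrow> x mod (p + 1) = j mod (p + 1) \<Longrightarrow> v j = g"
    and mw: "\<And>j. i \<le> j \<Longrightarrow> j < m \<Longrightarrow> (x + j) mod (p + 1) = b mod (p + 1) \<Longrightarrow> w j = g"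
  shows "\<exists>c. f - fsc c g \<in> V n m"
proof -
  let ?l = "\<gamma> * Aa ^ x"
  have "\<exists>c r. f = fsc c g + r \<and> r \<in> V n (i + k') \<and> th zeta r = fsc ?l r" if "i + k' \<le> m" for k'
    using that
  proof (induction k')
    case 0
    show "\<exists>c r. f = fsc c g + r \<and> r \<in> V n (i + 0) \<and> th zeta r = fsc ?l r"
      using f by (intro exI[of _ 0] exI[of _ f]) simp
  next
    case (Suc k')
    define k where "k = i + k'"
    have "\<exists>c r. f = fsc c g + r \<and> r \<in> V n (i + k') \<and> th zeta r = fsc ?l r"
      by (rule Suc.IH) (use Suc.prems in simp)
    then obtain c r where r: "f = fsc c g + r" "r \<in> V n k" "th zeta r = fsc ?l r"
      unfolding k_def by blast
    obtain a d where ad: "r - (fsc a (v k) + fsc d (w k)) \<in> V n (Suc k)" using V_expand[OF r(2)] by blast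
    define s where "s = r - (fsc a (v k) + fsc d (w k))"
    have s: "s \<in> V n (Suc k)" using ad by (simp only: s_def)
    have re: "r = (fsc a (v k) + fsc d (w k)) + s" by (simp add: s_def)
    have "r = Ep ?l r" using Ep_of_eigenvector[OF r(3) eigenvalue_q eigenvalue_q] by simp
    also have "\<dots> = (fsc a (Ep ?l (v k)) + fsc d (Ep ?l (w k))) + Ep ?l s"
      by (subst re) (simp only: Ep_add Ep_fsc)
    finally have e: "r = (fsc a (Ep ?l (v k)) + fsc d (Ep ?l (w k))) + Ep ?l s" .
    have km: "i \<le> k" "k < m" using Suc.prems by (simp_all add: k_def)
    have Ev: "Ep ?l (v k) = (if \<gamma> * Aa ^ k = ?l then v k else 0)"
      by (rule Ep_of_eigenvector[OF th_v eigenvalue_q eigenvalue_q])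
    have Ew: "Ep ?l (w k) = (if \<gamma> * Aa ^ (b + p * k) = ?l then w k else 0)"
      by (rule Ep_of_eigenvector[OF th_w eigenvalue_q eigenvalue_q])
    have "\<exists>a'. fsc a (Ep ?l (v k)) = fsc a' g"
    proof (cases "\<gamma> * Aa ^ k = ?l")
      case True
      hence vg: "v k = g" by (intro mv km match_v)
      have "Ep ?l (v k) = v k" by (simp only: Ev True if_True refl)
      thus ?thesis by (intro exI[of _ a]) (simp only: vg)
    next
      case False
      thus ?thesis
        by (intro exI[of _ 0]) (simp only: Ev if_False fs.scale_zero_right fs.scale_zero_left)
    qed
    then obtain a' where a': "fsc a (Ep ?l (v k)) = fsc a' g" by blast
    have "\<exists>d'. fsc d (Ep ?l (w k)) = fsc d' g"
    proof (cases "\<gamma> * Aa ^ (b + p * k) = ?l")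
      case True
      hence wg: "w k = g" by (intro mw km match_w)
      have "Ep ?l (w k) = w k" by (simp only: Ew True if_True refl)
      thus ?thesis by (intro exI[of _ d]) (simp only: wg)
    next
      case False
      thus ?thesis
        by (intro exI[of _ 0]) (simp only: Ew if_False fs.scale_zero_right fs.scale_zero_left)
    qed
    then obtain d' where d': "fsc d (Ep ?l (w k)) = fsc d' g" by blast
    have "f = fsc (c + (a' + d')) g + Ep ?l s"
      unfolding r(1) by (subst e) (simp add: a' d' fs.scale_left_distrib add.assoc)
    moreover have "Ep ?l s \<in> V n (i + Suc k')" using Ep_V[OF s] by (simp only: k_def add_Suc_right)
    moreover have "th zeta (Ep ?l s) = fsc ?l (Ep ?l s)" by (rule Ep_eigenvector[OF eigenvalue_q])
    ultimately show "\<exists>c r. f = fsc c g + r \<and> r \<in> V n (i + Suc k') \<and> th zeta r = fsc ?l r" by blast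
  qed
  moreover have "i + (m - i) = m" using im by simp
  ultimately have "\<exists>c r. f = fsc c g + r \<and> r \<in> V n m \<and> th zeta r = fsc ?l r" by (metis order_refl)
  then obtain c r where "f = fsc c g + r" "r \<in> V n m" by blast
  thus ?thesis by (intro exI[of _ c]) simp
qed

text \<open>To leading order \<open>gg s - 1\<close> acts on \<open>v m\<close> as
  \<open>- rd s\<close> times \<open>Yo\<close>, the contribution of \<open>Zo\<close> being of
  higher degree.\<close>

lemma ph_iterate:
  assumes s: "s \<in> Od"
  shows "((\<lambda>x. th (gg s) x - x) ^^ m) e1 - fsc ((- rd s) ^ m) (v m) \<in> V n (Suc m)"
proof (induction m)
  case 0 show "((\<lambda>x. th (gg s) x - x) ^^ 0) e1 - fsc ((- rd s) ^ 0) (v 0) \<in> V n (Suc 0)"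
    by (simp add: v_simps V_zero)
next
  case (Suc m)
  let ?y = "((\<lambda>x. th (gg s) x - x) ^^ m) e1" and ?c = "(- rd s) ^ m"
  define d where "d = ?y - fsc ?c (v m)"
  have d: "d \<in> V n (Suc m)" unfolding d_def by (rule Suc.IH)
  have y: "?y = fsc ?c (v m) + d" by (simp add: d_def)
  have 1: "th (gg s) d - d \<in> V n (Suc (Suc m))" using raise_1[OF gg_U[OF s] d] by (simp only: Suc_eq_plus1)
  have 2: "ph (v m) s + (fsc (rd s) (Yo (v m)) + fsc (rd s ^ p) (Zo (v m))) \<in> V n (Suc (Suc m))"
    using ph_eq[OF v_V s, of m n] by simp
  have 3: "ph (v m) s + fsc (rd s) (v (Suc m)) \<in> V n (Suc (Suc m))"
    using V_diff[OF 2 V_fsc[OF Zo_v, of "rd s ^ p"]] by (simp add: v_simps algebra_simps)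
  have "((\<lambda>x. th (gg s) x - x) ^^ Suc m) e1 = th (gg s) ?y - ?y" by (simp only: funpow.simps(2) o_apply)
  also have "\<dots> = fsc ?c (ph (v m) s) + (th (gg s) d - d)"
    unfolding y by (simp add: ph_def th_add th_fsc fs.scale_right_diff_distrib)
  finally have "((\<lambda>x. th (gg s) x - x) ^^ Suc m) e1 - fsc ((- rd s) ^ Suc m) (v (Suc m))
      = fsc ?c (ph (v m) s + fsc (rd s) (v (Suc m))) + (th (gg s) d - d)"
    by (simp add: fs.scale_right_distrib mult.commute)
  also have "\<dots> \<in> V n (Suc (Suc m))" by (rule V_add[OF V_fsc[OF 3] 1])
  finally show "((\<lambda>x. th (gg s) x - x) ^^ Suc m) e1 - fsc ((- rd s) ^ Suc m) (v (Suc m)) \<in> V n (Suc (Suc m))" .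
qed

text \<open>The summand of index \<open>i\<close> contributes
  \<open>(- rd (rho * zeta ^ i)) ^ p\<close> times \<open>v p\<close>. The weight
  \<open>inverse ((tau ^ i) ^ p)\<close> of \<open>Zo\<close> cancels the dependence on
  \<open>i\<close>, and \<open>- (q - 1)\<close> is 1 in characteristic \<open>p\<close>. With the
  weights of \<open>Yo\<close> the sum would be that of a nontrivial character, hence 0.\<close>

lemma Cz_e1: "Cz e1 - fsc (rd rho ^ p) (v p) \<in> V n (p + 1)"
proof -
  define c where "c i = inverse ((tau ^ i) ^ p)" for i
  define r where "r i = - (rd rho ^ p * (tau ^ i) ^ p)" for i
  define K where "K i = XX (th (gg (zeta ^ i)) e1) - th (gg (zeta ^ i)) (XX e1)" for i
  have K: "K i - fsc (r i) (v p) \<in> V n (p + 1)" for i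
  proof -
    have s: "rho * zeta ^ i \<in> Od" by (rule O_mult[OF rho_O zeta_pow_O])
    have l: "(- rd (rho * zeta ^ i)) ^ p = r i"
      by (simp only: r_def frobenius_uminus rd_mult[OF rho_O zeta_pow_O] rd_zeta_pow power_mult_distrib)
    have e: "e1 \<in> V n 0" by (rule M_V[OF e_M(1)])
    have 1: "K i - (th (gg (rho * zeta ^ i) ^ p) e1 - e1) \<in> V n (p + 1)"
      using XX_gg[OF e zeta_L(1)[of i] zeta_pow_O[of i]] by (simp only: K_def add_0)
    have 2: "(th (gg (rho * zeta ^ i) ^ p) e1 - e1) - fsc (r i) (v p) \<in> V n (p + 1)"
      using ph_iterate[OF s, of p n] by (simp only: th_power_p[OF gg_nz[OF s]] l Suc_eq_plus1)
    show ?thesis by (rule V_congruent[OF 1 2])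
  qed
  have "(\<Sum>i<q - 1. fsc (c i) (K i - fsc (r i) (v p))) \<in> V n (p + 1)"
    by (intro V_sum V_fsc K)
  also have "(\<Sum>i<q - 1. fsc (c i) (K i - fsc (r i) (v p))) = Cz e1 - fsc (\<Sum>i<q - 1. c i * r i) (v p)"
    by (simp only: Cz_eq c_def K_def fs.scale_right_diff_distrib sum_subtractf fs.scale_scale fs.scale_sum_left)
  also have "(\<Sum>i<q - 1. c i * r i) = (\<Sum>i<q - 1. - (rd rho ^ p))"
    by (rule sum.cong) (simp_all add: c_def r_def)
  also have "\<dots> = rd rho ^ p" by (simp add: of_nat_q_minus_1 del: of_nat_diff)
  finally show ?thesis .
qed

text \<open>\<open>XX\<close> is moved past the factors \<open>Zo\<close> one at a time; each
  commutator raises by \<open>p\<close> and the other \<open>m\<close> factors raise by 1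
  each.\<close>

lemma XX_w: "XX (w (Suc m)) - (Zo ^^ Suc m) (XX e2) \<in> V n (p + m)"
proof (induction m)
  case 0
  have "Cz e2 \<in> V n (0 + p)" by (rule Cz_V[OF M_V[OF e_M(2)]])
  thus "XX (w (Suc 0)) - (Zo ^^ Suc 0) (XX e2) \<in> V n (p + 0)"
    by (simp add: Cz_def w_simps(2)[symmetric] w_simps(1))
next
  case (Suc m)
  have 1: "Cz (w (Suc m)) \<in> V n (p + Suc m)" using Cz_V[OF w_V, of "Suc m" n] by (simp only: add.commute)
  have "Zo (XX (w (Suc m)) - (Zo ^^ Suc m) (XX e2)) \<in> V n (Suc (p + m))" by (rule Zo_V[OF Suc.IH])
  hence 2: "Zo (XX (w (Suc m)) - (Zo ^^ Suc m) (XX e2)) \<in> V n (p + Suc m)" by (simp only: add_Suc_right)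
  have "XX (w (Suc (Suc m))) - (Zo ^^ Suc (Suc m)) (XX e2)
      = Cz (w (Suc m)) + Zo (XX (w (Suc m)) - (Zo ^^ Suc m) (XX e2))"
    by (simp add: Cz_def w_simps lact_diff[OF Zelt_Lam])
  thus "XX (w (Suc (Suc m))) - (Zo ^^ Suc (Suc m)) (XX e2) \<in> V n (p + Suc m)"
    using V_add[OF 1 2] by (simp only:)
qed

lemma mod_small: "x < p + 1 \<Longrightarrow> x mod (p + 1) = x"
  by (rule mod_less)
lemma mod_big: "p + 1 \<le> x \<Longrightarrow> x < 2 * (p + 1) \<Longrightarrow> x mod (p + 1) = x - (p + 1)"
  by (simp add: le_mod_geq)

lemma contradiction: False
proof -
  obtain n where n: "KM n = {0}" using KM_eq_0 by blast
  have V_FM: "V n j \<subseteq> FM j" for j unfolding V_def n by auto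
  have indep: "v p - fsc a (w p) \<notin> V n (p + 1)" "w p \<notin> V n (p + 1)" for a
    using independent(1)[of a] independent(2) V_FM[of "p + 1"] unfolding v_def w_def Suc_eq_plus1 by blast+
  have b: "1 \<le> b" "b + 1 \<le> p" using b_bounds p_ge_5 by auto
  have p5: "5 \<le> p" by (rule p_ge_5)
  have bm: "b mod (p + 1) = b" by (rule mod_small) (use b in simp)
  have "Zo e1 \<in> V n 2" using Zo_v[of 0 n] by (simp add: v_simps numeral_2_eq_2)
  moreover have "th zeta (Zo e1) = fsc (\<gamma> * Aa ^ p) (Zo e1)"
    by (simp add: th_Zo e1_eigen lact_fsc[OF Zelt_Lam] mult.commute)
  \<comment> \<open>The exponent is \<open>p\<close>: in degrees 2 to \<open>p - 2\<close> no
    \<open>v j\<close> has it, and \<open>p + j\<close> is congruent to \<open>b\<close> modulo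
    \<open>p + 1\<close> only for \<open>j = b + 1\<close>. Precision \<open>p - 1\<close> suffices
    because \<open>XX\<close> adds 2.\<close>
  ultimately have "\<exists>c. Zo e1 - fsc c (w (b + 1)) \<in> V n (p - 1)"
  proof (rule eigen_expand)
    show "2 \<le> p - 1" using p5 by simp
    fix j assume j: "2 \<le> j" "j < p - 1"
    show "v j = w (b + 1)" if "p mod (p + 1) = j mod (p + 1)"
      using that mod_small[of p] mod_small[of j] j by simp
    show "w j = w (b + 1)" if "(p + j) mod (p + 1) = b mod (p + 1)"
    proof -
      have "p + j - (p + 1) = b" using that mod_big[of "p + j"] bm j by simp
      thus ?thesis using j by (intro arg_cong[of j "b + 1" w]) simp
    qed
  qed
  then obtain c where c: "Zo e1 - fsc c (w (b + 1)) \<in> V n (p - 1)" by blast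
  have "XX e1 \<in> V n 2" using XX_V[OF M_V[OF e_M(1)], of n] by (simp only: add_0_left)
  moreover have "th zeta (XX e1) = fsc (\<gamma> * Aa ^ 0) (XX e1)"
    by (rule XX_eigenvector) (simp add: e1_eigen)
  \<comment> \<open>\<open>XX\<close> preserves eigenvalues, so the exponent is 0: no
    \<open>v j\<close> with \<open>2 \<le> j < p\<close> has it, and \<open>w j\<close> only for
    \<open>j = b\<close>.\<close>
  ultimately have "\<exists>s. XX e1 - fsc s (w b) \<in> V n p"
  proof (rule eigen_expand)
    show "2 \<le> p" using p5 by simp
    fix j assume j: "2 \<le> j" "j < p"
    show "v j = w b" if "0 mod (p + 1) = j mod (p + 1)"
      using that mod_small[of j] j by simp
    show "w j = w b" if "(0 + j) mod (p + 1) = b mod (p + 1)"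
      using that mod_small[of j] bm j by simp
  qed
  then obtain s where s: "XX e1 - fsc s (w b) \<in> V n p" by blast
  have "XX e2 \<in> V n 2" using XX_V[OF M_V[OF e_M(2)], of n] by (simp only: add_0_left)
  moreover have "th zeta (XX e2) = fsc (\<gamma> * Aa ^ b) (XX e2)"
    by (rule XX_eigenvector[OF e2_eigen])
  \<comment> \<open>The exponent is \<open>b\<close>: among the \<open>v j\<close> only
    \<open>v b\<close> can have it, and \<open>w j\<close> would require \<open>j\<close> divisible
    by \<open>p + 1\<close>.\<close>
  ultimately have "\<exists>s. XX e2 - fsc s (v b) \<in> V n p"
  proof (rule eigen_expand)
    show "2 \<le> p" using p5 by simp
    fix j assume j: "2 \<le> j" "j < p"
    show "v j = v b" if "b mod (p + 1) = j mod (p + 1)"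
      using that mod_small[of j] bm j by simp
    show "w j = v b" if m: "(b + j) mod (p + 1) = b mod (p + 1)"
    proof (cases "b + j < p + 1")
      case True
      thus ?thesis using m mod_small[of "b + j"] bm j by simp
    next
      case False
      thus ?thesis using m mod_big[of "b + j"] bm j b by simp
    qed
  qed
  then obtain s2 where s2: "XX e2 - fsc s2 (v b) \<in> V n p" by blast
  have "Zo (v b) \<in> V n (b + 2)" using Zo_v[of b n] by simp
  moreover have "th zeta (Zo (v b)) = fsc (\<gamma> * Aa ^ (b - 1)) (Zo (v b))"
  proof -
    have "Aa ^ p * (\<gamma> * Aa ^ b) = \<gamma> * (Aa ^ (b - 1) * Aa ^ (p + 1))"
    proof -
      have "b + p = b - 1 + (p + 1)" using b by simp
      hence "Aa ^ (b + p) = Aa ^ (b - 1 + (p + 1))" by (simp only:)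
      thus ?thesis by (simp only: power_add mult_ac)
    qed
    hence "Aa ^ p * (\<gamma> * Aa ^ b) = \<gamma> * Aa ^ (b - 1)" by (simp only: Aa_order mult_1_right)
    thus ?thesis by (simp only: th_Zo th_v lact_fsc[OF Zelt_Lam] fs.scale_scale)
  qed
  \<comment> \<open>The exponent \<open>b + p\<close> is \<open>b - 1\<close> modulo
    \<open>p + 1\<close>. It would need \<open>v j\<close> with \<open>j = b - 1\<close>, or
    \<open>w j\<close> with \<open>j\<close> congruent to 1; neither occurs in degrees
    \<open>b + 2\<close> to \<open>p\<close>, hence the comparison vector 0.\<close>
  ultimately have "\<exists>c. Zo (v b) - fsc c 0 \<in> V n (p + 1)"
  proof (rule eigen_expand)
    show "b + 2 \<le> p + 1" using b by simp
    fix j assume j: "b + 2 \<le> j" "j < p + 1"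
    show "v j = 0" if "(b - 1) mod (p + 1) = j mod (p + 1)"
      using that mod_small[of j] mod_small[of "b - 1"] j b by simp
    show "w j = 0" if m: "(b - 1 + j) mod (p + 1) = b mod (p + 1)"
    proof (cases "b - 1 + j < p + 1")
      case True
      thus ?thesis using m mod_small[of "b - 1 + j"] bm j b by simp
    next
      case False
      have "(b - 1 + j) mod (p + 1) = b - 1 + j - (p + 1)"
      proof (rule mod_big)
        show "p + 1 \<le> b - 1 + j" using False by simp
        have "b - 1 \<le> p" using b by simp
        thus "b - 1 + j < 2 * (p + 1)" using j by simp
      qed
      hence "b - 1 + j - (p + 1) = b" using m bm by simp
      hence "j = p + 2" using b False by arith
      thus ?thesis using j by simp
    qed
  qed
  hence Zvb: "Zo (v b) \<in> V n (p + 1)" by simp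
  have Zd: "Zo (XX e2 - fsc s2 (v b)) \<in> V n (p + 1)" using Zo_V[OF s2] by (simp only: Suc_eq_plus1)
  have "Zo (XX e2) = fsc s2 (Zo (v b)) + Zo (XX e2 - fsc s2 (v b))"
    by (simp add: lact_diff[OF Zelt_Lam] lact_fsc[OF Zelt_Lam])
  hence "Zo (XX e2) \<in> V n (p + 1)" using V_add[OF V_fsc[OF Zvb, of s2] Zd] by (simp only:)
  from Zo_power_V[OF this, of b] have "(Zo ^^ b) (Zo (XX e2)) \<in> V n (p + 1)" by (rule V_mono) simp
  hence "(Zo ^^ Suc b) (XX e2) \<in> V n (p + 1)" by (simp only: funpow_swap1 funpow.simps(2) o_apply)
  \<comment> \<open>The error has degree \<open>p + b\<close>, and \<open>b \<ge> 1\<close>.\<close>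
  moreover have "XX (w (Suc b)) - (Zo ^^ Suc b) (XX e2) \<in> V n (p + 1)"
    by (rule V_mono[OF XX_w]) (use b in simp)
  ultimately have "(XX (w (Suc b)) - (Zo ^^ Suc b) (XX e2)) + (Zo ^^ Suc b) (XX e2) \<in> V n (p + 1)"
    by (intro V_add)
  hence Xw: "XX (w (b + 1)) \<in> V n (p + 1)" by (simp only: diff_add_cancel Suc_eq_plus1)
  have p1: "p - 1 + 2 = p + 1" using p5 by simp
  have X1: "XX (Zo e1 - fsc c (w (b + 1))) \<in> V n (p + 1)" using XX_V[OF c] by (simp only: p1)
  have Z2: "Zo (XX e1 - fsc s (w b)) \<in> V n (p + 1)" using Zo_V[OF s] by (simp only: Suc_eq_plus1)
  have wS: "w (b + 1) = w (Suc b)" by (simp only: Suc_eq_plus1)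
  \<comment> \<open>The commutator with both expansions inserted: apart from terms of degree
    \<open>p + 1\<close>, only \<open>- fsc s (Zo (w b))\<close> remains.\<close>
  have "Cz e1 + fsc s (w (b + 1)) = (XX (Zo e1 - fsc c (w (b + 1))) + fsc c (XX (w (b + 1)))) - Zo (XX e1 - fsc s (w b))"
    by (simp add: Cz_def XX_diff XX_fsc lact_diff[OF Zelt_Lam] lact_fsc[OF Zelt_Lam] w_simps wS)
  moreover have "\<dots> \<in> V n (p + 1)" by (intro V_add V_diff V_fsc X1 Z2 Xw)
  ultimately have C: "Cz e1 + fsc s (w (b + 1)) \<in> V n (p + 1)" by (simp only:)
  have "(Cz e1 + fsc s (w (b + 1))) - (Cz e1 - fsc (rd rho ^ p) (v p)) \<in> V n (p + 1)"
    by (rule V_diff[OF C Cz_e1])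
  hence main: "fsc (rd rho ^ p) (v p) + fsc s (w (b + 1)) \<in> V n (p + 1)" by (simp add: add.commute)
  have rz: "rd rho ^ p \<noteq> 0" using rd_rho_nz by simp
  have main': "v p + fsc (s / rd rho ^ p) (w (b + 1)) \<in> V n (p + 1)"
    using V_fsc[OF main, of "inverse (rd rho ^ p)"] rz
    by (simp add: fs.scale_right_distrib divide_inverse mult.commute)
  show False
  proof (cases "b + 1 = p")
    case True
    have "v p - fsc (- (s / rd rho ^ p)) (w p) \<in> V n (p + 1)"
      using main' by (simp add: True fs.scale_minus_left)
    thus False using indep(1) by blast
  next
    case False
    hence bp: "b + 1 < p" using b by simp
    show False
    proof (cases "s = 0")
      case True
      have "v p - fsc 0 (w p) \<in> V n (p + 1)" using main' by (simp add: True)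
      thus False using indep(1) by blast
    next
      case s0: False
      \<comment> \<open>As \<open>v p\<close> has degree \<open>p\<close>, so has
        \<open>w (b + 1)\<close>, although \<open>b + 1 < p\<close>. Applying \<open>Zo\<close> the
        remaining \<open>p - (b + 1)\<close> times, at least once, then puts \<open>w p\<close> into
        degree \<open>p + 1\<close>.\<close>
      have "(fsc (rd rho ^ p) (v p) + fsc s (w (b + 1))) - fsc (rd rho ^ p) (v p) \<in> V n p"
        by (rule V_diff[OF V_mono[OF main] V_fsc[OF v_V]]) simp
      hence "fsc s (w (b + 1)) \<in> V n p" by simp
      from V_fsc[OF this, of "inverse s"] have wb: "w (b + 1) \<in> V n p" using s0 by simp
      have "(Zo ^^ (p - (b + 1))) (w (b + 1)) = (Zo ^^ (p - (b + 1) + (b + 1))) e2"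
        by (simp only: w_def funpow_add o_apply)
      also have "p - (b + 1) + (b + 1) = p" using bp by simp
      finally have "w p = (Zo ^^ (p - (b + 1))) (w (b + 1))" by (simp only: w_def)
      hence "w p \<in> V n (p + (p - (b + 1)))" using Zo_power_V[OF wb] by simp
      hence "w p \<in> V n (p + 1)" by (rule V_mono) (use bp in simp)
      thus False using indep(2) by blast
    qed
  qed
qed

end

context smrep_iso
begin

text \<open>The lifts \<open>g1\<close>, \<open>g2\<close> are replaced by exact eigenvectors
  through \<open>Ep\<close>, which changes them only modulo the first filtration step. The image
  under an element of the \<open>k\<close>-th power of the maximal ideal then changes only modulo
  degree \<open>k + 1\<close>, so the relations and the independence pass to the
  eigenvectors.\<close>

lemma iso_contradiction:
  assumes \<chi>: "smooth_character D \<chi>" and ne1: "\<exists>x\<in>ord_units D. \<chi> x \<noteq> sigma_conj D \<chi> x"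
    and ne2: "\<exists>x\<in>ord_units D. \<chi> x \<noteq> sigma_conj D \<chi> x * alpha p D x ^ p"
  shows False
proof -
  let ?g = "inverse (\<chi> zeta)"
  obtain b where b: "1 \<le> b" "b \<le> p - 1" "inverse (\<chi> zeta ^ p) = ?g * Aa ^ b"
    using character_exponent[OF \<chi> ne1 ne2] unfolding Aa_def[symmetric] by blast
  have q1: "?g ^ (q - 1) = 1" using character_zeta_q[OF \<chi>] by (simp add: power_inverse)
  have q2: "(?g * Aa ^ b) ^ (q - 1) = 1" by (simp only: power_mult_distrib q1 Aa_q mult_1_left)
  define e1 where "e1 = Ep ?g g1"
  define e2 where "e2 = Ep (?g * Aa ^ b) g2"
  have t1: "th zeta g1 - fsc ?g g1 \<in> FM (Suc 0)" using th_g1 by (simp only: dual_char_def)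
  have t2: "th zeta g2 - fsc (?g * Aa ^ b) g2 \<in> FM (Suc 0)"
    using th_g2 by (simp only: dual_char_def sigma_conj_zeta[OF \<chi>] b(3))
  have d1: "e1 - g1 \<in> FM (Suc 0)" unfolding e1_def by (rule Ep_approx[OF t1 q1])
  have d2: "e2 - g2 \<in> FM (Suc 0)" unfolding e2_def by (rule Ep_approx[OF t2 q2])
  have M1: "e1 \<in> carrier M" unfolding e1_def FM_0[symmetric] by (rule Ep_FM) (simp add: FM_0 g1(1))
  have M2: "e2 \<in> carrier M" unfolding e2_def FM_0[symmetric] by (rule Ep_FM) (simp add: FM_0 g2(1))
  \<comment> \<open>A class in \<open>I1\<close> kills the generator of the first summand, so
    \<open>\<mu>\<close> raises one degree more than its own degree.\<close>
  have K1: "lact \<mu> e1 \<in> FM (Suc k)" if m: "\<mu> \<in> mp k" "cl k \<mu> \<in> I1" for \<mu> k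
  proof -
    have "lact \<mu> g1 + lact \<zero>\<^bsub>\<Lambda>\<^esub> g2 \<in> FM (Suc k)"
      unfolding pair_FM_iff[OF m(1) zero_mp] cl_consts
      using m(2) additive_subgroup.zero_closed[OF I_sub(2)] by blast
    hence "lact \<mu> g1 \<in> FM (Suc k)" by (simp only: lact_zero[OF g2(1)] add_0_right)
    from fs.subspace_add[OF FM_subspace lact_congruent[OF m(1) d1] this] show ?thesis
      by (simp only: diff_add_cancel)
  qed
  have K2: "lact \<mu> e2 \<in> FM (Suc k)" if m: "\<mu> \<in> mp k" "cl k \<mu> \<in> I2" for \<mu> k
  proof -
    have "lact \<zero>\<^bsub>\<Lambda>\<^esub> g1 + lact \<mu> g2 \<in> FM (Suc k)"
      unfolding pair_FM_iff[OF zero_mp m(1)] cl_consts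
      using m(2) additive_subgroup.zero_closed[OF I_sub(1)] by blast
    hence "lact \<mu> g2 \<in> FM (Suc k)" by (simp only: lact_zero[OF g1(1)] add_0_left)
    from fs.subspace_add[OF FM_subspace lact_congruent[OF m(1) d2] this] show ?thesis
      by (simp only: diff_add_cancel)
  qed
  let ?Y = "\<lambda>k::nat. Yelt p D [^]\<^bsub>\<Lambda>\<^esub> k" and ?Z = "\<lambda>k::nat. Zelt p D [^]\<^bsub>\<Lambda>\<^esub> k"
  have Ym: "?Y k \<in> mp k" and Zm: "?Z k \<in> mp k" for k
    by (rule mp_pow[OF Y_mD], rule mp_pow[OF Z_mD])
  have ZY: "Zo ((Yo ^^ k) e1) \<in> FM (Suc (Suc k))" for k
  proof -
    have e: "Zo ((Yo ^^ k) e1) = lact (Zelt p D \<otimes>\<^bsub>\<Lambda>\<^esub> ?Y k) e1"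
      by (simp only: lact_pow[OF Yelt_Lam] lact_mult[OF Zelt_Lam mp_carrier[OF Ym]])
    \<comment> \<open>Two-sidedness of \<open>I1\<close> enters here: the class is a right multiple
      of \<open>z\<close>.\<close>
    have "cl (Suc 0 + k) (Zelt p D \<otimes>\<^bsub>\<Lambda>\<^esub> ?Y k) \<in> I1"
      using ideal.I_r_closed[OF I1_ideal I1_gens(1) cl_closed[OF Ym, of k]]
      by (simp only: z_cl cl_mult[OF Z_mD Ym])
    from K1[OF mD_pow_mult[OF Ym Z_mD] this] show ?thesis by (simp only: e add_Suc add_0_left)
  qed
  have YZ: "Yo ((Zo ^^ k) e2) \<in> FM (Suc (Suc k))" for k
  proof -
    have e: "Yo ((Zo ^^ k) e2) = lact (Yelt p D \<otimes>\<^bsub>\<Lambda>\<^esub> ?Z k) e2"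
      by (simp only: lact_pow[OF Zelt_Lam] lact_mult[OF Yelt_Lam mp_carrier[OF Zm]])
    have "cl (Suc 0 + k) (Yelt p D \<otimes>\<^bsub>\<Lambda>\<^esub> ?Z k) \<in> I2"
      using ideal.I_r_closed[OF I2_ideal I2_gens(1) cl_closed[OF Zm, of k]]
      by (simp only: y_cl cl_mult[OF Y_mD Zm])
    from K2[OF mD_pow_mult[OF Zm Y_mD] this] show ?thesis by (simp only: e add_Suc add_0_left)
  qed
  have YT: "(Yo ^^ (p + 2)) e1 \<in> FM (Suc (p + 2))"
    unfolding lact_pow[OF Yelt_Lam]
    by (rule K1[OF Ym]) (use I1_gens(2) in \<open>simp only: y_cl cl_pow[OF Y_mD]\<close>)
  have ZT: "(Zo ^^ (p + 2)) e2 \<in> FM (Suc (p + 2))"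
    unfolding lact_pow[OF Zelt_Lam]
    by (rule K2[OF Zm]) (use I2_gens(2) in \<open>simp only: z_cl cl_pow[OF Z_mD]\<close>)
  have N1: "cl p (?Y p) \<notin> I1" using y_power_not_mem by (simp only: y_cl cl_pow[OF Y_mD] not_False_eq_True)
  have N2: "cl p (?Z p) \<notin> I2" using z_power_not_mem by (simp only: z_cl cl_pow[OF Z_mD] not_False_eq_True)
  have IY: "(Yo ^^ p) e1 - fsc a ((Zo ^^ p) e2) \<notin> FM (Suc p)" for a
  proof
    let ?s = "lam_scale (- a) \<one>\<^bsub>\<Lambda>\<^esub>"
    let ?n = "?s \<otimes>\<^bsub>\<Lambda>\<^esub> ?Z p"
    have s: "?s \<in> carrier \<Lambda>" by (rule Lam_scale_closed[OF Lam_one_closed])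
    have n: "?n \<in> mp p" by (rule ideal.I_l_closed[OF mD_pow_ideal Zm s])
    have ne: "lact ?n e2 = - fsc a ((Zo ^^ p) e2)"
    proof -
      have "lact ?n e2 = lact ?s (lact (?Z p) e2)" by (rule lact_mult[OF s mp_carrier[OF Zm]])
      thus ?thesis
        by (simp add: lact_scale[OF Lam_one_closed] lact_one lact_pow[OF Zelt_Lam] fun_eq_iff fsc_def)
    qed
    assume "(Yo ^^ p) e1 - fsc a ((Zo ^^ p) e2) \<in> FM (Suc p)"
    hence A: "lact (?Y p) e1 + lact ?n e2 \<in> FM (Suc p)"
      by (simp only: ne lact_pow[OF Yelt_Lam] add_uminus_conv_diff)
    have "(lact (?Y p) e1 + lact ?n e2) - ((lact (?Y p) e1 - lact (?Y p) g1) + (lact ?n e2 - lact ?n g2)) \<in> FM (Suc p)"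
      by (rule fs.subspace_diff[OF FM_subspace A
          fs.subspace_add[OF FM_subspace lact_congruent[OF Ym d1] lact_congruent[OF n d2]]])
    hence "lact (?Y p) g1 + lact ?n g2 \<in> FM (Suc p)" by (simp add: algebra_simps)
    thus False using pair_FM_iff[OF Ym n] N1 by blast
  qed
  have IZ: "(Zo ^^ p) e2 \<notin> FM (Suc p)"
  proof
    assume "(Zo ^^ p) e2 \<in> FM (Suc p)"
    hence A: "lact (?Z p) e2 \<in> FM (Suc p)" by (simp only: lact_pow[OF Zelt_Lam])
    have "lact (?Z p) e2 - (lact (?Z p) e2 - lact (?Z p) g2) \<in> FM (Suc p)"
      by (rule fs.subspace_diff[OF FM_subspace A lact_congruent[OF Zm d2]])
    hence "lact \<zero>\<^bsub>\<Lambda>\<^esub> g1 + lact (?Z p) g2 \<in> FM (Suc p)" by (simp add: lact_zero[OF g1(1)])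
    thus False using pair_FM_iff[OF zero_mp Zm] N2 by blast
  qed
  have gen: "\<exists>a c. f - (fsc a e1 + fsc c e2) \<in> FM (Suc 0)" if f: "f \<in> carrier M" for f
  proof -
    obtain a c where ac: "f - (fsc a g1 + fsc c g2) \<in> FM (Suc 0)" using approx_by_generators[OF f] by blast
    have "(f - (fsc a g1 + fsc c g2)) - (fsc a (e1 - g1) + fsc c (e2 - g2)) \<in> FM (Suc 0)"
      by (intro fs.subspace_diff[OF FM_subspace ac] fs.subspace_add[OF FM_subspace]
          fs.subspace_scale[OF FM_subspace] d1 d2)
    moreover have "(f - (fsc a g1 + fsc c g2)) - (fsc a (e1 - g1) + fsc c (e2 - g2)) = f - (fsc a e1 + fsc c e2)"
      by (simp add: fs.scale_right_diff_distrib)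
    ultimately show ?thesis by auto
  qed
  have E1: "th zeta e1 = fsc ?g e1" unfolding e1_def by (rule Ep_eigenvector[OF q1])
  have E2: "th zeta e2 = fsc (?g * Aa ^ b) e2" unfolding e2_def by (rule Ep_eigenvector[OF q2])
  have "smrep_pair p D sc act e1 e2 ?g b"
    by (intro smrep_pair.intro smrep_pair_axioms.intro smrep_axioms M1 M2 gen E1 E2 q1 b(1,2) ZY YZ YT ZT IY IZ)
  thus False by (rule smrep_pair.contradiction)
qed

end

theorem theorem2p31:
  fixes p :: nat
    and D :: "('k::field_char_0, 'd::division_ring, 'f::{finite,field}) quat_datum"
    and \<chi> :: "'d \<Rightarrow> 'f"
  assumes "prime p" and "p \<ge> 5" and "CHAR('f) = p"
    and "quat_setting p D"
    and "smooth_character D \<chi>"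
    and "\<exists>x\<in>ord_units D. \<chi> x \<noteq> sigma_conj D \<chi> x"
    and "\<exists>x\<in>ord_units D. \<chi> x \<noteq> sigma_conj D \<chi> x * alpha p D x ^ p"
  shows "\<not> (\<exists>(sc :: 'f \<Rightarrow> 'v::ab_group_add \<Rightarrow> 'v) (act :: 'd \<Rightarrow> 'v \<Rightarrow> 'v) \<phi>.
           smooth_rep D sc act \<and>
           graded_iso (grLam D) (Hgrp p D)
             (gr_dual D sc act)
             (direct_sum
               (twist D (dual_char \<chi>)
                 (grLam_quot D {z_elt p D, y_elt p D [^]\<^bsub>grLam D\<^esub> (p + 2)}))
               (twist D (dual_char (sigma_conj D \<chi>))
                 (grLam_quot D {y_elt p D, z_elt p D [^]\<^bsub>grLam D\<^esub> (p + 2)})))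
             \<phi>)"
proof
  assume "\<exists>(sc :: 'f \<Rightarrow> 'v::ab_group_add \<Rightarrow> 'v) (act :: 'd \<Rightarrow> 'v \<Rightarrow> 'v) \<phi>.
           smooth_rep D sc act \<and>
           graded_iso (grLam D) (Hgrp p D)
             (gr_dual D sc act)
             (direct_sum
               (twist D (dual_char \<chi>)
                 (grLam_quot D {z_elt p D, y_elt p D [^]\<^bsub>grLam D\<^esub> (p + 2)}))
               (twist D (dual_char (sigma_conj D \<chi>))
                 (grLam_quot D {y_elt p D, z_elt p D [^]\<^bsub>grLam D\<^esub> (p + 2)})))
             \<phi>"
  then obtain sc :: "'f \<Rightarrow> 'v \<Rightarrow> 'v" and act :: "'d \<Rightarrow> 'v \<Rightarrow> 'v" and \<phi> where smooth: "smooth_rep D sc act"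
    and iso: "graded_iso (grLam D) (Hgrp p D)
             (gr_dual D sc act)
             (direct_sum
               (twist D (dual_char \<chi>)
                 (grLam_quot D {z_elt p D, y_elt p D [^]\<^bsub>grLam D\<^esub> (p + 2)}))
               (twist D (dual_char (sigma_conj D \<chi>))
                 (grLam_quot D {y_elt p D, z_elt p D [^]\<^bsub>grLam D\<^esub> (p + 2)})))
             \<phi>"
    by blast
  have "smrep_iso p D sc act \<chi> \<phi>"
    by (intro smrep_iso.intro smrep_iso_axioms.intro smrep.intro smrep_axioms.intro quat.intro assms(1-4) smooth iso)
  thus False by (rule smrep_iso.iso_contradiction[OF _ assms(5-7)])
qed

end
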